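(* Let $W(t)=(W_1(t),\dots,W_8(t))$ be standard Brownian motion on $\mathbb{R}^8$ (started at $0$). Then with probability 1 there exists a compactly supported continuously differentiable function $f:\mathbb{R}^7\to\mathbb{R}$ (depending on the path), which is $C^\infty$ on $\mathbb{R}^7\setminus\{0\}$, such that the system $$dy_i=dW_i,\quad i=1,\dots,7,\qquad dy_8=f(y_1,\dots,y_7)\,dW_8$$ has no solution satisfying $y(0)=0$. More precisely, there is no continuous $y:[0,1]\to\mathbb{R}^8$ such that $y(0)=0$ and the system $dy_i=dW_i$ ($i=1,\dots,7$), $dy_8=f(y_1,\dots,y_7)\,dW_8$ is satisfied locally on $(0,1)$ in the pathwise sense defined in the context.
   Context: The iterated integrals $A^{rj}(s,t)=\int_s^t(W_r(u)-W_r(s))\,dW_j(u)$ (Itô; for $r\ne j$ the Stratonovich integral is the same, and only terms with $r\neq j$ matter for this system) are taken in a version for which, with probability 1, for all $s\le t\le u$, $A^{rj}(s,u)=A^{rj}(s,t)+A^{rj}(t,u)+(W_r(t)-W_r(s))(W_j(u)-W_j(t))$, and for every $p>2$ and every bounded interval there is a constant $c$ with $|W(t)-W(s)|\le c(t-s)^{1/p}$ and $|A^{rj}(s,t)|\le c(t-s)^{2/p}$ on that interval. A system $dy_i=\sum_j f^i_j(y)\,dW_j$ is satisfied locally on $(0,1)$ by $y$ if for every $[a,b]\subset(0,1)$ there exist a continuous increasing function $\tilde\omega$ on $[a,b]$ and a non-negative function $\theta$ on $[0,\infty)$ with $\theta(\delta)=o(\delta)$ as $\delta\to0$ such that for all $i$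 and all $a\le s<t\le b$ $$\Big|y_i(t)-y_i(s)-\sum_j f^i_j(y(s))(W_j(t)-W_j(s))-\sum_{h,r,j}f^h_r(y(s))\,\partial_hf^i_j(y(s))\,A^{rj}(s,t)\Big|\le\theta(\tilde\omega(t)-\tilde\omega(s)).$$ In the present system $n=d=8$, $f^i_i=1$ for $i\le7$, $f^8_8(y)=f(y_1,\dots,y_7)$, and all other $f^i_j$ are $0$. With probability 1, $(W_1,\dots,W_7)$ avoids the origin for $t>0$, and $f$ is smooth away from $0$. *)

theory Defs
  imports "HOL-Probability.Probability"
begin

section \<open>Brownian motion and iterated Ito integrals\<close>

definition standard_brownian_motion ::
  "'a measure \<Rightarrow> (real \<Rightarrow> 'a \<Rightarrow> real ^ 'd) \<Rightarrow> bool" where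
  "standard_brownian_motion M W \<longleftrightarrow>
     prob_space M \<and>
     (\<forall>t\<ge>0. W t \<in> borel_measurable M) \<and>
     (AE \<omega> in M. W 0 \<omega> = 0) \<and>
     (AE \<omega> in M. continuous_on {0..} (\<lambda>t. W t \<omega>)) \<and>
     (\<forall>(n::nat) \<tau>. 0 \<le> \<tau> 0 \<and> (\<forall>k<n. \<tau> k < \<tau> (Suc k)) \<longrightarrow>
        prob_space.indep_vars M (\<lambda>_. borel)
          (\<lambda>k \<omega>. W (\<tau> (Suc k)) \<omega> - W (\<tau> k) \<omega>) {..<n}) \<and>
     (\<forall>s t. 0 \<le> s \<and> s < t \<longrightarrow>
        prob_space.indep_vars M (\<lambda>_. borel) (\<lambda>i \<omega>. (W t \<omega> - W s \<omega>) $ i) UNIV \<and>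
        (\<forall>i. distributed M lborel (\<lambda>\<omega>. (W t \<omega> - W s \<omega>) $ i)
               (normal_density 0 (sqrt (t - s)))))"

definition natural_filtration ::
  "'a measure \<Rightarrow> (real \<Rightarrow> 'a \<Rightarrow> real ^ 'd) \<Rightarrow> real \<Rightarrow> 'a measure" where
  "natural_filtration M W t =
     sigma (space M) {W u -` B \<inter> space M | u B. u \<in> {0..t} \<and> B \<in> sets borel}"

text \<open>A simple process on $[s,t]$ is given by partition points
  $s = \tau_0 < \dots < \tau_n = t$ and square-integrable
  $\mathcal{F}_{\tau_k}$-measurable values $\xi_k$ on $(\tau_k, \tau_{k+1}]$.\<close>

definition simple_integrand ::
  "'a measure \<Rightarrow> (real \<Rightarrow> 'a measure) \<Rightarrow> real \<Rightarrow> real \<Rightarrow>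
   nat \<Rightarrow> (nat \<Rightarrow> real) \<Rightarrow> (nat \<Rightarrow> 'a \<Rightarrow> real) \<Rightarrow> bool" where
  "simple_integrand M F s t n \<tau> \<xi> \<longleftrightarrow>
     \<tau> 0 = s \<and> \<tau> n = t \<and> (\<forall>k<n. \<tau> k < \<tau> (Suc k)) \<and>
     (\<forall>k<n. \<xi> k \<in> borel_measurable (F (\<tau> k)) \<and> integrable M (\<lambda>\<omega>. (\<xi> k \<omega>)\<^sup>2))"

definition simple_process ::
  "nat \<Rightarrow> (nat \<Rightarrow> real) \<Rightarrow> (nat \<Rightarrow> 'a \<Rightarrow> real) \<Rightarrow> real \<Rightarrow> 'a \<Rightarrow> real" where
  "simple_process n \<tau> \<xi> u \<omega> = (\<Sum>k<n. \<xi> k \<omega> * indicator {\<tau> k<..\<tau> (Suc k)} u)"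

definition simple_integral ::
  "(real \<Rightarrow> 'a \<Rightarrow> real) \<Rightarrow> nat \<Rightarrow> (nat \<Rightarrow> real) \<Rightarrow> (nat \<Rightarrow> 'a \<Rightarrow> real) \<Rightarrow> 'a \<Rightarrow> real" where
  "simple_integral B n \<tau> \<xi> \<omega> = (\<Sum>k<n. \<xi> k \<omega> * (B (\<tau> (Suc k)) \<omega> - B (\<tau> k) \<omega>))"

text \<open>The random variable \<open>I\<close> is (a version of) the Ito integral $\int_s^t H\,dB$, the
  $L^2$-limit of the integrals of simple processes that approximate \<open>H\<close> in
  $L^2(M \otimes du)$. Nonnegative integrals are used so that no integral in the definition
  takes a default value.\<close>

definition has_ito_integral ::
  "'a measure \<Rightarrow> (real \<Rightarrow> 'a measure) \<Rightarrow> (real \<Rightarrow> 'a \<Rightarrow> real) \<Rightarrow>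
   (real \<Rightarrow> 'a \<Rightarrow> real) \<Rightarrow> real \<Rightarrow> real \<Rightarrow> ('a \<Rightarrow> real) \<Rightarrow> bool" where
  "has_ito_integral M F B H s t I \<longleftrightarrow>
     I \<in> borel_measurable M \<and>
     (\<exists>n \<tau> \<xi>.
        (\<forall>m::nat. simple_integrand M F s t (n m) (\<tau> m) (\<xi> m)) \<and>
        (\<lambda>m. \<integral>\<^sup>+\<omega>. (\<integral>\<^sup>+u\<in>{s..t}.
            ennreal ((H u \<omega> - simple_process (n m) (\<tau> m) (\<xi> m) u \<omega>)\<^sup>2) \<partial>lborel) \<partial>M)
          \<longlonglongrightarrow> 0 \<and>
        (\<lambda>m. \<integral>\<^sup>+\<omega>. ennreal ((I \<omega> - simple_integral B (n m) (\<tau> m) (\<xi> m) \<omega>)\<^sup>2) \<partial>M)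
          \<longlonglongrightarrow> 0)"

text \<open>\<open>A r j s t\<close> is the iterated integral $\int_s^t (W_r(u) - W_r(s))\,dW_j(u)$, in a version
  that almost surely satisfies Chen's relation and the Hoelder bounds simultaneously for all
  times.\<close>

definition iterated_integral_version ::
  "'a measure \<Rightarrow> (real \<Rightarrow> 'a \<Rightarrow> real ^ 'd) \<Rightarrow>
   ('d \<Rightarrow> 'd \<Rightarrow> real \<Rightarrow> real \<Rightarrow> 'a \<Rightarrow> real) \<Rightarrow> bool" where
  "iterated_integral_version M W A \<longleftrightarrow>
     (\<forall>r j s t. 0 \<le> s \<and> s \<le> t \<longrightarrow>
        has_ito_integral M (natural_filtration M W) (\<lambda>u \<omega>. W u \<omega> $ j)
          (\<lambda>u \<omega>. W u \<omega> $ r - W s \<omega> $ r) s t (A r j s t)) \<and>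
     (AE \<omega> in M.
        (\<forall>r j s t u. 0 \<le> s \<and> s \<le> t \<and> t \<le> u \<longrightarrow>
           A r j s u \<omega> = A r j s t \<omega> + A r j t u \<omega>
             + (W t \<omega> $ r - W s \<omega> $ r) * (W u \<omega> $ j - W t \<omega> $ j)) \<and>
        (\<forall>p a b. 2 < p \<and> 0 \<le> a \<and> a \<le> b \<longrightarrow>
           (\<exists>c. \<forall>s t. a \<le> s \<and> s \<le> t \<and> t \<le> b \<longrightarrow>
              norm (W t \<omega> - W s \<omega>) \<le> c * (t - s) powr (1 / p) \<and>
              (\<forall>r j. \<bar>A r j s t \<omega>\<bar> \<le> c * (t - s) powr (2 / p)))))"


section \<open>Differentiability classes\<close>

definition partial_deriv :: "'n \<Rightarrow> (real ^ 'n \<Rightarrow> real) \<Rightarrow> real ^ 'n \<Rightarrow> real" where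
  "partial_deriv h g x = deriv (\<lambda>t. g (x + t *\<^sub>R axis h 1)) 0"

text \<open>Only meant for open sets \<open>S\<close>.\<close>

primrec Ck_on :: "nat \<Rightarrow> (real ^ 'n) set \<Rightarrow> (real ^ 'n \<Rightarrow> real) \<Rightarrow> bool" where
  "Ck_on 0 S g \<longleftrightarrow> continuous_on S g"
| "Ck_on (Suc k) S g \<longleftrightarrow>
     (\<forall>x\<in>S. g differentiable (at x)) \<and> (\<forall>h. Ck_on k S (partial_deriv h g))"

definition smooth_on :: "(real ^ 'n) set \<Rightarrow> (real ^ 'n \<Rightarrow> real) \<Rightarrow> bool" where
  "smooth_on S g \<longleftrightarrow> (\<forall>k. Ck_on k S g)"


section \<open>Pathwise solutions\<close>

text \<open>\<open>F i j\<close> is the coefficient $f^i_j$ of $dy_i = \sum_j f^i_j(y)\,dw_j$; the driving path \<open>w\<close>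
  and its second-level increments \<open>a r j s t\<close> are deterministic here. The function
  \<open>\<omega>\<close> is only required to be nondecreasing; the condition \<open>\<theta> 0 = 0\<close> is the content
  of $\theta(\delta) = o(\delta)$ at $\delta = 0$, which the punctured filter does not see. For
  strictly increasing \<open>\<omega>\<close> the value \<open>\<theta> 0\<close> is irrelevant, so the notion of
  solution with strictly increasing \<open>\<omega>\<close> is included.\<close>

definition satisfied_on ::
  "('n \<Rightarrow> 'd \<Rightarrow> real ^ 'n \<Rightarrow> real) \<Rightarrow> (real \<Rightarrow> real ^ 'd) \<Rightarrow>
   ('d \<Rightarrow> 'd \<Rightarrow> real \<Rightarrow> real \<Rightarrow> real) \<Rightarrow> (real \<Rightarrow> real ^ 'n) \<Rightarrow> real \<Rightarrow> real \<Rightarrow> bool" where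
  "satisfied_on F w a y \<alpha> \<beta> \<longleftrightarrow>
     (\<exists>(\<omega> :: real \<Rightarrow> real) (\<theta> :: real \<Rightarrow> real).
        continuous_on {\<alpha>..\<beta>} \<omega> \<and> mono_on {\<alpha>..\<beta>} \<omega> \<and>
        (\<forall>\<delta>\<ge>0. 0 \<le> \<theta> \<delta>) \<and> \<theta> 0 = 0 \<and> \<theta> \<in> o[at_right 0](\<lambda>\<delta>. \<delta>) \<and>
        (\<forall>i s t. \<alpha> \<le> s \<and> s < t \<and> t \<le> \<beta> \<longrightarrow>
           \<bar>y t $ i - y s $ i
              - (\<Sum>j\<in>UNIV. F i j (y s) * (w t $ j - w s $ j))
              - (\<Sum>h\<in>UNIV. \<Sum>r\<in>UNIV. \<Sum>j\<in>UNIV.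
                   F h r (y s) * partial_deriv h (F i j) (y s) * a r j s t)\<bar>
           \<le> \<theta> (\<omega> t - \<omega> s)))"

definition satisfied_locally ::
  "('n \<Rightarrow> 'd \<Rightarrow> real ^ 'n \<Rightarrow> real) \<Rightarrow> (real \<Rightarrow> real ^ 'd) \<Rightarrow>
   ('d \<Rightarrow> 'd \<Rightarrow> real \<Rightarrow> real \<Rightarrow> real) \<Rightarrow> (real \<Rightarrow> real ^ 'n) \<Rightarrow> bool" where
  "satisfied_locally F w a y \<longleftrightarrow>
     (\<forall>\<alpha> \<beta>. 0 < \<alpha> \<and> \<alpha> \<le> \<beta> \<and> \<beta> < 1 \<longrightarrow> satisfied_on F w a y \<alpha> \<beta>)"


section \<open>The system\<close>

text \<open>The numerals 1, ..., 8 denote the eight distinct elements of the index type \<open>8\<close>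
  (where \<open>8 = 0\<close>), and similarly for the index type \<open>7\<close>.\<close>

definition first_seven :: "real ^ 8 \<Rightarrow> real ^ 7" where
  "first_seven y = vector [y $ 1, y $ 2, y $ 3, y $ 4, y $ 5, y $ 6, y $ 7]"

definition system_coeff :: "(real ^ 7 \<Rightarrow> real) \<Rightarrow> 8 \<Rightarrow> 8 \<Rightarrow> real ^ 8 \<Rightarrow> real" where
  "system_coeff f i j y =
     (if i \<noteq> j then 0 else if i = 8 then f (first_seven y) else 1)"

end

theory Submission
  imports Defs
begin

text \<open>Write \<open>W = (X, Z)\<close> with \<open>X\<close> the first seven coordinates. For a solution,
  \<open>y\<^sub>8(t) - y\<^sub>8(s)\<close> is the limit of the compensated sums of \<open>\<integral>\<^sub>s\<^sup>t f(X) dZ\<close>, so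
  it suffices to find one \<open>f\<close> for which these integrals over arbitrarily early windows are at
  least 1, which contradicts continuity at 0. Such an \<open>f\<close> is a sum of pieces supported in
  shrinking annuli around the origin, provided that on each window the integral is unbounded on the
  functions with \<open>|\<nabla>f| \<le> 3\<close> supported in a neighbourhood of the path.

  The unboundedness is variational. Among these functions, a near maximiser of
  \<open>J f - \<nu> P f\<close>, where \<open>J f = \<integral> f(X) dZ\<close> and \<open>P f = \<integral> |\<nabla>f(X\<^sub>t)|\<^sup>2 dt\<close>, has \<open>J f \<ge> \<nu> P f\<close> up to
  a small error, since \<open>f = 0\<close> is admissible; so it suffices that \<open>P f\<close> is bounded below as \<open>\<nu>\<close>
  grows. If \<open>P f\<close> is small, then \<open>|\<nabla>f| \<le> 2\<close> for most of the time, and on the cells of a grid of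
  mesh \<open>2\<^sup>-\<^sup>m\<close> where this holds one can add bumps of height of order \<open>2\<^sup>-\<^sup>m\<close> with suitable signs.
  Given \<open>X\<close>, the integrals of disjoint bumps are independent Gaussians whose variances are of the
  order of the occupation times of the cells, and this makes the functional gain a fixed amount. The needed
  almost sure limits follow from moment bounds, because in dimension 7 two times at which \<open>X\<close>
  visits the same cell are close to each other. The second-level terms average out by
  the Ito isometry.\<close>

text \<open>The height 2^-m is forced by scaling. In dimension 7 the path spends a time of order
  4^-m in each of the roughly 4^m cells it visits, so the integral of a unit bump is of order 2^-m;
  divided by 2^m, these integrals still have absolute values adding up to order one, while the
  gradients stay bounded. This is why the gain does not fade as m grows. Two obstacles shape the
  argument. The added bumps also change the penalty \<open>P\<close>, and its first-order change
  \<open>I (corr f m p)\<close> could cancel the gain. It does not, because for a fixed f it is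
  determined by X alone: the sum over the cells of its products with the integrals against Z is
  negligible even after multiplication by 2^m. Secondly, f is chosen after the path has been seen,
  so the almost sure statements must hold for all candidates at once. The candidates are therefore
  finite sums of bumps with rational coefficients, a countable family that the improving
  perturbation does not leave, and windows and annuli are also taken from countable
  families.\<close>

definition expoly :: "real poly \<Rightarrow> real \<Rightarrow> real" where
  "expoly p y = (if y \<le> 0 then 0 else poly p (1 / y) * exp (- (1 / y)))"

lemma tendsto_poly_exp_minus_at_top: "((\<lambda>u. poly p u * exp (- u)) \<longlongrightarrow> (0::real)) at_top"
proof -
  have "((\<lambda>u. \<Sum>i\<le>degree p. coeff p i * (u ^ i / exp u)) \<longlongrightarrow> (\<Sum>i\<le>degree p. coeff p i * 0)) at_top"
    by (intro tendsto_intros tendsto_power_div_exp_0)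
  then show ?thesis
    by (simp add: poly_altdef exp_minus sum_distrib_right divide_inverse mult.assoc)
qed

lemma tendsto_expoly_at_right_0: "(expoly p \<longlongrightarrow> 0) (at_right 0)"
proof -
  have "((\<lambda>y. poly p (inverse y) * exp (- (inverse y))) \<longlongrightarrow> 0) (at_right (0::real))"
    using filterlim_compose[OF tendsto_poly_exp_minus_at_top filterlim_inverse_at_top_right] .
  then show ?thesis
    by (rule Lim_transform_eventually)
       (auto simp: expoly_def eventually_at_filter inverse_eq_divide)
qed

text \<open>Differentiating p(1/y) exp(-1/y) replaces p by u^2 (p - p') in the variable u = 1/y, so
  this one rule yields all higher derivatives. Only the origin needs a limit argument.\<close>

lemma DERIV_expoly:
  "(expoly p has_real_derivative expoly (monom 1 2 * (p - pderiv p)) y) (at y)"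
proof -
  consider "y < 0" | "y > 0" | "y = 0" by linarith
  then show ?thesis
  proof cases
    case 1
    have "((\<lambda>_. 0) has_real_derivative expoly (monom 1 2 * (p - pderiv p)) y) (at y)"
      using 1 by (simp add: expoly_def)
    then show ?thesis
      by (rule has_field_derivative_transform_within_open[where S = "{..<0}"])
         (use 1 in \<open>auto simp: expoly_def\<close>)
  next
    case 2
    have "((\<lambda>y. poly p (1 / y) * exp (- (1 / y))) has_real_derivative
        expoly (monom 1 2 * (p - pderiv p)) y) (at y)"
      using 2
      by (auto intro!: derivative_eq_intros simp: expoly_def poly_monom field_simps power2_eq_square)
    then show ?thesis
      by (rule has_field_derivative_transform_within_open[where S = "{0<..}"])
         (use 2 in \<open>auto simp: expoly_def\<close>)
  next
    case 3
    have "((\<lambda>h. expoly p h / h) \<longlongrightarrow> 0) (at_left 0)"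
      by (rule Lim_transform_eventually[OF tendsto_const])
         (auto simp: expoly_def eventually_at_filter)
    \<comment> \<open>Dividing by h multiplies the polynomial by its variable, so the difference
      quotient is again an \<open>expoly\<close>, and its limit at 0 is already known.\<close>
    moreover have "((\<lambda>h. expoly p h / h) \<longlongrightarrow> 0) (at_right 0)"
      by (rule Lim_transform_eventually[OF tendsto_expoly_at_right_0[of "monom 1 1 * p"]])
         (auto simp: expoly_def poly_monom eventually_at_filter)
    ultimately have "((\<lambda>h. expoly p h / h) \<longlongrightarrow> 0) (at 0)"
      by (simp add: filterlim_split_at)
    then show ?thesis
      using 3 by (simp add: DERIV_def expoly_def)
  qed
qed

lemma expoly_nonneg_1: "0 \<le> expoly 1 y" and expoly_le_1: "expoly 1 y \<le> 1"
  by (auto simp: expoly_def)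

text \<open>The partial derivatives of these functions stay in the class, which makes every member
  smooth.\<close>

inductive_set elementary :: "(real ^ 'n \<Rightarrow> real) set" where
  const: "(\<lambda>_. c) \<in> elementary"
| expoly: "(\<lambda>x. expoly p (a * x $ h + b)) \<in> elementary"
| add: "f \<in> elementary \<Longrightarrow> g \<in> elementary \<Longrightarrow> (\<lambda>x. f x + g x) \<in> elementary"
| mult: "f \<in> elementary \<Longrightarrow> g \<in> elementary \<Longrightarrow> (\<lambda>x. f x * g x) \<in> elementary"

lemma partial_deriv_eqI:
  assumes "(g has_derivative g') (at x)"
  shows "partial_deriv h g x = g' (axis h 1)"
proof -
  have "((\<lambda>t. x + t *\<^sub>R axis h 1) has_derivative (\<lambda>t. t *\<^sub>R axis h 1)) (at 0)"
    by (auto intro!: derivative_eq_intros)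
  then have "((\<lambda>t. g (x + t *\<^sub>R axis h 1)) has_derivative (\<lambda>t. g' (t *\<^sub>R axis h 1))) (at 0)"
    using assms by (auto intro: has_derivative_compose[where g = g])
  moreover have "(\<lambda>t. g' (t *\<^sub>R axis h 1)) = (*) (g' (axis h 1))"
    using linear_cmul[OF has_derivative_linear[OF assms]] by (auto simp: fun_eq_iff)
  ultimately show ?thesis
    unfolding partial_deriv_def by (intro DERIV_imp_deriv) (simp add: has_field_derivative_def)
qed

text \<open>The induction carries the total derivative together with explicit elementary partials,
  because \<open>partial_deriv\<close> rests on \<open>deriv\<close>, which carries no information
  before differentiability is known.\<close>

lemma elementary_deriv_aux:
  assumes "g \<in> elementary"
  shows "\<exists>G. (\<forall>x. (g has_derivative (\<lambda>v. \<Sum>h\<in>UNIV. G h x * v $ h)) (at x)) \<and> (\<forall>h. G h \<in> elementary)"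
  using assms
proof induction
  case (const c)
  then show ?case
    by (intro exI[of _ "\<lambda>_ _. 0"]) (simp add: elementary.const)
next
  case (expoly p a h b)
  let ?D = "\<lambda>x. expoly (monom 1 2 * (p - pderiv p)) (a * x $ h + b)"
  have "((\<lambda>x. expoly p (a * x $ h + b)) has_derivative
      (\<lambda>v. \<Sum>i\<in>UNIV. (if i = h then a * ?D x else 0) * v $ i)) (at x)" for x
  proof -
    have "((\<lambda>x. a * x $ h + b) has_derivative (\<lambda>v. a * v $ h + 0)) (at x)"
      by (intro has_derivative_add has_derivative_mult_right has_derivative_const
          bounded_linear_imp_has_derivative bounded_linear_vec_nth)
    from has_derivative_compose[OF this DERIV_expoly[unfolded has_field_derivative_def]]
    have "((\<lambda>x. expoly p (a * x $ h + b)) has_derivative (\<lambda>v. ?D x * (a * v $ h))) (at x)"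
      by (simp only: add_0_right)
    moreover have "(\<Sum>i\<in>UNIV. (if i = h then a * ?D x else 0) * v $ i) = ?D x * (a * v $ h)" for v
      by (simp add: if_distrib[of "\<lambda>z. z * _"] cong: if_cong)
    ultimately show ?thesis by simp
  qed
  moreover have "(\<lambda>x. if i = h then a * ?D x else 0) \<in> elementary" for i
  proof (cases "i = h")
    case True
    have "(\<lambda>x. a * ?D x) \<in> elementary" by (rule elementary.mult[OF elementary.const elementary.expoly])
    then show ?thesis using True by simp
  next
    case False
    then show ?thesis by (simp add: elementary.const)
  qed
  ultimately show ?case
    by (intro exI[of _ "\<lambda>i x. if i = h then a * ?D x else 0"]) blast
next
  case (add f g)
  from add.IH(1) obtain F where F: "\<And>x. (f has_derivative (\<lambda>v. \<Sum>h\<in>UNIV. F h x * v $ h)) (at x)"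
    "\<And>h. F h \<in> elementary" by blast
  from add.IH(2) obtain G where G: "\<And>x. (g has_derivative (\<lambda>v. \<Sum>h\<in>UNIV. G h x * v $ h)) (at x)"
    "\<And>h. G h \<in> elementary" by blast
  note FG = F G
  have "((\<lambda>x. f x + g x) has_derivative (\<lambda>v. \<Sum>h\<in>UNIV. (F h x + G h x) * v $ h)) (at x)" for x
    using has_derivative_add[OF FG(1,3)] by (simp add: sum.distrib distrib_right)
  then show ?case using FG by (intro exI[of _ "\<lambda>h x. F h x + G h x"]) (simp add: elementary.add)
next
  case (mult f g)
  from mult.IH(1) obtain F where F: "\<And>x. (f has_derivative (\<lambda>v. \<Sum>h\<in>UNIV. F h x * v $ h)) (at x)"
    "\<And>h. F h \<in> elementary" by blast
  from mult.IH(2) obtain G where G: "\<And>x. (g has_derivative (\<lambda>v. \<Sum>h\<in>UNIV. G h x * v $ h)) (at x)"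
    "\<And>h. G h \<in> elementary" by blast
  note FG = F G
  have "((\<lambda>x. f x * g x) has_derivative (\<lambda>v. \<Sum>h\<in>UNIV. (f x * G h x + F h x * g x) * v $ h)) (at x)" for x
    using has_derivative_mult[OF FG(1,3)]
    by (rule has_derivative_eq_rhs)
       (rule ext, simp only: distrib_right sum.distrib sum_distrib_left sum_distrib_right mult.assoc mult.commute[of _ "g x"])
  then show ?case using FG mult
    by (intro exI[of _ "\<lambda>h x. f x * G h x + F h x * g x"]) (simp add: elementary.add elementary.mult)
qed

lemma
  assumes "g \<in> elementary"
  shows elementary_has_derivative:
      "(g has_derivative (\<lambda>v. \<Sum>h\<in>UNIV. partial_deriv h g x * v $ h)) (at x)"
    and elementary_partial_deriv: "partial_deriv h g \<in> elementary"
proof -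
  obtain G where G: "\<And>x. (g has_derivative (\<lambda>v. \<Sum>h\<in>UNIV. G h x * v $ h)) (at x)" "\<And>h. G h \<in> elementary"
    using elementary_deriv_aux[OF assms] by blast
  have eq: "partial_deriv h g = G h" for h
    by (rule ext) (simp add: partial_deriv_eqI[OF G(1)] axis_def if_distrib[of "\<lambda>z. _ * z"] cong: if_cong)
  show "(g has_derivative (\<lambda>v. \<Sum>h\<in>UNIV. partial_deriv h g x * v $ h)) (at x)"
    and "partial_deriv h g \<in> elementary"
    using G by (auto simp: eq)
qed

lemma elementary_differentiable: "g \<in> elementary \<Longrightarrow> g differentiable (at x)"
  unfolding differentiable_def by (rule exI) (rule elementary_has_derivative)

lemma elementary_continuous_on: "g \<in> elementary \<Longrightarrow> continuous_on S g"
  by (intro continuous_at_imp_continuous_on ballI differentiable_imp_continuous_within elementary_differentiable)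

lemma elementary_cmult: "g \<in> elementary \<Longrightarrow> (\<lambda>x. c * g x) \<in> elementary"
  by (rule elementary.mult[OF elementary.const])

lemma elementary_sum: "(\<And>i. i \<in> I \<Longrightarrow> g i \<in> elementary) \<Longrightarrow> (\<lambda>x. \<Sum>i\<in>I. g i x) \<in> elementary"
proof (induction I rule: infinite_finite_induct)
  case (insert i I)
  then show ?case using elementary.add[of "g i" "\<lambda>x. \<Sum>i\<in>I. g i x"] by simp
qed (simp_all add: elementary.const)

lemma elementary_prod: "(\<And>i. i \<in> I \<Longrightarrow> g i \<in> elementary) \<Longrightarrow> (\<lambda>x. \<Prod>i\<in>I. g i x) \<in> elementary"
proof (induction I rule: infinite_finite_induct)
  case (insert i I)
  then show ?case using elementary.mult[of "g i" "\<lambda>x. \<Prod>i\<in>I. g i x"] by simp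
qed (simp_all add: elementary.const)

section \<open>Partial derivatives and smoothness of elementary functions\<close>

lemma partial_deriv_add:
  assumes "f \<in> elementary" "g \<in> elementary"
  shows "partial_deriv h (\<lambda>x. f x + g x) x = partial_deriv h f x + partial_deriv h g x"
  by (subst partial_deriv_eqI[OF has_derivative_add[OF assms[THEN elementary_has_derivative]]])
     (simp add: axis_def if_distrib[of "\<lambda>z. _ * z"] cong: if_cong)

lemma partial_deriv_const: "partial_deriv h (\<lambda>_. c) x = 0"
  by (simp add: partial_deriv_def)

lemma partial_deriv_cmult:
  assumes "f \<in> elementary"
  shows "partial_deriv h (\<lambda>x. c * f x) x = c * partial_deriv h f x"
  by (subst partial_deriv_eqI[OF has_derivative_mult_right[OF elementary_has_derivative[OF assms]]])
     (simp add: axis_def if_distrib[of "\<lambda>z. _ * z"] cong: if_cong)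

lemma partial_deriv_sum:
  assumes "\<And>i. i \<in> I \<Longrightarrow> g i \<in> elementary"
  shows "partial_deriv h (\<lambda>x. \<Sum>i\<in>I. g i x) x = (\<Sum>i\<in>I. partial_deriv h (g i) x)"
  using assms
  by (induction I rule: infinite_finite_induct)
     (simp_all add: partial_deriv_const partial_deriv_add elementary_sum)

lemma partial_deriv_cong:
  assumes "open V" "x \<in> V" "\<And>y. y \<in> V \<Longrightarrow> f y = g y"
  shows "partial_deriv h f x = partial_deriv h g x"
proof -
  have "isCont (\<lambda>t. x + t *\<^sub>R axis h 1 :: real^'a) 0" by (intro continuous_intros)
  then have "\<forall>\<^sub>F t in nhds 0. x + t *\<^sub>R axis h 1 \<in> V"
    using assms by (intro eventually_compose_filterlim[OF topological_space_class.eventually_nhds_in_open[OF assms(1,2)]])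
      (simp add: isCont_def tendsto_nhds_iff)
  then show ?thesis
    unfolding partial_deriv_def
    by (intro deriv_cong_ev) (auto elim!: eventually_mono simp: assms)
qed

text \<open>Local agreement with an elementary function passes to partial derivatives, which is all
  the induction on k needs. The local form is required because the counterexample is an infinite sum
  of elementary pieces that is finite only near points other than the origin.\<close>

lemma Ck_on_locally_elementary:
  assumes "\<And>x. x \<in> S \<Longrightarrow> \<exists>V g. open V \<and> x \<in> V \<and> g \<in> elementary \<and> (\<forall>y\<in>V. f y = g y)"
  shows "Ck_on k S f"
  using assms
proof (induction k arbitrary: f)
  case 0
  have "isCont f x" if x: "x \<in> S" for x
  proof -
    obtain V g where V: "open V" "x \<in> V" "g \<in> elementary" "\<forall>y\<in>V. f y = g y" using 0[OF x] by blast
    have "isCont g x" using elementary_continuous_on[OF V(3), of UNIV] by (simp add: continuous_on_eq_continuous_at)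
    moreover have "\<forall>\<^sub>F y in nhds x. f y = g y"
      using V by (auto intro: eventually_mono[OF eventually_nhds_in_open])
    ultimately show ?thesis using isCont_cong by metis
  qed
  then show ?case by (simp add: continuous_at_imp_continuous_on)
next
  case (Suc k)
  have "f differentiable (at x)" if x: "x \<in> S" for x
  proof -
    obtain V g where V: "open V" "x \<in> V" "g \<in> elementary" "\<forall>y\<in>V. f y = g y" using Suc(2)[OF x] by blast
    have "(f has_derivative (\<lambda>v. \<Sum>h\<in>UNIV. partial_deriv h g x * v $ h)) (at x)"
      by (rule has_derivative_transform_within_open[OF elementary_has_derivative[OF V(3)] V(1,2)])
         (use V(4) in auto)
    then show ?thesis by (auto simp: differentiable_def)
  qed
  moreover have "Ck_on k S (partial_deriv h f)" for h
  proof (rule Suc.IH)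
    fix x assume "x \<in> S"
    then obtain V g where V: "open V" "x \<in> V" "g \<in> elementary" "\<forall>y\<in>V. f y = g y" using Suc(2) by blast
    then show "\<exists>V g. open V \<and> x \<in> V \<and> g \<in> elementary \<and> (\<forall>y\<in>V. partial_deriv h f y = g y)"
      by (intro exI[of _ V] exI[of _ "partial_deriv h g"])
         (auto intro!: partial_deriv_cong elementary_partial_deriv)
  qed
  ultimately show ?case by simp
qed

lemma elementary_lipschitz:
  fixes g :: "real ^ 'n \<Rightarrow> real"
  assumes g: "g \<in> elementary" and B: "\<And>h x. \<bar>partial_deriv h g x\<bar> \<le> B"
  shows "\<bar>g x - g y\<bar> \<le> real CARD('n) * B * norm (x - y)"
proof -
  have "norm (g x - g y) \<le> (real CARD('n) * B) * norm (x - y)"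
  proof (rule differentiable_bound[OF convex_UNIV])
    show "(g has_derivative (\<lambda>v. \<Sum>h\<in>UNIV. partial_deriv h g x * v $ h)) (at x within UNIV)" for x
      using elementary_has_derivative[OF g] by simp
    show "onorm (\<lambda>v. \<Sum>h\<in>UNIV. partial_deriv h g x * v $ h) \<le> real CARD('n) * B" for x
    proof (rule onorm_le)
      fix v
      have "\<bar>\<Sum>h\<in>UNIV. partial_deriv h g x * v $ h\<bar> \<le> (\<Sum>h::'n\<in>UNIV. B * norm v)"
        by (intro order_trans[OF sum_abs] sum_mono)
           (auto simp: abs_mult intro!: mult_mono B component_le_norm_cart order_trans[OF abs_ge_zero B])
      then show "norm (\<Sum>h\<in>UNIV. partial_deriv h g x * v $ h) \<le> real CARD('n) * B * norm v"
        by simp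
    qed
  qed auto
  then show ?thesis by simp
qed

section \<open>Bump functions on a grid of cubes\<close>

text \<open>This is exp(-1/y - 1/(1 - y)) on the open unit interval, extended by 0.\<close>

definition bump1 :: "real \<Rightarrow> real" where
  "bump1 y = expoly 1 y * expoly 1 (1 - y)"

definition bump1' :: "real \<Rightarrow> real" where
  "bump1' y = expoly (monom 1 2) y * expoly 1 (1 - y) - expoly 1 y * expoly (monom 1 2) (1 - y)"

lemma DERIV_bump1: "(bump1 has_real_derivative bump1' y) (at y)"
proof -
  have E: "(expoly 1 has_real_derivative expoly (monom 1 2) y) (at y)" for y
    using DERIV_expoly[of 1 y] by simp
  have "((\<lambda>y. expoly 1 (1 - y)) has_real_derivative expoly (monom 1 2) (1 - y) * (-1)) (at y)"
    by (rule DERIV_chain2[OF E]) (auto intro!: derivative_eq_intros)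
  from DERIV_mult[OF E this] show ?thesis
    by (simp add: bump1_def[abs_def] bump1'_def algebra_simps)
qed

lemma bump1_eq_0: "\<not> (0 < y \<and> y < 1) \<Longrightarrow> bump1 y = 0"
  by (auto simp: bump1_def expoly_def)

lemma bump1'_eq_0: "\<not> (0 < y \<and> y < 1) \<Longrightarrow> bump1' y = 0"
  by (auto simp: bump1'_def expoly_def)

lemma bump1_nonneg: "0 \<le> bump1 y" and bump1_le_1: "bump1 y \<le> 1"
  by (auto simp: bump1_def expoly_nonneg_1 expoly_le_1 mult_le_one)

text \<open>On the middle half of the interval both 1/y and 1/(1 - y) are at most 4, which gives the
  exponent -8.\<close>

lemma bump1_lower: "1 / 4 \<le> y \<Longrightarrow> y \<le> 3 / 4 \<Longrightarrow> exp (- 8) \<le> bump1 y"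
proof -
  assume y: "1 / 4 \<le> y" "y \<le> 3 / 4"
  have "1 / y \<le> 4" "1 / (1 - y) \<le> 4" using y by (auto simp: field_simps)
  then show ?thesis using y by (simp add: bump1_def expoly_def flip: exp_add)
qed

lemma bump1'_bounded: "\<exists>B>0. \<forall>y. \<bar>bump1' y\<bar> \<le> B"
proof -
  have "continuous_on UNIV (expoly p)" for p
    by (meson DERIV_expoly DERIV_isCont continuous_at_imp_continuous_on)
  then have E: "continuous_on S (\<lambda>y. expoly p (h y))" if "continuous_on S h" for S p and h :: "real \<Rightarrow> real"
    using continuous_on_compose2[OF _ that] by blast
  have "continuous_on {0..1} bump1'"
    unfolding bump1'_def[abs_def] by (intro continuous_intros E)
  then have "bounded (bump1' ` {0..1})"
    by (intro compact_imp_bounded compact_continuous_image) auto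
  then obtain B where B: "B > 0" "\<forall>y\<in>{0..1}. \<bar>bump1' y\<bar> \<le> B"
    by (auto simp: bounded_pos)
  then have "\<bar>bump1' y\<bar> \<le> B" for y
    using bump1'_eq_0[of y] by (cases "0 < y \<and> y < 1") auto
  then show ?thesis using B by blast
qed

text \<open>The first component records in which coordinates the grid is shifted by half a cell, the
  second the integer position. Cells with equal shift are disjoint, which gives independence; the
  different shifts together ensure that every point is well inside some cell, where the bump is
  bounded below.\<close>

type_synonym 'n cell = "('n \<Rightarrow> bool) \<times> ('n \<Rightarrow> int)"

definition cell_coord :: "nat \<Rightarrow> 'n cell \<Rightarrow> real ^ 'n \<Rightarrow> 'n \<Rightarrow> real" where
  "cell_coord m p x h = 2 ^ m * x $ h - of_bool (fst p h) / 2 - of_int (snd p h)"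

definition cell :: "nat \<Rightarrow> 'n cell \<Rightarrow> (real ^ 'n) set" where
  "cell m p = {x. \<forall>h. 0 < cell_coord m p x h \<and> cell_coord m p x h < 1}"

definition bump :: "nat \<Rightarrow> 'n cell \<Rightarrow> real ^ 'n \<Rightarrow> real" where
  "bump m p x = (\<Prod>h\<in>UNIV. bump1 (cell_coord m p x h))"

lemma bump_elementary: "bump m p \<in> elementary"
proof -
  have "(\<lambda>x. bump1 (cell_coord m p x h)) \<in> elementary" for h
  proof -
    let ?b = "- of_bool (fst p h) / 2 - of_int (snd p h)"
    have "(\<lambda>x. expoly 1 (2 ^ m * x $ h + ?b) * expoly 1 ((- (2 ^ m)) * x $ h + (1 - ?b))) \<in> elementary"
      by (intro elementary.intros)
    then show ?thesis by (simp add: bump1_def cell_coord_def algebra_simps)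
  qed
  then show ?thesis unfolding bump_def[abs_def] by (intro elementary_prod)
qed

lemma bump_nonneg: "0 \<le> bump m p x" and bump_le_1: "bump m p x \<le> 1"
  by (auto simp: bump_def bump1_nonneg bump1_le_1 intro!: prod_nonneg prod_le_1)

lemma bump_eq_0: "x \<notin> cell m p \<Longrightarrow> bump m p x = 0"
  unfolding cell_def bump_def by (auto simp: prod_zero_iff intro: bump1_eq_0)

lemma partial_deriv_bump:
  "partial_deriv h (bump m p) x =
     2 ^ m * bump1' (cell_coord m p x h) * (\<Prod>i\<in>UNIV - {h}. bump1 (cell_coord m p x i))"
proof -
  have eq: "bump m p (x + t *\<^sub>R axis h 1) =
      bump1 (2 ^ m * t + cell_coord m p x h) * (\<Prod>i\<in>UNIV - {h}. bump1 (cell_coord m p x i))" for t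
    unfolding bump_def
    by (subst prod.remove[of _ h]) (auto simp: cell_coord_def axis_def algebra_simps intro!: arg_cong2[where f = "(*)"] prod.cong)
  have "((\<lambda>t. bump1 (2 ^ m * t + cell_coord m p x h)) has_real_derivative
      bump1' (2 ^ m * 0 + cell_coord m p x h) * 2 ^ m) (at 0)"
    by (rule DERIV_chain2[OF DERIV_bump1]) (auto intro!: derivative_eq_intros)
  then have "((\<lambda>t. bump m p (x + t *\<^sub>R axis h 1)) has_real_derivative
      bump1' (cell_coord m p x h) * 2 ^ m * (\<Prod>i\<in>UNIV - {h}. bump1 (cell_coord m p x i))) (at 0)"
    unfolding eq by (auto intro!: DERIV_cmult_right)
  then show ?thesis unfolding partial_deriv_def by (simp add: DERIV_imp_deriv mult_ac)
qed

lemma partial_deriv_bump_eq_0: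
  assumes "x \<notin> cell m p" shows "partial_deriv h (bump m p) x = 0"
proof -
  obtain i where i: "\<not> (0 < cell_coord m p x i \<and> cell_coord m p x i < 1)"
    using assms unfolding cell_def by auto
  show ?thesis
  proof (cases "i = h")
    case True
    then show ?thesis using bump1'_eq_0[OF i] by (simp add: partial_deriv_bump)
  next
    case False
    then have "(\<Prod>i\<in>UNIV - {h}. bump1 (cell_coord m p x i)) = 0"
      using bump1_eq_0[OF i] by (auto simp: prod_zero_iff)
    then show ?thesis by (simp add: partial_deriv_bump)
  qed
qed

text \<open>The chain rule costs one factor 2^m and the remaining factors of the product are at most
  1. Hence bumps divided by 2^m have gradients bounded uniformly in m and in the position.\<close>

lemma bump_gradient_bound:
  obtains B where "B > 0" "\<And>m (p :: 'n::finite cell) h x. \<bar>partial_deriv h (bump m p) x\<bar> \<le> 2 ^ m * B"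
proof -
  obtain B where B: "B > 0" "\<And>y. \<bar>bump1' y\<bar> \<le> B" using bump1'_bounded by blast
  have "\<bar>partial_deriv h (bump m p) x\<bar> \<le> 2 ^ m * B" for m h x and p :: "'n cell"
  proof -
    have "\<bar>\<Prod>i\<in>UNIV - {h}. bump1 (cell_coord m p x i)\<bar> \<le> 1"
      by (simp add: abs_prod) (intro prod_le_1, auto simp: bump1_nonneg bump1_le_1)
    then have "\<bar>bump1' (cell_coord m p x h)\<bar> * \<bar>\<Prod>i\<in>UNIV - {h}. bump1 (cell_coord m p x i)\<bar> \<le> B * 1"
      by (intro mult_mono B) (use B in auto)
    then show ?thesis unfolding partial_deriv_bump by (simp add: abs_mult mult_ac)
  qed
  with B(1) that show ?thesis by blast
qed

text \<open>In each coordinate both integers lie strictly between y - 1 and y for the same real y.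
  This disjointness is the reason for proving the moment bounds one shift \<theta> at a
  time.\<close>

lemma cell_unique:
  assumes "x \<in> cell m (\<theta>, q)" "x \<in> cell m (\<theta>, q')"
  shows "q = q'"
proof
  fix h
  have "real_of_int (q h) < real_of_int (q' h) + 1" "real_of_int (q' h) < real_of_int (q h) + 1"
    using assms unfolding cell_def cell_coord_def by (auto dest!: spec[of _ h])
  then show "q h = q' h" by linarith
qed

lemma cell_dist:
  assumes "x \<in> cell m p" "y \<in> cell m p"
  shows "\<bar>x $ h - y $ h\<bar> \<le> 1 / 2 ^ m"
proof -
  have "\<bar>cell_coord m p x h - cell_coord m p y h\<bar> \<le> 1"
    using assms unfolding cell_def by (auto dest!: spec[of _ h])
  moreover have "cell_coord m p x h - cell_coord m p y h = 2 ^ m * (x $ h - y $ h)"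
    by (simp add: cell_coord_def algebra_simps)
  ultimately have "2 ^ m * \<bar>x $ h - y $ h\<bar> \<le> 1"
    by (simp only: abs_mult abs_numeral power_abs)
  then show ?thesis by (simp add: field_simps)
qed

text \<open>Each coordinate is well inside one of the two half-shifted unit intervals containing it.\<close>

lemma exists_cell_bump_lower:
  fixes x :: "real ^ 'n"
  shows "\<exists>p. x \<in> cell m p \<and> exp (- 8) ^ CARD('n) \<le> bump m p x"
proof -
  have "\<exists>(b::bool) (q::int). 1 / 4 \<le> y - of_bool b / 2 - of_int q \<and> y - of_bool b / 2 - of_int q \<le> 3 / 4" for y :: real
  proof -
    define f where "f = frac y"
    have f: "0 \<le> f" "f < 1" "y = of_int \<lfloor>y\<rfloor> + f" unfolding f_def by (simp_all add: frac_lt_1) (simp add: frac_def)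
    consider "1/4 \<le> f \<and> f \<le> 3/4" | "f < 1/4" | "f > 3/4" by linarith
    then show ?thesis
    proof cases
      case 1 then show ?thesis using f by (intro exI[of _ False] exI[of _ "\<lfloor>y\<rfloor>"]) auto
    next
      case 2 then show ?thesis using f by (intro exI[of _ True] exI[of _ "\<lfloor>y\<rfloor> - 1"]) auto
    next
      case 3 then show ?thesis using f by (intro exI[of _ True] exI[of _ "\<lfloor>y\<rfloor>"]) auto
    qed
  qed
  then obtain b q where bq: "\<And>y::real. 1 / 4 \<le> y - of_bool (b y) / 2 - of_int (q y)"
      "\<And>y::real. y - of_bool (b y) / 2 - of_int (q y) \<le> 3 / 4"
    by metis
  define p where "p = (\<lambda>h. b (2 ^ m * x $ h), \<lambda>h. q (2 ^ m * x $ h))"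
  have p: "1 / 4 \<le> cell_coord m p x h" "cell_coord m p x h \<le> 3 / 4" for h
    unfolding cell_coord_def p_def using bq by simp_all
  have "x \<in> cell m p" unfolding cell_def
  proof (clarify, intro conjI)
    show "0 < cell_coord m p x h" "cell_coord m p x h < 1" for h
      using p[of h] by linarith+
  qed
  moreover have "(\<Prod>h::'n\<in>UNIV. exp (- 8)) \<le> bump m p x"
    unfolding bump_def by (intro prod_mono) (use p bump1_lower in auto)
  ultimately show ?thesis by (intro exI[of _ p]) auto
qed

lemma finite_cells_in_bounded:
  assumes "bounded U"
  shows "finite {p. cell m p \<subseteq> U}"
proof -
  obtain R where R: "\<And>x. x \<in> U \<Longrightarrow> norm x \<le> R" using assms by (auto simp: bounded_iff)
  define K where "K = \<lceil>2 ^ m * R + 2\<rceil>"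
  have "{p. cell m p \<subseteq> U} \<subseteq> UNIV \<times> Pi UNIV (\<lambda>_. {- K..K})"
  proof clarsimp
    fix \<theta> :: "'a \<Rightarrow> bool" and q h
    assume s: "cell m (\<theta>, q) \<subseteq> U"
    \<comment> \<open>The centre of the cell: it belongs to the cell, hence to U, and its norm
      controls the integer position.\<close>
    define x :: "real ^ 'a" where "x = (\<chi> h. (1 / 2 + of_bool (\<theta> h) / 2 + of_int (q h)) / 2 ^ m)"
    have "x \<in> cell m (\<theta>, q)" by (simp add: x_def cell_def cell_coord_def field_simps)
    then have "\<bar>x $ h\<bar> \<le> R" using s R component_le_norm_cart[of x h] by (meson order_trans subsetD)
    then have "\<bar>1 / 2 + of_bool (\<theta> h) / 2 + of_int (q h)\<bar> \<le> 2 ^ m * R"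
      by (simp add: x_def field_simps)
    then have "\<bar>real_of_int (q h)\<bar> \<le> 2 ^ m * R + 2" by (cases "\<theta> h") auto
    also have "\<dots> \<le> of_int K" by (simp add: K_def)
    finally show "- K \<le> q h \<and> q h \<le> K" by linarith
  qed
  moreover have "finite (Pi UNIV (\<lambda>_::'a. {- K..K}))"
    using finite_PiE[of "UNIV::'a set" "\<lambda>_. {- K..K}"] by (simp add: PiE_UNIV_domain)
  ultimately show ?thesis by (meson finite_SigmaI finite_subset finite)
qed

section \<open>Solutions along a fixed path\<close>

text \<open>T is the length of the window and not its right end. The points are dyadic so that each
  grid refines the previous one.\<close>

definition grid :: "real \<Rightarrow> real \<Rightarrow> nat \<Rightarrow> nat \<Rightarrow> real" where
  "grid \<alpha> T n k = \<alpha> + T * real k / 2 ^ n"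

lemma grid_0: "grid \<alpha> T n 0 = \<alpha>" and grid_end: "grid \<alpha> T n (2 ^ n) = \<alpha> + T"
  by (auto simp: grid_def)

lemma grid_diff: "grid \<alpha> T n (Suc k) - grid \<alpha> T n k = T / 2 ^ n"
  by (simp add: grid_def field_simps)

lemma grid_mono: "0 \<le> T \<Longrightarrow> k \<le> l \<Longrightarrow> grid \<alpha> T n k \<le> grid \<alpha> T n l"
  by (simp add: grid_def divide_right_mono mult_left_mono)

lemma grid_less: "0 < T \<Longrightarrow> grid \<alpha> T n k < grid \<alpha> T n (Suc k)"
  by (simp add: grid_def divide_strict_right_mono)

lemma grid_bounds:
  assumes "0 \<le> T" "k \<le> 2 ^ n" shows "\<alpha> \<le> grid \<alpha> T n k" "grid \<alpha> T n k \<le> \<alpha> + T"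
  using grid_mono[OF assms(1), of 0 k \<alpha> n] grid_mono[OF assms, of \<alpha> n] by (simp_all add: grid_0 grid_end)

text \<open>Uniform continuity makes all increments of \<omega> over a fine grid small at once;
  \<theta> is then at most c times the increment, and the increments telescope to the total increase
  of \<omega>, whatever the mesh.\<close>

lemma sum_small_increments_tendsto_0:
  fixes E :: "real \<Rightarrow> real \<Rightarrow> real"
  assumes T: "0 < T" and cont: "continuous_on {\<alpha>..\<alpha> + T} \<omega>" and mono: "mono_on {\<alpha>..\<alpha> + T} \<omega>"
    and \<theta>0: "\<theta> 0 = 0" and \<theta>: "\<theta> \<in> o[at_right 0](\<lambda>\<delta>. \<delta>)"
    and E: "\<And>s t. \<alpha> \<le> s \<Longrightarrow> s < t \<Longrightarrow> t \<le> \<alpha> + T \<Longrightarrow> \<bar>E s t\<bar> \<le> \<theta> (\<omega> t - \<omega> s)"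
  shows "(\<lambda>n. \<Sum>k<2^n. \<bar>E (grid \<alpha> T n k) (grid \<alpha> T n (Suc k))\<bar>) \<longlonglongrightarrow> 0"
proof (rule LIMSEQ_I)
  fix e :: real assume e: "0 < e"
  define V where "V = \<omega> (\<alpha> + T) - \<omega> \<alpha>"
  have V: "0 \<le> V" using mono T by (auto simp: V_def mono_on_def)
  \<comment> \<open>The summand 1 keeps the quotient meaningful if \<omega> is constant, and makes c
    V strictly smaller than e.\<close>
  define c where "c = e / (V + 1)"
  have c: "0 < c" using e V by (simp add: c_def)
  have "\<forall>\<^sub>F \<delta> in at_right 0. \<bar>\<theta> \<delta>\<bar> \<le> c * \<bar>\<delta>\<bar>"
    using landau_o.smallD[OF \<theta> c] by simp
  then obtain \<delta>0 where \<delta>0: "0 < \<delta>0" "\<And>\<delta>. 0 < \<delta> \<Longrightarrow> \<delta> < \<delta>0 \<Longrightarrow> \<bar>\<theta> \<delta>\<bar> \<le> c * \<bar>\<delta>\<bar>"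
    by (auto simp: eventually_at_right_field)
  have "uniformly_continuous_on {\<alpha>..\<alpha> + T} \<omega>"
    using cont by (intro compact_uniformly_continuous) auto
  from this[unfolded uniformly_continuous_on_def, rule_format, OF \<delta>0(1)]
  obtain \<eta> where \<eta>: "0 < \<eta>"
    "\<forall>s\<in>{\<alpha>..\<alpha> + T}. \<forall>t\<in>{\<alpha>..\<alpha> + T}. dist t s < \<eta> \<longrightarrow> dist (\<omega> t) (\<omega> s) < \<delta>0"
    by (elim exE conjE)
  have "(\<lambda>n. T / 2 ^ n) \<longlonglongrightarrow> 0"
    by (rule LIMSEQ_divide_realpow_zero) simp
  then have "\<forall>\<^sub>F n in sequentially. T / 2 ^ n < \<eta>"
    using \<eta>(1) by (rule order_tendstoD)
  then obtain N where N: "\<And>n. N \<le> n \<Longrightarrow> T / 2 ^ n < \<eta>" by (auto simp: eventually_sequentially)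
  have "(\<Sum>k<2^n. \<bar>E (grid \<alpha> T n k) (grid \<alpha> T n (Suc k))\<bar>) < e" if n: "N \<le> n" for n
  proof -
    have "\<bar>E (grid \<alpha> T n k) (grid \<alpha> T n (Suc k))\<bar> \<le> c * (\<omega> (grid \<alpha> T n (Suc k)) - \<omega> (grid \<alpha> T n k))"
      if k: "k < 2 ^ n" for k
    proof -
      let ?s = "grid \<alpha> T n k" and ?t = "grid \<alpha> T n (Suc k)"
      have b: "\<alpha> \<le> ?s" "?s < ?t" "?t \<le> \<alpha> + T"
        using grid_bounds[of T k n \<alpha>] grid_bounds[of T "Suc k" n \<alpha>] grid_less[OF T, of \<alpha> n k] k T by auto
      have "dist (\<omega> ?t) (\<omega> ?s) < \<delta>0"
        using b N[OF n] grid_diff[of \<alpha> T n k] by (intro \<eta>(2)[rule_format]) (auto simp: dist_real_def)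
      moreover have "\<omega> ?s \<le> \<omega> ?t" using mono b by (auto simp: mono_on_def)
      \<comment> \<open>If \<omega> does not increase between the two grid points, the little-o
        condition says nothing and \<theta> 0 = 0 takes over.\<close>
      ultimately have "\<theta> (\<omega> ?t - \<omega> ?s) \<le> c * (\<omega> ?t - \<omega> ?s)"
        using \<delta>0(2)[of "\<omega> ?t - \<omega> ?s"] \<theta>0 by (cases "\<omega> ?t = \<omega> ?s") (auto simp: dist_real_def)
      then show ?thesis using E[OF b] by linarith
    qed
    then have "(\<Sum>k<2^n. \<bar>E (grid \<alpha> T n k) (grid \<alpha> T n (Suc k))\<bar>) \<le>
        (\<Sum>k<2^n. c * (\<omega> (grid \<alpha> T n (Suc k)) - \<omega> (grid \<alpha> T n k)))"
      by (intro sum_mono) auto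
    also have "\<dots> = c * V"
      unfolding sum_distrib_left[symmetric] V_def
      by (subst sum_lessThan_telescope) (simp add: grid_0 grid_end)
    also have "\<dots> < e" using V e by (simp add: c_def field_simps)
    finally show ?thesis .
  qed
  then show "\<exists>N. \<forall>n\<ge>N. norm ((\<Sum>k<2^n. \<bar>E (grid \<alpha> T n k) (grid \<alpha> T n (Suc k))\<bar>) - 0) < e"
    by (intro exI[of _ N]) (auto simp: sum_nonneg abs_of_nonneg)
qed

text \<open>The inclusion of the coordinates of R^7 among those of R^8. In the type 7 the numeral 7
  equals 0; the last branch sends it to the index 7 of the larger type.\<close>

definition emb :: "7 \<Rightarrow> 8" where
  "emb c = (if c = 1 then 1 else if c = 2 then 2 else if c = 3 then 3 else if c = 4 then 4
    else if c = 5 then 5 else if c = 6 then 6 else 7)"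

lemma exhaust_7: "(c :: 7) = 1 \<or> c = 2 \<or> c = 3 \<or> c = 4 \<or> c = 5 \<or> c = 6 \<or> c = 7"
proof (induct c)
  case (of_int z)
  then have "z = 0 \<or> z = 1 \<or> z = 2 \<or> z = 3 \<or> z = 4 \<or> z = 5 \<or> z = 6" by simp arith
  then show ?case by auto
qed

lemma exhaust_8: "(c :: 8) = 1 \<or> c = 2 \<or> c = 3 \<or> c = 4 \<or> c = 5 \<or> c = 6 \<or> c = 7 \<or> c = 8"
proof (induct c)
  case (of_int z)
  then have "z = 0 \<or> z = 1 \<or> z = 2 \<or> z = 3 \<or> z = 4 \<or> z = 5 \<or> z = 6 \<or> z = 7" by simp arith
  then show ?case by auto
qed

lemma first_seven_nth: "first_seven y $ c = y $ emb c"
  using exhaust_7[of c] by (auto simp: first_seven_def vector_def emb_def)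

lemma emb_neq_8: "emb c \<noteq> 8" and inj_emb: "inj emb" and UNIV_8: "UNIV = insert 8 (range emb)"
proof -
  show "emb c \<noteq> 8" by (simp add: emb_def)
  show "inj emb"
  proof (rule injI)
    fix c d assume "emb c = emb d"
    then show "c = d" using exhaust_7[of c] exhaust_7[of d] by (auto simp: emb_def)
  qed
  have "i \<in> insert 8 (range emb)" for i
  proof -
    have "emb 1 = 1" "emb 2 = 2" "emb 3 = 3" "emb 4 = 4" "emb 5 = 5" "emb 6 = 6" "emb 7 = 7"
      by (simp_all add: emb_def)
    then show ?thesis using exhaust_8[of i] by (metis insert_iff rangeI)
  qed
  then show "UNIV = insert 8 (range emb)" by auto
qed

lemma sum_UNIV_8:
  fixes g :: "8 \<Rightarrow> 'b::comm_monoid_add"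
  shows "(\<Sum>h\<in>UNIV. g h) = g 8 + (\<Sum>c\<in>UNIV. g (emb c))"
proof -
  have "(\<Sum>h\<in>insert 8 (range emb). g h) = g 8 + (\<Sum>h\<in>range emb. g h)"
    by (intro sum.insert) (use emb_neq_8 in force)+
  also have "(\<Sum>h\<in>range emb. g h) = (\<Sum>c\<in>UNIV. g (emb c))"
    by (simp add: sum.reindex[OF inj_emb])
  finally show ?thesis using UNIV_8 by simp
qed

lemma first_seven_add_axis:
  "first_seven (y + t *\<^sub>R axis (emb c) 1) = first_seven y + t *\<^sub>R axis c 1"
  "first_seven (y + t *\<^sub>R axis 8 1) = first_seven y"
  using emb_neq_8
  by (auto simp: vec_eq_iff first_seven_nth axis_def inj_eq[OF inj_emb])

text \<open>Only the coefficient with i = j = 8 depends on y, and it does so through the first seven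
  coordinates; \<open>inv emb\<close> translates the direction of differentiation back to
  R^7.\<close>

lemma partial_deriv_system_coeff:
  "partial_deriv h (system_coeff f i j) y =
     (if i = 8 \<and> j = 8 \<and> h \<noteq> 8 then partial_deriv (inv emb h) f (first_seven y) else 0)"
proof (cases "i = 8 \<and> j = 8")
  case True
  have "h = 8 \<or> (\<exists>c. h = emb c)" using UNIV_8 by auto
  then show ?thesis
    using True emb_neq_8
    by (auto simp: partial_deriv_def system_coeff_def first_seven_add_axis inv_f_f[OF inj_emb])
next
  case False
  then have "system_coeff f i j (y + t *\<^sub>R axis h 1) = system_coeff f i j y" for t
    by (auto simp: system_coeff_def)
  then show ?thesis using False by (auto simp: partial_deriv_def)
qed

lemma continuous_first_seven:
  assumes "continuous_on S (w :: real \<Rightarrow> real ^ 8)"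
  shows "continuous_on S (\<lambda>t. first_seven (w t))"
proof -
  have eq: "first_seven (w t) = (\<chi> c. w t $ emb c)" for t
    by (simp add: vec_eq_iff first_seven_nth)
  show ?thesis unfolding eq using assms by (intro continuous_intros)
qed

text \<open>The dyadic sums of the increments that the notion of solution prescribes for the eighth
  coordinate, with the coefficients evaluated along the driving path w instead of along y.\<close>

definition compensated_sum :: "(real ^ 7 \<Rightarrow> real) \<Rightarrow> (real \<Rightarrow> real ^ 8) \<Rightarrow>
    (8 \<Rightarrow> 8 \<Rightarrow> real \<Rightarrow> real \<Rightarrow> real) \<Rightarrow> real \<Rightarrow> real \<Rightarrow> nat \<Rightarrow> real" where
  "compensated_sum f w a \<alpha> T n =
     (\<Sum>k<2^n. f (first_seven (w (grid \<alpha> T n k))) * (w (grid \<alpha> T n (Suc k)) $ 8 - w (grid \<alpha> T n k) $ 8)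
        + (\<Sum>c\<in>UNIV. partial_deriv c f (first_seven (w (grid \<alpha> T n k))) *
            a (emb c) 8 (grid \<alpha> T n k) (grid \<alpha> T n (Suc k))))"

lemma satisfied_onE:
  assumes "satisfied_on F w a y \<alpha> \<beta>"
  obtains \<omega> \<theta> where "continuous_on {\<alpha>..\<beta>} \<omega>" "mono_on {\<alpha>..\<beta>} \<omega>" "\<theta> 0 = 0" "\<theta> \<in> o[at_right 0](\<lambda>\<delta>. \<delta>)"
    "\<And>i s t. \<alpha> \<le> s \<Longrightarrow> s < t \<Longrightarrow> t \<le> \<beta> \<Longrightarrow>
           \<bar>y t $ i - y s $ i
              - (\<Sum>j\<in>UNIV. F i j (y s) * (w t $ j - w s $ j))
              - (\<Sum>h\<in>UNIV. \<Sum>r\<in>UNIV. \<Sum>j\<in>UNIV.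
                   F h r (y s) * partial_deriv h (F i j) (y s) * a r j s t)\<bar>
           \<le> \<theta> (\<omega> t - \<omega> s)"
  using assms unfolding satisfied_on_def by (elim exE conjE) blast

text \<open>For these coordinates the coefficients are constant, so the second-level terms vanish
  and the defect \<open>E\<close> is additive over adjacent intervals. An additive defect whose
  absolute values over fine grids sum to something vanishing must be 0.\<close>

lemma satisfied_on_emb:
  assumes "satisfied_on (system_coeff f) w a y \<alpha> (\<alpha> + T)" "0 < T"
  shows "y (\<alpha> + T) $ emb c - y \<alpha> $ emb c = w (\<alpha> + T) $ emb c - w \<alpha> $ emb c"
proof -
  from satisfied_onE[OF assms(1)] obtain \<omega> \<theta> where
     o: "continuous_on {\<alpha>..\<alpha> + T} \<omega>" "mono_on {\<alpha>..\<alpha> + T} \<omega>" "\<theta> 0 = 0" "\<theta> \<in> o[at_right 0](\<lambda>\<delta>. \<delta>)"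
     and b: "\<And>i s t. \<alpha> \<le> s \<Longrightarrow> s < t \<Longrightarrow> t \<le> \<alpha> + T \<Longrightarrow>
           \<bar>y t $ i - y s $ i
              - (\<Sum>j\<in>UNIV. system_coeff f i j (y s) * (w t $ j - w s $ j))
              - (\<Sum>h\<in>UNIV. \<Sum>r\<in>UNIV. \<Sum>j\<in>UNIV.
                   system_coeff f h r (y s) * partial_deriv h (system_coeff f i j) (y s) * a r j s t)\<bar>
           \<le> \<theta> (\<omega> t - \<omega> s)" by blast
  define E where "E s t = (y t $ emb c - y s $ emb c) - (w t $ emb c - w s $ emb c)" for s t
  have *: "system_coeff f (emb c) j v * d = (if j = emb c then d else 0)" for j v d
    using emb_neq_8[of c] by (auto simp: system_coeff_def)
  have "\<bar>E s t\<bar> \<le> \<theta> (\<omega> t - \<omega> s)" if "\<alpha> \<le> s" "s < t" "t \<le> \<alpha> + T" for s t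
  proof -
    have "(\<Sum>j\<in>UNIV. system_coeff f (emb c) j (y s) * (w t $ j - w s $ j)) = w t $ emb c - w s $ emb c"
      unfolding * by simp
    then show ?thesis
      using b[of s t "emb c"] that emb_neq_8[of c] by (simp add: partial_deriv_system_coeff E_def)
  qed
  note lim = sum_small_increments_tendsto_0[OF assms(2) o this]
  have "\<bar>E \<alpha> (\<alpha> + T)\<bar> \<le> (\<Sum>k<2^n. \<bar>E (grid \<alpha> T n k) (grid \<alpha> T n (Suc k))\<bar>)" for n
  proof -
    have "(\<Sum>k<2^n. E (grid \<alpha> T n k) (grid \<alpha> T n (Suc k))) =
       (\<Sum>k<2^n. (y (grid \<alpha> T n (Suc k)) $ emb c - w (grid \<alpha> T n (Suc k)) $ emb c)
          - (y (grid \<alpha> T n k) $ emb c - w (grid \<alpha> T n k) $ emb c))"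
      by (intro sum.cong) (auto simp: E_def)
    also have "\<dots> = E \<alpha> (\<alpha> + T)"
      by (subst sum_lessThan_telescope) (simp add: grid_0 grid_end E_def)
    finally show ?thesis by (metis sum_abs)
  qed
  then have "\<bar>E \<alpha> (\<alpha> + T)\<bar> \<le> 0"
    by (intro LIMSEQ_le_const[OF lim]) auto
  then show ?thesis by (simp add: E_def)
qed

text \<open>On the open interval the difference between y and w is constant in these coordinates;
  continuity at 0 and the common starting point identify the constant as 0.\<close>

lemma solution_first_seven:
  assumes sat: "satisfied_locally (system_coeff f) w a y"
    and cont: "continuous_on {0..1} y" "continuous_on {0..} w" and init: "y 0 = 0" "w 0 = 0"
    and t: "0 < t" "t < 1"
  shows "first_seven (y t) = first_seven (w t)"
proof -
  have "y t $ emb c = w t $ emb c" for c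
  proof -
    define d where "d s = y s $ emb c - w s $ emb c" for s
    have "d s = d t" if "0 < s" "s < t" for s
    proof -
      have "satisfied_on (system_coeff f) w a y s (s + (t - s))"
        using sat that t unfolding satisfied_locally_def by auto
      from satisfied_on_emb[OF this, of c] show ?thesis using that by (simp add: d_def)
    qed
    then have "\<forall>\<^sub>F s in at_right 0. d s = d t"
      using t by (auto simp: eventually_at_right_field)
    then have "(d \<longlongrightarrow> d t) (at_right 0)"
      by (rule tendsto_eventually)
    moreover have "(d \<longlongrightarrow> d 0) (at_right 0)"
    proof -
      have "continuous_on {0..1} d" unfolding d_def
        using cont by (intro continuous_intros continuous_on_subset[OF cont(2)]) auto
      then have "(d \<longlongrightarrow> d 0) (at 0 within {0..1})" by (simp add: continuous_on_def)
      then show ?thesis by (simp add: at_within_Icc_at_right)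
    qed
    ultimately have "d t = d 0" by (intro tendsto_unique[of "at_right 0"]) auto
    then show ?thesis using init by (simp add: d_def)
  qed
  then show ?thesis by (simp add: vec_eq_iff first_seven_nth)
qed

text \<open>Since the first seven coordinates of y are those of w, every coefficient can be
  evaluated along w. The increment of the eighth coordinate is thereby determined by f and the
  driving data, the same for every solution.\<close>

lemma solution_increment:
  assumes sat: "satisfied_locally (system_coeff f) w a y"
    and cont: "continuous_on {0..1} y" "continuous_on {0..} w" and init: "y 0 = 0" "w 0 = 0"
    and \<alpha>: "0 < \<alpha>" "0 < T" "\<alpha> + T < 1"
  shows "compensated_sum f w a \<alpha> T \<longlonglongrightarrow> y (\<alpha> + T) $ 8 - y \<alpha> $ 8"
proof -
  have "satisfied_on (system_coeff f) w a y \<alpha> (\<alpha> + T)"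
    using sat \<alpha> unfolding satisfied_locally_def by auto
  from satisfied_onE[OF this] obtain \<omega> \<theta> where
     o: "continuous_on {\<alpha>..\<alpha> + T} \<omega>" "mono_on {\<alpha>..\<alpha> + T} \<omega>" "\<theta> 0 = 0" "\<theta> \<in> o[at_right 0](\<lambda>\<delta>. \<delta>)"
     and b: "\<And>i s t. \<alpha> \<le> s \<Longrightarrow> s < t \<Longrightarrow> t \<le> \<alpha> + T \<Longrightarrow>
           \<bar>y t $ i - y s $ i
              - (\<Sum>j\<in>UNIV. system_coeff f i j (y s) * (w t $ j - w s $ j))
              - (\<Sum>h\<in>UNIV. \<Sum>r\<in>UNIV. \<Sum>j\<in>UNIV.
                   system_coeff f h r (y s) * partial_deriv h (system_coeff f i j) (y s) * a r j s t)\<bar>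
           \<le> \<theta> (\<omega> t - \<omega> s)" by blast
  define X where "X s t = f (first_seven (w s)) * (w t $ 8 - w s $ 8) +
      (\<Sum>c\<in>UNIV. partial_deriv c f (first_seven (w s)) * a (emb c) 8 s t)" for s t
  define E where "E s t = (y t $ 8 - y s $ 8) - X s t" for s t
  have "\<bar>E s t\<bar> \<le> \<theta> (\<omega> t - \<omega> s)" if st: "\<alpha> \<le> s" "s < t" "t \<le> \<alpha> + T" for s t
  proof -
    have x: "first_seven (y s) = first_seven (w s)"
      using st \<alpha> by (intro solution_first_seven[OF sat cont init]) auto
    have 1: "(\<Sum>j\<in>UNIV. system_coeff f 8 j (y s) * (w t $ j - w s $ j)) =
        f (first_seven (w s)) * (w t $ 8 - w s $ 8)"
      using emb_neq_8 x by (simp add: sum_UNIV_8 system_coeff_def)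
    have 2: "(\<Sum>r\<in>UNIV. \<Sum>j\<in>UNIV. system_coeff f h r (y s) * partial_deriv h (system_coeff f 8 j) (y s) * a r j s t)
       = (if h = 8 then 0 else partial_deriv (inv emb h) f (first_seven (w s)) * a h 8 s t)" for h
    proof -
      have "(\<Sum>j\<in>UNIV. system_coeff f h r (y s) * partial_deriv h (system_coeff f 8 j) (y s) * a r j s t)
         = (if r = h then if h = 8 then 0 else partial_deriv (inv emb h) f (first_seven (w s)) * a r 8 s t else 0)" for r
        using emb_neq_8 x by (simp add: sum_UNIV_8 partial_deriv_system_coeff) (simp add: system_coeff_def)
      then show ?thesis by simp
    qed
    have "(\<Sum>h\<in>UNIV. \<Sum>r\<in>UNIV. \<Sum>j\<in>UNIV.
        system_coeff f h r (y s) * partial_deriv h (system_coeff f 8 j) (y s) * a r j s t) =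
        (\<Sum>c\<in>UNIV. partial_deriv c f (first_seven (w s)) * a (emb c) 8 s t)"
      unfolding 2 using emb_neq_8 by (simp add: sum_UNIV_8[of "\<lambda>h. if h = 8 then 0 else _ h"] inv_f_f[OF inj_emb])
    then show ?thesis using b[of s t 8] st 1 by (simp add: E_def X_def algebra_simps)
  qed
  note lim = sum_small_increments_tendsto_0[OF \<alpha>(2) o this]
  have eq: "(\<Sum>k<2^n. E (grid \<alpha> T n k) (grid \<alpha> T n (Suc k))) =
      (y (\<alpha> + T) $ 8 - y \<alpha> $ 8) - compensated_sum f w a \<alpha> T n" for n
  proof -
    have "(\<Sum>k<2^n. y (grid \<alpha> T n (Suc k)) $ 8 - y (grid \<alpha> T n k) $ 8) = y (\<alpha> + T) $ 8 - y \<alpha> $ 8"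
      by (subst sum_lessThan_telescope) (simp add: grid_0 grid_end)
    then show ?thesis by (simp add: E_def X_def compensated_sum_def sum_subtractf)
  qed
  have "(\<lambda>n. \<Sum>k<2^n. E (grid \<alpha> T n k) (grid \<alpha> T n (Suc k))) \<longlonglongrightarrow> 0"
    by (rule Lim_null_comparison[OF _ lim]) (auto intro!: sum_abs)
  then have "(\<lambda>n. (y (\<alpha> + T) $ 8 - y \<alpha> $ 8) - ((y (\<alpha> + T) $ 8 - y \<alpha> $ 8) - compensated_sum f w a \<alpha> T n))
     \<longlonglongrightarrow> (y (\<alpha> + T) $ 8 - y \<alpha> $ 8) - 0"
    unfolding eq by (intro tendsto_intros)
  then show ?thesis by simp
qed

section \<open>Assembling the counterexample from small pieces\<close>

text \<open>The pieces are placed recursively in disjoint annuli shrinking to the origin, the k-th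
  with partial derivatives at most 2^-k. This makes the sum continuously differentiable at 0, and on
  the k-th window the path meets only the k-th annulus, so a solution would increase by at least 1
  over each of these windows, which approach time 0.\<close>

theorem no_solution_from_pieces:
  assumes w: "continuous_on {0..} w" "w 0 = 0"
    and pieces: "\<And>\<delta> \<epsilon>. 0 < \<delta> \<Longrightarrow> 0 < \<epsilon> \<Longrightarrow> \<exists>\<alpha> T \<rho> g l. 0 < \<alpha> \<and> 0 < T \<and> \<alpha> + T < \<delta> \<and> 0 < \<rho> \<and> \<rho> < \<delta> \<and>
       g \<in> elementary \<and> (\<forall>x. \<not> (\<rho> < norm x \<and> norm x < \<delta>) \<longrightarrow> g x = 0 \<and> (\<forall>h. partial_deriv h g x = 0)) \<and>
       (\<forall>h x. \<bar>partial_deriv h g x\<bar> \<le> \<epsilon>) \<and>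
       (\<forall>t\<in>{\<alpha>..\<alpha> + T}. \<rho> < norm (first_seven (w t)) \<and> norm (first_seven (w t)) < \<delta>) \<and>
       compensated_sum g w a \<alpha> T \<longlonglongrightarrow> l \<and> 1 \<le> l"
  shows "\<exists>f :: real ^ 7 \<Rightarrow> real. compact (closure {x. f x \<noteq> 0}) \<and> Ck_on 1 UNIV f \<and> smooth_on (UNIV - {0}) f \<and>
     \<not> (\<exists>y. continuous_on {0..1} y \<and> y 0 = 0 \<and> satisfied_locally (system_coeff f) w a y)"
proof -
  define Q where "Q \<delta> \<epsilon> \<alpha> T \<rho> g l \<longleftrightarrow> 0 < \<alpha> \<and> 0 < T \<and> \<alpha> + T < \<delta> \<and> 0 < \<rho> \<and> \<rho> < \<delta> \<and>
       g \<in> elementary \<and> (\<forall>x. \<not> (\<rho> < norm x \<and> norm x < \<delta>) \<longrightarrow> g x = 0 \<and> (\<forall>h. partial_deriv h g x = 0)) \<and>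
       (\<forall>h x. \<bar>partial_deriv h g x\<bar> \<le> \<epsilon>) \<and>
       (\<forall>t\<in>{\<alpha>..\<alpha> + T}. \<rho> < norm (first_seven (w t)) \<and> norm (first_seven (w t)) < \<delta>) \<and>
       compensated_sum g w a \<alpha> T \<longlonglongrightarrow> l \<and> 1 \<le> l" for \<delta> \<epsilon> \<alpha> T \<rho> and g :: "real ^ 7 \<Rightarrow> real" and l
  define R where "R \<delta> \<epsilon> p \<longleftrightarrow> (case p of (\<alpha>, T, \<rho>, g, l) \<Rightarrow> Q \<delta> \<epsilon> \<alpha> T \<rho> g l)" for \<delta> \<epsilon> p
  \<comment> \<open>All data of a piece form one tuple, so that a single choice gives a function of
    \<delta> and \<epsilon> that the recursion can call.\<close>
  define p where "p \<delta> \<epsilon> = (SOME p. R \<delta> \<epsilon> p)" for \<delta> \<epsilon>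
  have p: "R \<delta> \<epsilon> (p \<delta> \<epsilon>)" if "0 < \<delta>" "0 < \<epsilon>" for \<delta> \<epsilon>
  proof -
    have "\<exists>\<alpha> T \<rho> g l. Q \<delta> \<epsilon> \<alpha> T \<rho> g l" unfolding Q_def by (intro pieces that)
    then obtain \<alpha> T \<rho> g l where "Q \<delta> \<epsilon> \<alpha> T \<rho> g l" by (elim exE)
    then have "R \<delta> \<epsilon> (\<alpha>, T, \<rho>, g, l)" by (simp add: R_def)
    then show ?thesis unfolding p_def by (rule someI)
  qed
  define \<rho>f where "\<rho>f \<delta> \<epsilon> = fst (snd (snd (p \<delta> \<epsilon>)))" for \<delta> \<epsilon>
  define \<epsilon> :: "nat \<Rightarrow> real" where "\<epsilon> k = 1 / 2 ^ k" for k
  \<comment> \<open>The next outer radius is at most the previous inner radius, which makes the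
    annuli disjoint, and at most 1/(k + 2), which makes the radii tend to 0.\<close>
  define \<delta> where "\<delta> = rec_nat (1::real) (\<lambda>k d. min (\<rho>f d (\<epsilon> k)) (1 / real (k + 2)))"
  define P where "P k = p (\<delta> k) (\<epsilon> k)" for k
  define \<alpha> where "\<alpha> k = fst (P k)" for k
  define T where "T k = fst (snd (P k))" for k
  define \<rho> where "\<rho> k = fst (snd (snd (P k)))" for k
  define g where "g k = fst (snd (snd (snd (P k))))" for k
  define l where "l k = snd (snd (snd (snd (P k))))" for k
  have \<delta>_Suc: "\<delta> (Suc k) = min (\<rho> k) (1 / real (k + 2))" for k
    by (simp add: \<delta>_def \<rho>_def P_def \<rho>f_def)
  have \<epsilon>_pos: "0 < \<epsilon> k" for k by (simp add: \<epsilon>_def)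
  have PQ: "Q (\<delta> k) (\<epsilon> k) (\<alpha> k) (T k) (\<rho> k) (g k) (l k)" if "0 < \<delta> k" for k
    using p[OF that \<epsilon>_pos, of k] by (simp add: \<alpha>_def T_def \<rho>_def g_def l_def P_def R_def split_beta)
  have \<delta>_pos: "0 < \<delta> k" for k
  proof (induction k)
    case (Suc k)
    then show ?case using PQ[OF Suc] by (simp add: \<delta>_Suc Q_def)
  qed (simp add: \<delta>_def)
  note Qk = PQ[OF \<delta>_pos]
  have \<alpha>T: "0 < \<alpha> k" "0 < T k" "\<alpha> k + T k < \<delta> k" for k using Qk[of k] unfolding Q_def by auto
  have \<rho>: "0 < \<rho> k" "\<rho> k < \<delta> k" for k using Qk[of k] unfolding Q_def by auto
  have g_el: "g k \<in> elementary" for k using Qk[of k] unfolding Q_def by auto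
  have g0: "g k x = 0" "partial_deriv h (g k) x = 0" if "\<not> (\<rho> k < norm x \<and> norm x < \<delta> k)" for k h x
    using Qk[of k] that unfolding Q_def by auto
  have g_bd: "\<bar>partial_deriv h (g k) x\<bar> \<le> \<epsilon> k" for k h x using Qk[of k] unfolding Q_def by auto
  have path: "\<rho> k < norm (first_seven (w t))" "norm (first_seven (w t)) < \<delta> k" if "t \<in> {\<alpha> k..\<alpha> k + T k}" for t k
    using Qk[of k] that unfolding Q_def by auto
  have lim: "compensated_sum (g k) w a (\<alpha> k) (T k) \<longlonglongrightarrow> l k" "1 \<le> l k" for k
    using Qk[of k] unfolding Q_def by auto
  have \<delta>_dec: "\<delta> j \<le> \<rho> k" if "k < j" for j k
  proof -
    have "\<delta> (Suc i) \<le> \<delta> i" for i using \<rho>(2)[of i] by (auto simp: \<delta>_Suc)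
    then have "decseq \<delta>" by (rule decseq_SucI)
    then have "\<delta> j \<le> \<delta> (Suc k)" by (rule decseqD) (use that in simp)
    then show ?thesis by (simp add: \<delta>_Suc)
  qed
  have \<delta>_small: "\<delta> (Suc k) \<le> 1 / real (k + 2)" for k by (simp add: \<delta>_Suc)
  have \<delta>_lim: "\<exists>k\<ge>N. \<delta> k < e" if e: "0 < e" for e N
  proof -
    obtain n where n: "inverse (real (Suc n)) < e" using reals_Archimedean[OF e] by blast
    have "1 / real (n + N + 2) \<le> inverse (real (Suc n))" by (simp add: field_simps)
    then have "\<delta> (Suc (n + N)) < e" using \<delta>_small[of "n + N"] n by linarith
    then show ?thesis by (intro exI[of _ "Suc (n + N)"]) auto
  qed
  define f where "f x = (\<Sum>k. g k x)" for x
  have f_sum: "f x = (\<Sum>j<K. g j x)" if "\<delta> K \<le> norm x" for K x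
    unfolding f_def
  proof (rule suminf_finite)
    fix j assume "j \<notin> {..<K}"
    then have "\<delta> j \<le> \<delta> K"
      using \<delta>_dec[of K j] \<rho>(2)[of K] by (cases "j = K") auto
    then show "g j x = 0" using that by (intro g0) auto
  qed auto
  have f_loc: "\<exists>V. open V \<and> x \<in> V \<and> (\<forall>y\<in>V. f y = (\<Sum>j<K. g j y))" if "\<delta> K < norm x" for K x
  proof (intro exI conjI)
    show "open {y :: real ^ 7. \<delta> K < norm y}" by (intro open_Collect_less continuous_intros)
  qed (use that f_sum in auto)
  have sum_el: "(\<lambda>x. \<Sum>j<K. g j x) \<in> elementary" for K by (intro elementary_sum g_el)
  have loc_el: "\<exists>V G. open V \<and> x \<in> V \<and> G \<in> elementary \<and> (\<forall>y\<in>V. f y = G y)" if "x \<noteq> 0" for x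
  proof -
    obtain K where "\<delta> K < norm x" using \<delta>_lim[of "norm x" 0] \<open>x \<noteq> 0\<close> by auto
    from f_loc[OF this] sum_el[of K] show ?thesis by blast
  qed
  have f_pd: "partial_deriv h f x = (\<Sum>j<K. partial_deriv h (g j) x)" if K: "\<delta> K < norm x" for K x h
  proof -
    obtain V where V: "open V" "x \<in> V" "\<forall>y\<in>V. f y = (\<Sum>j<K. g j y)" using f_loc[OF K] by blast
    then have "partial_deriv h f x = partial_deriv h (\<lambda>y. \<Sum>j<K. g j y) x"
      by (intro partial_deriv_cong) auto
    then show ?thesis using g_el by (simp add: partial_deriv_sum)
  qed
  have one: "(\<Sum>j<K. G j) = G k" if "\<And>j. \<not> (\<rho> j < norm x \<and> norm x < \<delta> j) \<Longrightarrow> G j = 0"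
     "\<rho> k < norm x" "norm x < \<delta> k" "k < K" for G :: "nat \<Rightarrow> real" and x :: "real ^ 7" and k K
  proof -
    have "G j = 0" if "j \<noteq> k" for j
    proof -
      have "\<not> (\<rho> j < norm x \<and> norm x < \<delta> j)"
        using \<delta>_dec[of j k] \<delta>_dec[of k j] \<open>j \<noteq> k\<close> that(1) \<open>\<rho> k < norm x\<close> \<open>norm x < \<delta> k\<close> by (cases "j < k") auto
      then show ?thesis by fact
    qed
    then have "(\<Sum>j<K. G j) = (\<Sum>j<K. if j = k then G k else 0)" by (intro sum.cong) auto
    then show ?thesis using that(4) by simp
  qed
  \<comment> \<open>At a given point at most one piece is nonzero, and at distance less than
    \<open>\<delta> K\<close> from the origin its index is at least K.\<close>
  have small: "\<bar>\<Sum>j<L. G j\<bar> \<le> B" if G: "\<And>j. \<not> (\<rho> j < norm x \<and> norm x < \<delta> j) \<Longrightarrow> G j = 0"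
     "norm x < \<delta> K" "0 \<le> B" "\<And>j. K \<le> j \<Longrightarrow> \<bar>G j\<bar> \<le> B"
     for G :: "nat \<Rightarrow> real" and x :: "real ^ 7" and K L B
  proof (cases "\<exists>k<L. \<rho> k < norm x \<and> norm x < \<delta> k")
    case True
    then obtain k where k: "k < L" "\<rho> k < norm x" "norm x < \<delta> k" by blast
    have "K \<le> k"
    proof (rule ccontr)
      assume "\<not> K \<le> k"
      then have "\<delta> K \<le> \<rho> k" by (intro \<delta>_dec) simp
      then show False using k G(2) by simp
    qed
    then show ?thesis using one[of x G k L] G k by simp
  next
    case False
    then have "(\<Sum>j<L. G j) = 0" using G(1) by (intro sum.neutral) auto
    then show ?thesis using G(3) by simp
  qed
  have f_0: "f 0 = 0" unfolding f_def using \<rho>(1) by (simp add: g0(1) not_less less_imp_le)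
  have \<epsilon>_mono: "\<epsilon> j \<le> \<epsilon> K" if "K \<le> j" for j K using that by (simp add: \<epsilon>_def field_simps)
  \<comment> \<open>Each piece vanishes at 0 and has Lipschitz constant at most 7 times its gradient
    bound. As K is arbitrary, f vanishes to more than first order at the origin and has derivative 0
    there.\<close>
  have f_small: "\<bar>f x\<bar> \<le> 7 * \<epsilon> K * norm x" if x: "norm x < \<delta> K" for K x
  proof (cases "x = 0")
    case False
    then obtain L where L: "\<delta> L < norm x" using \<delta>_lim[of "norm x" 0] by auto
    have "\<bar>g j x\<bar> \<le> 7 * \<epsilon> K * norm x" if "K \<le> j" for j
    proof -
      have "g j 0 = 0" using \<rho>(1)[of j] by (intro g0) auto
      then have "\<bar>g j x\<bar> \<le> 7 * \<epsilon> j * norm x"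
        using elementary_lipschitz[OF g_el g_bd, of j x 0] by simp
      also have "\<dots> \<le> 7 * \<epsilon> K * norm x" using \<epsilon>_mono[OF that] by (intro mult_right_mono) auto
      finally show ?thesis .
    qed
    then have "\<bar>\<Sum>j<L. g j x\<bar> \<le> 7 * \<epsilon> K * norm x"
      using \<epsilon>_pos[of K] x g0(1) by (intro small[where x = x and K = K]) auto
    then show ?thesis using f_sum[of L x] L by simp
  qed (simp add: f_0)
  have pd_small: "\<bar>partial_deriv h f x\<bar> \<le> \<epsilon> K" if x: "norm x < \<delta> K" "x \<noteq> 0" for K x h
  proof -
    obtain L where L: "\<delta> L < norm x" using \<delta>_lim[of "norm x" 0] x(2) by auto
    have "\<bar>\<Sum>j<L. partial_deriv h (g j) x\<bar> \<le> \<epsilon> K"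
      using \<epsilon>_pos[of K] x g0(2)
      by (intro small[where x = x and K = K]) (auto intro: order_trans[OF g_bd \<epsilon>_mono])
    then show ?thesis using f_pd[OF L] by simp
  qed
  have \<epsilon>_lim: "\<exists>K. c * \<epsilon> K < e" if "0 < e" "0 < c" for c e
  proof -
    have "(\<lambda>k. c / 2 ^ k) \<longlonglongrightarrow> 0" by (rule LIMSEQ_divide_realpow_zero) simp
    then have "\<forall>\<^sub>F k in sequentially. c / 2 ^ k < e" using that by (intro order_tendstoD) auto
    then show ?thesis by (auto simp: \<epsilon>_def eventually_sequentially)
  qed
  have deriv_0: "(f has_derivative (\<lambda>_. 0)) (at 0)"
  proof -
    have "((\<lambda>y. (f y - f 0 - 0) /\<^sub>R norm (y - 0)) \<longlongrightarrow> 0) (at 0)"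
    proof (rule tendstoI)
      fix e :: real assume e: "0 < e"
      obtain K where K: "7 * \<epsilon> K < e" using \<epsilon>_lim[OF e, of 7] by auto
      have "\<forall>\<^sub>F x in at 0. norm x < \<delta> K \<and> x \<noteq> (0 :: real ^ 7)"
        using \<delta>_pos[of K] by (auto simp: eventually_at dist_norm)
      then show "\<forall>\<^sub>F y in at 0. dist ((f y - f 0 - 0) /\<^sub>R norm (y - 0)) 0 < e"
      proof eventually_elim
        case (elim y)
        have "\<bar>f y\<bar> / norm y \<le> 7 * \<epsilon> K" using f_small[of y K] elim by (simp add: field_simps)
        then show ?case using K by (simp add: f_0 divide_inverse abs_mult mult.commute)
      qed
    qed
    then show ?thesis by (simp add: has_derivative_def)
  qed
  have pd_0: "partial_deriv h f 0 = 0" for h using partial_deriv_eqI[OF deriv_0] .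
  have smooth: "smooth_on (UNIV - {0}) f"
    unfolding smooth_on_def by (intro allI Ck_on_locally_elementary loc_el) auto
  then have "Ck_on (Suc 0) (UNIV - {0}) f" unfolding smooth_on_def by blast
  then have diff: "f differentiable (at x)" and cont_pd: "continuous_on (UNIV - {0}) (partial_deriv h f)"
    if "x \<noteq> 0" for x h
    using that by auto
  have "Ck_on 1 UNIV f"
  proof -
    have "f differentiable (at x)" for x
      using diff deriv_0 by (cases "x = 0") (auto simp: differentiable_def)
    moreover have "isCont (partial_deriv h f) x" for h x
    proof (cases "x = 0")
      case True
      have "(partial_deriv h f \<longlongrightarrow> 0) (at 0)"
      proof (rule tendstoI)
        fix e :: real assume e: "0 < e"
        obtain K where K: "\<epsilon> K < e" using \<epsilon>_lim[OF e, of 1] by auto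
        have "\<forall>\<^sub>F x in at 0. norm x < \<delta> K \<and> x \<noteq> (0 :: real ^ 7)"
          using \<delta>_pos[of K] by (auto simp: eventually_at dist_norm)
        then show "\<forall>\<^sub>F y in at 0. dist (partial_deriv h f y) 0 < e"
          by eventually_elim (use pd_small[of _ K h] K in force)
      qed
      then show ?thesis using True by (simp add: isCont_def pd_0)
    next
      case False
      have "open (UNIV - {0 :: real ^ 7})" by auto
      then show ?thesis using cont_pd[OF False, of h] False
        by (simp add: continuous_on_eq_continuous_at)
    qed
    ultimately show ?thesis unfolding One_nat_def by (simp add: continuous_at_imp_continuous_on)
  qed
  moreover have "compact (closure {x. f x \<noteq> 0})"
  proof -
    have "{x. f x \<noteq> 0} \<subseteq> cball 0 1"
    proof (rule subsetI, rule ccontr)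
      fix x assume x: "x \<in> {x. f x \<noteq> 0}" "x \<notin> cball 0 1"
      then have "f x = (\<Sum>j<0. g j x)" by (intro f_sum) (auto simp: \<delta>_def)
      then show False using x by simp
    qed
    then have "bounded {x. f x \<noteq> 0}" using bounded_subset bounded_cball by blast
    then show ?thesis by (simp add: compact_closure)
  qed
  moreover have "\<not> (\<exists>y. continuous_on {0..1} y \<and> y 0 = 0 \<and> satisfied_locally (system_coeff f) w a y)"
  proof
    assume "\<exists>y. continuous_on {0..1} y \<and> y 0 = 0 \<and> satisfied_locally (system_coeff f) w a y"
    then obtain y where y: "continuous_on {0..1} y" "y 0 = 0" "satisfied_locally (system_coeff f) w a y" by blast
    have big: "1 \<le> y (\<alpha> k + T k) $ 8 - y (\<alpha> k) $ 8" if "1 \<le> k" for k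
    proof -
      have eq: "f (first_seven (w t)) = g k (first_seven (w t))"
           "partial_deriv h f (first_seven (w t)) = partial_deriv h (g k) (first_seven (w t))"
        if t: "t \<in> {\<alpha> k..\<alpha> k + T k}" for t h
      proof -
        let ?x = "first_seven (w t)"
        have "\<delta> (Suc k) \<le> \<rho> k" by (simp add: \<delta>_Suc)
        then have *: "\<delta> (Suc k) < norm ?x" using path[OF t] by simp
        show "f ?x = g k ?x"
          using f_sum[of "Suc k" ?x] * one[of ?x "\<lambda>j. g j ?x" k "Suc k"] g0(1) path[OF t] by simp
        show "partial_deriv h f ?x = partial_deriv h (g k) ?x"
          using f_pd[OF *, of h] one[of ?x "\<lambda>j. partial_deriv h (g j) ?x" k "Suc k"] g0(2) path[OF t] by simp
      qed
      have "compensated_sum f w a (\<alpha> k) (T k) = compensated_sum (g k) w a (\<alpha> k) (T k)"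
        unfolding compensated_sum_def
        using \<alpha>T(2)[of k] grid_bounds[of "T k" _ _ "\<alpha> k"] by (intro ext sum.cong) (auto simp: eq)
      moreover have "\<delta> k \<le> 1"
      proof -
        have "\<delta> k \<le> 1 / real (k - 1 + 2)" using \<delta>_small[of "k - 1"] that by simp
        also have "\<dots> \<le> 1" by simp
        finally show ?thesis .
      qed
      ultimately have "y (\<alpha> k + T k) $ 8 - y (\<alpha> k) $ 8 = l k"
        using solution_increment[OF y(3,1) w(1) y(2) w(2), of "\<alpha> k" "T k"] \<alpha>T[of k] lim(1)[of k]
        by (intro LIMSEQ_unique) auto
      then show ?thesis using lim(2)[of k] by simp
    qed
    have "continuous_on {0..1} (\<lambda>t. y t $ 8)" using y(1) by (intro continuous_intros)
    then have "((\<lambda>t. y t $ 8) \<longlongrightarrow> 0) (at 0 within {0..1})" using y(2) by (simp add: continuous_on_def) force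
    then have "\<forall>\<^sub>F t in at 0 within {0..1}. dist (y t $ 8) 0 < 1 / 2"
      by (rule tendstoD) simp
    then obtain d where d: "0 < d" "\<And>t. t \<in> {0..1} \<Longrightarrow> t \<noteq> 0 \<Longrightarrow> dist t 0 < d \<Longrightarrow> \<bar>y t $ 8\<bar> < 1 / 2"
      by (auto simp: eventually_at)
    obtain k where k: "1 \<le> k" "\<delta> k < min d 1" using \<delta>_lim[of "min d 1" 1] d(1) by auto
    have "\<bar>y (\<alpha> k + T k) $ 8\<bar> < 1 / 2" "\<bar>y (\<alpha> k) $ 8\<bar> < 1 / 2"
      by (rule d(2); use \<alpha>T[of k] k in \<open>simp add: dist_real_def\<close>)+
    then show False using big[OF k(1)] by linarith
  qed
  ultimately show ?thesis using smooth by blast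
qed

section \<open>Unboundedness of the pathwise integral on the unit ball of C1\<close>

definition rsum :: "('v \<Rightarrow> real) \<Rightarrow> (real \<Rightarrow> 'v) \<Rightarrow> (real \<Rightarrow> real) \<Rightarrow> real \<Rightarrow> real \<Rightarrow> nat \<Rightarrow> real" where
  "rsum f x z \<alpha> T n = (\<Sum>k<2^n. f (x (grid \<alpha> T n k)) * (z (grid \<alpha> T n (Suc k)) - z (grid \<alpha> T n k)))"

text \<open>The left-point Riemann sum of the time integral of f along x. For the indicator of a
  cell it is the discretised occupation time of that cell.\<close>

definition tsum :: "('v \<Rightarrow> real) \<Rightarrow> (real \<Rightarrow> 'v) \<Rightarrow> real \<Rightarrow> real \<Rightarrow> nat \<Rightarrow> real" where
  "tsum f x \<alpha> T n = (\<Sum>k<2^n. T / 2 ^ n * f (x (grid \<alpha> T n k)))"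

lemma rsum_add: "rsum (\<lambda>v. f v + g v) x z \<alpha> T n = rsum f x z \<alpha> T n + rsum g x z \<alpha> T n"
  by (simp add: rsum_def distrib_right sum.distrib)

lemma rsum_cmult: "rsum (\<lambda>v. c * f v) x z \<alpha> T n = c * rsum f x z \<alpha> T n"
  by (simp add: rsum_def sum_distrib_left mult.assoc)

lemma rsum_sum: "rsum (\<lambda>v. \<Sum>i\<in>I. f i v) x z \<alpha> T n = (\<Sum>i\<in>I. rsum (f i) x z \<alpha> T n)"
  unfolding rsum_def sum_distrib_right by (rule sum.swap)

lemma tsum_add: "tsum (\<lambda>v. f v + g v) x \<alpha> T n = tsum f x \<alpha> T n + tsum g x \<alpha> T n"
  by (simp add: tsum_def distrib_left sum.distrib)

lemma tsum_cmult: "tsum (\<lambda>v. c * f v) x \<alpha> T n = c * tsum f x \<alpha> T n"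
  by (simp add: tsum_def sum_distrib_left mult_ac)

lemma tsum_sum: "tsum (\<lambda>v. \<Sum>i\<in>I. f i v) x \<alpha> T n = (\<Sum>i\<in>I. tsum (f i) x \<alpha> T n)"
  unfolding tsum_def sum_distrib_left by (rule sum.swap)

lemma tsum_const: "tsum (\<lambda>_. c) x \<alpha> T n = c * T"
  by (simp add: tsum_def)

lemma tsum_mono:
  assumes "0 \<le> T" "\<And>t. \<alpha> \<le> t \<Longrightarrow> t \<le> \<alpha> + T \<Longrightarrow> f (x t) \<le> g (x t)"
  shows "tsum f x \<alpha> T n \<le> tsum g x \<alpha> T n"
  unfolding tsum_def using assms by (intro sum_mono mult_left_mono assms(2) grid_bounds) auto

lemma tsum_nonneg:
  assumes "0 \<le> T" "\<And>v. 0 \<le> f v" shows "0 \<le> tsum f x \<alpha> T n"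
  using assms by (auto simp: tsum_def intro!: sum_nonneg)

lemma tsum_abs:
  assumes "0 \<le> T" shows "\<bar>tsum f x \<alpha> T n\<bar> \<le> tsum (\<lambda>v. \<bar>f v\<bar>) x \<alpha> T n"
  unfolding tsum_def using assms by (intro order_trans[OF sum_abs]) (simp add: abs_mult)

lemma tsum_convergent:
  assumes T: "0 \<le> T" and cont: "continuous_on {\<alpha>..\<alpha> + T} (\<lambda>t. f (x t))"
  shows "tsum f x \<alpha> T \<longlonglongrightarrow> integral {\<alpha>..\<alpha> + T} (\<lambda>t. f (x t))"
proof (rule LIMSEQ_I)
  fix e :: real assume e: "0 < e"
  define \<phi> where "\<phi> t = f (x t)" for t
  have cont: "continuous_on {\<alpha>..\<alpha> + T} \<phi>" using cont by (simp add: \<phi>_def)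
  define c where "c = e / (T + 1)"
  have c: "0 < c" using e T by (simp add: c_def)
  have "uniformly_continuous_on {\<alpha>..\<alpha> + T} \<phi>"
    using cont by (intro compact_uniformly_continuous) auto
  from this[unfolded uniformly_continuous_on_def, rule_format, OF c]
  obtain \<eta> where \<eta>: "0 < \<eta>"
    "\<forall>s\<in>{\<alpha>..\<alpha> + T}. \<forall>t\<in>{\<alpha>..\<alpha> + T}. dist t s < \<eta> \<longrightarrow> dist (\<phi> t) (\<phi> s) < c"
    by (elim exE conjE)
  have "(\<lambda>n. T / 2 ^ n) \<longlonglongrightarrow> 0" by (rule LIMSEQ_divide_realpow_zero) simp
  then have "\<forall>\<^sub>F n in sequentially. T / 2 ^ n < \<eta>"
    using \<eta>(1) by (rule order_tendstoD)
  then obtain N where N: "\<And>n. N \<le> n \<Longrightarrow> T / 2 ^ n < \<eta>" by (auto simp: eventually_sequentially)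
  define F where "F t = integral {\<alpha>..t} \<phi>" for t
  have "\<bar>F (\<alpha> + T) - F \<alpha> - tsum f x \<alpha> T n\<bar> < e" if n: "N \<le> n" for n
  proof -
    have step: "\<bar>F (grid \<alpha> T n (Suc k)) - F (grid \<alpha> T n k) - T / 2 ^ n * \<phi> (grid \<alpha> T n k)\<bar> \<le> c * (T / 2 ^ n)"
      if k: "k < 2 ^ n" for k
    proof -
      let ?s = "grid \<alpha> T n k" and ?t = "grid \<alpha> T n (Suc k)"
      have b: "\<alpha> \<le> ?s" "?s \<le> ?t" "?t \<le> \<alpha> + T"
        using grid_bounds[OF T, of k n \<alpha>] grid_bounds[OF T, of "Suc k" n \<alpha>] grid_mono[OF T, of k "Suc k"] k by auto
      have int: "\<phi> integrable_on {u..v}" if "\<alpha> \<le> u" "v \<le> \<alpha> + T" for u v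
        using cont that by (intro integrable_continuous_interval) (auto elim: continuous_on_subset)
      have "F ?t - F ?s = integral {?s..?t} \<phi>"
        using Henstock_Kurzweil_Integration.integral_combine[OF b(1,2) int] b unfolding F_def by auto
      moreover have "integral {?s..?t} (\<lambda>u. \<phi> u - \<phi> ?s) = integral {?s..?t} \<phi> - T / 2 ^ n * \<phi> ?s"
        using b int[of ?s ?t] grid_diff[of \<alpha> T n k] by (subst Henstock_Kurzweil_Integration.integral_diff) auto
      moreover have "norm (integral {?s..?t} (\<lambda>u. \<phi> u - \<phi> ?s)) \<le> c * (?t - ?s)"
      proof (rule integral_bound)
        show "continuous_on {?s..?t} (\<lambda>u. \<phi> u - \<phi> ?s)"
          using b by (intro continuous_intros continuous_on_subset[OF cont]) auto
        fix u assume u: "u \<in> {?s..?t}"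
        then have "dist (\<phi> u) (\<phi> ?s) < c"
          using b N[OF n] grid_diff[of \<alpha> T n k] by (intro \<eta>(2)[rule_format]) (auto simp: dist_real_def)
        then show "norm (\<phi> u - \<phi> ?s) \<le> c" by (simp add: dist_real_def)
      qed (use b in auto)
      ultimately show ?thesis by (simp add: grid_diff)
    qed
    have "F (\<alpha> + T) - F \<alpha> = (\<Sum>k<2^n. F (grid \<alpha> T n (Suc k)) - F (grid \<alpha> T n k))"
      by (subst sum_lessThan_telescope) (simp add: grid_0 grid_end)
    then have "\<bar>F (\<alpha> + T) - F \<alpha> - tsum f x \<alpha> T n\<bar> =
       \<bar>\<Sum>k<2^n. F (grid \<alpha> T n (Suc k)) - F (grid \<alpha> T n k) - T / 2 ^ n * \<phi> (grid \<alpha> T n k)\<bar>"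
      by (simp add: tsum_def \<phi>_def sum_subtractf)
    also have "\<dots> \<le> (\<Sum>k<(2::nat)^n. c * (T / 2 ^ n))"
      using step by (intro order_trans[OF sum_abs] sum_mono) auto
    also have "\<dots> = c * T" by simp
    also have "\<dots> < e" using T e by (simp add: c_def field_simps)
    finally show ?thesis .
  qed
  moreover have "F \<alpha> = 0" by (simp add: F_def)
  ultimately show "\<exists>N. \<forall>n\<ge>N. norm (tsum f x \<alpha> T n - integral {\<alpha>..\<alpha> + T} (\<lambda>t. f (x t))) < e"
    by (intro exI[of _ N]) (auto simp: F_def \<phi>_def[abs_def] abs_minus_commute)
qed

text \<open>The pointwise inequality that lets a fourth moment control the large values, in a
  Paley-Zygmund argument for the integrals over the cells.\<close>

lemma truncation_ineq:
  fixes j b r L \<mu> :: real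
  assumes "0 < r" "0 < L" "0 \<le> \<mu>"
  shows "(r * j - \<mu> * b) * j \<le> L * r * \<bar>r * j - \<mu> * b\<bar> + j ^ 4 / (L\<^sup>2 * r) + \<mu> * \<bar>b\<bar> * j\<^sup>2 / (L * r)"
\<comment> \<open>Below the threshold L r the factor j is simply replaced by its bound. Above it,
  powers of |j|/(L r), which are at least 1, are inserted to reach the fourth moment and the
  weighted square.\<close>
proof (cases "\<bar>j\<bar> \<le> L * r")
  case True
  have "(r * j - \<mu> * b) * j \<le> \<bar>r * j - \<mu> * b\<bar> * \<bar>j\<bar>" by (simp add: abs_mult[symmetric])
  also have "\<dots> \<le> \<bar>r * j - \<mu> * b\<bar> * (L * r)" using True by (intro mult_left_mono) auto
  finally have "(r * j - \<mu> * b) * j \<le> L * r * \<bar>r * j - \<mu> * b\<bar>" by (simp add: mult_ac)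
  moreover have "0 \<le> j ^ 4 / (L\<^sup>2 * r)" "0 \<le> \<mu> * \<bar>b\<bar> * j\<^sup>2 / (L * r)" using assms by auto
  ultimately show ?thesis by linarith
next
  case False
  then have 1: "1 \<le> \<bar>j\<bar> / (L * r)" using assms by (simp add: field_simps)
  then have "1\<^sup>2 \<le> (\<bar>j\<bar> / (L * r))\<^sup>2" by (intro power_mono) auto
  then have 2: "1 \<le> j\<^sup>2 / (L * r)\<^sup>2" by (simp add: power_divide)
  have "(r * j - \<mu> * b) * j \<le> r * j\<^sup>2 + \<mu> * \<bar>b\<bar> * \<bar>j\<bar>"
  proof -
    have "- (b * j) \<le> \<bar>b\<bar> * \<bar>j\<bar>" by (simp add: abs_mult[symmetric])
    then have "\<mu> * (- (b * j)) \<le> \<mu> * (\<bar>b\<bar> * \<bar>j\<bar>)" using assms by (intro mult_left_mono)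
    then show ?thesis by (simp add: algebra_simps power2_eq_square)
  qed
  also have "r * j\<^sup>2 \<le> r * j\<^sup>2 * (j\<^sup>2 / (L * r)\<^sup>2)"
    using mult_left_mono[OF 2, of "r * j\<^sup>2"] assms by simp
  also have "r * j\<^sup>2 * (j\<^sup>2 / (L * r)\<^sup>2) = j ^ 4 / (L\<^sup>2 * r)"
    using assms by (simp add: field_simps power2_eq_square power4_eq_xxxx)
  also have "\<mu> * \<bar>b\<bar> * \<bar>j\<bar> \<le> \<mu> * \<bar>b\<bar> * \<bar>j\<bar> * (\<bar>j\<bar> / (L * r))"
    using mult_left_mono[OF 1, of "\<mu> * \<bar>b\<bar> * \<bar>j\<bar>"] assms by simp
  also have "\<dots> = \<mu> * \<bar>b\<bar> * j\<^sup>2 / (L * r)"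
    by (simp add: power2_eq_square abs_mult_self_eq)
  finally have "(r * j - \<mu> * b) * j \<le> j ^ 4 / (L\<^sup>2 * r) + \<mu> * \<bar>b\<bar> * j\<^sup>2 / (L * r)" by simp
  moreover have "0 \<le> L * r * \<bar>r * j - \<mu> * b\<bar>" using assms by simp
  ultimately show ?thesis by linarith
qed

text \<open>The bound 2 leaves room for a perturbation of gradient at most 1 below the bound 3
  imposed on the candidates. For fixed f and U this is a deterministic set of cells, so moment
  bounds apply to sums over it.\<close>

definition good_cells :: "(real ^ 'n) set \<Rightarrow> (real ^ 'n \<Rightarrow> real) \<Rightarrow> nat \<Rightarrow> ('n \<Rightarrow> bool) \<Rightarrow> ('n \<Rightarrow> int) set" where
  "good_cells U f m \<theta> = {q. cell m (\<theta>, q) \<subseteq> U \<and> (\<forall>v\<in>cell m (\<theta>, q). \<forall>h. \<bar>partial_deriv h f v\<bar> \<le> 2)}"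

text \<open>Half the rate of change of the density |grad f|^2 when the bump divided by 2^m is added
  to f. With this normalisation it is bounded on good cells uniformly in m.\<close>

definition corr :: "(real ^ 'n \<Rightarrow> real) \<Rightarrow> nat \<Rightarrow> 'n cell \<Rightarrow> real ^ 'n \<Rightarrow> real" where
  "corr f m p v = (\<Sum>h\<in>UNIV. partial_deriv h f v * (partial_deriv h (bump m p) v / 2 ^ m))"

text \<open>A point lies in at most one cell for each of the possible shifts, and there is one shift
  for each subset of the coordinates.\<close>

lemma sum_cells_le:
  fixes F :: "'n::finite cell \<Rightarrow> real"
  assumes "finite G" "\<And>p. p \<in> G \<Longrightarrow> v \<notin> cell m p \<Longrightarrow> F p = 0" "\<And>p. p \<in> G \<Longrightarrow> \<bar>F p\<bar> \<le> C" "0 \<le> C"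
  shows "\<bar>\<Sum>p\<in>G. F p\<bar> \<le> 2 ^ CARD('n) * C"
proof -
  define H where "H = {p \<in> G. v \<in> cell m p}"
  have "(\<Sum>p\<in>G. F p) = (\<Sum>p\<in>H. F p)"
    unfolding H_def using assms(1,2) by (intro sum.mono_neutral_right) auto
  also have "\<bar>\<dots>\<bar> \<le> (\<Sum>p\<in>H. C)"
    by (intro order_trans[OF sum_abs] sum_mono) (auto simp: H_def assms(3))
  also have "\<dots> = real (card H) * C" by simp
  also have "\<dots> \<le> 2 ^ CARD('n) * C"
  proof (intro mult_right_mono)
    have "inj_on fst H" by (rule inj_onI) (auto simp: H_def dest: cell_unique)
    then have "card H \<le> card (UNIV :: ('n \<Rightarrow> bool) set)"
      by (rule card_inj_on_le) (auto)
    also have "\<dots> = 2 ^ CARD('n)" by (simp add: card_fun)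
    finally show "real (card H) \<le> 2 ^ CARD('n)" by (metis of_nat_le_iff of_nat_numeral of_nat_power)
  qed (use assms in auto)
  finally show ?thesis .
qed

text \<open>The assumptions \<open>square_var\<close>, \<open>cross_var\<close> and \<open>fourth\<close> are what Brownian motion provides almost
  surely.\<close>

locale window_path =
  fixes x :: "real \<Rightarrow> real ^ 'n::finite" and z :: "real \<Rightarrow> real" and \<alpha> T :: real
    and U :: "(real ^ 'n) set" and D :: "(real ^ 'n \<Rightarrow> real) set"
  assumes T: "0 < T" and x_cont: "continuous_on {\<alpha>..\<alpha> + T} x"
    and U: "open U" "bounded U" and x_in: "\<And>t. \<alpha> \<le> t \<Longrightarrow> t \<le> \<alpha> + T \<Longrightarrow> x t \<in> U"
    and D_elementary: "\<And>f. f \<in> D \<Longrightarrow> f \<in> elementary"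
    and D_0: "(\<lambda>_. 0) \<in> D"
    and D_add: "\<And>f c m p. f \<in> D \<Longrightarrow> c \<in> \<rat> \<Longrightarrow> (\<lambda>v. f v + c * bump m p v) \<in> D"
    and rsum_conv: "\<And>f. f \<in> D \<Longrightarrow> convergent (rsum f x z \<alpha> T)"
    and square_var: "\<And>f \<theta> e. f \<in> D \<Longrightarrow> 0 < e \<Longrightarrow> \<forall>\<^sub>F m in sequentially. \<exists>\<^sub>F n in sequentially.
       \<bar>\<Sum>q\<in>good_cells U f m \<theta>. (rsum (bump m (\<theta>, q)) x z \<alpha> T n)\<^sup>2 - tsum (\<lambda>v. (bump m (\<theta>, q) v)\<^sup>2) x \<alpha> T n\<bar> \<le> e"
    and cross_var: "\<And>f \<theta> e. f \<in> D \<Longrightarrow> 0 < e \<Longrightarrow> \<forall>\<^sub>F m in sequentially. \<exists>\<^sub>F n in sequentially.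
       \<bar>2 ^ m * (\<Sum>q\<in>good_cells U f m \<theta>. tsum (corr f m (\<theta>, q)) x \<alpha> T n * rsum (bump m (\<theta>, q)) x z \<alpha> T n)\<bar> \<le> e"
    and fourth: "\<exists>B. \<exists>\<^sub>F m in sequentially. \<exists>\<^sub>F n in sequentially.
       4 ^ m * (\<Sum>p\<in>{p. cell m p \<subseteq> U}. (rsum (bump m p) x z \<alpha> T n) ^ 4 +
          tsum (indicator (cell m p)) x \<alpha> T n * (rsum (bump m p) x z \<alpha> T n)\<^sup>2) \<le> B"
begin

section \<open>The variational argument on a fixed path\<close>

definition J :: "(real ^ 'n \<Rightarrow> real) \<Rightarrow> real" where
  "J f = lim (rsum f x z \<alpha> T)"

definition I :: "(real ^ 'n \<Rightarrow> real) \<Rightarrow> real" where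
  "I f = integral {\<alpha>..\<alpha> + T} (\<lambda>t. f (x t))"

definition P :: "(real ^ 'n \<Rightarrow> real) \<Rightarrow> real" where
  "P f = I (\<lambda>v. \<Sum>h\<in>UNIV. (partial_deriv h f v)\<^sup>2)"

definition cells :: "(real ^ 'n \<Rightarrow> real) \<Rightarrow> nat \<Rightarrow> 'n cell set" where
  "cells f m = (SIGMA \<theta>:UNIV. good_cells U f m \<theta>)"

lemma finite_cells: "finite (cells f m)" and finite_good_cells: "finite (good_cells U f m \<theta>)"
proof -
  have "cells f m \<subseteq> {p. cell m p \<subseteq> U}" by (auto simp: cells_def good_cells_def)
  then show "finite (cells f m)" using finite_cells_in_bounded[OF U(2)] finite_subset by blast
  then have "finite (Pair \<theta> -` cells f m)"
    by (intro finite_vimageI) (auto simp: inj_on_def)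
  also have "Pair \<theta> -` cells f m = good_cells U f m \<theta>" by (auto simp: cells_def)
  finally show "finite (good_cells U f m \<theta>)" .
qed

lemma J_tendsto: "f \<in> D \<Longrightarrow> rsum f x z \<alpha> T \<longlonglongrightarrow> J f"
  unfolding J_def using rsum_conv by (simp add: convergent_LIMSEQ_iff)

lemma I_tendsto: "continuous_on UNIV f \<Longrightarrow> tsum f x \<alpha> T \<longlonglongrightarrow> I f"
  unfolding I_def using T
  by (intro tsum_convergent continuous_on_compose2[OF _ x_cont]) auto

lemma cont_pd: "f \<in> D \<Longrightarrow> continuous_on UNIV (partial_deriv h f)"
  by (intro elementary_continuous_on elementary_partial_deriv D_elementary)

lemma cont_pd_bump: "continuous_on UNIV (partial_deriv h (bump m p))"
  by (intro elementary_continuous_on elementary_partial_deriv bump_elementary)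

lemma P_tendsto: "f \<in> D \<Longrightarrow> tsum (\<lambda>v. \<Sum>h\<in>UNIV. (partial_deriv h f v)\<^sup>2) x \<alpha> T \<longlonglongrightarrow> P f"
  unfolding P_def by (intro I_tendsto continuous_intros cont_pd)

lemma corr_tendsto: "f \<in> D \<Longrightarrow> tsum (corr f m p) x \<alpha> T \<longlonglongrightarrow> I (corr f m p)"
  unfolding corr_def[abs_def] by (intro I_tendsto continuous_intros cont_pd cont_pd_bump) auto

lemma P_nonneg: "f \<in> D \<Longrightarrow> 0 \<le> P f"
  using T by (intro LIMSEQ_le_const[OF P_tendsto]) (auto intro!: exI tsum_nonneg sum_nonneg)

lemma D_add_sum:
  assumes f: "f \<in> D" and "finite G" and c: "\<And>p. p \<in> G \<Longrightarrow> c p \<in> \<rat>"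
  shows "(\<lambda>v. f v + (\<Sum>p\<in>G. c p * bump m p v)) \<in> D"
  using assms(2,3)
proof (induction G)
  case (insert p G)
  then have "(\<lambda>v. (f v + (\<Sum>p\<in>G. c p * bump m p v)) + c p * bump m p v) \<in> D"
    by (intro D_add) auto
  then show ?case using insert by (simp add: add_ac)
qed (use f in simp)

lemma bump_in_D: "bump m p \<in> D"
  using D_add[OF D_0, of 1 m p] by simp

lemma partial_deriv_add_bumps:
  assumes "f \<in> D"
  shows "partial_deriv h (\<lambda>v. f v + (\<Sum>p\<in>G. c p * bump m p v)) v =
     partial_deriv h f v + (\<Sum>p\<in>G. c p * partial_deriv h (bump m p) v)"
proof -
  have "partial_deriv h (\<lambda>v. \<Sum>p\<in>G. c p * bump m p v) v = (\<Sum>p\<in>G. c p * partial_deriv h (bump m p) v)"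
    by (subst partial_deriv_sum) (auto simp: partial_deriv_cmult bump_elementary elementary_cmult)
  then show ?thesis
    by (subst partial_deriv_add) (auto intro!: D_elementary assms elementary_sum elementary_cmult bump_elementary)
qed

text \<open>Where the squared gradient along the path is at most 1, each partial derivative is at
  most 1 in absolute value, and by uniform continuity at most 2 throughout the surrounding cell once
  m is large. The cell whose bump is bounded below at the path point is then good. Elsewhere the
  left side is not positive.\<close>

lemma cells_cover:
  assumes f: "f \<in> D"
  shows "\<forall>\<^sub>F m in sequentially. \<forall>t. \<alpha> \<le> t \<longrightarrow> t \<le> \<alpha> + T \<longrightarrow>
     (exp (- 8) ^ CARD('n))\<^sup>2 * (1 - (\<Sum>h\<in>UNIV. (partial_deriv h f (x t))\<^sup>2)) \<le> (\<Sum>p\<in>cells f m. (bump m p (x t))\<^sup>2)"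
proof -
  let ?c = "exp (- 8) ^ CARD('n) :: real"
  have close: "\<forall>\<^sub>F m in sequentially. \<forall>u v :: real ^ 'n. (\<exists>p. u \<in> cell m p \<and> v \<in> cell m p) \<longrightarrow> dist u v < d"
    if d: "0 < d" for d :: real
  proof -
    have "(\<lambda>m. real CARD('n) / 2 ^ m) \<longlonglongrightarrow> 0" by (rule LIMSEQ_divide_realpow_zero) simp
    then have "\<forall>\<^sub>F m in sequentially. real CARD('n) / 2 ^ m < d" using d by (rule order_tendstoD)
    then show ?thesis
    proof eventually_elim
      case (elim m)
      show ?case
      proof (intro allI impI, elim exE conjE)
        fix u v :: "real ^ 'n" and p assume uv: "u \<in> cell m p" "v \<in> cell m p"
        have "norm (u - v) \<le> (\<Sum>h\<in>UNIV. \<bar>(u - v) $ h\<bar>)" by (rule norm_le_l1_cart)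
        also have "\<dots> \<le> (\<Sum>h::'n\<in>UNIV. 1 / 2 ^ m)"
          using cell_dist[OF uv] by (intro sum_mono) auto
        also have "\<dots> = real CARD('n) / 2 ^ m" by simp
        finally show "dist u v < d" using elim by (simp add: dist_norm)
      qed
    qed
  qed
  have comp: "compact (x ` {\<alpha>..\<alpha> + T})" by (intro compact_continuous_image x_cont) auto
  have "x ` {\<alpha>..\<alpha> + T} \<subseteq> U" using x_in by auto
  \<comment> \<open>The path over the window is compact, so a whole neighbourhood of it lies in U,
    and so does every sufficiently small cell that it visits.\<close>
  from compact_subset_open_imp_ball_epsilon_subset[OF comp U(1) this]
  obtain d where d: "0 < d" "(\<Union>v\<in>x ` {\<alpha>..\<alpha> + T}. ball v d) \<subseteq> U" by blast
  have ev_U: "\<forall>\<^sub>F m in sequentially. \<forall>t p. \<alpha> \<le> t \<longrightarrow> t \<le> \<alpha> + T \<longrightarrow> x t \<in> cell m p \<longrightarrow> cell m p \<subseteq> U"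
    using close[OF d(1)]
  proof eventually_elim
    case (elim m)
    show ?case
    proof (intro allI impI subsetI)
      fix t p v assume t: "\<alpha> \<le> t" "t \<le> \<alpha> + T" and v: "x t \<in> cell m p" "v \<in> cell m p"
      have "dist (x t) v < d" using elim v by blast
      moreover have "x t \<in> x ` {\<alpha>..\<alpha> + T}" using t by auto
      ultimately show "v \<in> U" using d(2) mem_ball by blast
    qed
  qed
  have "\<forall>\<^sub>F m in sequentially. \<forall>u v p. u \<in> cell m p \<longrightarrow> v \<in> cell m p \<longrightarrow> cell m p \<subseteq> U \<longrightarrow>
      \<bar>partial_deriv h f v\<bar> \<le> \<bar>partial_deriv h f u\<bar> + 1" for h
  proof -
    have "compact (closure U)" using U(2) by (simp add: compact_closure)
    then have "uniformly_continuous_on (closure U) (partial_deriv h f)"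
      by (intro compact_uniformly_continuous continuous_on_subset[OF cont_pd[OF f]]) auto
    from this[unfolded uniformly_continuous_on_def, rule_format, OF zero_less_one]
    obtain \<eta> where \<eta>: "0 < \<eta>"
      "\<forall>s\<in>closure U. \<forall>t\<in>closure U. dist t s < \<eta> \<longrightarrow> dist (partial_deriv h f t) (partial_deriv h f s) < 1"
      by (elim exE conjE)
    show ?thesis using close[OF \<eta>(1)]
    proof eventually_elim
      case (elim m)
      show ?case
      proof (intro allI impI)
        fix u v p assume uv: "u \<in> cell m p" "v \<in> cell m p" "cell m p \<subseteq> U"
        then have "u \<in> closure U" "v \<in> closure U" using closure_subset by blast+
        moreover have "dist v u < \<eta>" using uv elim by blast
        ultimately have "dist (partial_deriv h f v) (partial_deriv h f u) < 1" using \<eta>(2) by blast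
        then show "\<bar>partial_deriv h f v\<bar> \<le> \<bar>partial_deriv h f u\<bar> + 1" by (simp add: dist_real_def)
      qed
    qed
  qed
  then have "\<forall>\<^sub>F m in sequentially. \<forall>h. \<forall>u v p. u \<in> cell m p \<longrightarrow> v \<in> cell m p \<longrightarrow> cell m p \<subseteq> U \<longrightarrow>
      \<bar>partial_deriv h f v\<bar> \<le> \<bar>partial_deriv h f u\<bar> + 1"
    by (rule eventually_all_finite)
  then show ?thesis using ev_U
  proof eventually_elim
    case (elim m)
    show ?case
    proof (intro allI impI)
      fix t assume t: "\<alpha> \<le> t" "t \<le> \<alpha> + T"
      have nn: "0 \<le> (\<Sum>p\<in>cells f m. (bump m p (x t))\<^sup>2)" by (intro sum_nonneg) auto
      have pd_nn: "0 \<le> (\<Sum>h\<in>UNIV. (partial_deriv h f (x t))\<^sup>2)" by (intro sum_nonneg) auto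
      show "?c\<^sup>2 * (1 - (\<Sum>h\<in>UNIV. (partial_deriv h f (x t))\<^sup>2)) \<le> (\<Sum>p\<in>cells f m. (bump m p (x t))\<^sup>2)"
      proof (cases "(\<Sum>h\<in>UNIV. (partial_deriv h f (x t))\<^sup>2) \<le> 1")
        case False
        then have "?c\<^sup>2 * (1 - (\<Sum>h\<in>UNIV. (partial_deriv h f (x t))\<^sup>2)) \<le> 0"
          by (intro mult_nonneg_nonpos) auto
        then show ?thesis using nn by linarith
      next
        case True
        have le1: "\<bar>partial_deriv h f (x t)\<bar> \<le> 1" for h
        proof -
          have "(partial_deriv h f (x t))\<^sup>2 \<le> (\<Sum>h\<in>UNIV. (partial_deriv h f (x t))\<^sup>2)"
            by (intro member_le_sum) auto
          then have "(partial_deriv h f (x t))\<^sup>2 \<le> 1" using True by linarith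
          then show ?thesis by (simp add: abs_square_le_1)
        qed
        obtain p where p: "x t \<in> cell m p" "?c \<le> bump m p (x t)"
          using exists_cell_bump_lower[of "x t" m] by blast
        have sub: "cell m p \<subseteq> U" using elim(2) t p(1) by blast
        have "\<bar>partial_deriv h f v\<bar> \<le> 2" if "v \<in> cell m p" for v h
          using elim(1)[rule_format, OF p(1) that sub, of h] le1[of h] by linarith
        then have "p \<in> cells f m" using sub by (cases p) (auto simp: cells_def good_cells_def)
        then have "(bump m p (x t))\<^sup>2 \<le> (\<Sum>p\<in>cells f m. (bump m p (x t))\<^sup>2)"
          by (intro member_le_sum finite_cells) auto
        moreover have "?c\<^sup>2 \<le> (bump m p (x t))\<^sup>2" using p(2) by (intro power_mono) auto
        moreover have "?c\<^sup>2 * (1 - (\<Sum>h\<in>UNIV. (partial_deriv h f (x t))\<^sup>2)) \<le> ?c\<^sup>2 * 1"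
          using pd_nn by (intro mult_left_mono) auto
        ultimately show ?thesis by linarith
      qed
    qed
  qed
qed

text \<open>The probabilistic bounds come from lower limits and hold only for infinitely many n; for
  a convergent sequence this is enough to bound the limit.\<close>

lemma tendsto_frequently_le:
  fixes X :: "nat \<Rightarrow> real"
  assumes "X \<longlonglongrightarrow> l" "\<exists>\<^sub>F n in sequentially. X n \<le> c"
  shows "l \<le> c"
proof (rule ccontr)
  assume "\<not> l \<le> c"
  then have "\<forall>\<^sub>F n in sequentially. c < X n" using assms(1) by (intro order_tendstoD) auto
  then have "\<forall>\<^sub>F n in sequentially. \<not> X n \<le> c" by eventually_elim auto
  then show False using assms(2) by (simp add: frequently_def)
qed

text \<open>Write X_p = j_p / 2^m - 2 \<nu> b_p, with j_p the integral of the bump and b_p the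
  integral of \<open>corr\<close>, and sum X_p j_p over the good cells. After multiplication by 2^m,
  the squares of the j_p contribute at least c T/2 - c T/16, the cross terms remove at most c T/16,
  and truncation at level L bounds the whole by L times the sum of |X_p| plus c T/8. What remains is
  c T/4.\<close>

lemma gain:
  assumes f: "f \<in> D" "P f \<le> T / 2" and \<nu>: "0 < \<nu>"
    and C: "0 < C" "\<And>m p h v. \<bar>partial_deriv h (bump m p) (v :: real ^ 'n)\<bar> \<le> 2 ^ m * C"
    and B: "\<exists>\<^sub>F m in sequentially. \<exists>\<^sub>F n in sequentially.
       4 ^ m * (\<Sum>p\<in>{p. cell m p \<subseteq> U}. (rsum (bump m p) x z \<alpha> T n) ^ 4 +
          tsum (indicator (cell m p)) x \<alpha> T n * (rsum (bump m p) x z \<alpha> T n)\<^sup>2) \<le> B"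
    and c: "c = (exp (- 8) ^ CARD('n))\<^sup>2" and \<kappa>: "\<kappa> = real CARD('n) * (2 * C)"
    and L: "0 < L" "B / L\<^sup>2 + 2 * \<nu> * \<kappa> * B / L \<le> c * T / 8"
  shows "\<exists>m. c * T / (4 * L) \<le> (\<Sum>p\<in>cells f m. \<bar>J (bump m p) / 2 ^ m - 2 * \<nu> * I (corr f m p)\<bar>)"
proof -
  define N :: real where "N = real CARD('n \<Rightarrow> bool)"
  have N: "0 < N" by (simp add: N_def)
  have c0: "0 < c" by (simp add: c)
  \<comment> \<open>There are N shifts; the tolerances are chosen so that the errors of all shifts
    together amount to c T/16, for the squares and, with the factor 2 \<nu>, for the cross
    terms.\<close>
  define e1 where "e1 = c * T / (16 * N)"
  define e2 where "e2 = c * T / (32 * \<nu> * N)"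
  have e: "0 < e1" "0 < e2" using c0 T N \<nu> by (simp_all add: e1_def e2_def)
  have ev1: "\<forall>\<^sub>F m in sequentially. \<forall>\<theta>. \<exists>\<^sub>F n in sequentially.
       \<bar>\<Sum>q\<in>good_cells U f m \<theta>. (rsum (bump m (\<theta>, q)) x z \<alpha> T n)\<^sup>2 - tsum (\<lambda>v. (bump m (\<theta>, q) v)\<^sup>2) x \<alpha> T n\<bar> \<le> e1"
    by (intro eventually_all_finite square_var f e)
  have ev2: "\<forall>\<^sub>F m in sequentially. \<forall>\<theta>. \<exists>\<^sub>F n in sequentially.
       \<bar>2 ^ m * (\<Sum>q\<in>good_cells U f m \<theta>. tsum (corr f m (\<theta>, q)) x \<alpha> T n * rsum (bump m (\<theta>, q)) x z \<alpha> T n)\<bar> \<le> e2"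
    by (intro eventually_all_finite cross_var f e)
  \<comment> \<open>The fourth-moment bound holds for infinitely many m, the other statements for
    all large m, so one m satisfies all of them.\<close>
  from frequently_ex[OF frequently_eventually_frequently[OF B eventually_conj[OF ev1
        eventually_conj[OF ev2 cells_cover[OF f(1), folded c]]]]]
  obtain m where sq: "\<And>\<theta>. \<exists>\<^sub>F n in sequentially.
       \<bar>\<Sum>q\<in>good_cells U f m \<theta>. (rsum (bump m (\<theta>, q)) x z \<alpha> T n)\<^sup>2 - tsum (\<lambda>v. (bump m (\<theta>, q) v)\<^sup>2) x \<alpha> T n\<bar> \<le> e1"
   and cr: "\<And>\<theta>. \<exists>\<^sub>F n in sequentially.
       \<bar>2 ^ m * (\<Sum>q\<in>good_cells U f m \<theta>. tsum (corr f m (\<theta>, q)) x \<alpha> T n * rsum (bump m (\<theta>, q)) x z \<alpha> T n)\<bar> \<le> e2"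
   and cov: "\<And>t. \<alpha> \<le> t \<Longrightarrow> t \<le> \<alpha> + T \<Longrightarrow>
     c * (1 - (\<Sum>h\<in>UNIV. (partial_deriv h f (x t))\<^sup>2)) \<le> (\<Sum>p\<in>cells f m. (bump m p (x t))\<^sup>2)"
   and fo: "\<exists>\<^sub>F n in sequentially.
       4 ^ m * (\<Sum>p\<in>{p. cell m p \<subseteq> U}. (rsum (bump m p) x z \<alpha> T n) ^ 4 +
          tsum (indicator (cell m p)) x \<alpha> T n * (rsum (bump m p) x z \<alpha> T n)\<^sup>2) \<le> B"
    by blast
  define r :: real where "r = 1 / 2 ^ m"
  have r: "0 < r" by (simp add: r_def)
  define G where "G = cells f m"
  have G: "finite G" by (simp add: G_def finite_cells)
  have sum_G: "(\<Sum>p\<in>G. F p) = (\<Sum>\<theta>\<in>UNIV. \<Sum>q\<in>good_cells U f m \<theta>. F (\<theta>, q))" for F :: "'n cell \<Rightarrow> real"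
    unfolding G_def cells_def by (subst sum.Sigma) (auto simp: finite_good_cells)
  define jn where "jn n p = rsum (bump m p) x z \<alpha> T n" for n p
  define bn where "bn n p = tsum (corr f m p) x \<alpha> T n" for n p
  define sn where "sn n p = tsum (\<lambda>v. (bump m p v)\<^sup>2) x \<alpha> T n" for n p
  define on where "on n p = tsum (indicator (cell m p)) x \<alpha> T n" for n and p :: "'n cell"
  define j where "j p = J (bump m p)" for p
  define b where "b p = I (corr f m p)" for p
  define s where "s p = I (\<lambda>v. (bump m p v)\<^sup>2)" for p
  have lims: "(\<lambda>n. jn n p) \<longlonglongrightarrow> j p" "(\<lambda>n. bn n p) \<longlonglongrightarrow> b p" "(\<lambda>n. sn n p) \<longlonglongrightarrow> s p" for p
    unfolding jn_def bn_def sn_def j_def b_def s_def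
    by (intro J_tendsto bump_in_D corr_tendsto f I_tendsto continuous_intros
        elementary_continuous_on bump_elementary)+
  have sq': "\<bar>\<Sum>q\<in>good_cells U f m \<theta>. (j (\<theta>, q))\<^sup>2 - s (\<theta>, q)\<bar> \<le> e1" for \<theta>
    by (rule tendsto_frequently_le[OF _ sq[of \<theta>, folded jn_def sn_def]]) (intro tendsto_intros lims)
  have cr': "\<bar>2 ^ m * (\<Sum>q\<in>good_cells U f m \<theta>. b (\<theta>, q) * j (\<theta>, q))\<bar> \<le> e2" for \<theta>
    by (rule tendsto_frequently_le[OF _ cr[of \<theta>, folded jn_def bn_def]]) (intro tendsto_intros lims)
  have "(\<Sum>p\<in>G. s p) \<ge> c * (T - P f)"
  proof (rule LIMSEQ_le)
    show "(\<lambda>n. tsum (\<lambda>v. c * (1 + (- 1) * (\<Sum>h\<in>UNIV. (partial_deriv h f v)\<^sup>2))) x \<alpha> T n) \<longlonglongrightarrow> c * (T - P f)"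
      unfolding tsum_cmult tsum_add tsum_const
      using tendsto_mult_left[OF tendsto_diff[OF tendsto_const[of T] P_tendsto[OF f(1)]], of c] by simp
    show "(\<lambda>n. \<Sum>p\<in>G. sn n p) \<longlonglongrightarrow> (\<Sum>p\<in>G. s p)" by (intro tendsto_intros lims)
    show "\<exists>N. \<forall>n\<ge>N. tsum (\<lambda>v. c * (1 + (- 1) * (\<Sum>h\<in>UNIV. (partial_deriv h f v)\<^sup>2))) x \<alpha> T n \<le> (\<Sum>p\<in>G. sn n p)"
      unfolding sn_def tsum_sum[symmetric] using T cov by (auto intro!: tsum_mono simp: G_def)
  qed
  moreover have "c * (T / 2) \<le> c * (T - P f)" using f(2) c0 by (intro mult_left_mono) auto
  moreover have "(\<Sum>p\<in>G. (j p)\<^sup>2 - s p) \<ge> - (N * e1)"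
  proof -
    have "\<bar>\<Sum>p\<in>G. (j p)\<^sup>2 - s p\<bar> \<le> (\<Sum>\<theta>\<in>(UNIV :: ('n \<Rightarrow> bool) set). e1)"
      unfolding sum_G by (intro order_trans[OF sum_abs] sum_mono sq')
    then show ?thesis by (simp add: N_def)
  qed
  moreover have "N * e1 = c * T / 16" using N by (simp add: e1_def)
  ultimately have sum_sq: "(\<Sum>p\<in>G. (j p)\<^sup>2) \<ge> c * T / 2 - c * T / 16"
    unfolding sum_subtractf by linarith
  have sum_cr: "2 * \<nu> * (2 ^ m * (\<Sum>p\<in>G. b p * j p)) \<le> c * T / 16"
  proof -
    have "\<bar>2 ^ m * (\<Sum>p\<in>G. b p * j p)\<bar> \<le> (\<Sum>\<theta>\<in>(UNIV :: ('n \<Rightarrow> bool) set). e2)"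
      unfolding sum_G by (subst sum_distrib_left) (intro order_trans[OF sum_abs] sum_mono cr')
    then have "2 ^ m * (\<Sum>p\<in>G. b p * j p) \<le> N * e2" by (simp add: N_def)
    then have "2 * \<nu> * (2 ^ m * (\<Sum>p\<in>G. b p * j p)) \<le> 2 * \<nu> * (N * e2)"
      using \<nu> by (intro mult_left_mono) auto
    moreover have "2 * \<nu> * (N * e2) = c * T / 16" using N \<nu> by (simp add: e2_def)
    ultimately show ?thesis by linarith
  qed
  define X where "X p = r * j p - 2 * \<nu> * b p" for p
  define Xn where "Xn n p = r * jn n p - 2 * \<nu> * bn n p" for n p
  have b_le: "\<bar>bn n p\<bar> \<le> \<kappa> * on n p" if p: "p \<in> G" for n p
  proof -
    have "\<bar>corr f m p v\<bar> \<le> \<kappa> * indicator (cell m p) v" for v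
    proof (cases "v \<in> cell m p")
      case True
      have "\<bar>corr f m p v\<bar> \<le> (\<Sum>h::'n\<in>UNIV. 2 * C)"
        unfolding corr_def
      proof (intro order_trans[OF sum_abs] sum_mono)
        fix h
        have "\<bar>partial_deriv h f v\<bar> \<le> 2"
          using p True by (cases p) (auto simp: G_def cells_def good_cells_def)
        moreover have "\<bar>partial_deriv h (bump m p) v / 2 ^ m\<bar> \<le> C"
          using C(2)[of h m p v] by (simp add: field_simps)
        ultimately show "\<bar>partial_deriv h f v * (partial_deriv h (bump m p) v / 2 ^ m)\<bar> \<le> 2 * C"
          unfolding abs_mult by (intro mult_mono) auto
      qed
      then show ?thesis using True by (simp add: \<kappa>)
    qed (simp add: corr_def partial_deriv_bump_eq_0)
    then have "tsum (\<lambda>v. \<bar>corr f m p v\<bar>) x \<alpha> T n \<le> tsum (\<lambda>v. \<kappa> * indicator (cell m p) v) x \<alpha> T n"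
      using T by (intro tsum_mono) auto
    then show ?thesis
      using tsum_abs[of T "corr f m p" x \<alpha> n] T unfolding bn_def on_def tsum_cmult by linarith
  qed
  have \<kappa>0: "0 < \<kappa>" using C by (simp add: \<kappa>)
  have on_nn: "0 \<le> on n p" for n p unfolding on_def using T by (intro tsum_nonneg) auto
  \<comment> \<open>The truncation is carried out before n tends to infinity: the indicators in
    \<open>on\<close> are not continuous, so their sums are not known to converge. The conclusion no
    longer contains them and does pass to the limit.\<close>
  have "\<exists>\<^sub>F n in sequentially. (\<Sum>p\<in>G. (jn n p)\<^sup>2) - 2 * \<nu> * (2 ^ m * (\<Sum>p\<in>G. bn n p * jn n p)) - L * (\<Sum>p\<in>G. \<bar>Xn n p\<bar>) \<le> c * T / 8"
    using fo
  proof (rule frequently_elim1)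
    fix n assume n: "4 ^ m * (\<Sum>p\<in>{p. cell m p \<subseteq> U}. (rsum (bump m p) x z \<alpha> T n) ^ 4 +
          tsum (indicator (cell m p)) x \<alpha> T n * (rsum (bump m p) x z \<alpha> T n)\<^sup>2) \<le> B"
    have "(\<Sum>p\<in>G. (jn n p) ^ 4 + on n p * (jn n p)\<^sup>2) \<le> (\<Sum>p\<in>{p. cell m p \<subseteq> U}. (jn n p) ^ 4 + on n p * (jn n p)\<^sup>2)"
      by (intro sum_mono2 finite_cells_in_bounded U(2))
         (auto simp: G_def cells_def good_cells_def on_nn)
    also have "\<dots> = 4 ^ m * (\<Sum>p\<in>{p. cell m p \<subseteq> U}. (jn n p) ^ 4 + on n p * (jn n p)\<^sup>2) * r\<^sup>2"
    proof -
      have "(4::real) ^ m = (2 ^ m)\<^sup>2" by (simp add: power2_eq_square flip: power_mult_distrib)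
      then have "4 ^ m * r\<^sup>2 = 1" by (simp add: r_def power_divide)
      then have "4 ^ m * Y * r\<^sup>2 = Y" for Y :: real
        by (subst mult.commute[of _ Y], subst mult.assoc) simp
      then show ?thesis by simp
    qed
    also have "\<dots> \<le> B * r\<^sup>2"
      using n unfolding jn_def on_def by (intro mult_right_mono) auto
    finally have S: "(\<Sum>p\<in>G. (jn n p) ^ 4) + (\<Sum>p\<in>G. on n p * (jn n p)\<^sup>2) \<le> B * r\<^sup>2"
      by (simp add: sum.distrib)
    have S4: "0 \<le> (\<Sum>p\<in>G. (jn n p) ^ 4)" and S2: "0 \<le> (\<Sum>p\<in>G. on n p * (jn n p)\<^sup>2)"
      using on_nn by (auto intro!: sum_nonneg)
    have "r * ((\<Sum>p\<in>G. (jn n p)\<^sup>2) - 2 * \<nu> * (2 ^ m * (\<Sum>p\<in>G. bn n p * jn n p))) =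
       (\<Sum>p\<in>G. Xn n p * jn n p)"
      by (simp add: Xn_def r_def sum_distrib_left sum_subtractf algebra_simps power2_eq_square)
    also have "\<dots> \<le> (\<Sum>p\<in>G. L * r * \<bar>Xn n p\<bar> + (jn n p) ^ 4 / (L\<^sup>2 * r) + 2 * \<nu> * \<kappa> * (on n p * (jn n p)\<^sup>2) / (L * r))"
    proof (rule sum_mono)
      fix p assume p: "p \<in> G"
      have "2 * \<nu> * \<bar>bn n p\<bar> * (jn n p)\<^sup>2 / (L * r) \<le> 2 * \<nu> * (\<kappa> * on n p) * (jn n p)\<^sup>2 / (L * r)"
        using \<nu> L r b_le[OF p] by (intro divide_right_mono mult_right_mono mult_left_mono) auto
      then show "Xn n p * jn n p \<le> L * r * \<bar>Xn n p\<bar> + (jn n p) ^ 4 / (L\<^sup>2 * r) + 2 * \<nu> * \<kappa> * (on n p * (jn n p)\<^sup>2) / (L * r)"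
        using truncation_ineq[OF r L(1), of "2 * \<nu>" "jn n p" "bn n p"] \<nu>
        unfolding Xn_def by (simp add: mult.assoc)
    qed
    also have "\<dots> = L * r * (\<Sum>p\<in>G. \<bar>Xn n p\<bar>) + (\<Sum>p\<in>G. (jn n p) ^ 4) / (L\<^sup>2 * r)
        + 2 * \<nu> * \<kappa> * (\<Sum>p\<in>G. on n p * (jn n p)\<^sup>2) / (L * r)"
      by (simp add: sum.distrib sum_distrib_left sum_divide_distrib)
    also have "\<dots> \<le> L * r * (\<Sum>p\<in>G. \<bar>Xn n p\<bar>) + B * r\<^sup>2 / (L\<^sup>2 * r) + 2 * \<nu> * \<kappa> * (B * r\<^sup>2) / (L * r)"
      using S S4 S2 L r \<nu> \<kappa>0 by (intro add_mono divide_right_mono mult_left_mono order_refl) auto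
    also have "\<dots> = r * (L * (\<Sum>p\<in>G. \<bar>Xn n p\<bar>) + (B / L\<^sup>2 + 2 * \<nu> * \<kappa> * B / L))"
      using r L by (simp add: field_simps power2_eq_square)
    finally have "(\<Sum>p\<in>G. (jn n p)\<^sup>2) - 2 * \<nu> * (2 ^ m * (\<Sum>p\<in>G. bn n p * jn n p)) \<le>
       L * (\<Sum>p\<in>G. \<bar>Xn n p\<bar>) + (B / L\<^sup>2 + 2 * \<nu> * \<kappa> * B / L)"
      using r by simp
    then show "(\<Sum>p\<in>G. (jn n p)\<^sup>2) - 2 * \<nu> * (2 ^ m * (\<Sum>p\<in>G. bn n p * jn n p)) - L * (\<Sum>p\<in>G. \<bar>Xn n p\<bar>) \<le> c * T / 8"
      using L(2) by linarith
  qed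
  then have "(\<Sum>p\<in>G. (j p)\<^sup>2) - 2 * \<nu> * (2 ^ m * (\<Sum>p\<in>G. b p * j p)) - L * (\<Sum>p\<in>G. \<bar>X p\<bar>) \<le> c * T / 8"
    unfolding Xn_def X_def by (rule tendsto_frequently_le[rotated]) (intro tendsto_intros lims)
  then have "c * T / 4 \<le> L * (\<Sum>p\<in>G. \<bar>X p\<bar>)"
    using sum_sq sum_cr by linarith
  then have "c * T / (4 * L) \<le> (\<Sum>p\<in>G. \<bar>X p\<bar>)" using L by (simp add: field_simps)
  then show ?thesis by (intro exI[of _ m]) (simp add: X_def G_def j_def b_def r_def)
qed

text \<open>If \<open>\<Psi>\<close> is unbounded on the admissible functions, so is the larger
  \<open>J\<close>. Otherwise an almost maximal f cannot be improved by a fixed amount, hence P f >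
  T/2, and J f = \<Psi> f + \<nu> P f is large because \<Psi> f is at least -1.\<close>

theorem integral_unbounded:
  "\<exists>f\<in>D. (\<forall>v. v \<notin> U \<longrightarrow> f v = 0 \<and> (\<forall>h. partial_deriv h f v = 0)) \<and>
     (\<forall>h v. \<bar>partial_deriv h f v\<bar> \<le> 3) \<and> K \<le> J f"
proof -
  define K' where "K' = max K 0"
  \<comment> \<open>Chosen so that a penalty of T/2 is worth K' + 1; the extra 1 pays for \<Psi> f
    being possibly as low as -1.\<close>
  define \<nu> where "\<nu> = 2 * (K' + 1) / T"
  have \<nu>: "0 < \<nu>" "\<nu> * T / 2 = K' + 1" using T by (auto simp: \<nu>_def K'_def)
  obtain C where C: "0 < C" "\<And>m (p :: 'n cell) h v. \<bar>partial_deriv h (bump m p) v\<bar> \<le> 2 ^ m * C"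
    using bump_gradient_bound by blast
  from fourth obtain B where B: "\<exists>\<^sub>F m in sequentially. \<exists>\<^sub>F n in sequentially.
       4 ^ m * (\<Sum>p\<in>{p. cell m p \<subseteq> U}. (rsum (bump m p) x z \<alpha> T n) ^ 4 +
          tsum (indicator (cell m p)) x \<alpha> T n * (rsum (bump m p) x z \<alpha> T n)\<^sup>2) \<le> B" ..
  define c :: real where "c = (exp (- 8) ^ CARD('n))\<^sup>2"
  define \<kappa> where "\<kappa> = real CARD('n) * (2 * C)"
  have c0: "0 < c" by (simp add: c_def)
  have "((\<lambda>L. B / L\<^sup>2 + 2 * \<nu> * \<kappa> * B / L) \<longlongrightarrow> 0 + 0) at_top"
    by (intro tendsto_intros tendsto_divide_0[OF tendsto_const] filterlim_at_top_imp_at_infinity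
        filterlim_pow_at_top filterlim_ident) auto
  then have "\<forall>\<^sub>F L in at_top. B / L\<^sup>2 + 2 * \<nu> * \<kappa> * B / L < c * T / 8"
    using c0 T by (intro order_tendstoD) auto
  moreover have "\<forall>\<^sub>F L in at_top. (0::real) < L" by (rule eventually_gt_at_top)
  ultimately have "\<forall>\<^sub>F L in at_top. B / L\<^sup>2 + 2 * \<nu> * \<kappa> * B / L < c * T / 8 \<and> 0 < L"
    by (rule eventually_conj)
  from eventually_happens'[OF trivial_limit_at_top_linorder this]
  obtain L where L: "0 < L" "B / L\<^sup>2 + 2 * \<nu> * \<kappa> * B / L \<le> c * T / 8"
    by (elim exE conjE) (rule that, assumption, erule less_imp_le)
  define c1 where "c1 = c * T / (4 * L)"
  have c1: "0 < c1" using c0 T L by (simp add: c1_def)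
  define M where "M = 2 ^ CARD('n) * C"
  have M: "0 < M" using C by (simp add: M_def)
  define V where "V = T * (real CARD('n) * M\<^sup>2)"
  have V: "0 < V" using T M by (simp add: V_def)
  have "0 < min (1 / M) (c1 / (2 * \<nu> * V))" using M c1 \<nu> V by simp
  \<comment> \<open>The step size \<epsilon> is the reciprocal of an integer because coefficients
    must be rational. The first bound keeps the gradient change at most 1, the second makes the
    second-order cost at most half of the first-order gain.\<close>
  then obtain N0 where N0: "inverse (real (Suc N0)) < min (1 / M) (c1 / (2 * \<nu> * V))"
    using reals_Archimedean by blast
  define \<epsilon> where "\<epsilon> = inverse (real (Suc N0))"
  have \<epsilon>: "0 < \<epsilon>" "\<epsilon> * M \<le> 1" "\<nu> * \<epsilon> * V \<le> c1 / 2" "\<epsilon> \<in> \<rat>"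
  proof -
    show "0 < \<epsilon>" "\<epsilon> \<in> \<rat>" by (simp_all add: \<epsilon>_def)
    have "\<epsilon> < 1 / M" "\<epsilon> < c1 / (2 * \<nu> * V)" using N0 by (simp_all add: \<epsilon>_def)
    then show "\<epsilon> * M \<le> 1" "\<nu> * \<epsilon> * V \<le> c1 / 2" using M \<nu> V by (simp_all add: field_simps)
  qed
  define A where "A = {f \<in> D. (\<forall>v. v \<notin> U \<longrightarrow> f v = 0 \<and> (\<forall>h. partial_deriv h f v = 0)) \<and> (\<forall>h v. \<bar>partial_deriv h f v\<bar> \<le> 3)}"
  define \<Psi> where "\<Psi> f = J f - \<nu> * P f" for f
  have zero: "(\<lambda>_. 0) \<in> A" by (simp add: A_def D_0 partial_deriv_const)
  have \<Psi>_le: "\<Psi> f \<le> J f" if "f \<in> A" for f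
    using that P_nonneg[of f] \<nu> by (simp add: \<Psi>_def A_def)
  have improve: "\<exists>f'\<in>A. \<Psi> f + \<epsilon> * c1 / 2 \<le> \<Psi> f'" if fA: "f \<in> A" and Pf: "P f \<le> T / 2" for f
  proof -
    have f: "f \<in> D" and f_out: "\<And>v. v \<notin> U \<Longrightarrow> f v = 0" "\<And>v h. v \<notin> U \<Longrightarrow> partial_deriv h f v = 0"
      and f3: "\<And>h v. \<bar>partial_deriv h f v\<bar> \<le> 3"
      using fA by (auto simp: A_def)
    from gain[OF f Pf \<nu>(1) C B c_def \<kappa>_def L]
    obtain m where m: "c1 \<le> (\<Sum>p\<in>cells f m. \<bar>J (bump m p) / 2 ^ m - 2 * \<nu> * I (corr f m p)\<bar>)"
      unfolding c1_def by blast
    define G where "G = cells f m"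
    have G: "finite G" "\<And>p. p \<in> G \<Longrightarrow> cell m p \<subseteq> U" "\<And>p v h. p \<in> G \<Longrightarrow> v \<in> cell m p \<Longrightarrow> \<bar>partial_deriv h f v\<bar> \<le> 2"
      by (auto simp: G_def finite_cells) (auto simp: cells_def good_cells_def)
    define X where "X p = J (bump m p) / 2 ^ m - 2 * \<nu> * I (corr f m p)" for p
    \<comment> \<open>Each bump is added with the sign that turns its first-order effect on
      \<open>\<Psi>\<close> into an absolute value; signs are rational, so the family is not
      left.\<close>
    define s :: "'n cell \<Rightarrow> real" where "s p = sgn (X p)" for p
    have s: "\<bar>s p\<bar> \<le> 1" "s p \<in> \<rat>" for p by (auto simp: s_def sgn_if)
    define d where "d h v = (\<Sum>p\<in>G. s p * (partial_deriv h (bump m p) v / 2 ^ m))" for h v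
    define f' where "f' v = f v + (\<Sum>p\<in>G. (\<epsilon> * s p / 2 ^ m) * bump m p v)" for v
    have f'_D: "f' \<in> D" unfolding f'_def
      using \<epsilon>(4) s(2) by (intro D_add_sum f G) (auto intro!: Rats_mult Rats_divide Rats_power)
    have pd_f': "partial_deriv h f' v = partial_deriv h f v + \<epsilon> * d h v" for h v
      unfolding f'_def partial_deriv_add_bumps[OF f] d_def sum_distrib_left by (simp add: mult_ac)
    have d_bd: "\<bar>d h v\<bar> \<le> M" for h v
      unfolding d_def M_def
    proof (rule sum_cells_le[OF G(1), where v = v and m = m])
      fix p assume "p \<in> G"
      have "\<bar>partial_deriv h (bump m p) v / 2 ^ m\<bar> \<le> C" using C(2)[of h m p v] by (simp add: field_simps)
      then show "\<bar>s p * (partial_deriv h (bump m p) v / 2 ^ m)\<bar> \<le> C"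
        using mult_mono[OF s(1)[of p]] C(1) unfolding abs_mult by fastforce
    qed (use C in \<open>auto simp: partial_deriv_bump_eq_0\<close>)
    have f'_A: "f' \<in> A"
    proof -
      have "f' v = 0" "partial_deriv h f' v = 0" if "v \<notin> U" for v h
      proof -
        have "v \<notin> cell m p" if "p \<in> G" for p using G(2)[OF that] \<open>v \<notin> U\<close> by blast
        then show "f' v = 0" "partial_deriv h f' v = 0"
          unfolding pd_f' using f_out \<open>v \<notin> U\<close> by (auto simp: f'_def d_def bump_eq_0 partial_deriv_bump_eq_0)
      qed
      moreover have "\<bar>partial_deriv h f' v\<bar> \<le> 3" for h v
      proof (cases "\<exists>p\<in>G. v \<in> cell m p")
        case True
        then have "\<bar>partial_deriv h f v\<bar> \<le> 2" using G(3) by blast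
        moreover have "\<bar>\<epsilon> * d h v\<bar> \<le> \<epsilon> * M" using d_bd[of h v] \<epsilon>(1) by (simp add: abs_mult)
        ultimately show ?thesis unfolding pd_f' using \<epsilon>(2) by linarith
      next
        case False
        then have "d h v = 0" unfolding d_def by (intro sum.neutral) (auto simp: partial_deriv_bump_eq_0)
        then show ?thesis unfolding pd_f' using f3 by simp
      qed
      ultimately show ?thesis using f'_D by (simp add: A_def)
    qed
    have J': "J f' = J f + \<epsilon> * (\<Sum>p\<in>G. s p * (J (bump m p) / 2 ^ m))"
    proof (rule LIMSEQ_unique[OF J_tendsto[OF f'_D]])
      have "rsum f' x z \<alpha> T = (\<lambda>n. rsum f x z \<alpha> T n + \<epsilon> * (\<Sum>p\<in>G. s p * (rsum (bump m p) x z \<alpha> T n / 2 ^ m)))"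
        unfolding f'_def rsum_add rsum_sum rsum_cmult sum_distrib_left by (simp add: mult_ac)
      moreover have "(\<lambda>n. rsum f x z \<alpha> T n + \<epsilon> * (\<Sum>p\<in>G. s p * (rsum (bump m p) x z \<alpha> T n / 2 ^ m)))
         \<longlonglongrightarrow> J f + \<epsilon> * (\<Sum>p\<in>G. s p * (J (bump m p) / 2 ^ m))"
        by (intro tendsto_intros J_tendsto f bump_in_D) auto
      ultimately show "rsum f' x z \<alpha> T \<longlonglongrightarrow> J f + \<epsilon> * (\<Sum>p\<in>G. s p * (J (bump m p) / 2 ^ m))" by simp
    qed
    \<comment> \<open>Expanding the square gives a linear term, which is the sum of the
      \<open>corr\<close> contributions, and a quadratic term, which \<open>V\<close> bounds because
      only boundedly many cells overlap at a point.\<close>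
    have P': "P f' \<le> P f + 2 * \<epsilon> * (\<Sum>p\<in>G. s p * I (corr f m p)) + \<epsilon>\<^sup>2 * V"
    proof (rule LIMSEQ_le[OF P_tendsto[OF f'_D]])
      let ?R = "\<lambda>n. tsum (\<lambda>v. \<Sum>h\<in>UNIV. (partial_deriv h f v)\<^sup>2) x \<alpha> T n +
           2 * \<epsilon> * (\<Sum>p\<in>G. s p * tsum (corr f m p) x \<alpha> T n) + \<epsilon>\<^sup>2 * V"
      show "?R \<longlonglongrightarrow> P f + 2 * \<epsilon> * (\<Sum>p\<in>G. s p * I (corr f m p)) + \<epsilon>\<^sup>2 * V"
        by (intro tendsto_intros P_tendsto corr_tendsto f)
      have pt: "(\<Sum>h\<in>UNIV. (partial_deriv h f' v)\<^sup>2) \<le> (\<Sum>h\<in>UNIV. (partial_deriv h f v)\<^sup>2) +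
          (2 * \<epsilon> * (\<Sum>p\<in>G. s p * corr f m p v) + \<epsilon>\<^sup>2 * (real CARD('n) * M\<^sup>2))" for v
      proof -
        have "(\<Sum>h\<in>UNIV. partial_deriv h f v * d h v) = (\<Sum>p\<in>G. s p * corr f m p v)"
          unfolding d_def corr_def sum_distrib_left by (subst sum.swap) (simp add: mult_ac)
        moreover have "(\<Sum>h\<in>UNIV. (d h v)\<^sup>2) \<le> real CARD('n) * M\<^sup>2"
        proof -
          have "(d h v)\<^sup>2 \<le> M\<^sup>2" for h using d_bd[of h v] by (intro abs_le_square_iff[THEN iffD1]) simp
          then have "(\<Sum>h\<in>UNIV. (d h v)\<^sup>2) \<le> (\<Sum>h::'n\<in>UNIV. M\<^sup>2)" by (intro sum_mono)
          then show ?thesis by simp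
        qed
        moreover have "(\<Sum>h\<in>UNIV. (partial_deriv h f' v)\<^sup>2) = (\<Sum>h\<in>UNIV. (partial_deriv h f v)\<^sup>2) +
            2 * \<epsilon> * (\<Sum>h\<in>UNIV. partial_deriv h f v * d h v) + \<epsilon>\<^sup>2 * (\<Sum>h\<in>UNIV. (d h v)\<^sup>2)"
          unfolding pd_f' by (simp add: power2_sum sum.distrib sum_distrib_left power_mult_distrib mult_ac)
        ultimately show ?thesis using \<epsilon>(1) by (simp add: mult_left_mono)
      qed
      have "tsum (\<lambda>v. \<Sum>h\<in>UNIV. (partial_deriv h f' v)\<^sup>2) x \<alpha> T n \<le> ?R n" for n
      proof -
        have "tsum (\<lambda>v. \<Sum>h\<in>UNIV. (partial_deriv h f' v)\<^sup>2) x \<alpha> T n \<le>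
          tsum (\<lambda>v. (\<Sum>h\<in>UNIV. (partial_deriv h f v)\<^sup>2) +
            (2 * \<epsilon> * (\<Sum>p\<in>G. s p * corr f m p v) + \<epsilon>\<^sup>2 * (real CARD('n) * M\<^sup>2))) x \<alpha> T n"
          using T pt by (intro tsum_mono) auto
        also have "\<dots> = ?R n"
          unfolding tsum_add tsum_cmult tsum_sum tsum_const V_def by (simp add: mult_ac)
        finally show ?thesis .
      qed
      then show "\<exists>N. \<forall>n\<ge>N. tsum (\<lambda>v. \<Sum>h\<in>UNIV. (partial_deriv h f' v)\<^sup>2) x \<alpha> T n \<le> ?R n" by blast
    qed
    have sX: "s p * X p = \<bar>X p\<bar>" for p by (simp add: s_def sgn_if)
    have "c1 \<le> (\<Sum>p\<in>G. s p * X p)"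
      using m unfolding sX by (simp add: G_def X_def)
    also have "\<dots> = (\<Sum>p\<in>G. s p * (J (bump m p) / 2 ^ m)) - 2 * \<nu> * (\<Sum>p\<in>G. s p * I (corr f m p))"
      unfolding X_def by (simp add: algebra_simps sum_subtractf sum_distrib_left)
    finally have "\<epsilon> * c1 \<le> \<epsilon> * ((\<Sum>p\<in>G. s p * (J (bump m p) / 2 ^ m)) - 2 * \<nu> * (\<Sum>p\<in>G. s p * I (corr f m p)))"
      using \<epsilon>(1) by (intro mult_left_mono) auto
    moreover have "\<nu> * P f' \<le> \<nu> * (P f + 2 * \<epsilon> * (\<Sum>p\<in>G. s p * I (corr f m p)) + \<epsilon>\<^sup>2 * V)"
      using P' \<nu>(1) by (intro mult_left_mono) auto
    moreover have "\<epsilon> * (\<nu> * \<epsilon> * V) \<le> \<epsilon> * (c1 / 2)" using \<epsilon> by (intro mult_left_mono) auto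
    ultimately have "\<Psi> f + \<epsilon> * c1 / 2 \<le> \<Psi> f'"
      unfolding \<Psi>_def J' by (simp add: algebra_simps power2_eq_square)
    then show ?thesis using f'_A by blast
  qed
  show ?thesis
  proof (cases "bdd_above (\<Psi> ` A)")
    case False
    then obtain f where f: "f \<in> A" "K < \<Psi> f" by (auto simp: bdd_above_def not_le) 
    then show ?thesis using \<Psi>_le[OF f(1)] unfolding A_def by (intro bexI[of _ f]) auto
  next
    case True
    \<comment> \<open>At most the gain of one improvement, so that improving would exceed the
      supremum, and at most 1, so that \<Psi> f is at least -1.\<close>
    define \<eta> where "\<eta> = min 1 (\<epsilon> * c1 / 2)"
    have \<eta>: "0 < \<eta>" using \<epsilon> c1 by (simp add: \<eta>_def)
    define S where "S = Sup (\<Psi> ` A)"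
    have S: "\<Psi> f \<le> S" if "f \<in> A" for f unfolding S_def using that True by (intro cSup_upper) auto
    have "J (\<lambda>_. 0) = 0"
      by (rule LIMSEQ_unique[OF J_tendsto[OF D_0]]) (simp add: rsum_def[abs_def])
    moreover have "P (\<lambda>_. 0) = 0" by (simp add: P_def I_def partial_deriv_const)
    ultimately have S0: "0 \<le> S" using S[OF zero] by (simp add: \<Psi>_def)
    have "\<exists>y\<in>\<Psi> ` A. S - \<eta> < y"
      using zero \<eta> True unfolding S_def by (subst less_cSup_iff[symmetric]) auto
    then obtain f where f: "f \<in> A" "S - \<eta> < \<Psi> f" by blast
    have "T / 2 < P f"
    proof (rule ccontr)
      assume "\<not> T / 2 < P f"
      then obtain f' where "f' \<in> A" "\<Psi> f + \<epsilon> * c1 / 2 \<le> \<Psi> f'" using improve[OF f(1)] by force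
      then show False using S[of f'] f(2) by (simp add: \<eta>_def min_def split: if_splits)
    qed
    then have "\<nu> * (T / 2) \<le> \<nu> * P f" using \<nu>(1) by (intro mult_left_mono) auto
    then have "K' + 1 \<le> \<nu> * P f" using \<nu>(2) by simp
    moreover have "- 1 \<le> \<Psi> f" using f(2) S0 by (simp add: \<eta>_def min_def split: if_splits)
    ultimately have "K \<le> J f" by (simp add: \<Psi>_def K'_def)
    then show ?thesis using f(1) unfolding A_def by (intro bexI[of _ f]) auto
  qed
qed

end

section \<open>Gaussian sums and conditioning\<close>

context prob_space
begin

lemma normal_moments:
  assumes "distributed M lborel X (normal_density 0 \<sigma>)" "0 < \<sigma>"
  shows "integrable M (\<lambda>\<omega>. X \<omega> ^ k)" "expectation X = 0"
    "expectation (\<lambda>\<omega>. (X \<omega>)\<^sup>2) = \<sigma>\<^sup>2" "expectation (\<lambda>\<omega>. X \<omega> ^ 4) = 3 * \<sigma> ^ 4"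
proof -
  note D = distributed_integral[OF assms(1)] distributed_integrable[OF assms(1)]
  show "integrable M (\<lambda>\<omega>. X \<omega> ^ k)"
    using integrable_normal_moment[OF assms(2), of 0 k] D(2)[of "\<lambda>x. x ^ k"] by simp
  show "expectation X = 0"
    using integral_normal_moment_nz_1[OF assms(2), of 0] D(1)[of "\<lambda>x. x"] by simp
  show "expectation (\<lambda>\<omega>. (X \<omega>)\<^sup>2) = \<sigma>\<^sup>2"
    using integral_normal_moment_even[OF assms(2), of 0 1] D(1)[of "\<lambda>x. x ^ 2"] assms(2) by simp
  have "fact 4 / ((2 / \<sigma>\<^sup>2)\<^sup>2 * fact 2) = 3 * \<sigma> ^ 4"
    using assms(2) by (simp add: fact_numeral power_divide field_simps flip: power_mult)
  then show "expectation (\<lambda>\<omega>. X \<omega> ^ 4) = 3 * \<sigma> ^ 4"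
    using integral_normal_moment_even[OF assms(2), of 0 2] D(1)[of "\<lambda>x. x ^ 4"] by simp
qed

lemma gaussian_sum_moments:
  fixes \<Delta> :: "'k \<Rightarrow> 'a \<Rightarrow> real"
  assumes ind: "indep_vars (\<lambda>_. borel) \<Delta> K" and fin: "finite K" and \<sigma>: "0 < \<sigma>"
    and nd: "\<And>k. k \<in> K \<Longrightarrow> distributed M lborel (\<Delta> k) (normal_density 0 \<sigma>)"
  defines "S \<equiv> \<lambda>a \<omega>. \<Sum>k\<in>K. a k * \<Delta> k \<omega>" and "v \<equiv> \<lambda>a. \<sigma>\<^sup>2 * (\<Sum>k\<in>K. (a k)\<^sup>2)"
  shows "integrable M (\<lambda>\<omega>. S a \<omega> ^ j)" "expectation (S a) = 0"
    "expectation (\<lambda>\<omega>. (S a \<omega>)\<^sup>2) = v a" "expectation (\<lambda>\<omega>. S a \<omega> ^ 4) = 3 * (v a)\<^sup>2"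
proof -
  \<comment> \<open>Terms with coefficient 0 are removed because a normal density requires a
    positive standard deviation. If none remain, the sum is 0 and the claims are checked
    directly.\<close>
  define K' where "K' = {k \<in> K. a k \<noteq> 0}"
  have K': "K' \<subseteq> K" "finite K'" using fin by (auto simp: K'_def)
  have S: "S a = (\<lambda>\<omega>. \<Sum>k\<in>K'. a k * \<Delta> k \<omega>)" and v: "v a = (\<Sum>k\<in>K'. (\<bar>a k\<bar> * \<sigma>)\<^sup>2)"
    unfolding S_def v_def K'_def sum_distrib_left using fin
    by (auto simp: fun_eq_iff power_mult_distrib mult.commute intro!: sum.mono_neutral_right)
  have "integrable M (\<lambda>\<omega>. S a \<omega> ^ j) \<and> expectation (S a) = 0 \<and>
    expectation (\<lambda>\<omega>. (S a \<omega>)\<^sup>2) = v a \<and> expectation (\<lambda>\<omega>. S a \<omega> ^ 4) = 3 * (v a)\<^sup>2"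
  proof (cases "K' = {}")
    case True
    then show ?thesis by (cases "j = 0") (auto simp: S v power_0_left)
  next
    case False
    have ind': "indep_vars (\<lambda>_. borel) (\<lambda>k \<omega>. a k * \<Delta> k \<omega>) K'"
      by (rule indep_vars_compose2[OF indep_vars_subset[OF ind K'(1)]]) auto
    have "distributed M lborel (\<lambda>\<omega>. 0 + a k * \<Delta> k \<omega>) (normal_density (0 + a k * 0) (\<bar>a k\<bar> * \<sigma>))"
      if "k \<in> K'" for k
      using that K'(1) by (intro normal_density_affine nd \<sigma>) (auto simp: K'_def)
    then have "distributed M lborel (\<lambda>\<omega>. a k * \<Delta> k \<omega>) (normal_density 0 (\<bar>a k\<bar> * \<sigma>))" if "k \<in> K'" for k
      using that by simp
    from sum_indep_normal[OF K'(2) False ind' _ this]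
    have D: "distributed M lborel (S a) (normal_density 0 (sqrt (v a)))"
      using \<sigma> unfolding S v by (simp add: K'_def)
    have "0 < v a" unfolding v using K' False \<sigma> by (intro sum_pos) (auto simp: K'_def)
    then have "0 < sqrt (v a)" "(sqrt (v a))\<^sup>2 = v a" "sqrt (v a) ^ 4 = (v a)\<^sup>2"
      by (auto simp: power4_eq_xxxx power2_eq_square)
    with normal_moments[OF D] show ?thesis by simp
  qed
  then show "integrable M (\<lambda>\<omega>. S a \<omega> ^ j)" "expectation (S a) = 0"
    "expectation (\<lambda>\<omega>. (S a \<omega>)\<^sup>2) = v a" "expectation (\<lambda>\<omega>. S a \<omega> ^ 4) = 3 * (v a)\<^sup>2"
    by auto
qed

lemma expectation_square_sum:
  fixes \<zeta> :: "'q \<Rightarrow> 'a \<Rightarrow> real"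
  assumes "finite Q" and int: "\<And>p q. p \<in> Q \<Longrightarrow> q \<in> Q \<Longrightarrow> integrable M (\<lambda>\<omega>. \<zeta> p \<omega> * \<zeta> q \<omega>)"
    and orth: "\<And>p q. p \<in> Q \<Longrightarrow> q \<in> Q \<Longrightarrow> p \<noteq> q \<Longrightarrow> expectation (\<lambda>\<omega>. \<zeta> p \<omega> * \<zeta> q \<omega>) = 0"
  shows "integrable M (\<lambda>\<omega>. (\<Sum>q\<in>Q. \<zeta> q \<omega>)\<^sup>2)"
    "expectation (\<lambda>\<omega>. (\<Sum>q\<in>Q. \<zeta> q \<omega>)\<^sup>2) = (\<Sum>q\<in>Q. expectation (\<lambda>\<omega>. (\<zeta> q \<omega>)\<^sup>2))"
proof -
  have eq: "(\<Sum>q\<in>Q. \<zeta> q \<omega>)\<^sup>2 = (\<Sum>p\<in>Q. \<Sum>q\<in>Q. \<zeta> p \<omega> * \<zeta> q \<omega>)" for \<omega>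
    by (simp add: power2_eq_square sum_product)
  show "integrable M (\<lambda>\<omega>. (\<Sum>q\<in>Q. \<zeta> q \<omega>)\<^sup>2)"
    unfolding eq by (intro Bochner_Integration.integrable_sum int)
  have "expectation (\<lambda>\<omega>. (\<Sum>q\<in>Q. \<zeta> q \<omega>)\<^sup>2) = (\<Sum>p\<in>Q. \<Sum>q\<in>Q. expectation (\<lambda>\<omega>. \<zeta> p \<omega> * \<zeta> q \<omega>))"
    unfolding eq by (subst Bochner_Integration.integral_sum; (intro Bochner_Integration.integrable_sum int sum.cong refl
        Bochner_Integration.integral_sum | assumption)+)
  also have "\<dots> = (\<Sum>p\<in>Q. \<Sum>q\<in>Q. if q = p then expectation (\<lambda>\<omega>. (\<zeta> p \<omega>)\<^sup>2) else 0)"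
    using orth by (intro sum.cong refl) (auto simp: power2_eq_square)
  also have "\<dots> = (\<Sum>q\<in>Q. expectation (\<lambda>\<omega>. (\<zeta> q \<omega>)\<^sup>2))"
    using assms(1) by simp
  finally show "expectation (\<lambda>\<omega>. (\<Sum>q\<in>Q. \<zeta> q \<omega>)\<^sup>2) = (\<Sum>q\<in>Q. expectation (\<lambda>\<omega>. (\<zeta> q \<omega>)\<^sup>2))" .
qed

lemma indep_varsD_pair:
  assumes "indep_vars (\<lambda>_. N) X Q" "p \<in> Q" "q \<in> Q" "p \<noteq> q"
  shows "indep_var N (X p) N (X q)"
proof -
  have "indep_var (Pi\<^sub>M {p} (\<lambda>_. N)) (\<lambda>\<omega>. \<lambda>i\<in>{p}. X i \<omega>) (Pi\<^sub>M {q} (\<lambda>_. N)) (\<lambda>\<omega>. \<lambda>i\<in>{q}. X i \<omega>)"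
    using assms by (intro indep_var_restrict[OF assms(1)]) auto
  then have "indep_var N ((\<lambda>f. f p) \<circ> (\<lambda>\<omega>. \<lambda>i\<in>{p}. X i \<omega>)) N ((\<lambda>f. f q) \<circ> (\<lambda>\<omega>. \<lambda>i\<in>{q}. X i \<omega>))"
    by (rule indep_var_compose) auto
  then show ?thesis by (simp add: comp_def)
qed

text \<open>Each increment enters at most one of the sums, so the centred squares are independent.
  The variance of the square of a centred Gaussian of variance v is 3 v^2 - v^2 = 2 v^2.\<close>

lemma gaussian_square_sum_variance:
  fixes \<Delta> :: "'k \<Rightarrow> 'a \<Rightarrow> real" and a :: "'q \<Rightarrow> 'k \<Rightarrow> real"
  assumes ind: "indep_vars (\<lambda>_. borel) \<Delta> K" and fin: "finite K" "finite Q" and \<sigma>: "0 < \<sigma>"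
    and nd: "\<And>k. k \<in> K \<Longrightarrow> distributed M lborel (\<Delta> k) (normal_density 0 \<sigma>)"
    and disj: "\<And>p q k. p \<in> Q \<Longrightarrow> q \<in> Q \<Longrightarrow> p \<noteq> q \<Longrightarrow> k \<in> K \<Longrightarrow> a p k = 0 \<or> a q k = 0"
  defines "v \<equiv> \<lambda>q. \<sigma>\<^sup>2 * (\<Sum>k\<in>K. (a q k)\<^sup>2)"
  shows "integrable M (\<lambda>\<omega>. (\<Sum>q\<in>Q. (\<Sum>k\<in>K. a q k * \<Delta> k \<omega>)\<^sup>2 - v q)\<^sup>2)"
    "expectation (\<lambda>\<omega>. (\<Sum>q\<in>Q. (\<Sum>k\<in>K. a q k * \<Delta> k \<omega>)\<^sup>2 - v q)\<^sup>2) = 2 * (\<Sum>q\<in>Q. (v q)\<^sup>2)"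
proof -
  note gm = gaussian_sum_moments[OF ind fin(1) \<sigma> nd]
  define \<zeta> where "\<zeta> q \<omega> = (\<Sum>k\<in>K. a q k * \<Delta> k \<omega>)\<^sup>2 - v q" for q \<omega>
  define Kq where "Kq q = {k \<in> K. a q k \<noteq> 0}" for q
  have sub: "\<And>q. q \<in> Q \<Longrightarrow> Kq q \<subseteq> K" and dK: "disjoint_family_on Kq Q"
    using disj by (auto simp: Kq_def disjoint_family_on_def)
  from indep_vars_restrict[OF ind sub dK]
  have "indep_vars (\<lambda>_. borel) (\<lambda>q \<omega>. (\<lambda>f. (\<Sum>k\<in>Kq q. a q k * f k)\<^sup>2 - v q) (\<lambda>i\<in>Kq q. \<Delta> i \<omega>)) Q"
    by (rule indep_vars_compose2) measurable
  also have "(\<lambda>q \<omega>. (\<lambda>f. (\<Sum>k\<in>Kq q. a q k * f k)\<^sup>2 - v q) (\<lambda>i\<in>Kq q. \<Delta> i \<omega>)) = \<zeta>"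
  proof (intro ext)
    fix q \<omega>
    have "(\<Sum>k\<in>Kq q. a q k * (\<lambda>i\<in>Kq q. \<Delta> i \<omega>) k) = (\<Sum>k\<in>K. a q k * \<Delta> k \<omega>)"
      using fin by (intro sum.mono_neutral_cong_left) (auto simp: Kq_def)
    then show "(\<Sum>k\<in>Kq q. a q k * (\<lambda>i\<in>Kq q. \<Delta> i \<omega>) k)\<^sup>2 - v q = \<zeta> q \<omega>" by (simp add: \<zeta>_def)
  qed
  finally have ind\<zeta>: "indep_vars (\<lambda>_. borel) \<zeta> Q" .
  have i2: "integrable M (\<lambda>\<omega>. (\<Sum>k\<in>K. a q k * \<Delta> k \<omega>)\<^sup>2)"
    and i4: "integrable M (\<lambda>\<omega>. (\<Sum>k\<in>K. a q k * \<Delta> k \<omega>) ^ 4)" for q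
    using gm(1) by blast+
  have int1: "integrable M (\<zeta> q)" for q unfolding \<zeta>_def[abs_def] by (intro Bochner_Integration.integrable_diff i2) simp
  have sq: "(\<zeta> q \<omega>)\<^sup>2 = (\<Sum>k\<in>K. a q k * \<Delta> k \<omega>) ^ 4 - 2 * v q * (\<Sum>k\<in>K. a q k * \<Delta> k \<omega>)\<^sup>2 + (v q)\<^sup>2" for q \<omega>
    by (simp add: \<zeta>_def power2_diff algebra_simps flip: power_mult)
  have int2: "integrable M (\<lambda>\<omega>. (\<zeta> q \<omega>)\<^sup>2)" for q
    unfolding sq by (intro Bochner_Integration.integrable_add Bochner_Integration.integrable_diff integrable_mult_right i2 i4) simp
  have E0: "expectation (\<zeta> q) = 0" for q
    unfolding \<zeta>_def[abs_def] using gm(3)[of "a q"] by (subst Bochner_Integration.integral_diff[OF i2]) (auto simp: v_def prob_space)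
  have E2: "expectation (\<lambda>\<omega>. (\<zeta> q \<omega>)\<^sup>2) = 2 * (v q)\<^sup>2" for q
  proof -
    have "expectation (\<lambda>\<omega>. (\<zeta> q \<omega>)\<^sup>2) = expectation (\<lambda>\<omega>. (\<Sum>k\<in>K. a q k * \<Delta> k \<omega>) ^ 4) -
        2 * v q * expectation (\<lambda>\<omega>. (\<Sum>k\<in>K. a q k * \<Delta> k \<omega>)\<^sup>2) + (v q)\<^sup>2"
      unfolding sq using i2[of q] i4[of q] by (simp add: prob_space)
    also have "\<dots> = 2 * (v q)\<^sup>2"
      using gm(3,4)[of "a q"] by (simp add: v_def power2_eq_square)
    finally show ?thesis .
  qed
  have prod: "integrable M (\<lambda>\<omega>. \<zeta> p \<omega> * \<zeta> q \<omega>)" "p \<noteq> q \<Longrightarrow> expectation (\<lambda>\<omega>. \<zeta> p \<omega> * \<zeta> q \<omega>) = 0"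
    if pq: "p \<in> Q" "q \<in> Q" for p q
  proof -
    show "integrable M (\<lambda>\<omega>. \<zeta> p \<omega> * \<zeta> q \<omega>)"
      using int2[of p] indep_var_integrable[OF indep_varsD_pair[OF ind\<zeta> pq] int1 int1]
      by (cases "p = q") (auto simp: power2_eq_square)
    show "p \<noteq> q \<Longrightarrow> expectation (\<lambda>\<omega>. \<zeta> p \<omega> * \<zeta> q \<omega>) = 0"
      using indep_var_lebesgue_integral[OF indep_varsD_pair[OF ind\<zeta> pq] int1 int1] E0 by simp
  qed
  from expectation_square_sum[OF fin(2) prod]
  show "integrable M (\<lambda>\<omega>. (\<Sum>q\<in>Q. (\<Sum>k\<in>K. a q k * \<Delta> k \<omega>)\<^sup>2 - v q)\<^sup>2)"
    "expectation (\<lambda>\<omega>. (\<Sum>q\<in>Q. (\<Sum>k\<in>K. a q k * \<Delta> k \<omega>)\<^sup>2 - v q)\<^sup>2) = 2 * (\<Sum>q\<in>Q. (v q)\<^sup>2)"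
    unfolding E2 by (simp_all add: \<zeta>_def sum_distrib_left)
qed

text \<open>Conditioning on X becomes Tonelli's theorem for the product law. Working with
  nonnegative integrals and inequalities avoids conditional expectations.\<close>

lemma nn_integral_indep_le:
  assumes ind: "indep_var S X N Y" and F: "F \<in> borel_measurable (S \<Otimes>\<^sub>M N)"
    and G: "G \<in> borel_measurable S"
    and le: "\<And>x. x \<in> space S \<Longrightarrow> (\<integral>\<^sup>+\<omega>. F (x, Y \<omega>) \<partial>M) \<le> G x"
  shows "(\<integral>\<^sup>+\<omega>. F (X \<omega>, Y \<omega>) \<partial>M) \<le> (\<integral>\<^sup>+\<omega>. G (X \<omega>) \<partial>M)"
proof -
  have X[measurable]: "X \<in> measurable M S" and Y[measurable]: "Y \<in> measurable M N"
    and eq: "distr M S X \<Otimes>\<^sub>M distr M N Y = distr M (S \<Otimes>\<^sub>M N) (\<lambda>x. (X x, Y x))"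
    using ind by (auto simp: indep_var_distribution_eq)
  interpret DY: prob_space "distr M N Y" by (rule prob_space_distr) simp
  have F': "F \<in> borel_measurable (distr M S X \<Otimes>\<^sub>M distr M N Y)" using F by simp
  have "(\<integral>\<^sup>+\<omega>. F (X \<omega>, Y \<omega>) \<partial>M) = (\<integral>\<^sup>+p. F p \<partial>(distr M S X \<Otimes>\<^sub>M distr M N Y))"
    unfolding eq using F by (subst nn_integral_distr) auto
  also have "\<dots> = (\<integral>\<^sup>+x. (\<integral>\<^sup>+y. F (x, y) \<partial>distr M N Y) \<partial>distr M S X)"
    by (rule DY.nn_integral_fst[OF F', symmetric])
  also have "\<dots> \<le> (\<integral>\<^sup>+x. G x \<partial>distr M S X)"
  proof (rule nn_integral_mono)
    fix x assume "x \<in> space (distr M S X)"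
    then have x: "x \<in> space S" by simp
    then have "(\<integral>\<^sup>+y. F (x, y) \<partial>distr M N Y) = (\<integral>\<^sup>+\<omega>. F (x, Y \<omega>) \<partial>M)"
      using F by (intro nn_integral_distr) auto
    then show "(\<integral>\<^sup>+y. F (x, y) \<partial>distr M N Y) \<le> G x" using le[OF x] by simp
  qed
  also have "\<dots> = (\<integral>\<^sup>+\<omega>. G (X \<omega>) \<partial>M)" using G by (intro nn_integral_distr) auto
  finally show ?thesis .
qed

text \<open>The definition of Brownian motion states separately that increments over successive
  intervals are independent vectors and that the components of one increment are independent.
  Probabilities of product sets factor over the intervals and then over the components, which gives
  joint independence.\<close>

lemma indep_vars_components:
  fixes V :: "'k \<Rightarrow> 'a \<Rightarrow> real ^ 'd"
  assumes ind: "indep_vars (\<lambda>_. borel) V K" and K: "finite K" "K \<noteq> {}"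
    and comp: "\<And>k. k \<in> K \<Longrightarrow> indep_vars (\<lambda>_. borel) (\<lambda>c \<omega>. V k \<omega> $ c) UNIV"
  shows "indep_vars (\<lambda>_. borel) (\<lambda>i \<omega>. V (fst i) \<omega> $ snd i) (K \<times> UNIV)"
proof -
  have V[measurable]: "\<And>k. k \<in> K \<Longrightarrow> V k \<in> borel_measurable M"
    using ind by (auto simp: indep_vars_def2)
  have "prob (\<Inter>i\<in>K \<times> UNIV. (\<lambda>\<omega>. V (fst i) \<omega> $ snd i) -` A i \<inter> space M) =
     (\<Prod>i\<in>K \<times> UNIV. prob ((\<lambda>\<omega>. V (fst i) \<omega> $ snd i) -` A i \<inter> space M))"
    if A: "A \<in> Pi (K \<times> UNIV) (\<lambda>_. sets borel)" for A :: "'k \<times> 'd \<Rightarrow> real set"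
  proof -
    define B where "B k = {v :: real ^ 'd. \<forall>c. v $ c \<in> A (k, c)}" for k
    have B: "B k \<in> sets borel" if "k \<in> K" for k
    proof -
      have "B k = (\<Inter>c\<in>UNIV. (\<lambda>v. v $ c) -` A (k, c) \<inter> space borel)" by (auto simp: B_def)
      also have "\<dots> \<in> sets borel"
        using A that by (intro sets.finite_INT measurable_sets[of _ borel borel]) auto
      finally show ?thesis .
    qed
    have "(\<Inter>i\<in>K \<times> UNIV. (\<lambda>\<omega>. V (fst i) \<omega> $ snd i) -` A i \<inter> space M) = (\<Inter>k\<in>K. V k -` B k \<inter> space M)"
      using K by (auto simp: B_def)
    also have "prob \<dots> = (\<Prod>k\<in>K. prob (V k -` B k \<inter> space M))"
      using B by (intro indep_varsD_finite[OF ind K(2,1)]) auto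
    also have "\<dots> = (\<Prod>k\<in>K. \<Prod>c\<in>UNIV. prob ((\<lambda>\<omega>. V k \<omega> $ c) -` A (k, c) \<inter> space M))"
    proof (intro prod.cong refl)
      fix k assume k: "k \<in> K"
      have "V k -` B k \<inter> space M = (\<Inter>c\<in>UNIV. (\<lambda>\<omega>. V k \<omega> $ c) -` A (k, c) \<inter> space M)"
        by (auto simp: B_def)
      also have "prob \<dots> = (\<Prod>c\<in>UNIV. prob ((\<lambda>\<omega>. V k \<omega> $ c) -` A (k, c) \<inter> space M))"
        using A k by (intro indep_varsD_finite[OF comp[OF k]]) auto
      finally show "prob (V k -` B k \<inter> space M) = (\<Prod>c\<in>UNIV. prob ((\<lambda>\<omega>. V k \<omega> $ c) -` A (k, c) \<inter> space M))" .
    qed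
    also have "\<dots> = (\<Prod>i\<in>K \<times> UNIV. prob ((\<lambda>\<omega>. V (fst i) \<omega> $ snd i) -` A i \<inter> space M))"
      by (subst prod.cartesian_product) (auto simp: split_beta)
    finally show ?thesis .
  qed
  moreover have "(\<lambda>\<omega>. V k \<omega> $ c) \<in> borel_measurable M" if "k \<in> K" for k c
    using comp[OF that] by (auto simp: indep_vars_def2)
  ultimately show ?thesis
    using K sets.space_closed[of borel] sets.sigma_sets_eq[of borel]
    by (subst indep_vars_finite[where E = "\<lambda>_. sets borel"]) (auto simp: sets.Int_stable)
qed

end

text \<open>Fatou's lemma bounds the expectation of the lower limit in n by C q^m. These bounds are
  summable, so the lower limits tend to 0 almost surely as m grows. A lower limit only speaks about
  infinitely many n, hence the form of the conclusion.\<close>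

lemma AE_liminf_tendsto_0:
  fixes Z :: "nat \<Rightarrow> nat \<Rightarrow> 'a \<Rightarrow> ennreal"
  assumes meas: "\<And>m n. Z m n \<in> borel_measurable M"
    and le: "\<And>m n. (\<integral>\<^sup>+\<omega>. Z m n \<omega> \<partial>M) \<le> ennreal (b m n)"
    and lim: "\<And>m. (\<lambda>n. b m n) \<longlonglongrightarrow> C * q ^ m" and q: "0 \<le> q" "q < 1" and C: "0 \<le> C"
  shows "AE \<omega> in M. \<forall>e>0. \<forall>\<^sub>F m in sequentially. \<exists>\<^sub>F n in sequentially. Z m n \<omega> \<le> ennreal e"
proof -
  define L where "L m \<omega> = liminf (\<lambda>n. Z m n \<omega>)" for m \<omega>
  have L[measurable]: "L m \<in> borel_measurable M" for m
    unfolding L_def[abs_def] using meas by (rule borel_measurable_liminf)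
  have "(\<integral>\<^sup>+\<omega>. L m \<omega> \<partial>M) \<le> ennreal (C * q ^ m)" for m
  proof -
    have "(\<integral>\<^sup>+\<omega>. L m \<omega> \<partial>M) \<le> liminf (\<lambda>n. \<integral>\<^sup>+\<omega>. Z m n \<omega> \<partial>M)"
      unfolding L_def using meas by (rule nn_integral_liminf)
    also have "\<dots> \<le> liminf (\<lambda>n. ennreal (b m n))" by (intro Liminf_mono always_eventually allI le)
    also have "\<dots> = ennreal (C * q ^ m)"
      using lim by (intro lim_imp_Liminf tendsto_ennrealI) auto
    finally show ?thesis .
  qed
  then have "(\<integral>\<^sup>+\<omega>. (\<Sum>m. L m \<omega>) \<partial>M) \<le> (\<Sum>m. ennreal (C * q ^ m))"
    by (subst nn_integral_suminf) (auto intro!: suminf_le)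
  also have "\<dots> = ennreal (\<Sum>m. C * q ^ m)"
    using q C by (intro suminf_ennreal2) (auto intro!: summable_mult summable_geometric)
  also have "\<dots> < \<infinity>" by simp
  finally have "AE \<omega> in M. (\<Sum>m. L m \<omega>) \<noteq> \<infinity>"
    by (intro nn_integral_noteq_infinite) auto
  then show ?thesis
  proof eventually_elim
    case (elim \<omega>)
    show ?case
    proof (intro allI impI)
      fix e :: real assume e: "0 < e"
      define f where "f m = enn2real (L m \<omega>)" for m
      have f: "ennreal (f m) = L m \<omega>" for m
        unfolding f_def using elim ennreal_suminf_lessD[of "\<lambda>m. L m \<omega>" top m]
        by (intro ennreal_enn2real) (simp add: less_top)
      have nonneg: "0 \<le> f m" for m by (simp add: f_def)
      have "summable f"
        using elim nonneg by (intro summable_suminf_not_top) (simp_all add: f)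
      then have "(\<lambda>m. ennreal (f m)) \<longlonglongrightarrow> ennreal 0"
        by (intro tendsto_ennrealI summable_LIMSEQ_zero)
      then have "(\<lambda>m. L m \<omega>) \<longlonglongrightarrow> 0" by (simp add: f)
      then have "\<forall>\<^sub>F m in sequentially. L m \<omega> < ennreal e" using e by (intro order_tendstoD) auto
      then show "\<forall>\<^sub>F m in sequentially. \<exists>\<^sub>F n in sequentially. Z m n \<omega> \<le> ennreal e"
      proof eventually_elim
        case (elim m)
        show ?case
        proof (rule ccontr)
          assume "\<not> (\<exists>\<^sub>F n in sequentially. Z m n \<omega> \<le> ennreal e)"
          then have "\<forall>\<^sub>F n in sequentially. ennreal e \<le> Z m n \<omega>"
            by (auto simp: not_frequently not_le elim!: eventually_mono)
          then have "ennreal e \<le> L m \<omega>" unfolding L_def by (rule Liminf_bounded)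
          then show False using elim by simp
        qed
      qed
    qed
  qed
qed

section \<open>Brownian motion\<close>

text \<open>Coordinatewise closeness, so that by independence of the components its probability for
  two positions of the path factors.\<close>

definition close :: "real \<Rightarrow> real ^ 'n \<Rightarrow> real ^ 'n \<Rightarrow> bool" where
  "close r v w \<longleftrightarrow> (\<forall>c. \<bar>v $ c - w $ c\<bar> \<le> r)"

lemma close_sym: "close r v w \<longleftrightarrow> close r w v"
  by (simp add: close_def abs_minus_commute)

lemma cell_close: "v \<in> cell m p \<Longrightarrow> w \<in> cell m p \<Longrightarrow> close (1 / 2 ^ m) v w"
  by (simp add: close_def cell_dist)

text \<open>A bound for the probability that X moves by at most r in every coordinate during time d.
  Of the decay (r / sqrt d)^7 only the fourth power is kept: it is summable over multiples of a time
  step, with total of order r^2, and the formula stays finite at d = 0, where it equals 4.\<close>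

definition close_bound :: "real \<Rightarrow> real \<Rightarrow> real" where
  "close_bound r d = 4 / (1 + d / r\<^sup>2)\<^sup>2"

lemma close_bound_nonneg: "0 \<le> close_bound r d"
  by (simp add: close_bound_def)

lemma close_bound_0: "close_bound r 0 = 4"
  by (simp add: close_bound_def)

text \<open>The sum of 1/(1 + d j)^2 is compared with a telescoping sum of differences of 1/(1 + d
  j). The result says that the expected time spent within distance r of a visited position is of
  order r^2, up to the time step.\<close>

lemma sum_close_bound_le:
  assumes r: "0 < r" and \<tau>: "0 < \<tau>"
  shows "(\<Sum>j<N. \<tau> * close_bound r (\<tau> * real j)) \<le> 4 * (\<tau> + r\<^sup>2)"
proof (cases N)
  case (Suc N')
  define d where "d = \<tau> / r\<^sup>2"
  have d: "0 < d" using r \<tau> by (simp add: d_def)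
  have pos: "0 < 1 + d * real j" for j using d by (simp add: add_pos_nonneg)
  have cb: "close_bound r (\<tau> * real j) = 4 / (1 + d * real j)\<^sup>2" for j
    by (simp add: close_bound_def d_def)
  have step: "1 / (1 + d * real (Suc j))\<^sup>2 \<le> (1 / (1 + d * real j) - 1 / (1 + d * real (Suc j))) / d" for j
  proof -
    have "(1 / (1 + d * real j) - 1 / (1 + d * real (Suc j))) / d = 1 / ((1 + d * real j) * (1 + d * real (Suc j)))"
    proof -
      have "(1 / A - 1 / (A + d)) / d = 1 / (A * (A + d))" if "0 < A" for A
        using that d by (simp add: divide_simps)
      from this[OF pos[of j]] show ?thesis by (simp add: algebra_simps)
    qed
    moreover have "(1 + d * real j) * (1 + d * real (Suc j)) \<le> (1 + d * real (Suc j))\<^sup>2"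
      unfolding power2_eq_square using d pos[of "Suc j"] by (intro mult_right_mono) auto
    ultimately show ?thesis
      using pos[of j] pos[of "Suc j"] by (simp add: frac_le)
  qed
  have "(\<Sum>j<N. 1 / (1 + d * real j)\<^sup>2) = 1 + (\<Sum>j<N'. 1 / (1 + d * real (Suc j))\<^sup>2)"
    unfolding Suc by (subst sum.lessThan_Suc_shift) simp
  also have "(\<Sum>j<N'. 1 / (1 + d * real (Suc j))\<^sup>2) \<le> (\<Sum>j<N'. (1 / (1 + d * real j) - 1 / (1 + d * real (Suc j))) / d)"
    by (intro sum_mono step)
  also have "\<dots> = (1 - 1 / (1 + d * real N')) / d"
    unfolding sum_divide_distrib[symmetric] by (subst sum_lessThan_telescope') simp
  also have "\<dots> \<le> 1 / d" using d pos[of N'] by (intro divide_right_mono) auto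
  finally have "(\<Sum>j<N. 1 / (1 + d * real j)\<^sup>2) \<le> 1 + 1 / d" by simp
  then have "4 * \<tau> * (\<Sum>j<N. 1 / (1 + d * real j)\<^sup>2) \<le> 4 * \<tau> * (1 + 1 / d)"
    using \<tau> by (intro mult_left_mono) auto
  also have "\<dots> = 4 * (\<tau> + r\<^sup>2)" using r \<tau> by (simp add: d_def field_simps)
  finally show ?thesis unfolding cb by (simp add: sum_distrib_left mult_ac)
qed (use r \<tau> in auto)

lemma sum_close_bound_abs_le:
  assumes r: "0 < r" and \<tau>: "0 < \<tau>" and k: "k < N"
  shows "(\<Sum>l<N. \<tau> * close_bound r (\<tau> * \<bar>real k - real l\<bar>)) \<le> 8 * (\<tau> + r\<^sup>2)"
proof -
  let ?g = "\<lambda>j. \<tau> * close_bound r (\<tau> * real j)"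
  have g0: "0 \<le> ?g j" for j using \<tau> by (simp add: close_bound_nonneg)
  have "(\<Sum>l<N. \<tau> * close_bound r (\<tau> * \<bar>real k - real l\<bar>)) =
      (\<Sum>l\<in>{..k}. \<tau> * close_bound r (\<tau> * \<bar>real k - real l\<bar>)) + (\<Sum>l\<in>{k<..<N}. \<tau> * close_bound r (\<tau> * \<bar>real k - real l\<bar>))"
    using k by (subst sum.union_disjoint[symmetric]) (auto intro!: sum.cong)
  also have "(\<Sum>l\<in>{..k}. \<tau> * close_bound r (\<tau> * \<bar>real k - real l\<bar>)) = (\<Sum>j\<in>{..k}. ?g j)"
    by (rule sum.reindex_bij_witness[where i = "\<lambda>j. k - j" and j = "\<lambda>l. k - l"]) (auto simp: of_nat_diff)
  also have "\<dots> = (\<Sum>j<Suc k. ?g j)" by (simp add: lessThan_Suc_atMost)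
  also have "\<dots> \<le> 4 * (\<tau> + r\<^sup>2)" by (rule sum_close_bound_le[OF r \<tau>])
  also have "(\<Sum>l\<in>{k<..<N}. \<tau> * close_bound r (\<tau> * \<bar>real k - real l\<bar>)) = (\<Sum>j\<in>{0<..<N - k}. ?g j)"
    by (rule sum.reindex_bij_witness[where i = "\<lambda>j. k + j" and j = "\<lambda>l. l - k"]) (auto simp: of_nat_diff)
  also have "\<dots> \<le> (\<Sum>j<N - k. ?g j)" using g0 by (intro sum_mono2) auto
  also have "\<dots> \<le> 4 * (\<tau> + r\<^sup>2)" by (rule sum_close_bound_le[OF r \<tau>])
  finally show ?thesis by simp
qed

text \<open>The density is at most 1/(2 \<sigma>) because sqrt(2 pi) is at least 2, and the interval
  has length 2 r.\<close>

lemma (in prob_space) prob_normal_small: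
  assumes D: "distributed M lborel X (normal_density 0 \<sigma>)" and \<sigma>: "0 < \<sigma>" and r: "0 < r"
  shows "prob {\<omega> \<in> space M. \<bar>X \<omega>\<bar> \<le> r} \<le> r / \<sigma>"
proof -
  have "normal_density 0 \<sigma> y \<le> 1 / (2 * \<sigma>)" for y
  proof -
    have "2 \<le> sqrt (2 * pi)" using pi_gt3 by (intro real_le_rsqrt) simp
    then have "2 * \<sigma> \<le> sqrt (2 * pi * \<sigma>\<^sup>2)" using \<sigma> by (simp add: real_sqrt_mult)
    then have "1 / sqrt (2 * pi * \<sigma>\<^sup>2) \<le> 1 / (2 * \<sigma>)" using \<sigma> by (intro frac_le) auto
    moreover have "exp (- (y - 0)\<^sup>2 / (2 * \<sigma>\<^sup>2)) \<le> 1" using \<sigma> by simp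
    ultimately have "1 / sqrt (2 * pi * \<sigma>\<^sup>2) * exp (- (y - 0)\<^sup>2 / (2 * \<sigma>\<^sup>2)) \<le> 1 / (2 * \<sigma>) * 1"
      using \<sigma> by (intro mult_mono) auto
    then show ?thesis by (simp add: normal_density_def)
  qed
  note b = this
  have "{\<omega> \<in> space M. \<bar>X \<omega>\<bar> \<le> r} = X -` {- r..r} \<inter> space M" by (auto simp: abs_le_iff)
  then have "emeasure M {\<omega> \<in> space M. \<bar>X \<omega>\<bar> \<le> r} = (\<integral>\<^sup>+y. ennreal (normal_density 0 \<sigma> y) * indicator {- r..r} y \<partial>lborel)"
    using distributed_emeasure[OF D, of "{- r..r}"] by simp
  also have "\<dots> \<le> (\<integral>\<^sup>+y. ennreal (1 / (2 * \<sigma>)) * indicator {- r..r} y \<partial>lborel)"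
    by (intro nn_integral_mono mult_right_mono ennreal_leI b) auto
  also have "\<dots> = ennreal (1 / (2 * \<sigma>)) * ennreal (2 * r)"
    using r by (subst nn_integral_cmult_indicator) auto
  also have "\<dots> = ennreal (r / \<sigma>)" using r \<sigma> by (simp flip: ennreal_mult)
  finally show ?thesis using r \<sigma> by (simp add: emeasure_eq_measure)
qed

section \<open>Brownian motion in dimension eight and close returns of its first seven
  coordinates\<close>

locale brownian = prob_space M for M :: "'a measure" +
  fixes W :: "real \<Rightarrow> 'a \<Rightarrow> real ^ 8"
  assumes bm: "standard_brownian_motion M W"
begin

abbreviation "X t \<omega> \<equiv> first_seven (W t \<omega>)"
abbreviation "Z t \<omega> \<equiv> W t \<omega> $ 8"

lemma W_measurable[measurable]: "0 \<le> t \<Longrightarrow> W t \<in> borel_measurable M"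
  using bm by (auto simp: standard_brownian_motion_def)

lemma W_component_measurable[measurable]:
  assumes "0 \<le> t" shows "(\<lambda>\<omega>. W t \<omega> $ i) \<in> borel_measurable M"
proof -
  have "(\<lambda>v :: real ^ 8. v $ i) \<in> borel_measurable borel"
    by (intro borel_measurable_continuous_onI continuous_intros)
  then show ?thesis using measurable_compose[OF W_measurable[OF assms]] by blast
qed

lemma W_0: "AE \<omega> in M. W 0 \<omega> = 0" and W_continuous: "AE \<omega> in M. continuous_on {0..} (\<lambda>t. W t \<omega>)"
  using bm by (auto simp: standard_brownian_motion_def)

lemma increments_indep:
  assumes "0 \<le> \<tau> 0" "\<And>k. k < n \<Longrightarrow> \<tau> k < \<tau> (Suc k)"
  shows "indep_vars (\<lambda>_. borel) (\<lambda>k \<omega>. W (\<tau> (Suc k)) \<omega> - W (\<tau> k) \<omega>) {..<n}"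
  using bm assms unfolding standard_brownian_motion_def by blast

lemma components_indep:
  assumes "0 \<le> s" "s < t"
  shows "indep_vars (\<lambda>_. borel) (\<lambda>i \<omega>. (W t \<omega> - W s \<omega>) $ i) UNIV"
  using bm assms unfolding standard_brownian_motion_def by blast

lemma component_normal:
  assumes "0 \<le> s" "s < t"
  shows "distributed M lborel (\<lambda>\<omega>. (W t \<omega> - W s \<omega>) $ i) (normal_density 0 (sqrt (t - s)))"
  using bm assms unfolding standard_brownian_motion_def by blast

lemma X_measurable[measurable]: "0 \<le> t \<Longrightarrow> X t \<in> borel_measurable M"
proof -
  assume t: "0 \<le> t"
  have eq: "first_seven v = (\<chi> c. v $ emb c)" for v by (simp add: vec_eq_iff first_seven_nth)
  have "continuous_on UNIV first_seven" unfolding eq[abs_def] by (intro continuous_intros)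
  then have "first_seven \<in> borel_measurable borel" by (rule borel_measurable_continuous_onI)
  then show ?thesis using measurable_compose[OF W_measurable[OF t]] by blast
qed

lemma increment_nonneg_time:
  assumes "0 \<le> \<tau> 0" "\<And>k. k < n \<Longrightarrow> \<tau> k < \<tau> (Suc k)" "k \<le> n"
  shows "(0::real) \<le> \<tau> k"
  using assms(3)
proof (induction k)
  case (Suc k)
  then show ?case using assms(2)[of k] by simp
qed (use assms(1) in simp)

lemma increment_components_indep:
  assumes \<tau>: "0 \<le> \<tau> 0" "\<And>k. k < n \<Longrightarrow> \<tau> k < \<tau> (Suc k)" and n: "0 < n"
  shows "indep_vars (\<lambda>_. borel) (\<lambda>i \<omega>. (W (\<tau> (Suc (fst i))) \<omega> - W (\<tau> (fst i)) \<omega>) $ snd i) ({..<n} \<times> UNIV)"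
  using n increment_nonneg_time[of \<tau> n, OF \<tau>]
  by (intro indep_vars_components[where V = "\<lambda>k \<omega>. W (\<tau> (Suc k)) \<omega> - W (\<tau> k) \<omega>"] increments_indep \<tau>
      components_indep) auto

text \<open>Seven independent components each stay within r with probability at most u = min 1 (r /
  sqrt (t - s)). Since u is at most 1, u^7 is at most u^4, and with d = (t - s)/r^2 the square of u
  is at most 2/(1 + d).\<close>

lemma increment_small:
  assumes st: "0 \<le> s" "s < t" and r: "0 < r"
  shows "prob {\<omega> \<in> space M. close r (X s \<omega>) (X t \<omega>)} \<le> close_bound r (t - s)"
proof -
  define u where "u = min 1 (r / sqrt (t - s))"
  have u: "0 \<le> u" "u \<le> 1" using r st by (auto simp: u_def)
  define d where "d = (t - s) / r\<^sup>2"
  have d: "0 < d" using st r by (simp add: d_def)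
  have "u\<^sup>2 = min 1 (1 / d)"
  proof (cases "r / sqrt (t - s) \<le> 1")
    case True
    then have "(r / sqrt (t - s))\<^sup>2 \<le> 1" using r st by (intro power_le_one) auto
    moreover have "(r / sqrt (t - s))\<^sup>2 = 1 / d" using st by (simp add: d_def power_divide)
    ultimately show ?thesis using True by (simp add: u_def)
  next
    case False
    then have "1\<^sup>2 \<le> (r / sqrt (t - s))\<^sup>2" by (intro power_mono) auto
    moreover have "(r / sqrt (t - s))\<^sup>2 = 1 / d" using st by (simp add: d_def power_divide)
    ultimately show ?thesis using False by (simp add: u_def)
  qed
  also have "min 1 (1 / d) \<le> 2 / (1 + d)"
    using d by (cases "d \<le> 1") (auto simp: min_def field_simps)
  finally have u2: "u\<^sup>2 \<le> 2 / (1 + d)" .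
  have iv: "v \<in> {- r..r} \<longleftrightarrow> \<bar>v\<bar> \<le> r" for v by (auto simp: abs_le_iff)
  have "{\<omega> \<in> space M. close r (X s \<omega>) (X t \<omega>)} =
     (\<Inter>i\<in>range emb. (\<lambda>\<omega>. (W t \<omega> - W s \<omega>) $ i) -` {- r..r} \<inter> space M)"
    by (auto simp del: atLeastAtMost_iff simp: close_def first_seven_nth vimage_def iv abs_minus_commute)
  also have "prob \<dots> = (\<Prod>i\<in>range emb. prob ((\<lambda>\<omega>. (W t \<omega> - W s \<omega>) $ i) -` {- r..r} \<inter> space M))"
    by (intro indep_varsD[OF components_indep[OF st]]) auto
  also have "\<dots> \<le> (\<Prod>i\<in>range emb. u)"
  proof (intro prod_mono conjI)
    fix i
    have "(\<lambda>\<omega>. (W t \<omega> - W s \<omega>) $ i) -` {- r..r} \<inter> space M = {\<omega> \<in> space M. \<bar>(W t \<omega> - W s \<omega>) $ i\<bar> \<le> r}"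
      by auto
    then show "prob ((\<lambda>\<omega>. (W t \<omega> - W s \<omega>) $ i) -` {- r..r} \<inter> space M) \<le> u"
      using prob_normal_small[OF component_normal[OF st] _ r] st by (simp add: u_def)
  qed auto
  also have "\<dots> = u ^ 7" by (simp add: card_image[OF inj_emb])
  also have "\<dots> \<le> u ^ 4" using u by (intro power_decreasing) auto
  also have "\<dots> = (u\<^sup>2)\<^sup>2" by (simp flip: power_mult)
  also have "\<dots> \<le> (2 / (1 + d))\<^sup>2" using u2 by (intro power_mono) auto
  also have "\<dots> = close_bound r (t - s)" by (simp add: close_bound_def d_def power_divide)
  finally show ?thesis .
qed

lemma prob_close:
  assumes st: "0 \<le> s" "s \<le> t" and r: "0 < r"
  shows "prob {\<omega> \<in> space M. close r (X s \<omega>) (X t \<omega>)} \<le> close_bound r (t - s)"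
proof (cases "s = t")
  case True
  have "prob {\<omega> \<in> space M. close r (X s \<omega>) (X t \<omega>)} \<le> 1" by simp
  also have "\<dots> \<le> close_bound r (t - s)" using True by (simp add: close_bound_0)
  finally show ?thesis .
qed (use assms increment_small in auto)

lemma close_measurable[measurable]:
  assumes "0 \<le> s" "0 \<le> t"
  shows "{\<omega> \<in> space M. close r (X s \<omega>) (X t \<omega>)} \<in> sets M"
proof -
  have "{\<omega> \<in> space M. close r (X s \<omega>) (X t \<omega>)} = {\<omega> \<in> space M. \<forall>c\<in>UNIV. \<bar>X s \<omega> $ c - X t \<omega> $ c\<bar> \<le> r}"
    by (simp add: close_def)
  also have "\<dots> \<in> sets M" unfolding first_seven_nth using assms by measurable
  finally show ?thesis .
qed

text \<open>Consecutive increments are independent. If two of the times coincide, the corresponding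
  factor is 4, which is more than enough for the event that became trivial.\<close>

lemma prob_close_close:
  assumes st: "0 \<le> s" "s \<le> t" "t \<le> u" and r: "0 < r"
  shows "prob {\<omega> \<in> space M. close r (X s \<omega>) (X t \<omega>) \<and> close r (X t \<omega>) (X u \<omega>)} \<le>
    close_bound r (t - s) * close_bound r (u - t)"
proof (cases "s < t \<and> t < u")
  case True
  define \<tau> where "\<tau> k = (if k = 0 then s else if k = 1 then t else u)" for k :: nat
  define B where "B = {v :: real ^ 8. \<forall>c\<in>UNIV. \<bar>v $ emb c\<bar> \<le> r}"
  have B: "B \<in> sets borel" unfolding B_def by measurable
  have ind: "indep_vars (\<lambda>_. borel) (\<lambda>k \<omega>. W (\<tau> (Suc k)) \<omega> - W (\<tau> k) \<omega>) {..<2}"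
    using True st by (intro increments_indep) (auto simp: \<tau>_def less_Suc_eq numeral_2_eq_2)
  have eq: "{\<omega> \<in> space M. close r (X (\<tau> k) \<omega>) (X (\<tau> (Suc k)) \<omega>)} =
     (\<lambda>\<omega>. W (\<tau> (Suc k)) \<omega> - W (\<tau> k) \<omega>) -` B \<inter> space M" for k
    by (auto simp: B_def close_def first_seven_nth abs_minus_commute)
  have "{\<omega> \<in> space M. close r (X s \<omega>) (X t \<omega>) \<and> close r (X t \<omega>) (X u \<omega>)} =
     (\<Inter>k\<in>{..<2}. (\<lambda>\<omega>. W (\<tau> (Suc k)) \<omega> - W (\<tau> k) \<omega>) -` B \<inter> space M)"
  proof -
    have "{..<2} = {0, 1 :: nat}" by auto
    then show ?thesis unfolding eq[symmetric] by (auto simp: \<tau>_def)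
  qed
  also have "prob \<dots> = (\<Prod>k<2. prob ((\<lambda>\<omega>. W (\<tau> (Suc k)) \<omega> - W (\<tau> k) \<omega>) -` B \<inter> space M))"
    using B by (intro indep_varsD_finite[OF ind]) (auto simp: lessThan_empty_iff)
  also have "\<dots> = prob {\<omega> \<in> space M. close r (X s \<omega>) (X t \<omega>)} * prob {\<omega> \<in> space M. close r (X t \<omega>) (X u \<omega>)}"
    unfolding eq[symmetric] by (simp add: numeral_2_eq_2 \<tau>_def)
  also have "\<dots> \<le> close_bound r (t - s) * close_bound r (u - t)"
    using st r by (intro mult_mono prob_close close_bound_nonneg) auto
  finally show ?thesis .
next
  case False
  have 1: "prob {\<omega> \<in> space M. close r (X s \<omega>) (X t \<omega>) \<and> close r (X t \<omega>) (X u \<omega>)} \<le> close_bound r (t - s)"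
    using st r by (intro order_trans[OF finite_measure_mono prob_close]) auto
  have 2: "prob {\<omega> \<in> space M. close r (X s \<omega>) (X t \<omega>) \<and> close r (X t \<omega>) (X u \<omega>)} \<le> close_bound r (u - t)"
    using st r by (intro order_trans[OF finite_measure_mono prob_close]) auto
  show ?thesis
    using False st 1 2 close_bound_nonneg[of r "t - s"] close_bound_nonneg[of r "u - t"]
    by (cases "s = t") (auto simp: close_bound_0)
qed

section \<open>Conditioning on the first seven coordinates\<close>

definition dZ :: "real \<Rightarrow> real \<Rightarrow> nat \<Rightarrow> nat \<Rightarrow> 'a \<Rightarrow> real" where
  "dZ \<alpha> T n k \<omega> = Z (grid \<alpha> T n (Suc k)) \<omega> - Z (grid \<alpha> T n k) \<omega>"

text \<open>The discretised path as one point of the product space \<open>paths n\<close>, so that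
  conditioning on X means fixing such a point. Only the left endpoints of the grid intervals are
  recorded.\<close>

definition Xv :: "real \<Rightarrow> real \<Rightarrow> nat \<Rightarrow> 'a \<Rightarrow> nat \<Rightarrow> real ^ 7" where
  "Xv \<alpha> T n \<omega> = (\<lambda>k\<in>{..<2 ^ n}. X (grid \<alpha> T n k) \<omega>)"

abbreviation "paths n \<equiv> Pi\<^sub>M {..<2 ^ n} (\<lambda>_::nat. borel :: (real ^ 7) measure)"

context
  fixes \<alpha> T :: real and n :: nat
  assumes \<alpha>: "0 < \<alpha>" and T: "0 < T"
begin

lemma grid_nonneg: "0 \<le> grid \<alpha> T m k"
  using \<alpha> T by (simp add: grid_def)

lemma dZ_indep: "indep_vars (\<lambda>_. borel) (dZ \<alpha> T n) {..<2 ^ n}"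
proof -
  have "indep_vars (\<lambda>_. borel) (\<lambda>k \<omega>. W (grid \<alpha> T n (Suc k)) \<omega> - W (grid \<alpha> T n k) \<omega>) {..<2 ^ n}"
    using grid_less[OF T] grid_nonneg by (intro increments_indep) auto
  from indep_vars_compose2[OF this, of "\<lambda>_ v. v $ 8" "\<lambda>_. borel"]
  show ?thesis unfolding dZ_def[abs_def]
    by (auto intro: borel_measurable_continuous_onI continuous_intros)
qed

lemma dZ_normal: "distributed M lborel (dZ \<alpha> T n k) (normal_density 0 (sqrt (T / 2 ^ n)))"
  using component_normal[OF grid_nonneg grid_less[OF T], of n k 8] grid_diff[of \<alpha> T n k]
  by (simp add: dZ_def[abs_def])

text \<open>The positions of X on the grid are functions of the increments of the first seven
  components, the variables \<open>dZ\<close> of the increments of the eighth. These are disjoint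
  blocks of one jointly independent family, so F may be integrated over \<open>dZ\<close> with the
  path of X held fixed.\<close>

lemma conditioning:
  assumes F: "F \<in> borel_measurable (paths n \<Otimes>\<^sub>M Pi\<^sub>M {..<2 ^ n} (\<lambda>_. borel))"
    and G: "G \<in> borel_measurable (paths n)"
    and le: "\<And>\<xi>. (\<integral>\<^sup>+\<omega>. F (\<xi>, \<lambda>k\<in>{..<2 ^ n}. dZ \<alpha> T n k \<omega>) \<partial>M) \<le> G \<xi>"
  shows "(\<integral>\<^sup>+\<omega>. F (Xv \<alpha> T n \<omega>, \<lambda>k\<in>{..<2 ^ n}. dZ \<alpha> T n k \<omega>) \<partial>M) \<le> (\<integral>\<^sup>+\<omega>. G (Xv \<alpha> T n \<omega>) \<partial>M)"
proof -
  \<comment> \<open>Time 0 is put in front of the grid, so that positions, and not only increments,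
    of X are sums of increments.\<close>
  define \<tau> where "\<tau> k = (case k of 0 \<Rightarrow> 0 | Suc k \<Rightarrow> grid \<alpha> T n k)" for k
  define V where "V i \<omega> = (W (\<tau> (Suc (fst i))) \<omega> - W (\<tau> (fst i)) \<omega>) $ snd i" for i :: "nat \<times> 8" and \<omega>
  define N :: nat where "N = 2 ^ n"
  have ind: "indep_vars (\<lambda>_. borel) V ({..<Suc N} \<times> UNIV)"
    unfolding V_def[abs_def]
    by (rule increment_components_indep) (auto simp: \<tau>_def \<alpha> grid_0 grid_less[OF T] split: nat.splits)
  define A where "A = {..<Suc N} \<times> range emb"
  define B where "B = {..<Suc N} \<times> {8 :: 8}"
  have iv: "indep_var (Pi\<^sub>M A (\<lambda>_. borel)) (\<lambda>\<omega>. \<lambda>i\<in>A. V i \<omega>) (Pi\<^sub>M B (\<lambda>_. borel)) (\<lambda>\<omega>. \<lambda>i\<in>B. V i \<omega>)"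
    using emb_neq_8 by (intro indep_var_restrict[OF ind]) (auto simp: A_def B_def)
  define h1 :: "(nat \<times> 8 \<Rightarrow> real) \<Rightarrow> nat \<Rightarrow> real ^ 7"
    where "h1 f = (\<lambda>k\<in>{..<N}. \<chi> c. \<Sum>l\<le>k. f (l, emb c))" for f
  \<comment> \<open>The index is \<open>Suc k\<close> because increment 0 leads from time 0 to
    \<alpha>, before the window.\<close>
  define h2 :: "(nat \<times> 8 \<Rightarrow> real) \<Rightarrow> nat \<Rightarrow> real"
    where "h2 f = (\<lambda>k\<in>{..<N}. f (Suc k, 8))" for f
  have h1[measurable]: "h1 \<in> measurable (Pi\<^sub>M A (\<lambda>_. borel)) (Pi\<^sub>M {..<N} (\<lambda>_. borel))"
    unfolding h1_def
  proof (rule measurable_restrict)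
    fix k assume k: "k \<in> {..<N}"
    have comp: "(\<lambda>f. ((\<Sum>l\<le>k. f (l, emb c)) :: real)) \<in> borel_measurable (Pi\<^sub>M A (\<lambda>_. borel))" for c
      using k by (intro borel_measurable_sum measurable_component_singleton) (auto simp: A_def)
    have eq: "(\<chi> c. g c) = (\<Sum>c\<in>UNIV. g c *\<^sub>R axis c (1::real))" for g :: "7 \<Rightarrow> real"
      by (simp add: vec_eq_iff axis_def if_distrib[of "\<lambda>x. _ * x"] cong: if_cong)
    show "(\<lambda>f. \<chi> c. ((\<Sum>l\<le>k. f (l, emb c)) :: real)) \<in> borel_measurable (Pi\<^sub>M A (\<lambda>_. borel))"
      unfolding eq by (intro borel_measurable_sum borel_measurable_scaleR comp) auto
  qed
  have h2[measurable]: "h2 \<in> measurable (Pi\<^sub>M B (\<lambda>_. borel)) (Pi\<^sub>M {..<N} (\<lambda>_. borel))"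
    unfolding h2_def by (intro measurable_restrict measurable_component_singleton) (auto simp: B_def)
  define X' where "X' \<omega> k = (\<chi> c. \<Sum>l\<le>k. V (l, emb c) \<omega>)" for \<omega> k
  have e1: "h1 (\<lambda>i\<in>A. V i \<omega>) = (\<lambda>k\<in>{..<N}. X' \<omega> k)" for \<omega>
    by (auto simp: h1_def X'_def A_def fun_eq_iff intro!: sum.cong)
  have e2: "h2 (\<lambda>i\<in>B. V i \<omega>) = (\<lambda>k\<in>{..<N}. dZ \<alpha> T n k \<omega>)" for \<omega>
    by (auto simp: h2_def B_def fun_eq_iff V_def \<tau>_def dZ_def)
  \<comment> \<open>Summing increments recovers W minus its initial value, which is 0 only almost
    surely; this is why both ends of the final estimate are corrected on a null set.\<close>
  have X': "AE \<omega> in M. \<forall>k<2 ^ n. X' \<omega> k = X (grid \<alpha> T n k) \<omega>"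
    using W_0
  proof eventually_elim
    case (elim \<omega>)
    have "(\<Sum>l\<le>k. V (l, i) \<omega>) = W (grid \<alpha> T n k) \<omega> $ i" for k i
    proof -
      have "(\<Sum>l\<le>k. V (l, i) \<omega>) = (\<Sum>l<Suc k. W (\<tau> (Suc l)) \<omega> $ i - W (\<tau> l) \<omega> $ i)"
        by (simp add: V_def lessThan_Suc_atMost)
      also have "\<dots> = W (\<tau> (Suc k)) \<omega> $ i - W (\<tau> 0) \<omega> $ i" by (rule sum_lessThan_telescope)
      finally show ?thesis using elim by (simp add: \<tau>_def)
    qed
    then show ?case by (simp add: X'_def vec_eq_iff first_seven_nth)
  qed
  have ae: "AE \<omega> in M. (\<lambda>k\<in>{..<2 ^ n}. X' \<omega> k) = Xv \<alpha> T n \<omega>"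
    using X' by eventually_elim (auto simp: Xv_def fun_eq_iff)
  have "(\<integral>\<^sup>+\<omega>. F (Xv \<alpha> T n \<omega>, \<lambda>k\<in>{..<2 ^ n}. dZ \<alpha> T n k \<omega>) \<partial>M) =
      (\<integral>\<^sup>+\<omega>. F (\<lambda>k\<in>{..<2 ^ n}. X' \<omega> k, \<lambda>k\<in>{..<2 ^ n}. dZ \<alpha> T n k \<omega>) \<partial>M)"
    using ae by (intro nn_integral_cong_AE) auto
  also have "\<dots> \<le> (\<integral>\<^sup>+\<omega>. G (\<lambda>k\<in>{..<2 ^ n}. X' \<omega> k) \<partial>M)"
  proof -
    have F': "(\<lambda>p. F (h1 (fst p), h2 (snd p))) \<in> borel_measurable (Pi\<^sub>M A (\<lambda>_. borel) \<Otimes>\<^sub>M Pi\<^sub>M B (\<lambda>_. borel))"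
      using h1 h2 by (intro measurable_compose[OF _ F]) (simp add: N_def[symmetric])
    have G': "(\<lambda>f. G (h1 f)) \<in> borel_measurable (Pi\<^sub>M A (\<lambda>_. borel))"
      using h1 by (intro measurable_compose[OF _ G]) (simp add: N_def[symmetric])
    from nn_integral_indep_le[OF iv F' G'] show ?thesis
      using le by (simp add: e1 e2 N_def[symmetric])
  qed
  also have "\<dots> = (\<integral>\<^sup>+\<omega>. G (Xv \<alpha> T n \<omega>) \<partial>M)"
    using ae by (intro nn_integral_cong_AE) auto
  finally show ?thesis .
qed

lemmas gaussian_dZ = gaussian_sum_moments[OF dZ_indep finite_lessThan _ dZ_normal]

lemma sqrt_step: "0 < sqrt (T / 2 ^ n)" "(sqrt (T / 2 ^ n))\<^sup>2 = T / 2 ^ n"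
  using T by auto

text \<open>The coefficients may depend on the whole discretised path of X, including later times,
  since X is independent of Z. This freedom is used with occupation times as weights, where an
  isometry for adapted integrands would not apply.\<close>

lemma second_moment:
  assumes a[measurable]: "\<And>k. k < 2 ^ n \<Longrightarrow> (\<lambda>\<xi>. a \<xi> k) \<in> borel_measurable (paths n)"
  shows "(\<integral>\<^sup>+\<omega>. ennreal ((\<Sum>k<2^n. a (Xv \<alpha> T n \<omega>) k * dZ \<alpha> T n k \<omega>)\<^sup>2) \<partial>M) \<le>
    (\<integral>\<^sup>+\<omega>. ennreal (T / 2 ^ n * (\<Sum>k<2^n. (a (Xv \<alpha> T n \<omega>) k)\<^sup>2)) \<partial>M)"
proof -
  let ?F = "\<lambda>p. ennreal ((\<Sum>k<2^n. a (fst p) k * snd p k)\<^sup>2)"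
  have "(\<integral>\<^sup>+\<omega>. ?F (Xv \<alpha> T n \<omega>, \<lambda>k\<in>{..<2 ^ n}. dZ \<alpha> T n k \<omega>) \<partial>M) \<le>
     (\<integral>\<^sup>+\<omega>. (\<lambda>\<xi>. ennreal (T / 2 ^ n * (\<Sum>k<2^n. (a \<xi> k)\<^sup>2))) (Xv \<alpha> T n \<omega>) \<partial>M)"
  proof (rule conditioning)
    show "?F \<in> borel_measurable (paths n \<Otimes>\<^sub>M Pi\<^sub>M {..<2 ^ n} (\<lambda>_. borel))"
      by measurable
    show "(\<lambda>\<xi>. ennreal (T / 2 ^ n * (\<Sum>k<2^n. (a \<xi> k)\<^sup>2))) \<in> borel_measurable (paths n)"
      by measurable
    fix \<xi>
    show "(\<integral>\<^sup>+\<omega>. ?F (\<xi>, \<lambda>k\<in>{..<2 ^ n}. dZ \<alpha> T n k \<omega>) \<partial>M) \<le> ennreal (T / 2 ^ n * (\<Sum>k<2^n. (a \<xi> k)\<^sup>2))"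
      using gaussian_dZ(1)[OF sqrt_step(1), of "a \<xi>" 2] gaussian_dZ(3)[OF sqrt_step(1), of "a \<xi>"]
      by (simp add: nn_integral_eq_integral sqrt_step(2))
  qed
  then show ?thesis by simp
qed

lemma fourth_moment:
  assumes a[measurable]: "\<And>k. k < 2 ^ n \<Longrightarrow> (\<lambda>\<xi>. a \<xi> k) \<in> borel_measurable (paths n)"
  shows "(\<integral>\<^sup>+\<omega>. ennreal ((\<Sum>k<2^n. a (Xv \<alpha> T n \<omega>) k * dZ \<alpha> T n k \<omega>) ^ 4) \<partial>M) \<le>
    (\<integral>\<^sup>+\<omega>. ennreal (3 * (T / 2 ^ n * (\<Sum>k<2^n. (a (Xv \<alpha> T n \<omega>) k)\<^sup>2))\<^sup>2) \<partial>M)"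
proof -
  let ?F = "\<lambda>p. ennreal ((\<Sum>k<2^n. a (fst p) k * snd p k) ^ 4)"
  have "(\<integral>\<^sup>+\<omega>. ?F (Xv \<alpha> T n \<omega>, \<lambda>k\<in>{..<2 ^ n}. dZ \<alpha> T n k \<omega>) \<partial>M) \<le>
     (\<integral>\<^sup>+\<omega>. (\<lambda>\<xi>. ennreal (3 * (T / 2 ^ n * (\<Sum>k<2^n. (a \<xi> k)\<^sup>2))\<^sup>2)) (Xv \<alpha> T n \<omega>) \<partial>M)"
  proof (rule conditioning)
    show "?F \<in> borel_measurable (paths n \<Otimes>\<^sub>M Pi\<^sub>M {..<2 ^ n} (\<lambda>_. borel))"
      by measurable
    show "(\<lambda>\<xi>. ennreal (3 * (T / 2 ^ n * (\<Sum>k<2^n. (a \<xi> k)\<^sup>2))\<^sup>2)) \<in> borel_measurable (paths n)"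
      by measurable
    fix \<xi>
    show "(\<integral>\<^sup>+\<omega>. ?F (\<xi>, \<lambda>k\<in>{..<2 ^ n}. dZ \<alpha> T n k \<omega>) \<partial>M) \<le> ennreal (3 * (T / 2 ^ n * (\<Sum>k<2^n. (a \<xi> k)\<^sup>2))\<^sup>2)"
      using gaussian_dZ(1)[OF sqrt_step(1), of "a \<xi>" 4] gaussian_dZ(4)[OF sqrt_step(1), of "a \<xi>"]
      by (simp add: nn_integral_eq_integral sqrt_step(2))
  qed
  then show ?thesis by simp
qed

lemma square_sum_variance:
  assumes a[measurable]: "\<And>q k. k < 2 ^ n \<Longrightarrow> (\<lambda>\<xi>. a q \<xi> k) \<in> borel_measurable (paths n)"
    and Q: "finite Q" and disj: "\<And>p q \<xi> k. p \<in> Q \<Longrightarrow> q \<in> Q \<Longrightarrow> p \<noteq> q \<Longrightarrow> a p \<xi> k = 0 \<or> a q \<xi> k = 0"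
  shows "(\<integral>\<^sup>+\<omega>. ennreal ((\<Sum>q\<in>Q. (\<Sum>k<2^n. a q (Xv \<alpha> T n \<omega>) k * dZ \<alpha> T n k \<omega>)\<^sup>2
            - T / 2 ^ n * (\<Sum>k<2^n. (a q (Xv \<alpha> T n \<omega>) k)\<^sup>2))\<^sup>2) \<partial>M) \<le>
    (\<integral>\<^sup>+\<omega>. ennreal (2 * (\<Sum>q\<in>Q. (T / 2 ^ n * (\<Sum>k<2^n. (a q (Xv \<alpha> T n \<omega>) k)\<^sup>2))\<^sup>2)) \<partial>M)"
proof -
  let ?F = "\<lambda>p. ennreal ((\<Sum>q\<in>Q. (\<Sum>k<2^n. a q (fst p) k * snd p k)\<^sup>2 - T / 2 ^ n * (\<Sum>k<2^n. (a q (fst p) k)\<^sup>2))\<^sup>2)"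
  have "(\<integral>\<^sup>+\<omega>. ?F (Xv \<alpha> T n \<omega>, \<lambda>k\<in>{..<2 ^ n}. dZ \<alpha> T n k \<omega>) \<partial>M) \<le>
     (\<integral>\<^sup>+\<omega>. (\<lambda>\<xi>. ennreal (2 * (\<Sum>q\<in>Q. (T / 2 ^ n * (\<Sum>k<2^n. (a q \<xi> k)\<^sup>2))\<^sup>2))) (Xv \<alpha> T n \<omega>) \<partial>M)"
  proof (rule conditioning)
    show "?F \<in> borel_measurable (paths n \<Otimes>\<^sub>M Pi\<^sub>M {..<2 ^ n} (\<lambda>_. borel))"
      by measurable
    show "(\<lambda>\<xi>. ennreal (2 * (\<Sum>q\<in>Q. (T / 2 ^ n * (\<Sum>k<2^n. (a q \<xi> k)\<^sup>2))\<^sup>2))) \<in> borel_measurable (paths n)"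
      by measurable
    fix \<xi>
    have "p \<in> Q \<Longrightarrow> q \<in> Q \<Longrightarrow> p \<noteq> q \<Longrightarrow> k \<in> {..<2 ^ n} \<Longrightarrow> a p \<xi> k = 0 \<or> a q \<xi> k = 0" for p q k
      using disj by blast
    from gaussian_square_sum_variance[OF dZ_indep finite_lessThan Q sqrt_step(1) dZ_normal, of "\<lambda>q. a q \<xi>", OF this]
    show "(\<integral>\<^sup>+\<omega>. ?F (\<xi>, \<lambda>k\<in>{..<2 ^ n}. dZ \<alpha> T n k \<omega>) \<partial>M) \<le>
        ennreal (2 * (\<Sum>q\<in>Q. (T / 2 ^ n * (\<Sum>k<2^n. (a q \<xi> k)\<^sup>2))\<^sup>2))"
      by (simp add: nn_integral_eq_integral sqrt_step(2))
  qed
  then show ?thesis by simp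
qed

end

end

text \<open>Fatou's lemma is applied in n and then in m. The expectations are merely bounded and not
  summable in m, so finiteness is obtained for the lower limit only, which is why both indices occur
  frequently rather than eventually.\<close>

lemma AE_frequently_bounded:
  fixes Z :: "nat \<Rightarrow> nat \<Rightarrow> 'a \<Rightarrow> ennreal"
  assumes meas: "\<And>m n. Z m n \<in> borel_measurable M"
    and le: "\<And>m n. (\<integral>\<^sup>+\<omega>. Z m n \<omega> \<partial>M) \<le> ennreal (b m n)"
    and lim: "\<And>m. b m \<longlonglongrightarrow> C"
  shows "AE \<omega> in M. \<exists>B. \<exists>\<^sub>F m in sequentially. \<exists>\<^sub>F n in sequentially. Z m n \<omega> \<le> ennreal B"
proof -
  define L where "L m \<omega> = liminf (\<lambda>n. Z m n \<omega>)" for m \<omega>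
  have L[measurable]: "L m \<in> borel_measurable M" for m
    unfolding L_def[abs_def] using meas by (rule borel_measurable_liminf)
  have "(\<integral>\<^sup>+\<omega>. L m \<omega> \<partial>M) \<le> ennreal C" for m
  proof -
    have "(\<integral>\<^sup>+\<omega>. L m \<omega> \<partial>M) \<le> liminf (\<lambda>n. \<integral>\<^sup>+\<omega>. Z m n \<omega> \<partial>M)"
      unfolding L_def using meas by (rule nn_integral_liminf)
    also have "\<dots> \<le> liminf (\<lambda>n. ennreal (b m n))" by (intro Liminf_mono always_eventually allI le)
    also have "\<dots> = ennreal C"
      using lim by (intro lim_imp_Liminf tendsto_ennrealI) auto
    finally show ?thesis .
  qed
  then have "(\<integral>\<^sup>+\<omega>. liminf (\<lambda>m. L m \<omega>) \<partial>M) \<le> liminf (\<lambda>m. ennreal C)"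
    by (intro order_trans[OF nn_integral_liminf Liminf_mono]) auto
  also have "\<dots> < \<infinity>" by (simp add: Liminf_const)
  finally have "AE \<omega> in M. liminf (\<lambda>m. L m \<omega>) \<noteq> \<infinity>"
    by (intro nn_integral_noteq_infinite) auto
  then show ?thesis
  proof eventually_elim
    case (elim \<omega>)
    then obtain B where B: "0 \<le> B" "liminf (\<lambda>m. L m \<omega>) = ennreal B"
      by (cases "liminf (\<lambda>m. L m \<omega>)" rule: ennreal_cases) auto
    have "\<exists>\<^sub>F m in sequentially. L m \<omega> < ennreal (B + 1)"
    proof (rule ccontr)
      assume "\<not> ?thesis"
      then have "\<forall>\<^sub>F m in sequentially. ennreal (B + 1) \<le> L m \<omega>" by (simp add: not_frequently not_less)
      then have "ennreal (B + 1) \<le> ennreal B" unfolding B(2)[symmetric] by (rule Liminf_bounded)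
      then show False using B(1) by (simp add: ennreal_le_iff)
    qed
    then have "\<exists>\<^sub>F m in sequentially. \<exists>\<^sub>F n in sequentially. Z m n \<omega> \<le> ennreal (B + 1)"
    proof (rule frequently_elim1)
      fix m assume m: "L m \<omega> < ennreal (B + 1)"
      show "\<exists>\<^sub>F n in sequentially. Z m n \<omega> \<le> ennreal (B + 1)"
      proof (rule ccontr)
        assume "\<not> ?thesis"
        then have "\<forall>\<^sub>F n in sequentially. ennreal (B + 1) \<le> Z m n \<omega>"
          by (auto simp: not_frequently not_le elim!: eventually_mono)
        then have "ennreal (B + 1) \<le> L m \<omega>" unfolding L_def by (rule Liminf_bounded)
        then show False using m by simp
      qed
    qed
    then show ?case by blast
  qed
qed

text \<open>The squared increments remain summable in expectation after multiplication by (3/2)^n,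
  so almost surely the increments are of order (2/3)^(n/2) and their series converges
  absolutely.\<close>

lemma AE_convergent_of_square_increments:
  fixes Y :: "nat \<Rightarrow> 'a \<Rightarrow> real"
  assumes meas[measurable]: "\<And>n. Y n \<in> borel_measurable M"
    and le: "\<And>n. (\<integral>\<^sup>+\<omega>. ennreal ((Y (Suc n) \<omega> - Y n \<omega>)\<^sup>2) \<partial>M) \<le> ennreal (C / 2 ^ n)" and C: "0 \<le> C"
  shows "AE \<omega> in M. convergent (\<lambda>n. Y n \<omega>)"
proof -
  define f where "f n \<omega> = (3 / 2) ^ n * (Y (Suc n) \<omega> - Y n \<omega>)\<^sup>2" for n \<omega>
  have [measurable]: "f n \<in> borel_measurable M" for n unfolding f_def[abs_def] by measurable
  have "(\<integral>\<^sup>+\<omega>. ennreal (f n \<omega>) \<partial>M) \<le> ennreal (C * (3 / 4) ^ n)" for n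
  proof -
    have "(\<integral>\<^sup>+\<omega>. ennreal (f n \<omega>) \<partial>M) = ennreal ((3 / 2) ^ n) * (\<integral>\<^sup>+\<omega>. ennreal ((Y (Suc n) \<omega> - Y n \<omega>)\<^sup>2) \<partial>M)"
      unfolding f_def by (simp add: ennreal_mult nn_integral_cmult)
    also have "\<dots> \<le> ennreal ((3 / 2) ^ n) * ennreal (C / 2 ^ n)" by (intro mult_left_mono le) auto
    also have "\<dots> = ennreal ((3 / 2) ^ n * (C / 2 ^ n))" using C by (intro ennreal_mult[symmetric]) auto
    also have "(3 / 2) ^ n * (C / 2 ^ n) = C * (3 / 4) ^ n"
    proof -
      have "(4::real) ^ n = 2 ^ n * 2 ^ n" by (simp flip: power_mult_distrib)
      then show ?thesis by (simp add: power_divide)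
    qed
    finally show ?thesis .
  qed
  then have "(\<integral>\<^sup>+\<omega>. (\<Sum>n. ennreal (f n \<omega>)) \<partial>M) \<le> (\<Sum>n. ennreal (C * (3 / 4) ^ n))"
    by (subst nn_integral_suminf) (auto intro!: suminf_le)
  also have "\<dots> = ennreal (\<Sum>n. C * (3 / 4) ^ n)"
    using C by (intro suminf_ennreal2) (auto intro!: summable_mult summable_geometric)
  also have "\<dots> < \<infinity>" by simp
  finally have "AE \<omega> in M. (\<Sum>n. ennreal (f n \<omega>)) \<noteq> \<infinity>"
    by (intro nn_integral_noteq_infinite) auto
  then show ?thesis
  proof eventually_elim
    case (elim \<omega>)
    have "summable (\<lambda>n. f n \<omega>)"
      using elim by (intro summable_suminf_not_top) (auto simp: f_def)
    then have "(\<lambda>n. f n \<omega>) \<longlonglongrightarrow> 0" by (rule summable_LIMSEQ_zero)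
    then have "Bseq (\<lambda>n. f n \<omega>)" by (intro convergent_imp_Bseq convergentI)
    then obtain K where K: "0 < K" "\<And>n. f n \<omega> \<le> K" by (auto simp: Bseq_def abs_le_iff)
    define d where "d n = Y (Suc n) \<omega> - Y n \<omega>" for n
    have "summable d"
    proof (rule summable_comparison_test')
      show "summable (\<lambda>n. sqrt K * sqrt (2 / 3) ^ n)" by (intro summable_mult summable_geometric) simp
      fix n
      have "(d n)\<^sup>2 \<le> K * (2 / 3) ^ n"
        using K(2)[of n] by (simp add: f_def d_def power_divide field_simps)
      also have "\<dots> = (sqrt K * sqrt (2 / 3) ^ n)\<^sup>2"
        using K by (simp add: power_mult_distrib real_sqrt_power[symmetric])
      finally have "\<bar>d n\<bar> \<le> \<bar>sqrt K * sqrt (2 / 3) ^ n\<bar>" by (simp only: abs_le_square_iff)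
      then show "norm (d n) \<le> sqrt K * sqrt (2 / 3) ^ n" using K(1) by (simp add: abs_mult)
    qed
    then have "(\<lambda>n. Y 0 \<omega> + (\<Sum>k<n. d k)) \<longlonglongrightarrow> Y 0 \<omega> + suminf d"
      by (intro tendsto_intros summable_LIMSEQ)
    moreover have "Y 0 \<omega> + (\<Sum>k<n. d k) = Y n \<omega>" for n
      unfolding d_def by (subst sum_lessThan_telescope) simp
    ultimately show ?case by (auto simp: convergent_def)
  qed
qed

section \<open>Measurability and disjointness of cells\<close>

lemma open_cell: "open (cell m p)"
proof -
  have "cell m p = (\<Inter>h\<in>UNIV. {x. 0 < cell_coord m p x h} \<inter> {x. cell_coord m p x h < 1})"
    by (auto simp: cell_def)
  also have "open \<dots>"
    unfolding cell_coord_def by (intro open_INT open_Int open_Collect_less ballI continuous_intros finite)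
  finally show ?thesis .
qed

lemma bump_square_le_indicator: "(bump m p v)\<^sup>2 \<le> indicator (cell m p) v"
proof (cases "v \<in> cell m p")
  case True
  then show ?thesis using power_le_one[OF bump_nonneg bump_le_1, of m p v 2] by simp
qed (simp add: bump_eq_0)

text \<open>With a fixed shift, v lies in at most one cell, so at most one summand is nonzero. This
  removes the number of cells from all estimates.\<close>

lemma sum_cells_indicator_le:
  assumes "finite Q" and F: "\<And>q. q \<in> Q \<Longrightarrow> F q \<noteq> 0 \<Longrightarrow> v \<in> cell m (\<theta>, q) \<and> F q \<le> (b::real)" "0 \<le> b"
  shows "(\<Sum>q\<in>Q. F q) \<le> b"
proof (cases "\<exists>q\<in>Q. F q \<noteq> 0")
  case True
  then obtain q0 where q0: "q0 \<in> Q" "F q0 \<noteq> 0" by blast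
  have "F q = 0" if "q \<in> Q" "q \<noteq> q0" for q
    using F(1)[OF q0] F(1)[OF that(1)] cell_unique[of v m \<theta> q q0] that(2) by blast
  then have "(\<Sum>q\<in>Q. F q) = (\<Sum>q\<in>Q. if q = q0 then F q0 else 0)" by (intro sum.cong) auto
  then show ?thesis using F(1)[OF q0] q0 assms(1) by simp
next
  case False
  then have "(\<Sum>q\<in>Q. F q) = 0" by (intro sum.neutral) auto
  then show ?thesis using F(2) by simp
qed

lemma square_of_disjoint_sum:
  fixes F :: "'q \<Rightarrow> real"
  assumes "finite Q" "\<And>p q. p \<in> Q \<Longrightarrow> q \<in> Q \<Longrightarrow> p \<noteq> q \<Longrightarrow> F p = 0 \<or> F q = 0"
  shows "(\<Sum>q\<in>Q. F q)\<^sup>2 = (\<Sum>q\<in>Q. (F q)\<^sup>2)"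
proof -
  have "(\<Sum>q\<in>Q. F q)\<^sup>2 = (\<Sum>p\<in>Q. \<Sum>q\<in>Q. F p * F q)" by (simp add: power2_eq_square sum_product)
  also have "\<dots> = (\<Sum>p\<in>Q. \<Sum>q\<in>Q. if q = p then (F p)\<^sup>2 else 0)"
    using assms(2) by (intro sum.cong refl) (auto simp: power2_eq_square)
  finally show ?thesis using assms(1) by simp
qed

lemma elementary_borel: "f \<in> elementary \<Longrightarrow> f \<in> borel_measurable borel"
  by (intro borel_measurable_continuous_onI elementary_continuous_on)

lemma indicator_cell_borel: "(indicator (cell m p) :: real ^ 'n \<Rightarrow> real) \<in> borel_measurable borel"
  using open_cell[of m p] by (intro borel_measurable_indicator) auto

lemma bump_borel: "bump m p \<in> borel_measurable borel"
  by (intro elementary_borel bump_elementary)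

section \<open>Occupation times of cells and moments of the integrals of bumps\<close>

context brownian
begin

context
  fixes \<alpha> T :: real
  assumes \<alpha>: "0 < \<alpha>" and T: "0 < T"
begin

lemma rsum_eq: "rsum f (\<lambda>t. X t \<omega>) (\<lambda>t. Z t \<omega>) \<alpha> T n = (\<Sum>k<2^n. f (Xv \<alpha> T n \<omega> k) * dZ \<alpha> T n k \<omega>)"
  by (simp add: rsum_def Xv_def dZ_def)

lemma tsum_eq: "tsum f (\<lambda>t. X t \<omega>) \<alpha> T n = (\<Sum>k<2^n. T / 2 ^ n * f (Xv \<alpha> T n \<omega> k))"
  by (simp add: tsum_def Xv_def)

lemma coord_measurable:
  assumes "f \<in> borel_measurable borel" "k < 2 ^ n"
  shows "(\<lambda>\<xi>. f (\<xi> k)) \<in> borel_measurable (paths n)"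
  using assms by (intro measurable_compose[OF _ assms(1)] measurable_component_singleton) auto

lemma tsum_measurable:
  assumes "f \<in> borel_measurable borel"
  shows "(\<lambda>\<omega>. tsum f (\<lambda>t. X t \<omega>) \<alpha> T n) \<in> borel_measurable M"
  unfolding tsum_def using X_measurable[OF grid_nonneg[OF \<alpha> T]]
  by (intro borel_measurable_sum borel_measurable_times borel_measurable_const measurable_compose[OF _ assms])

lemma rsum_measurable:
  assumes "f \<in> borel_measurable borel"
  shows "(\<lambda>\<omega>. rsum f (\<lambda>t. X t \<omega>) (\<lambda>t. Z t \<omega>) \<alpha> T n) \<in> borel_measurable M"
  unfolding rsum_def using X_measurable[OF grid_nonneg[OF \<alpha> T]] W_component_measurable[OF grid_nonneg[OF \<alpha> T]]
  by (intro borel_measurable_sum borel_measurable_times borel_measurable_diff measurable_compose[OF _ assms])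

abbreviation "occ m p n \<omega> \<equiv> tsum (indicator (cell m p)) (\<lambda>t. X t \<omega>) \<alpha> T n"

lemma occ_nonneg: "0 \<le> occ m p n \<omega>"
  using T by (intro tsum_nonneg) auto

lemma prob_close_grid:
  assumes r: "0 < r"
  shows "prob {\<omega> \<in> space M. close r (X (grid \<alpha> T n k) \<omega>) (X (grid \<alpha> T n l) \<omega>)} \<le>
     close_bound r (T / 2 ^ n * \<bar>real k - real l\<bar>)"
proof -
  have *: "prob {\<omega> \<in> space M. close r (X (grid \<alpha> T n k) \<omega>) (X (grid \<alpha> T n l) \<omega>)} \<le>
     close_bound r (T / 2 ^ n * \<bar>real k - real l\<bar>)" if "k \<le> l" for k l
  proof -
    have "grid \<alpha> T n l - grid \<alpha> T n k = T / 2 ^ n * \<bar>real k - real l\<bar>"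
      using that by (simp add: grid_def field_simps)
    then show ?thesis
      using prob_close[OF grid_nonneg[OF \<alpha> T] grid_mono[OF less_imp_le[OF T] that] r, of n] by simp
  qed
  show ?thesis
    using *[of k l] *[of l k] by (cases "k \<le> l") (auto simp: close_sym abs_minus_commute)
qed

text \<open>For each order of the three times, the two increments adjacent to the middle one are
  independent, which gives one of the three products. The order is not known beforehand, so all
  three nonnegative products are added.\<close>

lemma prob_close_grid3:
  fixes n
  assumes r: "0 < r"
  defines "g \<equiv> \<lambda>k l. close_bound r (T / 2 ^ n * \<bar>real k - real l\<bar>)" and "x \<equiv> \<lambda>k. X (grid \<alpha> T n k)"
  shows "prob {\<omega> \<in> space M. close r (x k \<omega>) (x l \<omega>) \<and> close r (x l \<omega>) (x j \<omega>) \<and> close r (x k \<omega>) (x j \<omega>)} \<le>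
    g k l * g l j + g k j * g j l + g l k * g k j"
proof -
  let ?P = "\<lambda>k l j. prob {\<omega> \<in> space M. close r (x k \<omega>) (x l \<omega>) \<and> close r (x l \<omega>) (x j \<omega>) \<and> close r (x k \<omega>) (x j \<omega>)}"
  have g0: "0 \<le> g k l" for k l by (simp add: g_def close_bound_nonneg)
  have gs: "g k l = g l k" for k l by (simp add: g_def abs_minus_commute)
  have *: "?P k l j \<le> g k l * g l j" if "k \<le> l" "l \<le> j" for k l j
  proof -
    have d: "grid \<alpha> T n b - grid \<alpha> T n a = T / 2 ^ n * \<bar>real a - real b\<bar>" if "a \<le> b" for a b
      using that by (simp add: grid_def field_simps)
    have "?P k l j \<le> prob {\<omega> \<in> space M. close r (x k \<omega>) (x l \<omega>) \<and> close r (x l \<omega>) (x j \<omega>)}"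
    proof (intro finite_measure_mono)
      have "{\<omega> \<in> space M. close r (x k \<omega>) (x l \<omega>) \<and> close r (x l \<omega>) (x j \<omega>)} =
         {\<omega> \<in> space M. close r (x k \<omega>) (x l \<omega>)} \<inter> {\<omega> \<in> space M. close r (x l \<omega>) (x j \<omega>)}" by auto
      also have "\<dots> \<in> sets M" unfolding x_def by (intro sets.Int close_measurable grid_nonneg[OF \<alpha> T])
      finally show "{\<omega> \<in> space M. close r (x k \<omega>) (x l \<omega>) \<and> close r (x l \<omega>) (x j \<omega>)} \<in> sets M" .
    qed auto
    also have "\<dots> \<le> g k l * g l j"
      using prob_close_close[OF grid_nonneg[OF \<alpha> T] grid_mono[OF less_imp_le[OF T] that(1)] grid_mono[OF less_imp_le[OF T] that(2)] r, of n]
      unfolding x_def g_def d[OF that(1)] d[OF that(2)] .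
    finally show ?thesis .
  qed
  have perm: "?P k l j = ?P k j l" "?P k l j = ?P l k j" for k l j
    by (intro arg_cong[where f = prob]; use close_sym[of r] in blast)+
  have pos: "0 \<le> g a b * g c d" for a b c d using g0 by simp
  consider "k \<le> l \<and> l \<le> j" | "j \<le> l \<and> l \<le> k" | "k \<le> j \<and> j \<le> l" | "l \<le> j \<and> j \<le> k"
    | "l \<le> k \<and> k \<le> j" | "j \<le> k \<and> k \<le> l" by linarith
  then have "?P k l j \<le> g k l * g l j \<or> ?P k l j \<le> g k j * g j l \<or> ?P k l j \<le> g l k * g k j"
  proof cases
    case 1 then show ?thesis using *[of k l j] by auto
  next
    case 2 then show ?thesis using *[of j l k] perm(1)[of j l k] perm(2)[of j k l] perm(1)[of k j l]
      by (auto simp: gs[of j l] gs[of l k] mult.commute)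
  next
    case 3 then show ?thesis using *[of k j l] perm(1)[of k j l] by auto
  next
    case 4 then show ?thesis using *[of l j k] perm(1)[of l j k] perm(2)[of l k j] by (auto simp: gs[of l j] gs[of j k] mult.commute)
  next
    case 5 then show ?thesis using *[of l k j] perm(2)[of l k j] by auto
  next
    case 6 then show ?thesis using *[of j k l] perm(2)[of j k l] perm(1)[of k j l] by (auto simp: gs[of j k] gs[of k l] mult.commute)
  qed
  then show ?thesis using pos[of k l l j] pos[of k j j l] pos[of l k k j] by linarith
qed

lemma nn_integral_sum_indicator:
  assumes "finite I" "\<And>i. i \<in> I \<Longrightarrow> 0 \<le> c i" "\<And>i. i \<in> I \<Longrightarrow> A i \<in> sets M"
  shows "(\<integral>\<^sup>+\<omega>. ennreal (\<Sum>i\<in>I. c i * indicator (A i) \<omega>) \<partial>M) = ennreal (\<Sum>i\<in>I. c i * prob (A i))"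
proof -
  have "integrable M (\<lambda>\<omega>. c i * indicator (A i) \<omega>)" if "i \<in> I" for i
    using assms(3)[OF that] by (intro integrable_mult_right integrable_real_indicator) (auto simp: less_top[symmetric])
  moreover from this have "(\<integral>\<omega>. (\<Sum>i\<in>I. c i * indicator (A i) \<omega>) \<partial>M) = (\<Sum>i\<in>I. c i * prob (A i))"
    using assms(3) by (subst Bochner_Integration.integral_sum) (auto intro!: sum.cong)
  ultimately show ?thesis
    using assms(2) by (subst nn_integral_eq_integral) (auto intro!: sum_nonneg)
qed

text \<open>The square of an occupation time counts pairs of times in one cell. Over disjoint cells
  every pair is counted at most once, and only when the two positions are close. For each first
  time, the second contributes time of order 4^-m, so the number of cells does not enter.\<close>

lemma occupation_square:
  assumes Q: "finite Q"
  shows "(\<integral>\<^sup>+\<omega>. ennreal (\<Sum>q\<in>Q. (occ m (\<theta>, q) n \<omega>)\<^sup>2) \<partial>M) \<le> ennreal (8 * T * (T / 2 ^ n + 1 / 4 ^ m))"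
proof -
  define \<tau> where "\<tau> = T / 2 ^ n"
  have \<tau>: "0 < \<tau>" using T by (simp add: \<tau>_def)
  define r :: real where "r = 1 / 2 ^ m"
  have r: "0 < r" "r\<^sup>2 = 1 / 4 ^ m"
    by (simp_all add: r_def power_divide power2_eq_square flip: power_mult_distrib)
  define A where "A i = {\<omega> \<in> space M. close r (X (grid \<alpha> T n (fst i)) \<omega>) (X (grid \<alpha> T n (snd i)) \<omega>)}" for i
  define I where "I = {..<(2::nat) ^ n} \<times> {..<(2::nat) ^ n}"
  have pt: "(\<Sum>q\<in>Q. (occ m (\<theta>, q) n \<omega>)\<^sup>2) \<le> (\<Sum>i\<in>I. \<tau>\<^sup>2 * indicator (A i) \<omega>)" if "\<omega> \<in> space M" for \<omega>
  proof -
    let ?i = "\<lambda>q k. indicator (cell m (\<theta>, q)) (X (grid \<alpha> T n k) \<omega>) :: real"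
    have "(\<Sum>q\<in>Q. (occ m (\<theta>, q) n \<omega>)\<^sup>2) = (\<Sum>q\<in>Q. \<Sum>i\<in>I. \<tau>\<^sup>2 * (?i q (fst i) * ?i q (snd i)))"
      unfolding tsum_def \<tau>_def[symmetric] I_def power2_eq_square sum_product sum.cartesian_product
      by (intro sum.cong refl) (auto simp: split_beta mult_ac)
    also have "\<dots> = (\<Sum>i\<in>I. \<tau>\<^sup>2 * (\<Sum>q\<in>Q. ?i q (fst i) * ?i q (snd i)))"
      by (subst sum.swap) (simp add: sum_distrib_left)
    also have "\<dots> \<le> (\<Sum>i\<in>I. \<tau>\<^sup>2 * indicator (A i) \<omega>)"
    proof (intro sum_mono mult_left_mono)
      fix i
      show "(\<Sum>q\<in>Q. ?i q (fst i) * ?i q (snd i)) \<le> indicator (A i) \<omega>"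
      proof (rule sum_cells_indicator_le[OF Q, where v = "X (grid \<alpha> T n (fst i)) \<omega>" and m = m and \<theta> = \<theta>])
        fix q assume "?i q (fst i) * ?i q (snd i) \<noteq> 0"
        then have c: "X (grid \<alpha> T n (fst i)) \<omega> \<in> cell m (\<theta>, q)" "X (grid \<alpha> T n (snd i)) \<omega> \<in> cell m (\<theta>, q)"
          by (auto simp: indicator_def split: if_splits)
        then have "\<omega> \<in> A i" using that cell_close[OF c] by (simp add: A_def r_def)
        then show "X (grid \<alpha> T n (fst i)) \<omega> \<in> cell m (\<theta>, q) \<and> ?i q (fst i) * ?i q (snd i) \<le> indicator (A i) \<omega>"
          using c by simp
      qed simp
    qed simp
    finally show ?thesis .
  qed
  have "(\<integral>\<^sup>+\<omega>. ennreal (\<Sum>q\<in>Q. (occ m (\<theta>, q) n \<omega>)\<^sup>2) \<partial>M) \<le> (\<integral>\<^sup>+\<omega>. ennreal (\<Sum>i\<in>I. \<tau>\<^sup>2 * indicator (A i) \<omega>) \<partial>M)"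
    using pt by (intro nn_integral_mono ennreal_leI)
  also have "\<dots> = ennreal (\<Sum>i\<in>I. \<tau>\<^sup>2 * prob (A i))"
    by (intro nn_integral_sum_indicator) (auto simp: I_def A_def intro!: close_measurable grid_nonneg[OF \<alpha> T])
  also have "(\<Sum>i\<in>I. \<tau>\<^sup>2 * prob (A i)) \<le> (\<Sum>i\<in>I. \<tau>\<^sup>2 * close_bound r (\<tau> * \<bar>real (fst i) - real (snd i)\<bar>))"
    unfolding A_def \<tau>_def by (intro sum_mono mult_left_mono prob_close_grid r) auto
  also have "\<dots> = (\<Sum>k<2^n. \<tau> * (\<Sum>l<2^n. \<tau> * close_bound r (\<tau> * \<bar>real k - real l\<bar>)))"
    unfolding I_def sum_distrib_left sum.cartesian_product
    by (intro sum.cong refl) (auto simp: power2_eq_square)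
  also have "\<dots> \<le> (\<Sum>k<(2::nat)^n. \<tau> * (8 * (\<tau> + r\<^sup>2)))"
    using \<tau> r by (intro sum_mono mult_left_mono sum_close_bound_abs_le) auto
  also have "\<dots> = 8 * T * (T / 2 ^ n + 1 / 4 ^ m)" by (simp add: \<tau>_def r(2))
  finally show ?thesis by (simp add: ennreal_leI)
qed

text \<open>The same count with triples of times in one cell, so that two time differences are now
  small and the order is 16^-m. The constant is 3 products of probabilities times 8^2.\<close>

lemma occupation_cube:
  assumes Q: "finite Q"
  shows "(\<integral>\<^sup>+\<omega>. ennreal (\<Sum>q\<in>Q. (occ m (\<theta>, q) n \<omega>) ^ 3) \<partial>M) \<le> ennreal (192 * T * (T / 2 ^ n + 1 / 4 ^ m)\<^sup>2)"
proof -
  define \<tau> where "\<tau> = T / 2 ^ n"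
  have \<tau>: "0 < \<tau>" using T by (simp add: \<tau>_def)
  define r :: real where "r = 1 / 2 ^ m"
  have r: "0 < r" "r\<^sup>2 = 1 / 4 ^ m"
    by (simp_all add: r_def power_divide power2_eq_square flip: power_mult_distrib)
  define x where "x k = X (grid \<alpha> T n k)" for k
  define A where "A i = {\<omega> \<in> space M. close r (x (fst i) \<omega>) (x (fst (snd i)) \<omega>) \<and>
     close r (x (fst (snd i)) \<omega>) (x (snd (snd i)) \<omega>) \<and> close r (x (fst i) \<omega>) (x (snd (snd i)) \<omega>)}" for i
  define N :: nat where "N = 2 ^ n"
  define I where "I = {..<N} \<times> {..<N} \<times> {..<N}"
  have sum_I: "(\<Sum>i\<in>I. f i) = (\<Sum>k<N. \<Sum>l<N. \<Sum>j<N. f (k, l, j))" for f :: "_ \<Rightarrow> real"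
    unfolding I_def by (simp add: sum.cartesian_product split_beta)
  have A: "A i \<in> sets M" for i
  proof -
    have "A i = {\<omega> \<in> space M. close r (x (fst i) \<omega>) (x (fst (snd i)) \<omega>)} \<inter>
      {\<omega> \<in> space M. close r (x (fst (snd i)) \<omega>) (x (snd (snd i)) \<omega>)} \<inter> {\<omega> \<in> space M. close r (x (fst i) \<omega>) (x (snd (snd i)) \<omega>)}"
      by (auto simp: A_def)
    also have "\<dots> \<in> sets M" unfolding x_def by (intro sets.Int close_measurable grid_nonneg[OF \<alpha> T])
    finally show ?thesis .
  qed
  have pt: "(\<Sum>q\<in>Q. (occ m (\<theta>, q) n \<omega>) ^ 3) \<le> (\<Sum>i\<in>I. \<tau> ^ 3 * indicator (A i) \<omega>)" if "\<omega> \<in> space M" for \<omega>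
  proof -
    let ?i = "\<lambda>q k. indicator (cell m (\<theta>, q)) (x k \<omega>) :: real"
    have "(occ m (\<theta>, q) n \<omega>) ^ 3 = (\<Sum>i\<in>I. \<tau> ^ 3 * (?i q (fst i) * ?i q (fst (snd i)) * ?i q (snd (snd i))))" for q
    proof -
      have "(occ m (\<theta>, q) n \<omega>) ^ 3 = (\<Sum>k<N. \<tau> * ?i q k) * ((\<Sum>l<N. \<tau> * ?i q l) * (\<Sum>j<N. \<tau> * ?i q j))"
        by (simp add: tsum_def \<tau>_def x_def N_def power3_eq_cube mult_ac)
      also have "\<dots> = (\<Sum>k<N. \<Sum>l<N. \<Sum>j<N. (\<tau> * ?i q k) * ((\<tau> * ?i q l) * (\<tau> * ?i q j)))"
        unfolding sum_product by (simp only: sum_distrib_left)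
      finally show ?thesis unfolding sum_I by (simp add: power3_eq_cube mult_ac)
    qed
    then have "(\<Sum>q\<in>Q. (occ m (\<theta>, q) n \<omega>) ^ 3) = (\<Sum>i\<in>I. \<tau> ^ 3 * (\<Sum>q\<in>Q. ?i q (fst i) * ?i q (fst (snd i)) * ?i q (snd (snd i))))"
      by (simp only: sum_distrib_left) (rule sum.swap)
    also have "\<dots> \<le> (\<Sum>i\<in>I. \<tau> ^ 3 * indicator (A i) \<omega>)"
    proof (intro sum_mono mult_left_mono)
      fix i
      show "(\<Sum>q\<in>Q. ?i q (fst i) * ?i q (fst (snd i)) * ?i q (snd (snd i))) \<le> indicator (A i) \<omega>"
      proof (rule sum_cells_indicator_le[OF Q, where v = "x (fst i) \<omega>" and m = m and \<theta> = \<theta>])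
        fix q assume "?i q (fst i) * ?i q (fst (snd i)) * ?i q (snd (snd i)) \<noteq> 0"
        then have c: "x (fst i) \<omega> \<in> cell m (\<theta>, q)" "x (fst (snd i)) \<omega> \<in> cell m (\<theta>, q)" "x (snd (snd i)) \<omega> \<in> cell m (\<theta>, q)"
          by (auto simp: indicator_def split: if_splits)
        then have "\<omega> \<in> A i" using that cell_close[OF c(1,2)] cell_close[OF c(2,3)] cell_close[OF c(1,3)] by (simp add: A_def r_def)
        then show "x (fst i) \<omega> \<in> cell m (\<theta>, q) \<and> ?i q (fst i) * ?i q (fst (snd i)) * ?i q (snd (snd i)) \<le> indicator (A i) \<omega>"
          using c by simp
      qed simp
    qed (use \<tau> in simp)
    finally show ?thesis .
  qed
  define g where "g k l = close_bound r (\<tau> * \<bar>real k - real l\<bar>)" for k l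
  have gs: "g k l = g l k" for k l by (simp add: g_def abs_minus_commute)
  have g0: "0 \<le> g k l" for k l by (simp add: g_def close_bound_nonneg)
  define s where "s = 8 * (\<tau> + r\<^sup>2)"
  have s0: "0 \<le> s" using \<tau> by (simp add: s_def)
  have row: "(\<Sum>l<N. \<tau> * g k l) \<le> s" if "k < N" for k
    unfolding g_def s_def using sum_close_bound_abs_le[OF r(1) \<tau> that] .
  \<comment> \<open>Fixing the middle time separates the two outer sums, each of which is a row sum
    already bounded by s.\<close>
  have mid: "(\<Sum>l<N. \<Sum>k<N. \<Sum>j<N. \<tau> ^ 3 * (g l k * g l j)) \<le> T * s\<^sup>2"
  proof -
    have "(\<Sum>l<N. \<Sum>k<N. \<Sum>j<N. \<tau> ^ 3 * (g l k * g l j)) = (\<Sum>l<N. \<tau> * ((\<Sum>k<N. \<tau> * g l k) * (\<Sum>j<N. \<tau> * g l j)))"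
      by (simp add: sum_product sum_distrib_left power3_eq_cube mult_ac)
    also have "\<dots> \<le> (\<Sum>l<N. \<tau> * (s * s))"
      using \<tau> g0 s0 by (intro sum_mono mult_left_mono mult_mono row sum_nonneg) auto
    also have "\<dots> = T * s\<^sup>2" by (simp add: N_def \<tau>_def power2_eq_square)
    finally show ?thesis .
  qed
  have "(\<integral>\<^sup>+\<omega>. ennreal (\<Sum>q\<in>Q. (occ m (\<theta>, q) n \<omega>) ^ 3) \<partial>M) \<le> (\<integral>\<^sup>+\<omega>. ennreal (\<Sum>i\<in>I. \<tau> ^ 3 * indicator (A i) \<omega>) \<partial>M)"
    using pt by (intro nn_integral_mono ennreal_leI)
  also have "\<dots> = ennreal (\<Sum>i\<in>I. \<tau> ^ 3 * prob (A i))"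
    using \<tau> by (intro nn_integral_sum_indicator A) (auto simp: I_def)
  also have "(\<Sum>i\<in>I. \<tau> ^ 3 * prob (A i)) \<le> (\<Sum>i\<in>I. \<tau> ^ 3 * (g (fst i) (fst (snd i)) * g (fst (snd i)) (snd (snd i))
      + g (fst i) (snd (snd i)) * g (snd (snd i)) (fst (snd i)) + g (fst (snd i)) (fst i) * g (fst i) (snd (snd i))))"
    unfolding A_def x_def g_def \<tau>_def using T by (intro sum_mono mult_left_mono prob_close_grid3 r) auto
  also have "\<dots> = (\<Sum>l<N. \<Sum>k<N. \<Sum>j<N. \<tau> ^ 3 * (g l k * g l j)) + (\<Sum>l<N. \<Sum>k<N. \<Sum>j<N. \<tau> ^ 3 * (g l k * g l j))
      + (\<Sum>l<N. \<Sum>k<N. \<Sum>j<N. \<tau> ^ 3 * (g l k * g l j))"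
  proof -
    have 1: "(\<Sum>k<N. \<Sum>l<N. \<Sum>j<N. \<tau> ^ 3 * (g k l * g l j)) = (\<Sum>l<N. \<Sum>k<N. \<Sum>j<N. \<tau> ^ 3 * (g l k * g l j))"
      by (subst sum.swap) (simp add: gs)
    have 2: "(\<Sum>k<N. \<Sum>l<N. \<Sum>j<N. \<tau> ^ 3 * (g k j * g j l)) = (\<Sum>l<N. \<Sum>k<N. \<Sum>j<N. \<tau> ^ 3 * (g l k * g l j))"
    proof -
      have "(\<Sum>k<N. \<Sum>l<N. \<Sum>j<N. \<tau> ^ 3 * (g k j * g j l)) = (\<Sum>k<N. \<Sum>j<N. \<Sum>l<N. \<tau> ^ 3 * (g k j * g j l))"
        by (intro sum.cong refl sum.swap)
      also have "\<dots> = (\<Sum>j<N. \<Sum>k<N. \<Sum>l<N. \<tau> ^ 3 * (g k j * g j l))" by (rule sum.swap)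
      finally show ?thesis by (simp add: gs)
    qed
    have 3: "(\<Sum>k<N. \<Sum>l<N. \<Sum>j<N. \<tau> ^ 3 * (g l k * g k j)) = (\<Sum>l<N. \<Sum>k<N. \<Sum>j<N. \<tau> ^ 3 * (g l k * g l j))"
      by (intro sum.cong refl) (simp add: gs)
    show ?thesis unfolding sum_I by (simp add: distrib_left sum.distrib 1 2 3)
  qed
  also have "\<dots> \<le> T * s\<^sup>2 + T * s\<^sup>2 + T * s\<^sup>2" by (intro add_mono mid)
  also have "\<dots> = 192 * T * (T / 2 ^ n + 1 / 4 ^ m)\<^sup>2"
    unfolding s_def r(2) \<tau>_def power_mult_distrib by simp
  finally show ?thesis by (simp add: ennreal_leI)
qed

lemma nn_integral_sum_real:
  assumes "finite Q" "\<And>q \<omega>. q \<in> Q \<Longrightarrow> 0 \<le> f q \<omega>" "\<And>q. q \<in> Q \<Longrightarrow> f q \<in> borel_measurable M"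
  shows "(\<integral>\<^sup>+\<omega>. ennreal (\<Sum>q\<in>Q. f q \<omega>) \<partial>M) = (\<Sum>q\<in>Q. \<integral>\<^sup>+\<omega>. ennreal (f q \<omega>) \<partial>M)"
proof -
  have "(\<integral>\<^sup>+\<omega>. ennreal (\<Sum>q\<in>Q. f q \<omega>) \<partial>M) = (\<integral>\<^sup>+\<omega>. (\<Sum>q\<in>Q. ennreal (f q \<omega>)) \<partial>M)"
    using assms(2) by (simp add: sum_ennreal)
  then show ?thesis using assms(3) by (subst (asm) nn_integral_sum) auto
qed

abbreviation "bsum m p n \<omega> \<equiv> rsum (bump m p) (\<lambda>t. X t \<omega>) (\<lambda>t. Z t \<omega>) \<alpha> T n"

lemma bump_square_sum_le_occ: "T / 2 ^ n * (\<Sum>k<2^n. (bump m p (Xv \<alpha> T n \<omega> k))\<^sup>2) \<le> occ m p n \<omega>"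
  unfolding tsum_eq sum_distrib_left using T by (intro sum_mono mult_left_mono bump_square_le_indicator) auto

lemma bump_square_sum_nonneg: "0 \<le> T / 2 ^ n * (\<Sum>k<2^n. (bump m p (Xv \<alpha> T n \<omega> k))\<^sup>2)"
  using T by (intro mult_nonneg_nonneg sum_nonneg) auto

text \<open>Given X, the fourth moment is three times the squared variance, and the variance is at
  most the occupation time because bumps are at most 1.\<close>

lemma fourth_moment_cells:
  assumes Q: "finite Q"
  shows "(\<integral>\<^sup>+\<omega>. ennreal (\<Sum>q\<in>Q. (bsum m (\<theta>, q) n \<omega>) ^ 4) \<partial>M) \<le> ennreal (3 * (8 * T * (T / 2 ^ n + 1 / 4 ^ m)))"
proof -
  have "(\<integral>\<^sup>+\<omega>. ennreal (\<Sum>q\<in>Q. (bsum m (\<theta>, q) n \<omega>) ^ 4) \<partial>M) = (\<Sum>q\<in>Q. \<integral>\<^sup>+\<omega>. ennreal ((bsum m (\<theta>, q) n \<omega>) ^ 4) \<partial>M)"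
    by (intro nn_integral_sum_real Q borel_measurable_power rsum_measurable bump_borel) auto
  also have "\<dots> \<le> (\<Sum>q\<in>Q. \<integral>\<^sup>+\<omega>. ennreal (3 * (occ m (\<theta>, q) n \<omega>)\<^sup>2) \<partial>M)"
  proof (rule sum_mono)
    fix q
    have "(\<integral>\<^sup>+\<omega>. ennreal ((bsum m (\<theta>, q) n \<omega>) ^ 4) \<partial>M) \<le>
      (\<integral>\<^sup>+\<omega>. ennreal (3 * (T / 2 ^ n * (\<Sum>k<2^n. (bump m (\<theta>, q) (Xv \<alpha> T n \<omega> k))\<^sup>2))\<^sup>2) \<partial>M)"
      unfolding rsum_eq by (intro fourth_moment \<alpha> T coord_measurable bump_borel)
    also have "\<dots> \<le> (\<integral>\<^sup>+\<omega>. ennreal (3 * (occ m (\<theta>, q) n \<omega>)\<^sup>2) \<partial>M)"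
      by (intro nn_integral_mono ennreal_leI mult_left_mono power_mono bump_square_sum_le_occ bump_square_sum_nonneg) auto
    finally show "(\<integral>\<^sup>+\<omega>. ennreal ((bsum m (\<theta>, q) n \<omega>) ^ 4) \<partial>M) \<le> (\<integral>\<^sup>+\<omega>. ennreal (3 * (occ m (\<theta>, q) n \<omega>)\<^sup>2) \<partial>M)" .
  qed
  also have "\<dots> = (\<integral>\<^sup>+\<omega>. ennreal (\<Sum>q\<in>Q. 3 * (occ m (\<theta>, q) n \<omega>)\<^sup>2) \<partial>M)"
    by (intro nn_integral_sum_real[symmetric] Q borel_measurable_times borel_measurable_power
        tsum_measurable indicator_cell_borel) auto
  also have "\<dots> = ennreal 3 * (\<integral>\<^sup>+\<omega>. ennreal (\<Sum>q\<in>Q. (occ m (\<theta>, q) n \<omega>)\<^sup>2) \<partial>M)"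
    unfolding sum_distrib_left[symmetric]
    by (subst nn_integral_cmult[symmetric])
       (auto simp: ennreal_mult' sum_nonneg intro!: measurable_compose[OF _ measurable_ennreal]
          borel_measurable_sum borel_measurable_power tsum_measurable indicator_cell_borel)
  also have "\<dots> \<le> ennreal 3 * ennreal (8 * T * (T / 2 ^ n + 1 / 4 ^ m))"
    by (intro mult_left_mono occupation_square Q) auto
  also have "\<dots> = ennreal (3 * (8 * T * (T / 2 ^ n + 1 / 4 ^ m)))"
    using T by (intro ennreal_mult[symmetric]) auto
  finally show ?thesis .
qed

lemma weighted_second_moment_cells:
  assumes Q: "finite Q"
  shows "(\<integral>\<^sup>+\<omega>. ennreal (\<Sum>q\<in>Q. occ m (\<theta>, q) n \<omega> * (bsum m (\<theta>, q) n \<omega>)\<^sup>2) \<partial>M) \<le> ennreal (8 * T * (T / 2 ^ n + 1 / 4 ^ m))"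
proof -
  have "(\<integral>\<^sup>+\<omega>. ennreal (\<Sum>q\<in>Q. occ m (\<theta>, q) n \<omega> * (bsum m (\<theta>, q) n \<omega>)\<^sup>2) \<partial>M) =
     (\<Sum>q\<in>Q. \<integral>\<^sup>+\<omega>. ennreal (occ m (\<theta>, q) n \<omega> * (bsum m (\<theta>, q) n \<omega>)\<^sup>2) \<partial>M)"
    by (intro nn_integral_sum_real Q borel_measurable_power borel_measurable_times rsum_measurable
        tsum_measurable indicator_cell_borel bump_borel mult_nonneg_nonneg occ_nonneg) auto
  also have "\<dots> \<le> (\<Sum>q\<in>Q. \<integral>\<^sup>+\<omega>. ennreal ((occ m (\<theta>, q) n \<omega>)\<^sup>2) \<partial>M)"
  proof (rule sum_mono)
    fix q
    define o' where "o' \<xi> = (\<Sum>k<2^n. T / 2 ^ n * indicator (cell m (\<theta>, q)) (\<xi> k))" for \<xi> :: "nat \<Rightarrow> real ^ 7"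
    have o': "occ m (\<theta>, q) n \<omega> = o' (Xv \<alpha> T n \<omega>)" for \<omega> by (simp add: o'_def tsum_eq)
    have [measurable]: "o' \<in> borel_measurable (paths n)" unfolding o'_def
      by (intro borel_measurable_sum borel_measurable_times borel_measurable_const coord_measurable indicator_cell_borel) auto
    have o'_nn: "0 \<le> o' \<xi>" for \<xi> unfolding o'_def using T by (intro sum_nonneg) auto
    \<comment> \<open>The weight is a function of the path of X alone, so its square root can be
      absorbed into the coefficients of the Gaussian sum.\<close>
    define a where "a \<xi> k = sqrt (o' \<xi>) * bump m (\<theta>, q) (\<xi> k)" for \<xi> :: "nat \<Rightarrow> real ^ 7" and k :: nat
    have "(\<integral>\<^sup>+\<omega>. ennreal (occ m (\<theta>, q) n \<omega> * (bsum m (\<theta>, q) n \<omega>)\<^sup>2) \<partial>M) =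
       (\<integral>\<^sup>+\<omega>. ennreal ((\<Sum>k<2^n. a (Xv \<alpha> T n \<omega>) k * dZ \<alpha> T n k \<omega>)\<^sup>2) \<partial>M)"
    proof -
      have "(\<Sum>k<2^n. a (Xv \<alpha> T n \<omega>) k * dZ \<alpha> T n k \<omega>) = sqrt (o' (Xv \<alpha> T n \<omega>)) * bsum m (\<theta>, q) n \<omega>" for \<omega>
        unfolding a_def rsum_eq sum_distrib_left by (simp add: mult_ac)
      then show ?thesis using o'_nn by (simp add: o' power_mult_distrib)
    qed
    also have "\<dots> \<le> (\<integral>\<^sup>+\<omega>. ennreal (T / 2 ^ n * (\<Sum>k<2^n. (a (Xv \<alpha> T n \<omega>) k)\<^sup>2)) \<partial>M)"
      unfolding a_def by (intro second_moment \<alpha> T borel_measurable_times coord_measurable bump_borel borel_measurable_sqrt) measurable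
    also have "\<dots> \<le> (\<integral>\<^sup>+\<omega>. ennreal ((occ m (\<theta>, q) n \<omega>)\<^sup>2) \<partial>M)"
    proof (intro nn_integral_mono ennreal_leI)
      fix \<omega>
      have "T / 2 ^ n * (\<Sum>k<2^n. (a (Xv \<alpha> T n \<omega>) k)\<^sup>2) =
         occ m (\<theta>, q) n \<omega> * (T / 2 ^ n * (\<Sum>k<2^n. (bump m (\<theta>, q) (Xv \<alpha> T n \<omega> k))\<^sup>2))"
        unfolding a_def power_mult_distrib sum_distrib_left using o'_nn by (simp add: o' mult_ac)
      also have "\<dots> \<le> occ m (\<theta>, q) n \<omega> * occ m (\<theta>, q) n \<omega>"
        by (intro mult_left_mono bump_square_sum_le_occ occ_nonneg)
      finally show "T / 2 ^ n * (\<Sum>k<2^n. (a (Xv \<alpha> T n \<omega>) k)\<^sup>2) \<le> (occ m (\<theta>, q) n \<omega>)\<^sup>2"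
        by (simp add: power2_eq_square)
    qed
    finally show "(\<integral>\<^sup>+\<omega>. ennreal (occ m (\<theta>, q) n \<omega> * (bsum m (\<theta>, q) n \<omega>)\<^sup>2) \<partial>M) \<le> (\<integral>\<^sup>+\<omega>. ennreal ((occ m (\<theta>, q) n \<omega>)\<^sup>2) \<partial>M)" .
  qed
  also have "\<dots> = (\<integral>\<^sup>+\<omega>. ennreal (\<Sum>q\<in>Q. (occ m (\<theta>, q) n \<omega>)\<^sup>2) \<partial>M)"
    by (intro nn_integral_sum_real[symmetric] Q borel_measurable_times borel_measurable_power
        tsum_measurable indicator_cell_borel) auto
  also have "\<dots> \<le> ennreal (8 * T * (T / 2 ^ n + 1 / 4 ^ m))" by (rule occupation_square[OF Q])
  finally show ?thesis .
qed

text \<open>The factor 4^m compensates the 1/4^m of the occupation bound, so that for n tending to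
  infinity the bound does not depend on m. Of the factor 4, three parts come from the fourth powers
  and one from the weighted squares; the cardinality counts the shifts.\<close>

lemma fourth_moment_bound:
  assumes U: "bounded U"
  shows "(\<integral>\<^sup>+\<omega>. ennreal (4 ^ m * (\<Sum>p\<in>{p. cell m p \<subseteq> U}. (bsum m p n \<omega>) ^ 4 + occ m p n \<omega> * (bsum m p n \<omega>)\<^sup>2)) \<partial>M) \<le>
    ennreal (4 ^ m * (real CARD(7 \<Rightarrow> bool) * (4 * (8 * T * (T / 2 ^ n + 1 / 4 ^ m)))))"
proof -
  define b where "b = 8 * T * (T / 2 ^ n + 1 / 4 ^ m)"
  have b: "0 \<le> b" using T by (simp add: b_def)
  define Q where "Q \<theta> = {q. cell m (\<theta>, q) \<subseteq> U}" for \<theta>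
  have P: "{p. cell m p \<subseteq> U} = (SIGMA \<theta>:UNIV. Q \<theta>)" by (auto simp: Q_def)
  have Q: "finite (Q \<theta>)" for \<theta>
  proof -
    have "finite (Pair \<theta> -` {p. cell m p \<subseteq> U})"
      by (intro finite_vimageI finite_cells_in_bounded U) (auto simp: inj_on_def)
    then show ?thesis by (simp add: Q_def vimage_def)
  qed
  define f where "f p \<omega> = (bsum m p n \<omega>) ^ 4 + occ m p n \<omega> * (bsum m p n \<omega>)\<^sup>2" for p \<omega>
  have f_nn: "0 \<le> f p \<omega>" for p \<omega> unfolding f_def by (intro add_nonneg_nonneg mult_nonneg_nonneg occ_nonneg) auto
  note meas = rsum_measurable[OF bump_borel, measurable] tsum_measurable[OF indicator_cell_borel, measurable]
  have f_meas[measurable]: "f p \<in> borel_measurable M" for p unfolding f_def[abs_def] by measurable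
  have \<theta>: "(\<integral>\<^sup>+\<omega>. ennreal (\<Sum>q\<in>Q \<theta>. f (\<theta>, q) \<omega>) \<partial>M) \<le> ennreal (4 * b)" for \<theta>
  proof -
    have "(\<integral>\<^sup>+\<omega>. ennreal (\<Sum>q\<in>Q \<theta>. f (\<theta>, q) \<omega>) \<partial>M) =
      (\<integral>\<^sup>+\<omega>. ennreal (\<Sum>q\<in>Q \<theta>. (bsum m (\<theta>, q) n \<omega>) ^ 4) \<partial>M) +
      (\<integral>\<^sup>+\<omega>. ennreal (\<Sum>q\<in>Q \<theta>. occ m (\<theta>, q) n \<omega> * (bsum m (\<theta>, q) n \<omega>)\<^sup>2) \<partial>M)"
      unfolding f_def sum.distrib
      by (subst nn_integral_add[symmetric]) (auto simp: ennreal_plus[symmetric] sum_nonneg occ_nonneg intro!: nn_integral_cong simp del: ennreal_plus)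
    also have "\<dots> \<le> ennreal (3 * b) + ennreal b"
      unfolding b_def by (intro add_mono fourth_moment_cells weighted_second_moment_cells Q)
    also have "\<dots> = ennreal (4 * b)" using b by (simp add: ennreal_plus[symmetric] del: ennreal_plus)
    finally show ?thesis .
  qed
  have "(\<integral>\<^sup>+\<omega>. ennreal (4 ^ m * (\<Sum>p\<in>{p. cell m p \<subseteq> U}. f p \<omega>)) \<partial>M) =
      ennreal (4 ^ m) * (\<integral>\<^sup>+\<omega>. ennreal (\<Sum>\<theta>\<in>UNIV. \<Sum>q\<in>Q \<theta>. f (\<theta>, q) \<omega>) \<partial>M)"
    unfolding P using Q f_nn
    by (subst nn_integral_cmult[symmetric]) (auto simp: sum.Sigma ennreal_mult' sum_nonneg intro!: nn_integral_cong)
  also have "(\<integral>\<^sup>+\<omega>. ennreal (\<Sum>\<theta>\<in>UNIV. \<Sum>q\<in>Q \<theta>. f (\<theta>, q) \<omega>) \<partial>M) =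
      (\<Sum>\<theta>\<in>UNIV. \<integral>\<^sup>+\<omega>. ennreal (\<Sum>q\<in>Q \<theta>. f (\<theta>, q) \<omega>) \<partial>M)"
    using f_nn by (intro nn_integral_sum_real) (auto intro!: sum_nonneg)
  also have "\<dots> \<le> (\<Sum>\<theta>\<in>(UNIV :: (7 \<Rightarrow> bool) set). ennreal (4 * b))" by (intro sum_mono \<theta>)
  also have "\<dots> = ennreal (real CARD(7 \<Rightarrow> bool) * (4 * b))"
    using b by (subst sum_ennreal) auto
  also have "ennreal (4 ^ m) * \<dots> = ennreal (4 ^ m * (real CARD(7 \<Rightarrow> bool) * (4 * b)))"
    using b by (intro ennreal_mult[symmetric]) auto
  finally show ?thesis by (simp add: f_def b_def mult_left_mono)
qed

lemma square_variance_bound: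
  assumes Q: "finite Q"
  shows "(\<integral>\<^sup>+\<omega>. ennreal ((\<Sum>q\<in>Q. (bsum m (\<theta>, q) n \<omega>)\<^sup>2 - tsum (\<lambda>v. (bump m (\<theta>, q) v)\<^sup>2) (\<lambda>t. X t \<omega>) \<alpha> T n)\<^sup>2) \<partial>M) \<le>
    ennreal (2 * (8 * T * (T / 2 ^ n + 1 / 4 ^ m)))"
proof -
  have "(\<integral>\<^sup>+\<omega>. ennreal ((\<Sum>q\<in>Q. (bsum m (\<theta>, q) n \<omega>)\<^sup>2 - tsum (\<lambda>v. (bump m (\<theta>, q) v)\<^sup>2) (\<lambda>t. X t \<omega>) \<alpha> T n)\<^sup>2) \<partial>M) \<le>
    (\<integral>\<^sup>+\<omega>. ennreal (2 * (\<Sum>q\<in>Q. (T / 2 ^ n * (\<Sum>k<2^n. (bump m (\<theta>, q) (Xv \<alpha> T n \<omega> k))\<^sup>2))\<^sup>2)) \<partial>M)"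
    unfolding rsum_eq tsum_eq sum_distrib_left[symmetric]
  proof (rule square_sum_variance[OF \<alpha> T _ Q])
    fix p q :: "7 \<Rightarrow> int" and \<xi> :: "nat \<Rightarrow> real ^ 7" and k :: nat assume "p \<noteq> q"
    then show "bump m (\<theta>, p) (\<xi> k) = 0 \<or> bump m (\<theta>, q) (\<xi> k) = 0"
      using cell_unique[of "\<xi> k" m \<theta> p q] bump_eq_0 by blast
  qed (intro coord_measurable bump_borel)
  also have "\<dots> \<le> (\<integral>\<^sup>+\<omega>. ennreal 2 * ennreal (\<Sum>q\<in>Q. (occ m (\<theta>, q) n \<omega>)\<^sup>2) \<partial>M)"
  proof (rule nn_integral_mono)
    fix \<omega>
    have "(\<Sum>q\<in>Q. (T / 2 ^ n * (\<Sum>k<2^n. (bump m (\<theta>, q) (Xv \<alpha> T n \<omega> k))\<^sup>2))\<^sup>2) \<le> (\<Sum>q\<in>Q. (occ m (\<theta>, q) n \<omega>)\<^sup>2)"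
      by (intro sum_mono power_mono bump_square_sum_le_occ bump_square_sum_nonneg)
    then have "ennreal (2 * (\<Sum>q\<in>Q. (T / 2 ^ n * (\<Sum>k<2^n. (bump m (\<theta>, q) (Xv \<alpha> T n \<omega> k))\<^sup>2))\<^sup>2)) \<le>
        ennreal (2 * (\<Sum>q\<in>Q. (occ m (\<theta>, q) n \<omega>)\<^sup>2))" by (intro ennreal_leI) simp
    also have "\<dots> = ennreal 2 * ennreal (\<Sum>q\<in>Q. (occ m (\<theta>, q) n \<omega>)\<^sup>2)"
      by (intro ennreal_mult sum_nonneg) auto
    finally show "ennreal (2 * (\<Sum>q\<in>Q. (T / 2 ^ n * (\<Sum>k<2^n. (bump m (\<theta>, q) (Xv \<alpha> T n \<omega> k))\<^sup>2))\<^sup>2)) \<le>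
      ennreal 2 * ennreal (\<Sum>q\<in>Q. (occ m (\<theta>, q) n \<omega>)\<^sup>2)" .
  qed
  also have "\<dots> = ennreal 2 * (\<integral>\<^sup>+\<omega>. ennreal (\<Sum>q\<in>Q. (occ m (\<theta>, q) n \<omega>)\<^sup>2) \<partial>M)"
    by (intro nn_integral_cmult measurable_compose[OF _ measurable_ennreal] borel_measurable_sum
        borel_measurable_power tsum_measurable indicator_cell_borel)
  also have "\<dots> \<le> ennreal 2 * ennreal (8 * T * (T / 2 ^ n + 1 / 4 ^ m))"
    by (intro mult_left_mono occupation_square Q) auto
  also have "\<dots> = ennreal (2 * (8 * T * (T / 2 ^ n + 1 / 4 ^ m)))"
    using T by (intro ennreal_mult[symmetric]) auto
  finally show ?thesis .
qed

text \<open>The time sums depend on X only, so the whole expression is one Gaussian sum given X.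
  Since the bumps have disjoint supports, its conditional variance splits over the cells, and each
  cell contributes at most a constant times the cube of its occupation time: two powers from the
  time sum and one from the bump.\<close>

lemma cross_bound:
  assumes Q: "finite Q" and \<psi>: "\<And>q. \<psi> q \<in> borel_measurable borel"
    "\<And>q v. q \<in> Q \<Longrightarrow> \<bar>\<psi> q v\<bar> \<le> \<kappa> * indicator (cell m (\<theta>, q)) v" and \<kappa>: "0 \<le> \<kappa>"
  shows "(\<integral>\<^sup>+\<omega>. ennreal ((c * (\<Sum>q\<in>Q. tsum (\<psi> q) (\<lambda>t. X t \<omega>) \<alpha> T n * bsum m (\<theta>, q) n \<omega>))\<^sup>2) \<partial>M) \<le>
    ennreal (c\<^sup>2 * \<kappa>\<^sup>2 * (192 * T * (T / 2 ^ n + 1 / 4 ^ m)\<^sup>2))"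
proof -
  define b where "b q \<xi> = (\<Sum>k<2^n. T / 2 ^ n * \<psi> q (\<xi> k))" for q and \<xi> :: "nat \<Rightarrow> real ^ 7"
  define a where "a \<xi> k = (\<Sum>q\<in>Q. c * b q \<xi> * bump m (\<theta>, q) (\<xi> k))" for \<xi> :: "nat \<Rightarrow> real ^ 7" and k :: nat
  have b: "tsum (\<psi> q) (\<lambda>t. X t \<omega>) \<alpha> T n = b q (Xv \<alpha> T n \<omega>)" for q \<omega> by (simp add: b_def tsum_eq)
  have [measurable]: "b q \<in> borel_measurable (paths n)" for q unfolding b_def
    by (intro borel_measurable_sum borel_measurable_times borel_measurable_const coord_measurable \<psi>) auto
  have b_le: "\<bar>b q (Xv \<alpha> T n \<omega>)\<bar> \<le> \<kappa> * occ m (\<theta>, q) n \<omega>" if "q \<in> Q" for q \<omega>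
  proof -
    have "\<bar>tsum (\<psi> q) (\<lambda>t. X t \<omega>) \<alpha> T n\<bar> \<le> tsum (\<lambda>v. \<bar>\<psi> q v\<bar>) (\<lambda>t. X t \<omega>) \<alpha> T n"
      using T by (intro tsum_abs) simp
    also have "\<dots> \<le> tsum (\<lambda>v. \<kappa> * indicator (cell m (\<theta>, q)) v) (\<lambda>t. X t \<omega>) \<alpha> T n"
      using T \<psi>(2)[OF that] by (intro tsum_mono) auto
    finally show ?thesis by (simp add: b tsum_cmult)
  qed
  have eq: "(c * (\<Sum>q\<in>Q. tsum (\<psi> q) (\<lambda>t. X t \<omega>) \<alpha> T n * bsum m (\<theta>, q) n \<omega>)) = (\<Sum>k<2^n. a (Xv \<alpha> T n \<omega>) k * dZ \<alpha> T n k \<omega>)" for \<omega>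
    unfolding a_def rsum_eq b sum_distrib_left sum_distrib_right by (subst sum.swap) (simp add: mult_ac)
  have "(\<integral>\<^sup>+\<omega>. ennreal ((c * (\<Sum>q\<in>Q. tsum (\<psi> q) (\<lambda>t. X t \<omega>) \<alpha> T n * bsum m (\<theta>, q) n \<omega>))\<^sup>2) \<partial>M) \<le>
     (\<integral>\<^sup>+\<omega>. ennreal (T / 2 ^ n * (\<Sum>k<2^n. (a (Xv \<alpha> T n \<omega>) k)\<^sup>2)) \<partial>M)"
    unfolding eq
    by (intro second_moment \<alpha> T, unfold a_def, intro borel_measurable_sum borel_measurable_times coord_measurable bump_borel) measurable
  also have "\<dots> \<le> (\<integral>\<^sup>+\<omega>. ennreal (c\<^sup>2 * \<kappa>\<^sup>2) * ennreal (\<Sum>q\<in>Q. (occ m (\<theta>, q) n \<omega>) ^ 3) \<partial>M)"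
  proof (intro nn_integral_mono)
    fix \<omega>
    let ?\<xi> = "Xv \<alpha> T n \<omega>"
    have "(a ?\<xi> k)\<^sup>2 = (\<Sum>q\<in>Q. (c * b q ?\<xi> * bump m (\<theta>, q) (?\<xi> k))\<^sup>2)" for k
      unfolding a_def
    proof (rule square_of_disjoint_sum[OF Q])
      fix p q :: "7 \<Rightarrow> int" assume "p \<noteq> q"
      then have "bump m (\<theta>, p) (?\<xi> k) = 0 \<or> bump m (\<theta>, q) (?\<xi> k) = 0"
        using cell_unique[of "?\<xi> k" m \<theta> p q] bump_eq_0 by blast
      then show "c * b p ?\<xi> * bump m (\<theta>, p) (?\<xi> k) = 0 \<or> c * b q ?\<xi> * bump m (\<theta>, q) (?\<xi> k) = 0" by auto
    qed
    then have "T / 2 ^ n * (\<Sum>k<2^n. (a ?\<xi> k)\<^sup>2) =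
       (\<Sum>k<2^n. \<Sum>q\<in>Q. T / 2 ^ n * (c * b q ?\<xi> * bump m (\<theta>, q) (?\<xi> k))\<^sup>2)"
      by (simp only: sum_distrib_left)
    also have "\<dots> = (\<Sum>q\<in>Q. \<Sum>k<2^n. T / 2 ^ n * (c * b q ?\<xi> * bump m (\<theta>, q) (?\<xi> k))\<^sup>2)"
      by (rule sum.swap)
    also have "\<dots> = (\<Sum>q\<in>Q. c\<^sup>2 * (b q ?\<xi>)\<^sup>2 * (T / 2 ^ n * (\<Sum>k<2^n. (bump m (\<theta>, q) (?\<xi> k))\<^sup>2)))"
      by (intro sum.cong refl) (simp add: sum_distrib_left power_mult_distrib mult_ac)
    also have "\<dots> \<le> (\<Sum>q\<in>Q. c\<^sup>2 * (\<kappa> * occ m (\<theta>, q) n \<omega>)\<^sup>2 * occ m (\<theta>, q) n \<omega>)"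
    proof (intro sum_mono mult_mono)
      fix q assume "q \<in> Q"
      then have "\<bar>b q ?\<xi>\<bar> \<le> \<bar>\<kappa> * occ m (\<theta>, q) n \<omega>\<bar>" using b_le[of q \<omega>] by linarith
      then show "(b q ?\<xi>)\<^sup>2 \<le> (\<kappa> * occ m (\<theta>, q) n \<omega>)\<^sup>2" by (simp only: abs_le_square_iff)
    qed (rule bump_square_sum_le_occ bump_square_sum_nonneg | simp)+
    also have "\<dots> = (c\<^sup>2 * \<kappa>\<^sup>2) * (\<Sum>q\<in>Q. (occ m (\<theta>, q) n \<omega>) ^ 3)"
      by (simp add: sum_distrib_left power_mult_distrib power2_eq_square power3_eq_cube mult_ac)
    finally show "ennreal (T / 2 ^ n * (\<Sum>k<2^n. (a ?\<xi> k)\<^sup>2)) \<le> ennreal (c\<^sup>2 * \<kappa>\<^sup>2) * ennreal (\<Sum>q\<in>Q. (occ m (\<theta>, q) n \<omega>) ^ 3)"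
      by (subst ennreal_mult[symmetric]) (auto intro!: ennreal_leI sum_nonneg occ_nonneg zero_le_power)
  qed
  also have "\<dots> = ennreal (c\<^sup>2 * \<kappa>\<^sup>2) * (\<integral>\<^sup>+\<omega>. ennreal (\<Sum>q\<in>Q. (occ m (\<theta>, q) n \<omega>) ^ 3) \<partial>M)"
    by (intro nn_integral_cmult measurable_compose[OF _ measurable_ennreal] borel_measurable_sum
        borel_measurable_power tsum_measurable indicator_cell_borel)
  also have "\<dots> \<le> ennreal (c\<^sup>2 * \<kappa>\<^sup>2) * ennreal (192 * T * (T / 2 ^ n + 1 / 4 ^ m)\<^sup>2)"
    by (intro mult_left_mono occupation_cube Q) auto
  also have "\<dots> = ennreal (c\<^sup>2 * \<kappa>\<^sup>2 * (192 * T * (T / 2 ^ n + 1 / 4 ^ m)\<^sup>2))"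
    using T by (intro ennreal_mult[symmetric]) auto
  finally show ?thesis .
qed

end

end

lemma sum_lessThan_double:
  fixes h :: "nat \<Rightarrow> 'a::comm_monoid_add"
  shows "(\<Sum>j<2 * N. h j) = (\<Sum>k<N. h (2 * k) + h (Suc (2 * k)))"
  by (induction N) (auto simp: add_ac)

section \<open>Almost sure limits on a single window\<close>

context brownian
begin

context
  fixes \<alpha> T :: real
  assumes \<alpha>: "0 < \<alpha>" and T: "0 < T"
begin

lemma tendsto_time_step: "(\<lambda>n. T / 2 ^ n) \<longlonglongrightarrow> 0"
  by (rule LIMSEQ_divide_realpow_zero) simp

lemma AE_square_var:
  assumes Q: "\<And>m. finite (Q m)"
  shows "AE \<omega> in M. \<forall>e>0. \<forall>\<^sub>F m in sequentially. \<exists>\<^sub>F n in sequentially.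
    \<bar>\<Sum>q\<in>Q m. (rsum (bump m (\<theta>, q)) (\<lambda>t. X t \<omega>) (\<lambda>t. Z t \<omega>) \<alpha> T n)\<^sup>2 - tsum (\<lambda>v. (bump m (\<theta>, q) v)\<^sup>2) (\<lambda>t. X t \<omega>) \<alpha> T n\<bar> \<le> e"
proof -
  define Y where "Y m n \<omega> = (\<Sum>q\<in>Q m. (rsum (bump m (\<theta>, q)) (\<lambda>t. X t \<omega>) (\<lambda>t. Z t \<omega>) \<alpha> T n)\<^sup>2 - tsum (\<lambda>v. (bump m (\<theta>, q) v)\<^sup>2) (\<lambda>t. X t \<omega>) \<alpha> T n)" for m n \<omega>
  have meas: "Y m n \<in> borel_measurable M" for m n
    unfolding Y_def[abs_def]
    by (intro borel_measurable_sum borel_measurable_diff borel_measurable_power rsum_measurable tsum_measurable \<alpha> T bump_borel)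
  have "AE \<omega> in M. \<forall>e>0. \<forall>\<^sub>F m in sequentially. \<exists>\<^sub>F n in sequentially. ennreal ((Y m n \<omega>)\<^sup>2) \<le> ennreal e"
  proof (rule AE_liminf_tendsto_0)
    show "(\<integral>\<^sup>+\<omega>. ennreal ((Y m n \<omega>)\<^sup>2) \<partial>M) \<le> ennreal (2 * (8 * T * (T / 2 ^ n + 1 / 4 ^ m)))" for m n
      unfolding Y_def by (rule square_variance_bound[OF \<alpha> T Q])
    have "(\<lambda>n. 2 * (8 * T * (T / 2 ^ n + 1 / 4 ^ m))) \<longlonglongrightarrow> 2 * (8 * T * (0 + 1 / 4 ^ m))" for m
      by (intro tendsto_intros tendsto_time_step)
    then show "(\<lambda>n. 2 * (8 * T * (T / 2 ^ n + 1 / 4 ^ m))) \<longlonglongrightarrow> 16 * T * (1 / 4) ^ m" for m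
      by (simp add: power_divide)
  qed (use T meas in auto)
  then show ?thesis
  proof eventually_elim
    case (elim \<omega>)
    show ?case
    proof (intro allI impI)
      fix e :: real assume e: "0 < e"
      with elim have "\<forall>\<^sub>F m in sequentially. \<exists>\<^sub>F n in sequentially. ennreal ((Y m n \<omega>)\<^sup>2) \<le> ennreal (e\<^sup>2)" by simp
      then have "\<forall>\<^sub>F m in sequentially. \<exists>\<^sub>F n in sequentially. \<bar>Y m n \<omega>\<bar> \<le> e"
        by (rule eventually_mono, elim frequently_elim1) (use e in \<open>auto simp: abs_le_square_iff[symmetric]\<close>)
      then show "\<forall>\<^sub>F m in sequentially. \<exists>\<^sub>F n in sequentially.
        \<bar>\<Sum>q\<in>Q m. (rsum (bump m (\<theta>, q)) (\<lambda>t. X t \<omega>) (\<lambda>t. Z t \<omega>) \<alpha> T n)\<^sup>2 - tsum (\<lambda>v. (bump m (\<theta>, q) v)\<^sup>2) (\<lambda>t. X t \<omega>) \<alpha> T n\<bar> \<le> e"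
        unfolding Y_def .
    qed
  qed
qed

text \<open>The prefactor 2^m contributes 4^m to the second moment, while the cubes of the
  occupation times are of order 16^-m. The product 4^-m is still summable.\<close>

lemma AE_cross_var:
  assumes Q: "\<And>m. finite (Q m)" and \<psi>: "\<And>m q. \<psi> m q \<in> borel_measurable borel"
    "\<And>m q v. q \<in> Q m \<Longrightarrow> \<bar>\<psi> m q v\<bar> \<le> \<kappa> * indicator (cell m (\<theta>, q)) v" and \<kappa>: "0 \<le> \<kappa>"
  shows "AE \<omega> in M. \<forall>e>0. \<forall>\<^sub>F m in sequentially. \<exists>\<^sub>F n in sequentially.
    \<bar>2 ^ m * (\<Sum>q\<in>Q m. tsum (\<psi> m q) (\<lambda>t. X t \<omega>) \<alpha> T n * rsum (bump m (\<theta>, q)) (\<lambda>t. X t \<omega>) (\<lambda>t. Z t \<omega>) \<alpha> T n)\<bar> \<le> e"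
proof -
  define Y where "Y m n \<omega> = 2 ^ m * (\<Sum>q\<in>Q m. tsum (\<psi> m q) (\<lambda>t. X t \<omega>) \<alpha> T n * rsum (bump m (\<theta>, q)) (\<lambda>t. X t \<omega>) (\<lambda>t. Z t \<omega>) \<alpha> T n)" for m n \<omega>
  have meas: "Y m n \<in> borel_measurable M" for m n
    unfolding Y_def[abs_def]
    by (intro borel_measurable_sum borel_measurable_times borel_measurable_const rsum_measurable tsum_measurable \<alpha> T bump_borel \<psi>(1))
  have "AE \<omega> in M. \<forall>e>0. \<forall>\<^sub>F m in sequentially. \<exists>\<^sub>F n in sequentially. ennreal ((Y m n \<omega>)\<^sup>2) \<le> ennreal e"
  proof (rule AE_liminf_tendsto_0)
    show "(\<integral>\<^sup>+\<omega>. ennreal ((Y m n \<omega>)\<^sup>2) \<partial>M) \<le> ennreal ((2 ^ m)\<^sup>2 * \<kappa>\<^sup>2 * (192 * T * (T / 2 ^ n + 1 / 4 ^ m)\<^sup>2))" for m n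
      unfolding Y_def by (rule cross_bound[OF \<alpha> T Q \<psi> \<kappa>])
    have "(\<lambda>n. (2 ^ m)\<^sup>2 * \<kappa>\<^sup>2 * (192 * T * (T / 2 ^ n + 1 / 4 ^ m)\<^sup>2)) \<longlonglongrightarrow> (2 ^ m)\<^sup>2 * \<kappa>\<^sup>2 * (192 * T * (0 + 1 / 4 ^ m)\<^sup>2)" for m :: nat
      by (intro tendsto_intros tendsto_time_step)
    moreover have "(2 ^ m)\<^sup>2 * \<kappa>\<^sup>2 * (192 * T * (0 + 1 / 4 ^ m)\<^sup>2) = 192 * \<kappa>\<^sup>2 * T * (1 / 4) ^ m" for m :: nat
    proof -
      have "(4::real) ^ m = (2 ^ m)\<^sup>2" by (simp add: power2_eq_square flip: power_mult_distrib)
      then show ?thesis by (simp add: power_divide power2_eq_square)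
    qed
    ultimately show "(\<lambda>n. (2 ^ m)\<^sup>2 * \<kappa>\<^sup>2 * (192 * T * (T / 2 ^ n + 1 / 4 ^ m)\<^sup>2)) \<longlonglongrightarrow> 192 * \<kappa>\<^sup>2 * T * (1 / 4) ^ m" for m :: nat
      by metis
  qed (use T meas in auto)
  then show ?thesis
  proof eventually_elim
    case (elim \<omega>)
    show ?case
    proof (intro allI impI)
      fix e :: real assume e: "0 < e"
      with elim have "\<forall>\<^sub>F m in sequentially. \<exists>\<^sub>F n in sequentially. ennreal ((Y m n \<omega>)\<^sup>2) \<le> ennreal (e\<^sup>2)" by simp
      then have "\<forall>\<^sub>F m in sequentially. \<exists>\<^sub>F n in sequentially. \<bar>Y m n \<omega>\<bar> \<le> e"
        by (rule eventually_mono, elim frequently_elim1) (use e in \<open>auto simp: abs_le_square_iff[symmetric]\<close>)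
      then show "\<forall>\<^sub>F m in sequentially. \<exists>\<^sub>F n in sequentially.
        \<bar>2 ^ m * (\<Sum>q\<in>Q m. tsum (\<psi> m q) (\<lambda>t. X t \<omega>) \<alpha> T n * rsum (bump m (\<theta>, q)) (\<lambda>t. X t \<omega>) (\<lambda>t. Z t \<omega>) \<alpha> T n)\<bar> \<le> e"
        unfolding Y_def .
    qed
  qed
qed

lemma AE_fourth:
  assumes U: "bounded U"
  shows "AE \<omega> in M. \<exists>B. \<exists>\<^sub>F m in sequentially. \<exists>\<^sub>F n in sequentially.
    4 ^ m * (\<Sum>p\<in>{p. cell m p \<subseteq> U}. (rsum (bump m p) (\<lambda>t. X t \<omega>) (\<lambda>t. Z t \<omega>) \<alpha> T n) ^ 4 +
       tsum (indicator (cell m p)) (\<lambda>t. X t \<omega>) \<alpha> T n * (rsum (bump m p) (\<lambda>t. X t \<omega>) (\<lambda>t. Z t \<omega>) \<alpha> T n)\<^sup>2) \<le> B"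
proof -
  define Y where "Y m n \<omega> = 4 ^ m * (\<Sum>p\<in>{p. cell m p \<subseteq> U}. (rsum (bump m p) (\<lambda>t. X t \<omega>) (\<lambda>t. Z t \<omega>) \<alpha> T n) ^ 4 +
       tsum (indicator (cell m p)) (\<lambda>t. X t \<omega>) \<alpha> T n * (rsum (bump m p) (\<lambda>t. X t \<omega>) (\<lambda>t. Z t \<omega>) \<alpha> T n)\<^sup>2)" for m n \<omega>
  have meas: "Y m n \<in> borel_measurable M" for m n
    unfolding Y_def[abs_def]
    by (intro borel_measurable_sum borel_measurable_add borel_measurable_times borel_measurable_power borel_measurable_const
        rsum_measurable tsum_measurable \<alpha> T bump_borel indicator_cell_borel)
  let ?N = "real CARD(7 \<Rightarrow> bool)"
  have "AE \<omega> in M. \<exists>B. \<exists>\<^sub>F m in sequentially. \<exists>\<^sub>F n in sequentially. ennreal (Y m n \<omega>) \<le> ennreal B"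
  proof (rule AE_frequently_bounded)
    show "(\<integral>\<^sup>+\<omega>. ennreal (Y m n \<omega>) \<partial>M) \<le> ennreal (4 ^ m * (?N * (4 * (8 * T * (T / 2 ^ n + 1 / 4 ^ m)))))" for m n
      unfolding Y_def by (rule fourth_moment_bound[OF \<alpha> T U])
    have "(\<lambda>n. 4 ^ m * (?N * (4 * (8 * T * (T / 2 ^ n + 1 / 4 ^ m))))) \<longlonglongrightarrow> 4 ^ m * (?N * (4 * (8 * T * (0 + 1 / 4 ^ m))))" for m :: nat
      by (intro tendsto_intros tendsto_time_step)
    then show "(\<lambda>n. 4 ^ m * (?N * (4 * (8 * T * (T / 2 ^ n + 1 / 4 ^ m))))) \<longlonglongrightarrow> ?N * (4 * (8 * T))" for m :: nat
      by simp
  qed (use meas in auto)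
  then show ?thesis
  proof eventually_elim
    case (elim \<omega>)
    then obtain B where B: "\<exists>\<^sub>F m in sequentially. \<exists>\<^sub>F n in sequentially. ennreal (Y m n \<omega>) \<le> ennreal B" by blast
    \<comment> \<open>For negative B the value \<open>ennreal B\<close> is 0, hence the
      maximum.\<close>
    then have "\<exists>\<^sub>F m in sequentially. \<exists>\<^sub>F n in sequentially. Y m n \<omega> \<le> max B 0"
      by (elim frequently_elim1) (metis ennreal_le_iff2 max.coboundedI1 max.coboundedI2 order_refl)
    then show ?case unfolding Y_def by blast
  qed
qed

text \<open>Passing to the finer grid changes the integrand only on every second interval, by an
  increment of f(X) over one step of the finer grid. Its mean square is of the order of the step, so
  the conditional variances, each carrying another factor of the step, add up to order 2^-n.\<close>

lemma AE_rsum_convergent: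
  assumes f: "f \<in> elementary" and B: "\<And>h x. \<bar>partial_deriv h f x\<bar> \<le> B"
  shows "AE \<omega> in M. convergent (rsum f (\<lambda>t. X t \<omega>) (\<lambda>t. Z t \<omega>) \<alpha> T)"
proof (rule AE_convergent_of_square_increments)
  define L where "L = real CARD(7) * B"
  have lip: "\<bar>f x - f y\<bar> \<le> L * norm (x - y)" for x y unfolding L_def by (rule elementary_lipschitz[OF f B])
  show "(\<lambda>\<omega>. rsum f (\<lambda>t. X t \<omega>) (\<lambda>t. Z t \<omega>) \<alpha> T n) \<in> borel_measurable M" for n
    by (intro rsum_measurable \<alpha> T elementary_borel f)
  show "0 \<le> 7 * L\<^sup>2 * T\<^sup>2" by simp
  fix n
  define \<tau> where "\<tau> = T / 2 ^ Suc n"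
  have \<tau>: "0 < \<tau>" using T by (simp add: \<tau>_def)
  define N :: nat where "N = 2 ^ n"
  have N: "2 ^ Suc n = 2 * N" by (simp add: N_def)
  let ?g = "grid \<alpha> T (Suc n)"
  \<comment> \<open>The index 2 (j div 2) is that of the coarse grid point at or before j; the
    coefficient is therefore 0 for even j.\<close>
  define a :: "(nat \<Rightarrow> real ^ 7) \<Rightarrow> nat \<Rightarrow> real" where "a \<xi> j = f (\<xi> j) - f (\<xi> (2 * (j div 2)))" for \<xi> j
  have diff: "rsum f (\<lambda>t. X t \<omega>) (\<lambda>t. Z t \<omega>) \<alpha> T (Suc n) - rsum f (\<lambda>t. X t \<omega>) (\<lambda>t. Z t \<omega>) \<alpha> T n =
     (\<Sum>j<2 ^ Suc n. a (Xv \<alpha> T (Suc n) \<omega>) j * dZ \<alpha> T (Suc n) j \<omega>)" for \<omega>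
  proof -
    have g: "grid \<alpha> T n k = ?g (2 * k)" for k by (simp add: grid_def)
    have "rsum f (\<lambda>t. X t \<omega>) (\<lambda>t. Z t \<omega>) \<alpha> T n =
       (\<Sum>k<N. f (X (?g (2 * k)) \<omega>) * (Z (?g (Suc (2 * k))) \<omega> - Z (?g (2 * k)) \<omega>) +
          f (X (?g (2 * k)) \<omega>) * (Z (?g (Suc (Suc (2 * k)))) \<omega> - Z (?g (Suc (2 * k))) \<omega>))"
      unfolding rsum_def g N_def by (intro sum.cong refl) (simp add: algebra_simps)
    also have "\<dots> = (\<Sum>j<2 * N. f (X (?g (2 * (j div 2))) \<omega>) * (Z (?g (Suc j)) \<omega> - Z (?g j) \<omega>))"
      unfolding sum_lessThan_double by simp
    finally have 1: "rsum f (\<lambda>t. X t \<omega>) (\<lambda>t. Z t \<omega>) \<alpha> T n = \<dots>" .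
    show ?thesis
      unfolding 1 unfolding rsum_def N sum_subtractf[symmetric]
    proof (intro sum.cong refl)
      fix j assume j: "j \<in> {..<2 * N}"
      then have "j < 2 ^ Suc n" "2 * (j div 2) < 2 ^ Suc n" unfolding N by auto
      then show "f (X (?g j) \<omega>) * (Z (?g (Suc j)) \<omega> - Z (?g j) \<omega>) - f (X (?g (2 * (j div 2))) \<omega>) * (Z (?g (Suc j)) \<omega> - Z (?g j) \<omega>) =
        a (Xv \<alpha> T (Suc n) \<omega>) j * dZ \<alpha> T (Suc n) j \<omega>"
        by (simp add: a_def Xv_def dZ_def left_diff_distrib)
    qed
  qed
  have dW: "(\<integral>\<^sup>+\<omega>. ennreal ((X (?g (Suc j)) \<omega> $ c - X (?g j) \<omega> $ c)\<^sup>2) \<partial>M) = ennreal \<tau>" for j c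
  proof -
    have D: "distributed M lborel (\<lambda>\<omega>. (W (?g (Suc j)) \<omega> - W (?g j) \<omega>) $ emb c) (normal_density 0 (sqrt (?g (Suc j) - ?g j)))"
      by (rule component_normal[OF grid_nonneg[OF \<alpha> T] grid_less[OF T]])
    have "0 < sqrt (?g (Suc j) - ?g j)" using grid_less[OF T] by simp
    note nm = normal_moments[OF D this]
    have "(\<integral>\<^sup>+\<omega>. ennreal (((W (?g (Suc j)) \<omega> - W (?g j) \<omega>) $ emb c)\<^sup>2) \<partial>M) = ennreal (?g (Suc j) - ?g j)"
      using nm(1)[of 2] nm(3) grid_less[OF T, of \<alpha> "Suc n" j] by (subst nn_integral_eq_integral) auto
    then show ?thesis by (simp add: first_seven_nth grid_diff \<tau>_def)
  qed
  have "(\<integral>\<^sup>+\<omega>. ennreal ((rsum f (\<lambda>t. X t \<omega>) (\<lambda>t. Z t \<omega>) \<alpha> T (Suc n) - rsum f (\<lambda>t. X t \<omega>) (\<lambda>t. Z t \<omega>) \<alpha> T n)\<^sup>2) \<partial>M) \<le>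
     (\<integral>\<^sup>+\<omega>. ennreal (T / 2 ^ Suc n * (\<Sum>j<2 ^ Suc n. (a (Xv \<alpha> T (Suc n) \<omega>) j)\<^sup>2)) \<partial>M)"
    unfolding diff
  proof (rule second_moment[OF \<alpha> T])
    fix j :: nat assume "j < 2 ^ Suc n"
    then have "2 * (j div 2) < 2 ^ Suc n" using times_div_less_eq_dividend[of 2 j] by linarith
    then show "(\<lambda>\<xi>. a \<xi> j) \<in> borel_measurable (paths (Suc n))"
      unfolding a_def using \<open>j < 2 ^ Suc n\<close>
      by (intro borel_measurable_diff coord_measurable[OF \<alpha> T] elementary_borel f)
  qed
  also have "\<dots> \<le> (\<integral>\<^sup>+\<omega>. ennreal (\<Sum>k<N. \<Sum>c\<in>UNIV. \<tau> * L\<^sup>2 * (X (?g (Suc (2 * k))) \<omega> $ c - X (?g (2 * k)) \<omega> $ c)\<^sup>2) \<partial>M)"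
  proof (intro nn_integral_mono ennreal_leI)
    fix \<omega>
    have "T / 2 ^ Suc n * (\<Sum>j<2 ^ Suc n. (a (Xv \<alpha> T (Suc n) \<omega>) j)\<^sup>2) =
      \<tau> * (\<Sum>k<N. (a (Xv \<alpha> T (Suc n) \<omega>) (Suc (2 * k)))\<^sup>2)"
      unfolding N \<tau>_def[symmetric] sum_lessThan_double by (simp add: a_def)
    also have "\<dots> \<le> \<tau> * (\<Sum>k<N. \<Sum>c\<in>UNIV. L\<^sup>2 * (X (?g (Suc (2 * k))) \<omega> $ c - X (?g (2 * k)) \<omega> $ c)\<^sup>2)"
    proof (intro mult_left_mono sum_mono)
      fix k assume k: "k \<in> {..<N}"
      let ?u = "X (?g (Suc (2 * k))) \<omega>" and ?v = "X (?g (2 * k)) \<omega>"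
      have "Suc (2 * k) < 2 ^ Suc n" "2 * k < 2 ^ Suc n" using k unfolding N by auto
      then have "a (Xv \<alpha> T (Suc n) \<omega>) (Suc (2 * k)) = f ?u - f ?v"
        by (simp add: a_def Xv_def)
      moreover have "(f ?u - f ?v)\<^sup>2 \<le> (L * norm (?u - ?v))\<^sup>2"
        using lip[of ?u ?v] by (intro abs_le_square_iff[THEN iffD1]) simp
      moreover have "(norm (?u - ?v))\<^sup>2 = (\<Sum>c\<in>UNIV. (?u $ c - ?v $ c)\<^sup>2)"
        by (simp add: norm_vec_def L2_set_def sum_nonneg)
      ultimately show "(a (Xv \<alpha> T (Suc n) \<omega>) (Suc (2 * k)))\<^sup>2 \<le> (\<Sum>c\<in>UNIV. L\<^sup>2 * (?u $ c - ?v $ c)\<^sup>2)"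
        by (simp add: power_mult_distrib sum_distrib_left)
    qed (use \<tau> in simp)
    finally show "T / 2 ^ Suc n * (\<Sum>j<2 ^ Suc n. (a (Xv \<alpha> T (Suc n) \<omega>) j)\<^sup>2) \<le>
       (\<Sum>k<N. \<Sum>c\<in>UNIV. \<tau> * L\<^sup>2 * (X (?g (Suc (2 * k))) \<omega> $ c - X (?g (2 * k)) \<omega> $ c)\<^sup>2)"
      by (simp add: sum_distrib_left mult_ac)
  qed
  also have "\<dots> = (\<Sum>k<N. \<Sum>c\<in>(UNIV :: 7 set). ennreal (\<tau> * L\<^sup>2) * ennreal \<tau>)"
  proof -
    have m[measurable]: "(\<lambda>\<omega>. X (?g k) \<omega> $ c) \<in> borel_measurable M" for k c
      unfolding first_seven_nth by (intro W_component_measurable grid_nonneg \<alpha> T)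
    have "(\<integral>\<^sup>+\<omega>. ennreal (\<tau> * L\<^sup>2 * (X (?g (Suc (2 * k))) \<omega> $ c - X (?g (2 * k)) \<omega> $ c)\<^sup>2) \<partial>M) = ennreal (\<tau> * L\<^sup>2) * ennreal \<tau>" for k c
    proof -
      have "(\<integral>\<^sup>+\<omega>. ennreal (\<tau> * L\<^sup>2 * (X (?g (Suc (2 * k))) \<omega> $ c - X (?g (2 * k)) \<omega> $ c)\<^sup>2) \<partial>M) =
        (\<integral>\<^sup>+\<omega>. ennreal (\<tau> * L\<^sup>2) * ennreal ((X (?g (Suc (2 * k))) \<omega> $ c - X (?g (2 * k)) \<omega> $ c)\<^sup>2) \<partial>M)"
        using \<tau> by (simp add: ennreal_mult)
      also have "\<dots> = ennreal (\<tau> * L\<^sup>2) * ennreal \<tau>"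
        unfolding dW[symmetric, of "2 * k" c] by (rule nn_integral_cmult) measurable
      finally show ?thesis .
    qed
    then show ?thesis
      using \<tau> by (subst nn_integral_sum_real; (subst nn_integral_sum_real)?) (auto intro!: sum_nonneg)
  qed
  also have "\<dots> = ennreal (7 * L\<^sup>2 * T\<^sup>2 / 2 ^ n / 4)"
  proof -
    have "(\<Sum>k<N. \<Sum>c\<in>(UNIV :: 7 set). ennreal (\<tau> * L\<^sup>2) * ennreal \<tau>) = (\<Sum>k<N. \<Sum>c\<in>(UNIV :: 7 set). ennreal (\<tau> * L\<^sup>2 * \<tau>))"
      using \<tau> by (simp add: ennreal_mult)
    also have "\<dots> = ennreal (\<Sum>k<N. \<Sum>c\<in>(UNIV :: 7 set). \<tau> * L\<^sup>2 * \<tau>)"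
      using \<tau> by (simp only: sum_ennreal sum_nonneg mult_nonneg_nonneg zero_le_power2 less_imp_le)
    also have "(\<Sum>k<N. \<Sum>c\<in>(UNIV :: 7 set). \<tau> * L\<^sup>2 * \<tau>) = 7 * L\<^sup>2 * T\<^sup>2 / 2 ^ n / 4"
      by (simp add: N_def \<tau>_def power2_eq_square mult_ac)
    finally show ?thesis .
  qed
  also have "\<dots> \<le> ennreal (7 * L\<^sup>2 * T\<^sup>2 / 2 ^ n)"
  proof (rule ennreal_leI)
    have "y / 4 \<le> y" if "0 \<le> y" for y :: real using that by simp
    from this[of "7 * L\<^sup>2 * T\<^sup>2 / 2 ^ n"] show "7 * L\<^sup>2 * T\<^sup>2 / 2 ^ n / 4 \<le> 7 * L\<^sup>2 * T\<^sup>2 / 2 ^ n" by simp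
  qed
  finally show "(\<integral>\<^sup>+\<omega>. ennreal ((rsum f (\<lambda>t. X t \<omega>) (\<lambda>t. Z t \<omega>) \<alpha> T (Suc n) - rsum f (\<lambda>t. X t \<omega>) (\<lambda>t. Z t \<omega>) \<alpha> T n)\<^sup>2) \<partial>M)
      \<le> ennreal (7 * L\<^sup>2 * T\<^sup>2 / 2 ^ n)" .
qed

end

end

section \<open>The second-level terms average out\<close>

context brownian
begin

abbreviation "\<F> \<equiv> natural_filtration M W"

lemma space_filtration: "space (\<F> t) = space M"
  by (simp add: natural_filtration_def space_measure_of_conv)

lemma sets_filtration:
  "sets (\<F> t) = sigma_sets (space M) {W u -` B \<inter> space M | u B. u \<in> {0..t} \<and> B \<in> sets borel}"
  unfolding natural_filtration_def by (rule sets_measure_of) auto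

lemma sets_filtration_subset: "sets (\<F> t) \<subseteq> sets M"
  unfolding sets_filtration
  by (rule sets.sigma_sets_subset) (auto intro!: measurable_sets[OF W_measurable])

lemma filtration_mono:
  assumes "s \<le> t" shows "sets (\<F> s) \<subseteq> sets (\<F> t)"
  unfolding sets_filtration
proof (intro sigma_sets_mono' subsetI, elim CollectE exE conjE)
  fix a u B assume "a = W u -` B \<inter> space M" "u \<in> {0..s}" "B \<in> sets borel"
  then show "a \<in> {W u -` B \<inter> space M | u B. u \<in> {0..t} \<and> B \<in> sets borel}"
    using assms by (intro CollectI exI[of _ u] exI[of _ B]) auto
qed

lemma measurable_filtration_mono:
  "f \<in> borel_measurable (\<F> s) \<Longrightarrow> s \<le> t \<Longrightarrow> f \<in> borel_measurable (\<F> t)"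
  using filtration_mono[of s t] by (auto simp: measurable_def space_filtration)

lemma measurable_filtration_M: "f \<in> borel_measurable (\<F> s) \<Longrightarrow> f \<in> borel_measurable M"
  using sets_filtration_subset[of s] by (auto simp: measurable_def space_filtration)

lemma W_filtration_measurable: "0 \<le> u \<Longrightarrow> u \<le> t \<Longrightarrow> W u \<in> borel_measurable (\<F> t)"
  by (rule measurableI) (auto simp: sets_filtration space_filtration intro!: sigma_sets.Basic)

text \<open>The values of W at finitely many times up to s are partial sums of increments over a
  partition of [0, s], and these are independent of the increment from s to t.\<close>

lemma increment_indep_finite:
  assumes U: "finite U" "U \<subseteq> {0..s}" and st: "0 \<le> s" "s < t"
    and B: "\<And>u. u \<in> U \<Longrightarrow> B u \<in> sets borel" and C: "C \<in> sets borel"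
  shows "prob ({\<omega> \<in> space M. \<forall>u\<in>U. W u \<omega> \<in> B u} \<inter> ((\<lambda>\<omega>. W t \<omega> - W s \<omega>) -` C \<inter> space M)) =
    prob {\<omega> \<in> space M. \<forall>u\<in>U. W u \<omega> \<in> B u} * prob ((\<lambda>\<omega>. W t \<omega> - W s \<omega>) -` C \<inter> space M)"
proof -
  \<comment> \<open>Time 0 makes values of W partial sums of increments, and s ensures that the last
    increment of the extended partition is the one from s to t.\<close>
  define S where "S = insert 0 (insert s U)"
  have S: "finite S" "S \<subseteq> {0..s}" using U st by (auto simp: S_def)
  define ls where "ls = sorted_list_of_set S"
  have ls: "set ls = S" "sorted_wrt (<) ls" using S by (auto simp: ls_def)
  define n where "n = length ls - 1"
  have len: "length ls = Suc n"
  proof -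
    have "ls \<noteq> []" using ls(1) by (auto simp: S_def)
    then show ?thesis by (simp add: n_def)
  qed
  define \<tau> where "\<tau> k = (if k \<le> n then ls ! k else t)" for k
  have in_S: "\<tau> k \<in> S" if "k \<le> n" for k using that len ls(1) by (auto simp: \<tau>_def intro: nth_mem)
  have inc: "\<tau> k < \<tau> l" if "k < l" "l \<le> n" for k l
    using that len sorted_wrt_nth_less[OF ls(2), of k l] by (simp add: \<tau>_def)
  have ex: "\<exists>k\<le>n. \<tau> k = u" if "u \<in> S" for u
    using that len by (auto simp: \<tau>_def ls(1)[symmetric] in_set_conv_nth less_Suc_eq_le)
  have \<tau>0: "\<tau> 0 = 0"
  proof -
    obtain k where k: "k \<le> n" "\<tau> k = 0" using ex[of 0] by (auto simp: S_def)
    have "0 \<le> \<tau> 0" using in_S[of 0] S by auto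
    then show ?thesis using inc[of 0 k] k by (cases "k = 0") auto
  qed
  have \<tau>n: "\<tau> n = s"
  proof -
    obtain k where k: "k \<le> n" "\<tau> k = s" using ex[of s] by (auto simp: S_def)
    have "\<tau> n \<le> s" using in_S[of n] S by auto
    then show ?thesis using inc[of k n] k by (cases "k = n") auto
  qed
  have \<tau>t: "\<tau> (Suc n) = t" by (simp add: \<tau>_def)
  have step: "\<tau> k < \<tau> (Suc k)" if "k < Suc n" for k
    using that inc[of k "Suc k"] \<tau>n \<tau>t st by (cases "k = n") auto
  define V where "V k \<omega> = W (\<tau> (Suc k)) \<omega> - W (\<tau> k) \<omega>" for k \<omega>
  have ind: "indep_vars (\<lambda>_. borel) V {..<Suc n}"
    unfolding V_def[abs_def] using step \<tau>0 by (intro increments_indep) auto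
  have iv: "indep_var (Pi\<^sub>M {..<n} (\<lambda>_. borel)) (\<lambda>\<omega>. \<lambda>i\<in>{..<n}. V i \<omega>) (Pi\<^sub>M {n} (\<lambda>_. borel)) (\<lambda>\<omega>. \<lambda>i\<in>{n}. V i \<omega>)"
    by (intro indep_var_restrict[OF ind]) auto
  define E where "E = {f \<in> space (Pi\<^sub>M {..<n} (\<lambda>_. borel :: (real ^ 8) measure)). \<forall>k\<in>{k. k \<le> n \<and> \<tau> k \<in> U}. (\<Sum>l<k. f l) \<in> B (\<tau> k)}"
  have E: "E \<in> sets (Pi\<^sub>M {..<n} (\<lambda>_. borel))"
    unfolding E_def
  proof (rule sets.sets_Collect_finite_All)
    fix k assume k: "k \<in> {k. k \<le> n \<and> \<tau> k \<in> U}"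
    have "(\<lambda>f. \<Sum>l<k. f l) \<in> borel_measurable (Pi\<^sub>M {..<n} (\<lambda>_. borel :: (real ^ 8) measure))"
      using k by (intro borel_measurable_sum measurable_component_singleton) auto
    from measurable_sets[OF this B[of "\<tau> k"]] k
    show "{f \<in> space (Pi\<^sub>M {..<n} (\<lambda>_. borel)). (\<Sum>l<k. f l) \<in> B (\<tau> k)} \<in> sets (Pi\<^sub>M {..<n} (\<lambda>_. borel))"
      by (simp add: vimage_def Int_def conj_commute)
  next
    show "finite {k. k \<le> n \<and> \<tau> k \<in> U}" by simp
  qed
  define a' where "a' = (\<lambda>\<omega>. \<lambda>i\<in>{..<n}. V i \<omega>) -` E \<inter> space M"
  define a where "a = {\<omega> \<in> space M. \<forall>u\<in>U. W u \<omega> \<in> B u}"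
  define b where "b = (\<lambda>\<omega>. W t \<omega> - W s \<omega>) -` C \<inter> space M"
  have rv: "(\<lambda>\<omega>. \<lambda>i\<in>{..<n}. V i \<omega>) \<in> measurable M (Pi\<^sub>M {..<n} (\<lambda>_. borel))"
    using iv by (auto simp: indep_var_eq)
  have a'_sets: "a' \<in> sets M" unfolding a'_def by (rule measurable_sets[OF rv E])
  have a_sets: "a \<in> sets M"
  proof -
    have "{\<omega> \<in> space M. W u \<omega> \<in> B u} \<in> sets M" if "u \<in> U" for u
      using measurable_sets[OF W_measurable B[OF that]] U that by (auto simp: vimage_def Int_def conj_commute)
    then show ?thesis unfolding a_def using U(1) by (intro sets.sets_Collect_finite_All) auto
  qed
  have b_sets: "b \<in> sets M" unfolding b_def using st C
    by (intro measurable_sets[OF borel_measurable_diff] W_measurable) auto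
  have ae: "AE \<omega> in M. \<omega> \<in> a \<longleftrightarrow> \<omega> \<in> a'"
    using W_0 AE_space
  proof eventually_elim
    case (elim \<omega>)
    have tel: "(\<Sum>l<k. (\<lambda>i\<in>{..<n}. V i \<omega>) l) = W (\<tau> k) \<omega>" if "k \<le> n" for k
    proof -
      have "(\<Sum>l<k. (\<lambda>i\<in>{..<n}. V i \<omega>) l) = (\<Sum>l<k. W (\<tau> (Suc l)) \<omega> - W (\<tau> l) \<omega>)"
        using that by (intro sum.cong) (auto simp: V_def)
      also have "\<dots> = W (\<tau> k) \<omega> - W (\<tau> 0) \<omega>" by (rule sum_lessThan_telescope)
      finally show ?thesis using elim(1) \<tau>0 by simp
    qed
    have "\<omega> \<in> a' \<longleftrightarrow> (\<forall>k\<in>{k. k \<le> n \<and> \<tau> k \<in> U}. W (\<tau> k) \<omega> \<in> B (\<tau> k))"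
      using elim(2) tel by (simp add: a'_def E_def space_PiM)
    also have "\<dots> \<longleftrightarrow> (\<forall>u\<in>U. W u \<omega> \<in> B u)"
      using ex by (force simp: S_def)
    finally show ?case using elim(2) by (simp add: a_def)
  qed
  have "prob (a \<inter> b) = prob (a' \<inter> b)"
    using ae a_sets a'_sets b_sets by (intro finite_measure_eq_AE) auto
  also have "a' \<inter> b = (\<lambda>\<omega>. \<lambda>i\<in>{..<n}. V i \<omega>) -` E \<inter> space M \<inter> ((\<lambda>\<omega>. \<lambda>i\<in>{n}. V i \<omega>) -` {f \<in> space (Pi\<^sub>M {n} (\<lambda>_. borel)). f n \<in> C} \<inter> space M)"
    by (auto simp: a'_def b_def V_def \<tau>n \<tau>t space_PiM)
  also have "prob \<dots> = prob ((\<lambda>\<omega>. \<lambda>i\<in>{..<n}. V i \<omega>) -` E \<inter> space M) * prob ((\<lambda>\<omega>. \<lambda>i\<in>{n}. V i \<omega>) -` {f \<in> space (Pi\<^sub>M {n} (\<lambda>_. borel)). f n \<in> C} \<inter> space M)"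
  proof -
    have "{f \<in> space (Pi\<^sub>M {n} (\<lambda>_. borel)). f n \<in> C} \<in> sets (Pi\<^sub>M {n} (\<lambda>_. borel))"
      using measurable_sets[OF measurable_component_singleton[of n "{n}" "\<lambda>_. borel"] C]
      by (simp add: vimage_def Int_def conj_commute)
    from indep_varD[OF iv E this] show ?thesis
      by (simp add: Int_assoc vimage_Times[symmetric] vimage_def Int_def conj_ac)
  qed
  also have "(\<lambda>\<omega>. \<lambda>i\<in>{n}. V i \<omega>) -` {f \<in> space (Pi\<^sub>M {n} (\<lambda>_. borel)). f n \<in> C} \<inter> space M = b"
    by (auto simp: b_def V_def \<tau>n \<tau>t space_PiM)
  also have "(\<lambda>\<omega>. \<lambda>i\<in>{..<n}. V i \<omega>) -` E \<inter> space M = a'" by (simp add: a'_def)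
  also have "prob a' = prob a"
    using ae a_sets a'_sets by (intro finite_measure_eq_AE) auto
  finally show ?thesis by (simp add: a_def b_def)
qed

text \<open>Events that restrict W at finitely many times up to s are stable under intersection and
  generate the filtration, so independence extends from them to the generated sigma-algebra.\<close>

lemma filtration_indep_increment:
  assumes \<xi>: "\<xi> \<in> borel_measurable (\<F> s)" and st: "0 \<le> s" "s < t"
  shows "indep_var borel \<xi> borel (\<lambda>\<omega>. W t \<omega> $ j - W s \<omega> $ j)"
proof -
  define G where "G = {{\<omega> \<in> space M. \<forall>u\<in>U. W u \<omega> \<in> B u} | U B. finite U \<and> U \<subseteq> {0..s} \<and> (\<forall>u\<in>U. B u \<in> sets borel)}"
  define H where "H = {(\<lambda>\<omega>. W t \<omega> - W s \<omega>) -` C \<inter> space M | C. C \<in> sets (borel :: (real ^ 8) measure)}"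
  have "indep_set G H"
  proof (rule indep_setI)
    show "G \<subseteq> events"
    proof (clarsimp simp: G_def)
      fix U and B :: "real \<Rightarrow> (real ^ 8) set" assume U: "finite U" "U \<subseteq> {0..s}" "\<forall>u\<in>U. B u \<in> sets borel"
      have "{\<omega> \<in> space M. W u \<omega> \<in> B u} \<in> sets M" if "u \<in> U" for u
        using measurable_sets[OF W_measurable] U that by (auto simp: vimage_def Int_def conj_commute)
      then show "{\<omega> \<in> space M. \<forall>u\<in>U. W u \<omega> \<in> B u} \<in> events" using U(1) by (intro sets.sets_Collect_finite_All) auto
    qed
    show "H \<subseteq> events" unfolding H_def using st
      by (auto intro!: measurable_sets[OF borel_measurable_diff] W_measurable)
    fix a b assume "a \<in> G" "b \<in> H"
    then show "prob (a \<inter> b) = prob a * prob b"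
      unfolding G_def H_def using increment_indep_finite[OF _ _ st] by auto
  qed
  moreover have "Int_stable G"
  proof (rule Int_stableI)
    fix a b assume "a \<in> G" "b \<in> G"
    then obtain U1 B1 U2 B2 where a: "a = {\<omega> \<in> space M. \<forall>u\<in>U1. W u \<omega> \<in> B1 u}" "finite U1" "U1 \<subseteq> {0..s}" "\<forall>u\<in>U1. B1 u \<in> sets borel"
      and b: "b = {\<omega> \<in> space M. \<forall>u\<in>U2. W u \<omega> \<in> B2 u}" "finite U2" "U2 \<subseteq> {0..s}" "\<forall>u\<in>U2. B2 u \<in> sets borel"
      unfolding G_def by blast
    define B where "B u = (if u \<in> U1 then B1 u else UNIV) \<inter> (if u \<in> U2 then B2 u else UNIV)" for u
    have "a \<inter> b = {\<omega> \<in> space M. \<forall>u\<in>U1 \<union> U2. W u \<omega> \<in> B u}"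
      unfolding a(1) b(1) B_def by auto
    moreover have "\<forall>u\<in>U1 \<union> U2. B u \<in> sets borel" using a(4) b(4) by (auto simp: B_def)
    ultimately show "a \<inter> b \<in> G" unfolding G_def using a(2,3) b(2,3) by (auto intro!: exI[of _ "U1 \<union> U2"] exI[of _ B])
  qed
  moreover have "Int_stable H"
  proof (rule Int_stableI)
    fix a b assume "a \<in> H" "b \<in> H"
    then obtain C1 C2 where "a = (\<lambda>\<omega>. W t \<omega> - W s \<omega>) -` C1 \<inter> space M" "C1 \<in> sets borel"
      "b = (\<lambda>\<omega>. W t \<omega> - W s \<omega>) -` C2 \<inter> space M" "C2 \<in> sets borel" unfolding H_def by blast
    then show "a \<inter> b \<in> H" unfolding H_def by (intro CollectI exI[of _ "C1 \<inter> C2"]) auto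
  qed
  ultimately have ind: "indep_set (sigma_sets (space M) G) (sigma_sets (space M) H)"
    by (rule indep_set_sigma_sets)
  have sub: "sets (\<F> s) \<subseteq> sigma_sets (space M) G"
    unfolding sets_filtration
  proof (rule sigma_sets_mono, safe)
    fix u and B :: "(real ^ 8) set" assume u: "u \<in> {0..s}" "B \<in> sets borel"
    have "W u -` B \<inter> space M = {\<omega> \<in> space M. \<forall>u\<in>{u}. W u \<omega> \<in> B}" by auto
    then have "W u -` B \<inter> space M \<in> G" unfolding G_def using u by (intro CollectI exI[of _ "{u}"] exI[of _ "\<lambda>_. B"]) auto
    then show "W u -` B \<inter> space M \<in> sigma_sets (space M) G" by (rule sigma_sets.Basic)
  qed
  have \<Delta>: "(\<lambda>\<omega>. W t \<omega> $ j - W s \<omega> $ j) \<in> borel_measurable M"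
    using st by (intro borel_measurable_diff W_component_measurable) auto
  have s1: "{\<xi> -` A \<inter> space M | A. A \<in> sets borel} \<subseteq> sigma_sets (space M) G"
    using measurable_sets[OF \<xi>] sub by (auto simp: space_filtration)
  have s2: "{(\<lambda>\<omega>. W t \<omega> $ j - W s \<omega> $ j) -` A \<inter> space M | A. A \<in> sets borel} \<subseteq> sigma_sets (space M) H"
  proof safe
    fix A :: "real set" assume A: "A \<in> sets borel"
    have "(\<lambda>v :: real ^ 8. v $ j) \<in> borel_measurable borel"
      by (intro borel_measurable_continuous_onI continuous_intros)
    from measurable_sets[OF this A] have "(\<lambda>v :: real ^ 8. v $ j) -` A \<in> sets borel" by simp
    moreover have "(\<lambda>\<omega>. W t \<omega> $ j - W s \<omega> $ j) -` A \<inter> space M = (\<lambda>\<omega>. W t \<omega> - W s \<omega>) -` ((\<lambda>v. v $ j) -` A) \<inter> space M"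
      by auto
    ultimately show "(\<lambda>\<omega>. W t \<omega> $ j - W s \<omega> $ j) -` A \<inter> space M \<in> sigma_sets (space M) H"
      unfolding H_def by (intro sigma_sets.Basic) blast
  qed
  have "indep_set (sigma_sets (space M) {\<xi> -` A \<inter> space M | A. A \<in> sets borel})
     (sigma_sets (space M) {(\<lambda>\<omega>. W t \<omega> $ j - W s \<omega> $ j) -` A \<inter> space M | A. A \<in> sets borel})"
    unfolding indep_set_def
    by (rule indep_sets_mono_sets[OF ind[unfolded indep_set_def]])
       (auto split: bool.split dest!: subsetD[OF sigma_sets_mono[OF s1]] subsetD[OF sigma_sets_mono[OF s2]])
  then show ?thesis
    unfolding indep_var_eq using measurable_filtration_M[OF \<xi>] \<Delta> by auto
qed


section \<open>Orthogonality and isometry for simple Ito integrals\<close>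

lemma increment_moments:
  fixes j :: 8
  assumes st: "0 \<le> s" "s < t"
  defines "\<Delta> \<equiv> \<lambda>\<omega>. W t \<omega> $ j - W s \<omega> $ j"
  shows "integrable M \<Delta>" "integrable M (\<lambda>\<omega>. (\<Delta> \<omega>)\<^sup>2)" "expectation \<Delta> = 0" "expectation (\<lambda>\<omega>. (\<Delta> \<omega>)\<^sup>2) = t - s"
proof -
  have D: "distributed M lborel \<Delta> (normal_density 0 (sqrt (t - s)))"
    using component_normal[OF st, of j] by (simp add: \<Delta>_def)
  have "0 < sqrt (t - s)" using st by simp
  note nm = normal_moments[OF D this]
  show "integrable M \<Delta>" "integrable M (\<lambda>\<omega>. (\<Delta> \<omega>)\<^sup>2)" "expectation \<Delta> = 0" "expectation (\<lambda>\<omega>. (\<Delta> \<omega>)\<^sup>2) = t - s"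
    using nm(1)[of 1] nm(1)[of 2] nm(2,3) st by simp_all
qed

lemma filtered_product:
  fixes j :: 8
  assumes \<xi>: "\<xi> \<in> borel_measurable (\<F> s)" and st: "0 \<le> s" "s < t"
  defines "\<Delta> \<equiv> \<lambda>\<omega>. W t \<omega> $ j - W s \<omega> $ j"
  shows "integrable M \<xi> \<Longrightarrow> integrable M (\<lambda>\<omega>. \<xi> \<omega> * \<Delta> \<omega>)"
    "integrable M \<xi> \<Longrightarrow> expectation (\<lambda>\<omega>. \<xi> \<omega> * \<Delta> \<omega>) = 0"
    "integrable M (\<lambda>\<omega>. (\<xi> \<omega>)\<^sup>2) \<Longrightarrow> integrable M (\<lambda>\<omega>. (\<xi> \<omega> * \<Delta> \<omega>)\<^sup>2)"
    "integrable M (\<lambda>\<omega>. (\<xi> \<omega>)\<^sup>2) \<Longrightarrow> expectation (\<lambda>\<omega>. (\<xi> \<omega> * \<Delta> \<omega>)\<^sup>2) = expectation (\<lambda>\<omega>. (\<xi> \<omega>)\<^sup>2) * (t - s)"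
proof -
  have m: "integrable M \<Delta>" "integrable M (\<lambda>\<omega>. (\<Delta> \<omega>)\<^sup>2)" "expectation \<Delta> = 0" "expectation (\<lambda>\<omega>. (\<Delta> \<omega>)\<^sup>2) = t - s"
    unfolding \<Delta>_def by (rule increment_moments[OF st])+
  have ind: "indep_var borel \<xi> borel \<Delta>"
    unfolding \<Delta>_def by (rule filtration_indep_increment[OF \<xi> st])
  have ind2: "indep_var borel (\<lambda>\<omega>. (\<xi> \<omega>)\<^sup>2) borel (\<lambda>\<omega>. (\<Delta> \<omega>)\<^sup>2)"
    using indep_var_compose[OF ind, of "\<lambda>x. x\<^sup>2" borel "\<lambda>x. x\<^sup>2" borel] by (simp add: comp_def)
  show "integrable M \<xi> \<Longrightarrow> integrable M (\<lambda>\<omega>. \<xi> \<omega> * \<Delta> \<omega>)"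
    "integrable M \<xi> \<Longrightarrow> expectation (\<lambda>\<omega>. \<xi> \<omega> * \<Delta> \<omega>) = 0"
    using indep_var_integrable[OF ind _ m(1)] indep_var_lebesgue_integral[OF ind _ m(1)] m(3) by auto
  show "integrable M (\<lambda>\<omega>. (\<xi> \<omega>)\<^sup>2) \<Longrightarrow> integrable M (\<lambda>\<omega>. (\<xi> \<omega> * \<Delta> \<omega>)\<^sup>2)"
    "integrable M (\<lambda>\<omega>. (\<xi> \<omega>)\<^sup>2) \<Longrightarrow> expectation (\<lambda>\<omega>. (\<xi> \<omega> * \<Delta> \<omega>)\<^sup>2) = expectation (\<lambda>\<omega>. (\<xi> \<omega>)\<^sup>2) * (t - s)"
    using indep_var_integrable[OF ind2 _ m(2)] indep_var_lebesgue_integral[OF ind2 _ m(2)] m(4)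
    by (auto simp: power_mult_distrib)
qed

lemma integrable_mult_L2:
  assumes "f \<in> borel_measurable M" "g \<in> borel_measurable M" "integrable M (\<lambda>\<omega>. (f \<omega>)\<^sup>2)" "integrable M (\<lambda>\<omega>. (g \<omega>)\<^sup>2)"
  shows "integrable M (\<lambda>\<omega>. f \<omega> * g \<omega> :: real)"
proof (rule Bochner_Integration.integrable_bound)
  show "integrable M (\<lambda>\<omega>. (f \<omega>)\<^sup>2 + (g \<omega>)\<^sup>2)" using assms by simp
  show "(\<lambda>\<omega>. f \<omega> * g \<omega>) \<in> borel_measurable M" using assms by simp
  have "\<bar>x * y\<bar> \<le> x\<^sup>2 + y\<^sup>2" for x y :: real
  proof -
    have "0 \<le> (\<bar>x\<bar> - \<bar>y\<bar>)\<^sup>2" "0 \<le> \<bar>x\<bar> * \<bar>y\<bar>" by auto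
    moreover have "(\<bar>x\<bar> - \<bar>y\<bar>)\<^sup>2 = x\<^sup>2 + y\<^sup>2 - 2 * (\<bar>x\<bar> * \<bar>y\<bar>)" by (simp add: power2_diff)
    ultimately show ?thesis unfolding abs_mult by linarith
  qed
  then show "AE \<omega> in M. norm (f \<omega> * g \<omega>) \<le> norm ((f \<omega>)\<^sup>2 + (g \<omega>)\<^sup>2)" by simp
qed

text \<open>Every term is an increment times a factor known before it, so terms are orthogonal and
  the second moment is additive. Orthogonality to all square-integrable Y known at time s is the
  martingale property in the form needed for sums over successive windows.\<close>

lemma simple_integral_props:
  fixes j :: 8
  assumes si: "simple_integrand M \<F> s t n \<tau> \<xi>" and s: "0 \<le> s"
  defines "S \<equiv> simple_integral (\<lambda>u \<omega>. W u \<omega> $ j) n \<tau> \<xi>"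
  shows "S \<in> borel_measurable (\<F> t)" "integrable M (\<lambda>\<omega>. (S \<omega>)\<^sup>2)"
    "expectation (\<lambda>\<omega>. (S \<omega>)\<^sup>2) = (\<Sum>k<n. expectation (\<lambda>\<omega>. (\<xi> k \<omega>)\<^sup>2) * (\<tau> (Suc k) - \<tau> k))"
    "\<And>Y. Y \<in> borel_measurable (\<F> s) \<Longrightarrow> integrable M (\<lambda>\<omega>. (Y \<omega>)\<^sup>2) \<Longrightarrow> expectation (\<lambda>\<omega>. Y \<omega> * S \<omega>) = 0"
proof -
  have \<tau>0: "\<tau> 0 = s" and \<tau>n: "\<tau> n = t" and inc: "\<And>k. k < n \<Longrightarrow> \<tau> k < \<tau> (Suc k)"
    and \<xi>: "\<And>k. k < n \<Longrightarrow> \<xi> k \<in> borel_measurable (\<F> (\<tau> k))" "\<And>k. k < n \<Longrightarrow> integrable M (\<lambda>\<omega>. (\<xi> k \<omega>)\<^sup>2)"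
    using si by (auto simp: simple_integrand_def)
  have mono: "\<tau> k \<le> \<tau> l" if "k \<le> l" "l \<le> n" for k l
    using that(1) that(2)
  proof (induction l rule: dec_induct)
    case (step i) then show ?case using inc[of i] by simp
  qed simp
  have \<tau>_nn: "0 \<le> \<tau> k" if "k \<le> n" for k using mono[of 0 k] that \<tau>0 s by simp
  define \<Delta> where "\<Delta> k \<omega> = W (\<tau> (Suc k)) \<omega> $ j - W (\<tau> k) \<omega> $ j" for k \<omega>
  define \<zeta> where "\<zeta> k \<omega> = \<xi> k \<omega> * \<Delta> k \<omega>" for k \<omega>
  have S: "S = (\<lambda>\<omega>. \<Sum>k<n. \<zeta> k \<omega>)" by (simp add: S_def simple_integral_def \<zeta>_def \<Delta>_def fun_eq_iff)
  have comp: "(\<lambda>\<omega>. W u \<omega> $ j) \<in> borel_measurable (\<F> v)" if "0 \<le> u" "u \<le> v" for u v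
  proof -
    have "(\<lambda>v :: real ^ 8. v $ j) \<in> borel_measurable borel"
      by (intro borel_measurable_continuous_onI continuous_intros)
    then show ?thesis using measurable_compose[OF W_filtration_measurable[OF that]] by blast
  qed
  have \<zeta>_meas: "\<zeta> k \<in> borel_measurable (\<F> (\<tau> l))" if "k < l" "l \<le> n" for k l
    unfolding \<zeta>_def[abs_def] \<Delta>_def using that mono[of "Suc k" l] mono[of k l] \<tau>_nn
    by (intro borel_measurable_times borel_measurable_diff comp measurable_filtration_mono[OF \<xi>(1)]) auto
  have \<xi>M: "\<xi> k \<in> borel_measurable M" if "k < n" for k using measurable_filtration_M[OF \<xi>(1)[OF that]] .
  have \<zeta>M: "\<zeta> k \<in> borel_measurable M" if "k < n" for k
    using measurable_filtration_M[OF \<zeta>_meas[of k n]] that by simp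
  have \<zeta>2: "integrable M (\<lambda>\<omega>. (\<zeta> k \<omega>)\<^sup>2)" "expectation (\<lambda>\<omega>. (\<zeta> k \<omega>)\<^sup>2) = expectation (\<lambda>\<omega>. (\<xi> k \<omega>)\<^sup>2) * (\<tau> (Suc k) - \<tau> k)"
    if k: "k < n" for k
    using filtered_product(3,4)[OF \<xi>(1)[OF k] \<tau>_nn inc[OF k] \<xi>(2)[OF k]] k unfolding \<zeta>_def \<Delta>_def by auto
  have orth: "expectation (\<lambda>\<omega>. Y \<omega> * \<zeta> k \<omega>) = 0 \<and> integrable M (\<lambda>\<omega>. Y \<omega> * \<zeta> k \<omega>)"
    if k: "k < n" and Y: "Y \<in> borel_measurable (\<F> (\<tau> k))" "integrable M (\<lambda>\<omega>. (Y \<omega>)\<^sup>2)" for Y k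
  proof -
    have "(\<lambda>\<omega>. Y \<omega> * \<xi> k \<omega>) \<in> borel_measurable (\<F> (\<tau> k))" using Y(1) \<xi>(1)[OF k] by simp
    moreover have "integrable M (\<lambda>\<omega>. Y \<omega> * \<xi> k \<omega>)"
      using measurable_filtration_M[OF Y(1)] \<xi>M[OF k] Y(2) \<xi>(2)[OF k] by (rule integrable_mult_L2)
    ultimately show ?thesis
      using filtered_product(1,2)[where \<xi> = "\<lambda>\<omega>. Y \<omega> * \<xi> k \<omega>" and s = "\<tau> k" and t = "\<tau> (Suc k)" and j = j] \<tau>_nn[of k] inc[OF k] k
      unfolding \<zeta>_def \<Delta>_def by (simp add: mult.assoc)
  qed
  have int: "integrable M (\<lambda>\<omega>. \<zeta> p \<omega> * \<zeta> q \<omega>)" if "p \<in> {..<n}" "q \<in> {..<n}" for p q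
    using that by (intro integrable_mult_L2 \<zeta>M \<zeta>2) auto
  have orth2: "expectation (\<lambda>\<omega>. \<zeta> p \<omega> * \<zeta> q \<omega>) = 0" if "p \<in> {..<n}" "q \<in> {..<n}" "p \<noteq> q" for p q
  proof -
    have *: "expectation (\<lambda>\<omega>. \<zeta> p \<omega> * \<zeta> q \<omega>) = 0" if "p < q" "q < n" for p q
      using orth[OF that(2) \<zeta>_meas[of p q] \<zeta>2(1)] that by simp
    show ?thesis using *[of p q] *[of q p] that by (cases "p < q") (auto simp: mult.commute)
  qed
  note es = expectation_square_sum[OF finite_lessThan int orth2]
  show "S \<in> borel_measurable (\<F> t)" unfolding S \<tau>n[symmetric] by (intro borel_measurable_sum \<zeta>_meas) auto
  show "integrable M (\<lambda>\<omega>. (S \<omega>)\<^sup>2)" unfolding S by (rule es(1))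
  show "expectation (\<lambda>\<omega>. (S \<omega>)\<^sup>2) = (\<Sum>k<n. expectation (\<lambda>\<omega>. (\<xi> k \<omega>)\<^sup>2) * (\<tau> (Suc k) - \<tau> k))"
    unfolding S using es(2) \<zeta>2(2) by simp
  fix Y :: "'a \<Rightarrow> real" assume Y: "Y \<in> borel_measurable (\<F> s)" "integrable M (\<lambda>\<omega>. (Y \<omega>)\<^sup>2)"
  have Yk: "Y \<in> borel_measurable (\<F> (\<tau> k))" if "k < n" for k
    using mono[of 0 k] that \<tau>0 by (intro measurable_filtration_mono[OF Y(1)]) auto
  have "expectation (\<lambda>\<omega>. Y \<omega> * S \<omega>) = (\<Sum>k<n. expectation (\<lambda>\<omega>. Y \<omega> * \<zeta> k \<omega>))"
    unfolding S sum_distrib_left using orth Yk Y(2) by (intro Bochner_Integration.integral_sum) auto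
  then show "expectation (\<lambda>\<omega>. Y \<omega> * S \<omega>) = 0" using orth Yk Y(2) by simp
qed

lemma simple_process_square:
  assumes si: "simple_integrand M \<F> s t n \<tau> \<xi>"
  shows "(simple_process n \<tau> \<xi> u \<omega>)\<^sup>2 = (\<Sum>k<n. (\<xi> k \<omega>)\<^sup>2 * indicator {\<tau> k<..\<tau> (Suc k)} u)"
proof -
  have inc: "\<And>k. k < n \<Longrightarrow> \<tau> k < \<tau> (Suc k)" using si by (auto simp: simple_integrand_def)
  have mono: "\<tau> k \<le> \<tau> l" if "k \<le> l" "l \<le> n" for k l
    using that(1) that(2)
  proof (induction l rule: dec_induct)
    case (step i) then show ?case using inc[of i] by simp
  qed simp
  have *: "\<not> (u \<in> {\<tau> p<..\<tau> (Suc p)} \<and> u \<in> {\<tau> q<..\<tau> (Suc q)})" if "p < q" "q < n" for p q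
    using mono[of "Suc p" q] that by auto
  have "(simple_process n \<tau> \<xi> u \<omega>)\<^sup>2 = (\<Sum>k<n. (\<xi> k \<omega> * indicator {\<tau> k<..\<tau> (Suc k)} u)\<^sup>2)"
    unfolding simple_process_def
  proof (rule square_of_disjoint_sum)
    fix p q assume "p \<in> {..<n}" "q \<in> {..<n}" "p \<noteq> q"
    then show "\<xi> p \<omega> * indicator {\<tau> p<..\<tau> (Suc p)} u = 0 \<or> \<xi> q \<omega> * indicator {\<tau> q<..\<tau> (Suc q)} u = 0"
      using *[of p q] *[of q p] by (cases "p < q") (auto simp: indicator_def)
  qed simp
  also have "\<dots> = (\<Sum>k<n. (\<xi> k \<omega>)\<^sup>2 * indicator {\<tau> k<..\<tau> (Suc k)} u)"
    by (intro sum.cong refl) (simp add: indicator_def)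
  finally show ?thesis .
qed

text \<open>Both sides reduce to the same sum of second moments times lengths: the left by
  orthogonality of the terms, the right because the intervals of constancy are disjoint.\<close>

lemma simple_isometry:
  assumes si: "simple_integrand M \<F> s t n \<tau> \<xi>" and s: "0 \<le> s"
  shows "(\<integral>\<^sup>+\<omega>. ennreal ((simple_integral (\<lambda>u \<omega>. W u \<omega> $ j) n \<tau> \<xi> \<omega>)\<^sup>2) \<partial>M) \<le>
    (\<integral>\<^sup>+\<omega>. (\<integral>\<^sup>+u\<in>{s..t}. ennreal ((simple_process n \<tau> \<xi> u \<omega>)\<^sup>2) \<partial>lborel) \<partial>M)"
proof -
  note sp = simple_integral_props[OF si s, where j = j]
  have inc: "\<And>k. k < n \<Longrightarrow> \<tau> k < \<tau> (Suc k)" and \<tau>0: "\<tau> 0 = s" and \<tau>n: "\<tau> n = t"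
    and \<xi>: "\<And>k. k < n \<Longrightarrow> \<xi> k \<in> borel_measurable (\<F> (\<tau> k))" "\<And>k. k < n \<Longrightarrow> integrable M (\<lambda>\<omega>. (\<xi> k \<omega>)\<^sup>2)"
    using si by (auto simp: simple_integrand_def)
  have mono: "\<tau> k \<le> \<tau> l" if "k \<le> l" "l \<le> n" for k l
    using that(1) that(2)
  proof (induction l rule: dec_induct)
    case (step i) then show ?case using inc[of i] by simp
  qed simp
  have [measurable]: "\<xi> k \<in> borel_measurable M" if "k < n" for k using measurable_filtration_M[OF \<xi>(1)[OF that]] .
  have inner: "(\<integral>\<^sup>+u\<in>{s..t}. ennreal ((simple_process n \<tau> \<xi> u \<omega>)\<^sup>2) \<partial>lborel) =
     (\<Sum>k<n. ennreal ((\<xi> k \<omega>)\<^sup>2 * (\<tau> (Suc k) - \<tau> k)))" for \<omega>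
  proof -
    have sub: "u \<in> {s..t}" if "k < n" "u \<in> {\<tau> k<..\<tau> (Suc k)}" for k u
      using that mono[of 0 k] mono[of "Suc k" n] \<tau>0 \<tau>n by auto
    have "(\<integral>\<^sup>+u\<in>{s..t}. ennreal ((simple_process n \<tau> \<xi> u \<omega>)\<^sup>2) \<partial>lborel) =
       (\<integral>\<^sup>+u. (\<Sum>k<n. ennreal ((\<xi> k \<omega>)\<^sup>2) * indicator {\<tau> k<..\<tau> (Suc k)} u) \<partial>lborel)"
    proof (rule nn_integral_cong)
      fix u
      have "ennreal ((simple_process n \<tau> \<xi> u \<omega>)\<^sup>2) = (\<Sum>k<n. ennreal ((\<xi> k \<omega>)\<^sup>2) * indicator {\<tau> k<..\<tau> (Suc k)} u)"
        unfolding simple_process_square[OF si]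
        by (subst sum_ennreal[symmetric]) (auto intro!: sum.cong simp: indicator_def)
      moreover have "u \<notin> {s..t} \<Longrightarrow> (\<Sum>k<n. ennreal ((\<xi> k \<omega>)\<^sup>2) * indicator {\<tau> k<..\<tau> (Suc k)} u) = 0"
        using sub by (intro sum.neutral) (auto simp: indicator_def)
      ultimately show "ennreal ((simple_process n \<tau> \<xi> u \<omega>)\<^sup>2) * indicator {s..t} u =
          (\<Sum>k<n. ennreal ((\<xi> k \<omega>)\<^sup>2) * indicator {\<tau> k<..\<tau> (Suc k)} u)"
        by (cases "u \<in> {s..t}") auto
    qed
    also have "\<dots> = (\<Sum>k<n. ennreal ((\<xi> k \<omega>)\<^sup>2) * ennreal (\<tau> (Suc k) - \<tau> k))"
      using inc by (subst nn_integral_sum) (auto intro!: sum.cong simp: nn_integral_cmult_indicator less_imp_le)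
    also have "\<dots> = (\<Sum>k<n. ennreal ((\<xi> k \<omega>)\<^sup>2 * (\<tau> (Suc k) - \<tau> k)))"
      using inc by (intro sum.cong refl ennreal_mult[symmetric]) (auto simp: less_imp_le)
    finally show ?thesis .
  qed
  have "(\<integral>\<^sup>+\<omega>. ennreal ((simple_integral (\<lambda>u \<omega>. W u \<omega> $ j) n \<tau> \<xi> \<omega>)\<^sup>2) \<partial>M) =
     ennreal (\<Sum>k<n. expectation (\<lambda>\<omega>. (\<xi> k \<omega>)\<^sup>2) * (\<tau> (Suc k) - \<tau> k))"
    using sp(2,3) by (simp add: nn_integral_eq_integral)
  also have "\<dots> = (\<Sum>k<n. ennreal (expectation (\<lambda>\<omega>. (\<xi> k \<omega>)\<^sup>2) * (\<tau> (Suc k) - \<tau> k)))"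
    using inc by (intro sum_ennreal[symmetric]) (auto intro!: mult_nonneg_nonneg simp: less_imp_le)
  also have "\<dots> = (\<Sum>k<n. \<integral>\<^sup>+\<omega>. ennreal ((\<xi> k \<omega>)\<^sup>2 * (\<tau> (Suc k) - \<tau> k)) \<partial>M)"
    using inc \<xi>(2) by (intro sum.cong refl) (subst nn_integral_eq_integral, auto simp: less_imp_le)
  also have "\<dots> = (\<integral>\<^sup>+\<omega>. (\<integral>\<^sup>+u\<in>{s..t}. ennreal ((simple_process n \<tau> \<xi> u \<omega>)\<^sup>2) \<partial>lborel) \<partial>M)"
    unfolding inner by (subst nn_integral_sum) auto
  finally show ?thesis by simp
qed

text \<open>The path is jointly measurable only up to a null set, since continuity holds almost surely.\<close>

lemma exists_joint_version:
  assumes st: "0 \<le> s" "s \<le> t"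
  obtains H where "H \<in> borel_measurable (lborel \<Otimes>\<^sub>M M)"
    "AE \<omega> in M. \<forall>u\<in>{s..t}. H (u, \<omega>) = W u \<omega> $ r - W s \<omega> $ r"
proof -
  \<comment> \<open>The dyadic time at or before u. The maximum with 0 keeps it in the range where W
    is known to be measurable, whatever the integer i.\<close>
  define g where "g n i = max 0 (real_of_int i / 2 ^ n)" for n :: nat and i :: int
  define Hn where "Hn n p = W (g n \<lfloor>fst p * 2 ^ n\<rfloor>) (snd p) $ r - W s (snd p) $ r" for n and p :: "real \<times> 'a"
  have [measurable]: "Hn n \<in> borel_measurable (lborel \<Otimes>\<^sub>M M)" for n
  proof -
    have "(\<lambda>p. W (g n \<lfloor>fst p * 2 ^ n :: real\<rfloor>) (snd p) $ r - W s (snd p) $ r) \<in> borel_measurable (lborel \<Otimes>\<^sub>M M)"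
    proof (rule measurable_compose_countable[where f = "\<lambda>i p. W (g n i) (snd p) $ r - W s (snd p) $ r"
          and g = "\<lambda>p. \<lfloor>fst p * 2 ^ n :: real\<rfloor>"])
      show "(\<lambda>p. W (g n i) (snd p) $ r - W s (snd p) $ r) \<in> borel_measurable (lborel \<Otimes>\<^sub>M M)" for i
        using st by (intro borel_measurable_diff measurable_compose[OF measurable_snd W_component_measurable]) (auto simp: g_def)
    next
      have "(\<lambda>p. fst p * 2 ^ n :: real) \<in> borel_measurable (lborel \<Otimes>\<^sub>M M)" by measurable
      then show "(\<lambda>p. \<lfloor>fst p * 2 ^ n :: real\<rfloor>) \<in> measurable (lborel \<Otimes>\<^sub>M M) (count_space UNIV)"
        by measurable
    qed
    then show ?thesis by (simp add: Hn_def[abs_def])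
  qed
  define H where "H p = lim (\<lambda>n. Hn n p)" for p
  have "H \<in> borel_measurable (lborel \<Otimes>\<^sub>M M)" unfolding H_def[abs_def] by measurable
  moreover have "AE \<omega> in M. \<forall>u\<in>{s..t}. H (u, \<omega>) = W u \<omega> $ r - W s \<omega> $ r"
    using W_continuous
  proof eventually_elim
    case (elim \<omega>)
    show ?case
    proof
      fix u assume u: "u \<in> {s..t}"
      have "(\<lambda>n. real_of_int \<lfloor>u * 2 ^ n\<rfloor> / 2 ^ n) \<longlonglongrightarrow> u"
      proof (rule LIMSEQ_I)
        fix e :: real assume e: "0 < e"
        have "(\<lambda>n. 1 / 2 ^ n :: real) \<longlonglongrightarrow> 0" by (rule LIMSEQ_divide_realpow_zero) simp
        then have "\<forall>\<^sub>F n in sequentially. 1 / 2 ^ n < e" using e by (intro order_tendstoD) auto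
        then obtain N where N: "\<And>n. N \<le> n \<Longrightarrow> 1 / 2 ^ n < e" by (auto simp: eventually_sequentially)
        have "norm (real_of_int \<lfloor>u * 2 ^ n\<rfloor> / 2 ^ n - u) < e" if "N \<le> n" for n
        proof -
          have "\<bar>real_of_int \<lfloor>u * 2 ^ n\<rfloor> - u * 2 ^ n\<bar> \<le> 1" by linarith
          moreover have "real_of_int \<lfloor>u * 2 ^ n\<rfloor> / 2 ^ n - u = (real_of_int \<lfloor>u * 2 ^ n\<rfloor> - u * 2 ^ n) / 2 ^ n"
            by (simp add: diff_divide_distrib)
          ultimately have "\<bar>real_of_int \<lfloor>u * 2 ^ n\<rfloor> / 2 ^ n - u\<bar> \<le> 1 / 2 ^ n"
            by (simp add: abs_divide divide_right_mono)
          then show ?thesis using N[OF that] by simp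
        qed
        then show "\<exists>N. \<forall>n\<ge>N. norm (real_of_int \<lfloor>u * 2 ^ n\<rfloor> / 2 ^ n - u) < e" by blast
      qed
      moreover have "g n \<lfloor>u * 2 ^ n\<rfloor> = real_of_int \<lfloor>u * 2 ^ n\<rfloor> / 2 ^ n" for n
        using u st by (simp add: g_def)
      ultimately have lim: "(\<lambda>n. g n \<lfloor>u * 2 ^ n\<rfloor>) \<longlonglongrightarrow> u" by simp
      have "(\<lambda>n. W (g n \<lfloor>u * 2 ^ n\<rfloor>) \<omega>) \<longlonglongrightarrow> W u \<omega>"
        using continuous_on_tendsto_compose[OF elim lim] u st by (simp add: g_def)
      then have "(\<lambda>n. Hn n (u, \<omega>)) \<longlonglongrightarrow> W u \<omega> $ r - W s \<omega> $ r"
        unfolding Hn_def by (auto intro!: tendsto_intros)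
      then show "H (u, \<omega>) = W u \<omega> $ r - W s \<omega> $ r" unfolding H_def by (rule limI)
    qed
  qed
  ultimately show ?thesis by (rule that)
qed

text \<open>By the isometry the left side is controlled by the simple process in L2, and that by
  twice the integrand plus twice the approximation error. The integrand has mean square u - s at
  time u, at most t - s. The exchange of the two integrations requires the jointly measurable
  version.\<close>

lemma simple_integral_bound:
  assumes si: "simple_integrand M \<F> s t n \<tau> \<xi>" and st: "0 \<le> s" "s \<le> t"
  shows "(\<integral>\<^sup>+\<omega>. ennreal ((simple_integral (\<lambda>u \<omega>. W u \<omega> $ j) n \<tau> \<xi> \<omega>)\<^sup>2) \<partial>M) \<le> 2 * ennreal ((t - s)\<^sup>2) +
    2 * (\<integral>\<^sup>+\<omega>. (\<integral>\<^sup>+u\<in>{s..t}. ennreal ((W u \<omega> $ r - W s \<omega> $ r - simple_process n \<tau> \<xi> u \<omega>)\<^sup>2) \<partial>lborel) \<partial>M)"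
proof -
  interpret P: pair_sigma_finite lborel M ..
  obtain H where H[measurable]: "H \<in> borel_measurable (lborel \<Otimes>\<^sub>M M)"
    and HW: "AE \<omega> in M. \<forall>u\<in>{s..t}. H (u, \<omega>) = W u \<omega> $ r - W s \<omega> $ r"
    using exists_joint_version[OF st] by blast
  define sp where "sp p = simple_process n \<tau> \<xi> (fst p) (snd p)" for p
  have sp[measurable]: "sp \<in> borel_measurable (lborel \<Otimes>\<^sub>M M)"
    unfolding sp_def[abs_def] simple_process_def
  proof (intro borel_measurable_sum borel_measurable_times)
    fix k assume "k \<in> {..<n}"
    then have "\<xi> k \<in> borel_measurable M"
      using si measurable_filtration_M unfolding simple_integrand_def by blast
    then show "(\<lambda>p. \<xi> k (snd p)) \<in> borel_measurable (lborel \<Otimes>\<^sub>M M)" by measurable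
  qed measurable
  define ind :: "real \<times> 'a \<Rightarrow> ennreal" where "ind p = indicator {s..t} (fst p)" for p
  have [measurable]: "ind \<in> borel_measurable (lborel \<Otimes>\<^sub>M M)" unfolding ind_def[abs_def] by measurable
  have iter: "(\<integral>\<^sup>+\<omega>. (\<integral>\<^sup>+u\<in>{s..t}. ennreal ((f (u, \<omega>))\<^sup>2) \<partial>lborel) \<partial>M) = (\<integral>\<^sup>+p. ennreal ((f p)\<^sup>2) * ind p \<partial>(lborel \<Otimes>\<^sub>M M))"
    if [measurable]: "f \<in> borel_measurable (lborel \<Otimes>\<^sub>M M)" for f :: "real \<times> 'a \<Rightarrow> real"
    using P.nn_integral_snd[of "\<lambda>p. ennreal ((f p)\<^sup>2) * ind p"] by (simp add: ind_def)
  have "(\<integral>\<^sup>+p. ennreal ((H p)\<^sup>2) * ind p \<partial>(lborel \<Otimes>\<^sub>M M)) = (\<integral>\<^sup>+u. (\<integral>\<^sup>+\<omega>. ennreal ((H (u, \<omega>))\<^sup>2) * ind (u, \<omega>) \<partial>M) \<partial>lborel)"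
    by (rule nn_integral_fst[symmetric]) measurable
  also have "\<dots> \<le> (\<integral>\<^sup>+u. ennreal (t - s) * indicator {s..t} u \<partial>lborel)"
  proof (rule nn_integral_mono)
    fix u
    show "(\<integral>\<^sup>+\<omega>. ennreal ((H (u, \<omega>))\<^sup>2) * ind (u, \<omega>) \<partial>M) \<le> ennreal (t - s) * indicator {s..t} u"
    proof (cases "u \<in> {s..t}")
      case True
      have "(\<integral>\<^sup>+\<omega>. ennreal ((H (u, \<omega>))\<^sup>2) * ind (u, \<omega>) \<partial>M) = (\<integral>\<^sup>+\<omega>. ennreal ((W u \<omega> $ r - W s \<omega> $ r)\<^sup>2) \<partial>M)"
        using HW True by (intro nn_integral_cong_AE) (auto simp: ind_def elim!: eventually_mono)
      also have "\<dots> = ennreal (u - s)"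
      proof (cases "u = s")
        case False
        then have "s < u" using True by simp
        from increment_moments(2,4)[OF st(1) this, of r] show ?thesis by (simp add: nn_integral_eq_integral)
      qed simp
      also have "\<dots> \<le> ennreal (t - s)" using True by (intro ennreal_leI) simp
      finally show ?thesis using True by simp
    qed (simp add: ind_def)
  qed
  also have "\<dots> = ennreal (t - s) * ennreal (t - s)"
    using st by (subst nn_integral_cmult_indicator) auto
  also have "\<dots> = ennreal ((t - s)\<^sup>2)" using st by (simp add: power2_eq_square ennreal_mult)
  finally have H2: "(\<integral>\<^sup>+p. ennreal ((H p)\<^sup>2) * ind p \<partial>(lborel \<Otimes>\<^sub>M M)) \<le> ennreal ((t - s)\<^sup>2)" .
  have diff: "(\<integral>\<^sup>+\<omega>. (\<integral>\<^sup>+u\<in>{s..t}. ennreal ((W u \<omega> $ r - W s \<omega> $ r - simple_process n \<tau> \<xi> u \<omega>)\<^sup>2) \<partial>lborel) \<partial>M) =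
      (\<integral>\<^sup>+p. ennreal ((H p - sp p)\<^sup>2) * ind p \<partial>(lborel \<Otimes>\<^sub>M M))"
  proof -
    have "(\<integral>\<^sup>+\<omega>. (\<integral>\<^sup>+u\<in>{s..t}. ennreal ((W u \<omega> $ r - W s \<omega> $ r - simple_process n \<tau> \<xi> u \<omega>)\<^sup>2) \<partial>lborel) \<partial>M) =
       (\<integral>\<^sup>+\<omega>. (\<integral>\<^sup>+u\<in>{s..t}. ennreal ((H (u, \<omega>) - sp (u, \<omega>))\<^sup>2) \<partial>lborel) \<partial>M)"
    proof (rule nn_integral_cong_AE, use HW in eventually_elim)
      case (elim \<omega>)
      show ?case using elim by (intro nn_integral_cong) (auto simp: sp_def indicator_def)
    qed
    then show ?thesis by (subst (asm) iter) measurable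
  qed
  have "(\<integral>\<^sup>+\<omega>. ennreal ((simple_integral (\<lambda>u \<omega>. W u \<omega> $ j) n \<tau> \<xi> \<omega>)\<^sup>2) \<partial>M) \<le>
      (\<integral>\<^sup>+\<omega>. (\<integral>\<^sup>+u\<in>{s..t}. ennreal ((sp (u, \<omega>))\<^sup>2) \<partial>lborel) \<partial>M)"
    using simple_isometry[OF si st(1)] by (simp add: sp_def)
  also have "\<dots> = (\<integral>\<^sup>+p. ennreal ((sp p)\<^sup>2) * ind p \<partial>(lborel \<Otimes>\<^sub>M M))" by (rule iter) measurable
  also have "\<dots> \<le> (\<integral>\<^sup>+p. 2 * (ennreal ((H p)\<^sup>2) * ind p) + 2 * (ennreal ((H p - sp p)\<^sup>2) * ind p) \<partial>(lborel \<Otimes>\<^sub>M M))"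
  proof (rule nn_integral_mono)
    fix p
    have "(sp p)\<^sup>2 \<le> 2 * (H p)\<^sup>2 + 2 * (H p - sp p)\<^sup>2"
    proof -
      have "0 \<le> (2 * H p - sp p)\<^sup>2" by simp
      then show ?thesis by (simp add: power2_eq_square algebra_simps)
    qed
    then have "ennreal ((sp p)\<^sup>2) \<le> ennreal (2 * (H p)\<^sup>2 + 2 * (H p - sp p)\<^sup>2)" by (rule ennreal_leI)
    also have "\<dots> = 2 * ennreal ((H p)\<^sup>2) + 2 * ennreal ((H p - sp p)\<^sup>2)"
      by (simp add: ennreal_plus ennreal_mult)
    finally have "ennreal ((sp p)\<^sup>2) * ind p \<le> (2 * ennreal ((H p)\<^sup>2) + 2 * ennreal ((H p - sp p)\<^sup>2)) * ind p"
      by (rule mult_right_mono) simp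
    then show "ennreal ((sp p)\<^sup>2) * ind p \<le> 2 * (ennreal ((H p)\<^sup>2) * ind p) + 2 * (ennreal ((H p - sp p)\<^sup>2) * ind p)"
      by (simp add: distrib_right mult.assoc)
  qed
  also have "\<dots> = 2 * (\<integral>\<^sup>+p. ennreal ((H p)\<^sup>2) * ind p \<partial>(lborel \<Otimes>\<^sub>M M)) + 2 * (\<integral>\<^sup>+p. ennreal ((H p - sp p)\<^sup>2) * ind p \<partial>(lborel \<Otimes>\<^sub>M M))"
    by (subst nn_integral_add, measurable, subst nn_integral_cmult, measurable, subst nn_integral_cmult, measurable)
  also have "\<dots> \<le> 2 * ennreal ((t - s)\<^sup>2) + 2 * (\<integral>\<^sup>+p. ennreal ((H p - sp p)\<^sup>2) * ind p \<partial>(lborel \<Otimes>\<^sub>M M))"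
    by (intro add_mono mult_left_mono H2) auto
  finally show ?thesis unfolding diff .
qed

text \<open>The summands are orthogonal, each with second moment of order (T/2^n)^2, and there are
  2^n of them. Orthogonality is proved for approximating simple integrals, which are adapted by
  construction, because a version of the Ito integral is only assumed measurable with respect to
  M.\<close>

lemma second_level_sum_bound:
  assumes iv: "iterated_integral_version M W A" and \<alpha>: "0 < \<alpha>" and T: "0 < T"
    and \<psi>: "\<psi> \<in> borel_measurable borel" "\<And>v. \<bar>\<psi> v\<bar> \<le> C"
  shows "(\<integral>\<^sup>+\<omega>. ennreal ((\<Sum>k<2^n. \<psi> (X (grid \<alpha> T n k) \<omega>) * A r 8 (grid \<alpha> T n k) (grid \<alpha> T n (Suc k)) \<omega>)\<^sup>2) \<partial>M)
    \<le> ennreal (4 * C\<^sup>2 * T\<^sup>2 / 2 ^ n)"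
proof -
  define t where "t k = grid \<alpha> T n k" for k
  define N :: nat where "N = 2 ^ n"
  have t: "0 \<le> t k" "t k < t (Suc k)" "t (Suc k) - t k = T / 2 ^ n" for k
    unfolding t_def using grid_nonneg[OF \<alpha> T] grid_less[OF T] grid_diff by auto
  have t_mono: "t k \<le> t l" if "k \<le> l" for k l unfolding t_def using grid_mono[OF less_imp_le[OF T] that] .
  define I where "I k = A r 8 (t k) (t (Suc k))" for k
  define d where "d k p m = (\<integral>\<^sup>+\<omega>. (\<integral>\<^sup>+u\<in>{t k..t (Suc k)}. ennreal ((W u \<omega> $ r - W (t k) \<omega> $ r -
       simple_process (fst p m) (fst (snd p) m) (snd (snd p) m) u \<omega>)\<^sup>2) \<partial>lborel) \<partial>M)" for k m and p :: "(nat \<Rightarrow> nat) \<times> (nat \<Rightarrow> nat \<Rightarrow> real) \<times> (nat \<Rightarrow> nat \<Rightarrow> 'a \<Rightarrow> real)"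
  define S where "S p m = simple_integral (\<lambda>u \<omega>. W u \<omega> $ 8) (fst p m) (fst (snd p) m) (snd (snd p) m)" for p :: "(nat \<Rightarrow> nat) \<times> (nat \<Rightarrow> nat \<Rightarrow> real) \<times> (nat \<Rightarrow> nat \<Rightarrow> 'a \<Rightarrow> real)" and m
  define e where "e k p m = (\<integral>\<^sup>+\<omega>. ennreal ((I k \<omega> - S p m \<omega>)\<^sup>2) \<partial>M)" for k p m
  have hi: "has_ito_integral M \<F> (\<lambda>u \<omega>. W u \<omega> $ 8) (\<lambda>u \<omega>. W u \<omega> $ r - W (t k) \<omega> $ r) (t k) (t (Suc k)) (I k)" for k
    using iv t[of k] unfolding iterated_integral_version_def I_def by (simp add: less_imp_le)
  have I_meas: "I k \<in> borel_measurable M" for k using hi[of k] by (simp add: has_ito_integral_def)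
  have "\<exists>p. (\<forall>m. simple_integrand M \<F> (t k) (t (Suc k)) (fst p m) (fst (snd p) m) (snd (snd p) m)) \<and>
     d k p \<longlonglongrightarrow> 0 \<and> e k p \<longlonglongrightarrow> 0" for k
  proof -
    obtain n' \<tau>' \<xi>' where "(\<forall>m::nat. simple_integrand M \<F> (t k) (t (Suc k)) (n' m) (\<tau>' m) (\<xi>' m)) \<and>
        (\<lambda>m. \<integral>\<^sup>+\<omega>. (\<integral>\<^sup>+u\<in>{t k..t (Suc k)}.
            ennreal ((W u \<omega> $ r - W (t k) \<omega> $ r - simple_process (n' m) (\<tau>' m) (\<xi>' m) u \<omega>)\<^sup>2) \<partial>lborel) \<partial>M)
          \<longlonglongrightarrow> 0 \<and>
        (\<lambda>m. \<integral>\<^sup>+\<omega>. ennreal ((I k \<omega> - simple_integral (\<lambda>u \<omega>. W u \<omega> $ 8) (n' m) (\<tau>' m) (\<xi>' m) \<omega>)\<^sup>2) \<partial>M)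
          \<longlonglongrightarrow> 0"
      using hi[of k] unfolding has_ito_integral_def by (elim conjE exE) (rule that, intro conjI)
    then show ?thesis
      by (intro exI[of _ "(n', \<tau>', \<xi>')"]) (simp add: d_def[abs_def] e_def[abs_def] S_def)
  qed
  then obtain p where p: "\<And>k m. simple_integrand M \<F> (t k) (t (Suc k)) (fst (p k) m) (fst (snd (p k)) m) (snd (snd (p k)) m)"
     "\<And>k. d k (p k) \<longlonglongrightarrow> 0" "\<And>k. e k (p k) \<longlonglongrightarrow> 0"
    by metis
  note sip = simple_integral_props[OF p(1) t(1), where j = 8, folded S_def]
  \<comment> \<open>The first part bounds the sum of the orthogonal approximations, the second the
    approximation error by Cauchy-Schwarz. The latter has a factor N, harmless since n is fixed
    while m tends to infinity.\<close>
  define R where "R m = 2 * (ennreal (C\<^sup>2) * (\<Sum>k<N. 2 * ennreal ((T / 2 ^ n)\<^sup>2) + 2 * d k (p k) m)) +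
     2 * (ennreal (real N * C\<^sup>2) * (\<Sum>k<N. e k (p k) m))" for m
  have bound: "(\<integral>\<^sup>+\<omega>. ennreal ((\<Sum>k<N. \<psi> (X (t k) \<omega>) * I k \<omega>)\<^sup>2) \<partial>M) \<le> R m" for m
  proof -
    have X_F: "(\<lambda>\<omega>. \<psi> (X (t k) \<omega>)) \<in> borel_measurable (\<F> (t l))" if "k \<le> l" for k l
    proof -
      have eq: "first_seven v = (\<chi> c. v $ emb c)" for v by (simp add: vec_eq_iff first_seven_nth)
      have "continuous_on UNIV first_seven" unfolding eq[abs_def] by (intro continuous_intros)
      then have "first_seven \<in> borel_measurable borel" by (rule borel_measurable_continuous_onI)
      from measurable_compose[OF measurable_compose[OF W_filtration_measurable[OF t(1) t_mono[OF that]] this] \<psi>(1)]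
      show ?thesis .
    qed
    have XM: "(\<lambda>\<omega>. \<psi> (X (t k) \<omega>)) \<in> borel_measurable M" for k
      using measurable_filtration_M[OF X_F[of k k]] by simp
    have \<psi>2: "(\<psi> v)\<^sup>2 \<le> C\<^sup>2" for v
    proof -
      have "\<bar>\<psi> v\<bar> \<le> \<bar>C\<bar>" using \<psi>(2)[of v] by linarith
      then show ?thesis by (simp only: abs_le_square_iff)
    qed
    have SM[measurable]: "S (p k) m \<in> borel_measurable M" for k using measurable_filtration_M[OF sip(1)] .
    have bdd_L2: "integrable M (\<lambda>\<omega>. (\<psi> (X (t k) \<omega>) * f \<omega>)\<^sup>2)" if f: "f \<in> borel_measurable M" "integrable M (\<lambda>\<omega>. (f \<omega>)\<^sup>2)" for f k
    proof (rule Bochner_Integration.integrable_bound)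
      show "integrable M (\<lambda>\<omega>. C\<^sup>2 * (f \<omega>)\<^sup>2)" using f by simp
      show "(\<lambda>\<omega>. (\<psi> (X (t k) \<omega>) * f \<omega>)\<^sup>2) \<in> borel_measurable M" using XM f by simp
      show "AE \<omega> in M. norm ((\<psi> (X (t k) \<omega>) * f \<omega>)\<^sup>2) \<le> norm (C\<^sup>2 * (f \<omega>)\<^sup>2)"
        using \<psi>2 by (simp add: power_mult_distrib mult_right_mono)
    qed
    define \<zeta> where "\<zeta> k \<omega> = \<psi> (X (t k) \<omega>) * S (p k) m \<omega>" for k \<omega>
    have \<zeta>2: "integrable M (\<lambda>\<omega>. (\<zeta> k \<omega>)\<^sup>2)" for k unfolding \<zeta>_def by (intro bdd_L2 SM sip(2))
    have \<zeta>M[measurable]: "\<zeta> k \<in> borel_measurable M" for k unfolding \<zeta>_def[abs_def] using XM by measurable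
    have int: "integrable M (\<lambda>\<omega>. \<zeta> a \<omega> * \<zeta> b \<omega>)" for a b by (intro integrable_mult_L2 \<zeta>M \<zeta>2)
    have orth0: "expectation (\<lambda>\<omega>. \<zeta> a \<omega> * \<zeta> b \<omega>) = 0" if "a < b" for a b
    proof -
      \<comment> \<open>The earlier summand together with the later weight; both are known at the
        start of the later interval, to whose simple integral the product is therefore
        orthogonal.\<close>
      define Y where "Y \<omega> = \<psi> (X (t b) \<omega>) * \<zeta> a \<omega>" for \<omega>
      have "\<zeta> a \<in> borel_measurable (\<F> (t b))" unfolding \<zeta>_def[abs_def]
        using that by (intro borel_measurable_times X_F measurable_filtration_mono[OF sip(1) t_mono]) auto
      then have "Y \<in> borel_measurable (\<F> (t b))" unfolding Y_def[abs_def] by (intro borel_measurable_times X_F) auto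
      moreover have "integrable M (\<lambda>\<omega>. (Y \<omega>)\<^sup>2)" unfolding Y_def by (intro bdd_L2 \<zeta>M \<zeta>2)
      ultimately have "expectation (\<lambda>\<omega>. Y \<omega> * S (p b) m \<omega>) = 0" by (rule sip(4))
      moreover have "Y \<omega> * S (p b) m \<omega> = \<zeta> a \<omega> * \<zeta> b \<omega>" for \<omega> by (simp add: Y_def \<zeta>_def mult_ac)
      ultimately show ?thesis by simp
    qed
    have orth: "expectation (\<lambda>\<omega>. \<zeta> a \<omega> * \<zeta> b \<omega>) = 0" if "a \<noteq> b" for a b
      using orth0[of a b] orth0[of b a] that by (cases "a < b") (auto simp: mult.commute)
    note es = expectation_square_sum[of "{..<N}" \<zeta>, OF finite_lessThan int orth]
    have main: "(\<integral>\<^sup>+\<omega>. ennreal ((\<Sum>k<N. \<zeta> k \<omega>)\<^sup>2) \<partial>M) \<le> ennreal (C\<^sup>2) * (\<Sum>k<N. 2 * ennreal ((T / 2 ^ n)\<^sup>2) + 2 * d k (p k) m)"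
    proof -
      have "(\<integral>\<^sup>+\<omega>. ennreal ((\<Sum>k<N. \<zeta> k \<omega>)\<^sup>2) \<partial>M) = ennreal (\<Sum>k<N. expectation (\<lambda>\<omega>. (\<zeta> k \<omega>)\<^sup>2))"
        using es by (simp add: nn_integral_eq_integral)
      also have "\<dots> = (\<Sum>k<N. ennreal (expectation (\<lambda>\<omega>. (\<zeta> k \<omega>)\<^sup>2)))" by (rule sum_ennreal[symmetric]) simp
      also have "\<dots> = (\<Sum>k<N. \<integral>\<^sup>+\<omega>. ennreal ((\<zeta> k \<omega>)\<^sup>2) \<partial>M)" using \<zeta>2 by (simp add: nn_integral_eq_integral)
      also have "\<dots> \<le> (\<Sum>k<N. ennreal (C\<^sup>2) * (2 * ennreal ((T / 2 ^ n)\<^sup>2) + 2 * d k (p k) m))"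
      proof (rule sum_mono)
        fix k
        have "(\<integral>\<^sup>+\<omega>. ennreal ((\<zeta> k \<omega>)\<^sup>2) \<partial>M) \<le> (\<integral>\<^sup>+\<omega>. ennreal (C\<^sup>2) * ennreal ((S (p k) m \<omega>)\<^sup>2) \<partial>M)"
          unfolding \<zeta>_def power_mult_distrib
          by (subst ennreal_mult[symmetric]) (auto intro!: nn_integral_mono ennreal_leI mult_right_mono \<psi>2)
        also have "\<dots> = ennreal (C\<^sup>2) * (\<integral>\<^sup>+\<omega>. ennreal ((S (p k) m \<omega>)\<^sup>2) \<partial>M)" by (rule nn_integral_cmult) measurable
        also have "\<dots> \<le> ennreal (C\<^sup>2) * (2 * ennreal ((t (Suc k) - t k)\<^sup>2) + 2 * d k (p k) m)"
          unfolding d_def S_def by (intro mult_left_mono simple_integral_bound p(1) t(1) less_imp_le[OF t(2)]) auto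
        finally show "(\<integral>\<^sup>+\<omega>. ennreal ((\<zeta> k \<omega>)\<^sup>2) \<partial>M) \<le> ennreal (C\<^sup>2) * (2 * ennreal ((T / 2 ^ n)\<^sup>2) + 2 * d k (p k) m)"
          unfolding t(3) .
      qed
      finally show ?thesis by (simp only: sum_distrib_left)
    qed
    have err: "(\<integral>\<^sup>+\<omega>. ennreal ((\<Sum>k<N. \<psi> (X (t k) \<omega>) * (I k \<omega> - S (p k) m \<omega>))\<^sup>2) \<partial>M) \<le> ennreal (real N * C\<^sup>2) * (\<Sum>k<N. e k (p k) m)"
    proof -
      have "(\<integral>\<^sup>+\<omega>. ennreal ((\<Sum>k<N. \<psi> (X (t k) \<omega>) * (I k \<omega> - S (p k) m \<omega>))\<^sup>2) \<partial>M) \<le>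
        (\<integral>\<^sup>+\<omega>. ennreal (real N * C\<^sup>2) * (\<Sum>k<N. ennreal ((I k \<omega> - S (p k) m \<omega>)\<^sup>2)) \<partial>M)"
      proof (rule nn_integral_mono)
        fix \<omega>
        have "(\<Sum>k<N. \<psi> (X (t k) \<omega>) * (I k \<omega> - S (p k) m \<omega>))\<^sup>2 \<le> (\<Sum>k<N. (\<psi> (X (t k) \<omega>) * (I k \<omega> - S (p k) m \<omega>))\<^sup>2) * (\<Sum>k<N. 1\<^sup>2)"
          using Cauchy_Schwarz_ineq_sum[of "\<lambda>k. \<psi> (X (t k) \<omega>) * (I k \<omega> - S (p k) m \<omega>)" "\<lambda>_. 1" "{..<N}"] by simp
        also have "\<dots> \<le> (\<Sum>k<N. C\<^sup>2 * (I k \<omega> - S (p k) m \<omega>)\<^sup>2) * (\<Sum>k<N. 1\<^sup>2)"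
          unfolding power_mult_distrib by (intro mult_right_mono sum_mono \<psi>2 sum_nonneg) auto
        also have "\<dots> = real N * C\<^sup>2 * (\<Sum>k<N. (I k \<omega> - S (p k) m \<omega>)\<^sup>2)"
          by (simp add: sum_distrib_left mult_ac)
        finally have "ennreal ((\<Sum>k<N. \<psi> (X (t k) \<omega>) * (I k \<omega> - S (p k) m \<omega>))\<^sup>2) \<le> ennreal (real N * C\<^sup>2 * (\<Sum>k<N. (I k \<omega> - S (p k) m \<omega>)\<^sup>2))"
          by (rule ennreal_leI)
        also have "\<dots> = ennreal (real N * C\<^sup>2) * ennreal (\<Sum>k<N. (I k \<omega> - S (p k) m \<omega>)\<^sup>2)"
          by (intro ennreal_mult sum_nonneg) auto
        also have "ennreal (\<Sum>k<N. (I k \<omega> - S (p k) m \<omega>)\<^sup>2) = (\<Sum>k<N. ennreal ((I k \<omega> - S (p k) m \<omega>)\<^sup>2))"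
          by (rule sum_ennreal[symmetric]) simp
        finally show "ennreal ((\<Sum>k<N. \<psi> (X (t k) \<omega>) * (I k \<omega> - S (p k) m \<omega>))\<^sup>2) \<le>
           ennreal (real N * C\<^sup>2) * (\<Sum>k<N. ennreal ((I k \<omega> - S (p k) m \<omega>)\<^sup>2))" .
      qed
      also have "\<dots> = ennreal (real N * C\<^sup>2) * (\<Sum>k<N. e k (p k) m)"
        unfolding e_def using I_meas by (subst nn_integral_cmult, measurable, subst nn_integral_sum, measurable)
      finally show ?thesis .
    qed
    have "(\<integral>\<^sup>+\<omega>. ennreal ((\<Sum>k<N. \<psi> (X (t k) \<omega>) * I k \<omega>)\<^sup>2) \<partial>M) \<le>
      (\<integral>\<^sup>+\<omega>. 2 * ennreal ((\<Sum>k<N. \<zeta> k \<omega>)\<^sup>2) + 2 * ennreal ((\<Sum>k<N. \<psi> (X (t k) \<omega>) * (I k \<omega> - S (p k) m \<omega>))\<^sup>2) \<partial>M)"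
    proof (rule nn_integral_mono)
      fix \<omega>
      let ?a = "\<Sum>k<N. \<zeta> k \<omega>" and ?b = "\<Sum>k<N. \<psi> (X (t k) \<omega>) * (I k \<omega> - S (p k) m \<omega>)"
      have "(\<Sum>k<N. \<psi> (X (t k) \<omega>) * I k \<omega>) = ?a + ?b"
        by (simp add: \<zeta>_def sum.distrib[symmetric] algebra_simps)
      moreover have "(?a + ?b)\<^sup>2 \<le> 2 * ?a\<^sup>2 + 2 * ?b\<^sup>2"
      proof -
        have "0 \<le> (?a - ?b)\<^sup>2" by simp
        then show ?thesis by (simp add: power2_sum power2_diff)
      qed
      ultimately have "ennreal ((\<Sum>k<N. \<psi> (X (t k) \<omega>) * I k \<omega>)\<^sup>2) \<le> ennreal (2 * ?a\<^sup>2 + 2 * ?b\<^sup>2)"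
        by (intro ennreal_leI) simp
      also have "\<dots> = 2 * ennreal (?a\<^sup>2) + 2 * ennreal (?b\<^sup>2)" by (simp add: ennreal_plus ennreal_mult)
      finally show "ennreal ((\<Sum>k<N. \<psi> (X (t k) \<omega>) * I k \<omega>)\<^sup>2) \<le> 2 * ennreal (?a\<^sup>2) + 2 * ennreal (?b\<^sup>2)" .
    qed
    also have "\<dots> = 2 * (\<integral>\<^sup>+\<omega>. ennreal ((\<Sum>k<N. \<zeta> k \<omega>)\<^sup>2) \<partial>M) +
       2 * (\<integral>\<^sup>+\<omega>. ennreal ((\<Sum>k<N. \<psi> (X (t k) \<omega>) * (I k \<omega> - S (p k) m \<omega>))\<^sup>2) \<partial>M)"
    proof -
      have [measurable]: "(\<lambda>\<omega>. \<Sum>k<N. \<psi> (X (t k) \<omega>) * (I k \<omega> - S (p k) m \<omega>)) \<in> borel_measurable M"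
        using XM I_meas SM by (intro borel_measurable_sum borel_measurable_times borel_measurable_diff)
      show ?thesis
        by (subst nn_integral_add, measurable, subst nn_integral_cmult, measurable, subst nn_integral_cmult, measurable)
    qed
    also have "\<dots> \<le> R m" unfolding R_def by (intro add_mono mult_left_mono main err) auto
    finally show ?thesis .
  qed
  have "R \<longlonglongrightarrow> 2 * (ennreal (C\<^sup>2) * (\<Sum>k<N. 2 * ennreal ((T / 2 ^ n)\<^sup>2) + 2 * 0)) + 2 * (ennreal (real N * C\<^sup>2) * (\<Sum>k<N. 0))"
    unfolding R_def[abs_def]
    by (intro tendsto_add ennreal_tendsto_cmult tendsto_sum tendsto_const p(2,3)) auto
  then have "(\<integral>\<^sup>+\<omega>. ennreal ((\<Sum>k<N. \<psi> (X (t k) \<omega>) * I k \<omega>)\<^sup>2) \<partial>M) \<le>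
     2 * (ennreal (C\<^sup>2) * (\<Sum>k<N. 2 * ennreal ((T / 2 ^ n)\<^sup>2) + 2 * 0)) + 2 * (ennreal (real N * C\<^sup>2) * (\<Sum>k<N. 0))"
    by (rule LIMSEQ_le_const) (use bound in auto)
  also have "\<dots> = ennreal (2 * (C\<^sup>2 * (real N * (2 * (T / 2 ^ n)\<^sup>2))))"
  proof -
    have "2 * (a * (b * (2 * x))) = (2 * 2) * (a * (b * x))" for a b x :: ennreal by (simp only: mult_ac)
    then have four: "2 * (a * (b * (2 * x))) = 4 * (a * (b * x))" for a b x :: ennreal by simp
    show ?thesis
      by (simp add: ennreal_mult ennreal_of_nat_eq_real_of_nat four)
  qed
  also have "2 * (C\<^sup>2 * (real N * (2 * (T / 2 ^ n)\<^sup>2))) = 4 * C\<^sup>2 * T\<^sup>2 / 2 ^ n"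
    by (simp add: N_def power_divide power2_eq_square)
  finally show ?thesis by (simp add: I_def t_def N_def)
qed

lemma AE_second_level_sum:
  assumes iv: "iterated_integral_version M W A" and \<alpha>: "0 < \<alpha>" and T: "0 < T"
    and \<psi>: "\<psi> \<in> borel_measurable borel" "\<And>v. \<bar>\<psi> v\<bar> \<le> C"
  shows "AE \<omega> in M. (\<lambda>n. \<Sum>k<2^n. \<psi> (X (grid \<alpha> T n k) \<omega>) * A r 8 (grid \<alpha> T n k) (grid \<alpha> T n (Suc k)) \<omega>) \<longlonglongrightarrow> 0"
proof -
  define Y where "Y n \<omega> = (\<Sum>k<2^n. \<psi> (X (grid \<alpha> T n k) \<omega>) * A r 8 (grid \<alpha> T n k) (grid \<alpha> T n (Suc k)) \<omega>)" for n \<omega>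
  have A_meas: "A r 8 (grid \<alpha> T n k) (grid \<alpha> T n (Suc k)) \<in> borel_measurable M" for n k
    using iv grid_nonneg[OF \<alpha> T, of n k] less_imp_le[OF grid_less[OF T, of \<alpha> n k]]
    unfolding iterated_integral_version_def has_ito_integral_def by blast
  have Y_meas: "Y n \<in> borel_measurable M" for n
    unfolding Y_def[abs_def]
    by (intro borel_measurable_sum borel_measurable_times A_meas measurable_compose[OF X_measurable \<psi>(1)] grid_nonneg \<alpha> T)
  \<comment> \<open>The general limit lemma is used with m as the grid index and without dependence
    on n, where frequently in n means simply that the statement holds.\<close>
  have "AE \<omega> in M. \<forall>e>0. \<forall>\<^sub>F m in sequentially. \<exists>\<^sub>F n in sequentially. ennreal ((Y m \<omega>)\<^sup>2) \<le> ennreal e"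
  proof (rule AE_liminf_tendsto_0)
    show "(\<integral>\<^sup>+\<omega>. ennreal ((Y m \<omega>)\<^sup>2) \<partial>M) \<le> ennreal (4 * C\<^sup>2 * T\<^sup>2 / 2 ^ m)" for m n :: nat
      unfolding Y_def by (rule second_level_sum_bound[OF iv \<alpha> T \<psi>])
    show "(\<lambda>n. 4 * C\<^sup>2 * T\<^sup>2 / 2 ^ m) \<longlonglongrightarrow> 4 * C\<^sup>2 * T\<^sup>2 * (1 / 2) ^ m" for m
      by (simp add: power_divide)
  qed (use Y_meas in auto)
  then show ?thesis
  proof eventually_elim
    case (elim \<omega>)
    have "(\<lambda>n. Y n \<omega>) \<longlonglongrightarrow> 0"
    proof (rule tendstoI)
      fix e :: real assume e: "0 < e"
      then have "0 < (e / 2)\<^sup>2" by simp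
      with elim have "\<forall>\<^sub>F m in sequentially. ennreal ((Y m \<omega>)\<^sup>2) \<le> ennreal ((e / 2)\<^sup>2)"
        by (auto simp: frequently_const_iff)
      then show "\<forall>\<^sub>F m in sequentially. dist (Y m \<omega>) 0 < e"
      proof eventually_elim
        case (elim m)
        then have "(Y m \<omega>)\<^sup>2 \<le> (e / 2)\<^sup>2" by simp
        then have "\<bar>Y m \<omega>\<bar> \<le> \<bar>e / 2\<bar>" by (simp only: abs_le_square_iff)
        then show ?case using e by simp
      qed
    qed
    then show ?case by (simp add: Y_def)
  qed
qed

section \<open>Gluing the pieces along almost every path\<close>

text \<open>The radius matches the oscillation of a path with Hoelder exponent 1/3 over one grid
  step. At one grid point the probability is of order r^4/\<alpha>^2, that is 2^(-4n/3); the 2^n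
  grid points together give 2^(-n/3), which tends to 0.\<close>

lemma AE_not_near_origin:
  assumes \<alpha>: "0 < \<alpha>" and T: "0 < T" and K: "0 < K"
  shows "AE \<omega> in M. \<exists>n. \<forall>k<2 ^ n. \<not> close (K * (T / 2 ^ n) powr (1 / 3)) (X 0 \<omega>) (X (grid \<alpha> T n k) \<omega>)"
proof -
  define r where "r n = K * (T / 2 ^ n) powr (1 / 3)" for n :: nat
  have r: "0 < r n" for n using K T by (simp add: r_def)
  define E where "E n = (\<Union>k<2 ^ n. {\<omega> \<in> space M. close (r n) (X 0 \<omega>) (X (grid \<alpha> T n k) \<omega>)})" for n :: nat
  have E: "E n \<in> sets M" for n unfolding E_def using grid_nonneg[OF \<alpha> T] by (intro sets.finite_UN close_measurable) auto
  define c where "c = 4 * K ^ 4 * T powr (4 / 3) / \<alpha>\<^sup>2"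
  have prob_E: "prob (E n) \<le> c * (2 powr (- 1 / 3)) ^ n" for n
  proof -
    \<comment> \<open>A factor 1/2^n is split off, to be consumed by the sum over the grid
      points.\<close>
    have r4: "r n ^ 4 = K ^ 4 * T powr (4 / 3) / 2 ^ n * (2 powr (- 1 / 3)) ^ n"
    proof -
      have "((T / 2 ^ n) powr (1 / 3)) ^ 4 = (T / 2 ^ n) powr (4 / 3)"
        using T by (simp add: powr_realpow[symmetric] powr_powr)
      also have "\<dots> = T powr (4 / 3) / (2 powr real n) powr (4 / 3)"
        using T by (simp add: powr_divide powr_realpow)
      also have "(2 powr real n) powr (4 / 3) = 2 powr real n * 2 powr (real n / 3)"
        unfolding powr_powr powr_add[symmetric] by (rule arg_cong[where f = "(powr) 2"]) simp
      also have "T powr (4 / 3) / (2 powr real n * 2 powr (real n / 3)) = T powr (4 / 3) / 2 ^ n * (2 powr (- 1 / 3)) ^ n"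
      proof -
        have "(2 powr (- 1 / 3)) ^ n = (2::real) powr (- (real n / 3))"
          by (subst powr_realpow[symmetric]) (simp_all add: powr_powr)
        also have "\<dots> = inverse (2 powr (real n / 3))" by (rule powr_minus)
        finally show ?thesis
          by (simp only: powr_realpow[OF zero_less_numeral] divide_inverse inverse_mult_distrib mult.assoc)
      qed
      finally show ?thesis by (simp add: r_def power_mult_distrib)
    qed
    have "prob (E n) \<le> (\<Sum>k<2^n. prob {\<omega> \<in> space M. close (r n) (X 0 \<omega>) (X (grid \<alpha> T n k) \<omega>)})"
      unfolding E_def using grid_nonneg[OF \<alpha> T] by (intro finite_measure_subadditive_finite) (auto intro!: close_measurable)
    also have "\<dots> \<le> (\<Sum>k<(2::nat)^n. 4 * r n ^ 4 / \<alpha>\<^sup>2)"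
    proof (rule sum_mono)
      fix k
      have g: "\<alpha> \<le> grid \<alpha> T n k" using T by (simp add: grid_def)
      have "prob {\<omega> \<in> space M. close (r n) (X 0 \<omega>) (X (grid \<alpha> T n k) \<omega>)} \<le> close_bound (r n) (grid \<alpha> T n k - 0)"
        using g \<alpha> by (intro prob_close r) auto
      also have "\<dots> \<le> 4 / (\<alpha> / (r n)\<^sup>2)\<^sup>2"
      proof -
        have "\<alpha> / (r n)\<^sup>2 \<le> 1 + grid \<alpha> T n k / (r n)\<^sup>2" using g by (simp add: add_increasing divide_right_mono)
        then have "(\<alpha> / (r n)\<^sup>2)\<^sup>2 \<le> (1 + grid \<alpha> T n k / (r n)\<^sup>2)\<^sup>2" using \<alpha> by (intro power_mono) auto
        moreover have "0 < (\<alpha> / (r n)\<^sup>2)\<^sup>2" using \<alpha> r[of n] by simp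
        ultimately show ?thesis unfolding close_bound_def by (simp add: frac_le)
      qed
      also have "\<dots> = 4 * r n ^ 4 / \<alpha>\<^sup>2" by (simp add: power_divide flip: power_mult)
      finally show "prob {\<omega> \<in> space M. close (r n) (X 0 \<omega>) (X (grid \<alpha> T n k) \<omega>)} \<le> 4 * r n ^ 4 / \<alpha>\<^sup>2" .
    qed
    also have "\<dots> = c * (2 powr (- 1 / 3)) ^ n" unfolding r4 by (simp add: c_def)
    finally show ?thesis .
  qed
  have "(\<lambda>n. c * (2 powr (- 1 / 3)) ^ n) \<longlonglongrightarrow> c * 0"
  proof (intro tendsto_intros LIMSEQ_power_zero)
    have "2 powr (- 1 / 3) < 2 powr (0 :: real)" by (intro powr_less_mono) auto
    then show "norm (2 powr (- 1 / 3) :: real) < 1" by simp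
  qed
  then have lim: "(\<lambda>n. c * (2 powr (- 1 / 3)) ^ n) \<longlonglongrightarrow> 0" by simp
  have "prob (\<Inter>n. E n) \<le> c * (2 powr (- 1 / 3)) ^ n" for n
    by (rule order_trans[OF finite_measure_mono prob_E]) (use E in auto)
  then have "prob (\<Inter>n. E n) \<le> 0" by (intro LIMSEQ_le_const[OF lim]) auto
  then have "prob (\<Inter>n. E n) = 0" using measure_nonneg[of M "\<Inter>n. E n"] by linarith
  moreover have "(\<Inter>n. E n) \<in> sets M" using E by auto
  ultimately have "AE \<omega> in M. \<omega> \<notin> (\<Inter>n. E n)" using prob_eq_0 by blast
  then show ?thesis using AE_space
    by eventually_elim (auto simp: E_def r_def)
qed

text \<open>A zero of X would, by Hoelder continuity, bring X close to the origin at the preceding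
  grid point, on every grid. The Hoelder constant depends on the path, so the exclusion is first
  obtained for all integer constants.\<close>

lemma AE_path_nonzero:
  assumes hoelder: "AE \<omega> in M. \<forall>b\<ge>0. \<exists>c. \<forall>s t. 0 \<le> s \<and> s \<le> t \<and> t \<le> b \<longrightarrow> norm (W t \<omega> - W s \<omega>) \<le> c * (t - s) powr (1 / 3)"
    and \<alpha>: "0 < \<alpha>" and T: "0 < T"
  shows "AE \<omega> in M. \<forall>t. \<alpha> \<le> t \<and> t < \<alpha> + T \<longrightarrow> X t \<omega> \<noteq> 0"
proof -
  have "AE \<omega> in M. \<forall>K::nat. \<exists>n. \<forall>k<2 ^ n. \<not> close (real (Suc K) * (T / 2 ^ n) powr (1 / 3)) (X 0 \<omega>) (X (grid \<alpha> T n k) \<omega>)"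
    unfolding AE_all_countable by (intro allI AE_not_near_origin \<alpha> T) simp
  then show ?thesis using hoelder W_0
  proof eventually_elim
    case (elim \<omega>)
    have "0 \<le> \<alpha> + T" using \<alpha> T by simp
    then obtain c where c: "\<And>s t. 0 \<le> s \<Longrightarrow> s \<le> t \<Longrightarrow> t \<le> \<alpha> + T \<Longrightarrow> norm (W t \<omega> - W s \<omega>) \<le> c * (t - s) powr (1 / 3)"
      using elim(2) by meson
    obtain K :: nat where "c < real K" using reals_Archimedean2 by blast
    then have K: "c \<le> real (Suc K)" by simp
    obtain n where n: "\<And>k. k < 2 ^ n \<Longrightarrow> \<not> close (real (Suc K) * (T / 2 ^ n) powr (1 / 3)) (X 0 \<omega>) (X (grid \<alpha> T n k) \<omega>)"
      using elim(1) by blast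
    show ?case
    proof (intro allI impI notI)
      fix t assume t: "\<alpha> \<le> t \<and> t < \<alpha> + T" and X0: "X t \<omega> = 0"
      \<comment> \<open>The last grid point not after t; excluding the right end of the window
        guarantees k < 2^n.\<close>
      define k where "k = nat \<lfloor>(t - \<alpha>) / T * 2 ^ n\<rfloor>"
      have nn: "0 \<le> (t - \<alpha>) / T * 2 ^ n" using t T by simp
      have k: "real k \<le> (t - \<alpha>) / T * 2 ^ n" "(t - \<alpha>) / T * 2 ^ n < real k + 1"
        unfolding k_def using nn by linarith+
      have "(t - \<alpha>) / T * 2 ^ n < 1 * 2 ^ n" using t T by (intro mult_strict_right_mono) auto
      then have "real k < 2 ^ n" using k(1) by linarith
      then have kN: "k < 2 ^ n" by (metis of_nat_less_iff of_nat_numeral of_nat_power)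
      have lo: "grid \<alpha> T n k \<le> t" using k(1) T by (simp add: grid_def field_simps)
      have "t - \<alpha> \<le> (real k + 1) * T / 2 ^ n" using k(2) T by (simp add: field_simps)
      then have hi: "t - grid \<alpha> T n k \<le> T / 2 ^ n" by (simp add: grid_def add_divide_distrib algebra_simps)
      have "norm (W t \<omega> - W (grid \<alpha> T n k) \<omega>) \<le> c * (t - grid \<alpha> T n k) powr (1 / 3)"
        using lo t by (intro c grid_nonneg \<alpha> T) auto
      also have "\<dots> \<le> real (Suc K) * (T / 2 ^ n) powr (1 / 3)"
        using K hi lo by (intro mult_mono powr_mono2) auto
      finally have *: "norm (W t \<omega> - W (grid \<alpha> T n k) \<omega>) \<le> real (Suc K) * (T / 2 ^ n) powr (1 / 3)" .
      have "close (real (Suc K) * (T / 2 ^ n) powr (1 / 3)) (X 0 \<omega>) (X (grid \<alpha> T n k) \<omega>)"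
        unfolding close_def
      proof
        fix c
        have "X 0 \<omega> $ c = 0" using elim(3) by (simp add: first_seven_nth)
        moreover have "W t \<omega> $ emb c = 0" using X0 by (metis first_seven_nth zero_index)
        ultimately have "\<bar>X 0 \<omega> $ c - X (grid \<alpha> T n k) \<omega> $ c\<bar> = \<bar>(W t \<omega> - W (grid \<alpha> T n k) \<omega>) $ emb c\<bar>"
          by (simp add: first_seven_nth)
        then show "\<bar>X 0 \<omega> $ c - X (grid \<alpha> T n k) \<omega> $ c\<bar> \<le> real (Suc K) * (T / 2 ^ n) powr (1 / 3)"
          using component_le_norm_cart[of "W t \<omega> - W (grid \<alpha> T n k) \<omega>" "emb c"] * by linarith
      qed
      then show False using n[OF kN] by blast
    qed
  qed
qed

end

text \<open>Lists of rational coefficients and cells form a countable type, so almost sure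
  statements hold for all members at once, and adding another bump is just extending the
  list.\<close>

definition bump_sum :: "(rat \<times> nat \<times> 'n::finite cell) list \<Rightarrow> real ^ 'n \<Rightarrow> real" where
  "bump_sum l v = (\<Sum>(c, m, p)\<leftarrow>l. of_rat c * bump m p v)"

lemma bump_sum_simps:
  "bump_sum [] = (\<lambda>_. 0)"
  "bump_sum ((c, m, p) # l) = (\<lambda>v. bump_sum l v + of_rat c * bump m p v)"
  by (auto simp: bump_sum_def fun_eq_iff)

lemma bump_sum_elementary: "bump_sum l \<in> elementary"
proof (induction l)
  case (Cons a l)
  then show ?case
    by (cases a) (simp add: bump_sum_simps elementary.add elementary_cmult bump_elementary)
qed (simp add: bump_sum_simps elementary.const)

lemma bump_sum_gradient_bounded:
  fixes l :: "(rat \<times> nat \<times> 'n::finite cell) list"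
  shows "\<exists>B. \<forall>h v. \<bar>partial_deriv h (bump_sum l) v\<bar> \<le> B"
proof (induction l)
  case Nil
  then show ?case by (auto simp: bump_sum_simps partial_deriv_const)
next
  case (Cons a l)
  obtain c m p where a: "a = (c, m, p)" by (cases a)
  obtain B where B: "\<And>h v. \<bar>partial_deriv h (bump_sum l) v\<bar> \<le> B" using Cons by blast
  obtain C where C: "0 < C" "\<And>m (p :: 'n cell) h v. \<bar>partial_deriv h (bump m p) v\<bar> \<le> 2 ^ m * C"
    using bump_gradient_bound by blast
  have "\<bar>partial_deriv h (bump_sum (a # l)) v\<bar> \<le> B + \<bar>of_rat c\<bar> * (2 ^ m * C)" for h v
  proof -
    have "partial_deriv h (bump_sum (a # l)) v = partial_deriv h (bump_sum l) v + of_rat c * partial_deriv h (bump m p) v"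
      unfolding a bump_sum_simps
      by (simp add: partial_deriv_add partial_deriv_cmult bump_sum_elementary elementary_cmult bump_elementary)
    moreover have "\<bar>of_rat c * partial_deriv h (bump m p) v\<bar> \<le> \<bar>of_rat c\<bar> * (2 ^ m * C)"
      unfolding abs_mult by (intro mult_left_mono C(2)) auto
    ultimately show ?thesis using B[of h v] by linarith
  qed
  then show ?case by blast
qed

text \<open>The radii are reciprocals of integers so that only countably many regions occur,
  although the one that contains the path is selected after the path is known.\<close>

definition annulus :: "nat \<Rightarrow> nat \<Rightarrow> (real ^ 'n) set" where
  "annulus i k = {v. 1 / real (Suc i) < norm v \<and> norm v < 1 / real (Suc k)}"

lemma annulus_open: "open (annulus i k :: (real ^ 'n) set)"
proof -
  have eq: "annulus i k = {v. 1 / real (Suc i) < norm v} \<inter> {v :: real ^ 'n. norm v < 1 / real (Suc k)}"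
    by (auto simp: annulus_def)
  show ?thesis unfolding eq by (intro open_Int open_Collect_less continuous_intros)
qed

lemma annulus_bounded: "bounded (annulus i k)"
  by (rule boundedI[of _ "1 / real (Suc k)"]) (auto simp: annulus_def)

section \<open>Paths with all required almost sure properties\<close>

context brownian
begin

text \<open>The first four conditions are the probabilistic assumptions of
  \<open>window_path\<close> for the family of all \<open>bump_sum l\<close>; the last makes the
  second-level part of the compensated sums disappear in the limit.\<close>

definition good_path :: "(8 \<Rightarrow> 8 \<Rightarrow> real \<Rightarrow> real \<Rightarrow> 'a \<Rightarrow> real) \<Rightarrow> real \<Rightarrow> real \<Rightarrow> (real ^ 7) set \<Rightarrow> 'a \<Rightarrow> bool" where
  "good_path A \<alpha> T U \<omega> \<longleftrightarrow> (\<forall>l. convergent (rsum (bump_sum l) (\<lambda>t. X t \<omega>) (\<lambda>t. Z t \<omega>) \<alpha> T)) \<and>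
    (\<forall>l \<theta>. \<forall>e>0. \<forall>\<^sub>F m in sequentially. \<exists>\<^sub>F n in sequentially.
       \<bar>\<Sum>q\<in>good_cells U (bump_sum l) m \<theta>. (rsum (bump m (\<theta>, q)) (\<lambda>t. X t \<omega>) (\<lambda>t. Z t \<omega>) \<alpha> T n)\<^sup>2
          - tsum (\<lambda>v. (bump m (\<theta>, q) v)\<^sup>2) (\<lambda>t. X t \<omega>) \<alpha> T n\<bar> \<le> e) \<and>
    (\<forall>l \<theta>. \<forall>e>0. \<forall>\<^sub>F m in sequentially. \<exists>\<^sub>F n in sequentially.
       \<bar>2 ^ m * (\<Sum>q\<in>good_cells U (bump_sum l) m \<theta>. tsum (corr (bump_sum l) m (\<theta>, q)) (\<lambda>t. X t \<omega>) \<alpha> T n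
          * rsum (bump m (\<theta>, q)) (\<lambda>t. X t \<omega>) (\<lambda>t. Z t \<omega>) \<alpha> T n)\<bar> \<le> e) \<and>
    (\<exists>B. \<exists>\<^sub>F m in sequentially. \<exists>\<^sub>F n in sequentially.
       4 ^ m * (\<Sum>p\<in>{p. cell m p \<subseteq> U}. (rsum (bump m p) (\<lambda>t. X t \<omega>) (\<lambda>t. Z t \<omega>) \<alpha> T n) ^ 4 +
          tsum (indicator (cell m p)) (\<lambda>t. X t \<omega>) \<alpha> T n * (rsum (bump m p) (\<lambda>t. X t \<omega>) (\<lambda>t. Z t \<omega>) \<alpha> T n)\<^sup>2) \<le> B) \<and>
    (\<forall>l c. (\<lambda>n. \<Sum>k<2^n. partial_deriv c (bump_sum l) (X (grid \<alpha> T n k) \<omega>) *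
        A (emb c) 8 (grid \<alpha> T n k) (grid \<alpha> T n (Suc k)) \<omega>) \<longlonglongrightarrow> 0)"

lemma AE_good_path:
  assumes iv: "iterated_integral_version M W A" and \<alpha>: "0 < \<alpha>" and T: "0 < T" and U: "bounded U"
  shows "AE \<omega> in M. good_path A \<alpha> T U \<omega>"
  unfolding good_path_def
proof (intro AE_conjI)
  have fin: "finite (good_cells U f m \<theta>)" for f m \<theta>
  proof -
    have "finite (Pair \<theta> -` {p. cell m p \<subseteq> U})"
      by (intro finite_vimageI finite_cells_in_bounded U) (auto simp: inj_on_def)
    then show ?thesis by (rule finite_subset[rotated]) (auto simp: good_cells_def)
  qed
  show "AE \<omega> in M. \<forall>l. convergent (rsum (bump_sum l) (\<lambda>t. X t \<omega>) (\<lambda>t. Z t \<omega>) \<alpha> T)"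
    unfolding AE_all_countable
  proof
    fix l :: "(rat \<times> nat \<times> 7 cell) list"
    obtain B where "\<And>h v. \<bar>partial_deriv h (bump_sum l) v\<bar> \<le> B" using bump_sum_gradient_bounded by blast
    then show "AE \<omega> in M. convergent (rsum (bump_sum l) (\<lambda>t. X t \<omega>) (\<lambda>t. Z t \<omega>) \<alpha> T)"
      by (rule AE_rsum_convergent[OF \<alpha> T bump_sum_elementary])
  qed
  show "AE \<omega> in M. \<forall>l \<theta>. \<forall>e>0. \<forall>\<^sub>F m in sequentially. \<exists>\<^sub>F n in sequentially.
       \<bar>\<Sum>q\<in>good_cells U (bump_sum l) m \<theta>. (rsum (bump m (\<theta>, q)) (\<lambda>t. X t \<omega>) (\<lambda>t. Z t \<omega>) \<alpha> T n)\<^sup>2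
          - tsum (\<lambda>v. (bump m (\<theta>, q) v)\<^sup>2) (\<lambda>t. X t \<omega>) \<alpha> T n\<bar> \<le> e"
    unfolding AE_all_countable[where P = "\<lambda>\<omega> l. \<forall>\<theta>. _ \<omega> l \<theta>"] AE_all_countable[where P = "\<lambda>\<omega> \<theta>. \<forall>e>0. _ \<omega> \<theta> e"]
    by (intro allI AE_square_var \<alpha> T fin)
  show "AE \<omega> in M. \<forall>l \<theta>. \<forall>e>0. \<forall>\<^sub>F m in sequentially. \<exists>\<^sub>F n in sequentially.
       \<bar>2 ^ m * (\<Sum>q\<in>good_cells U (bump_sum l) m \<theta>. tsum (corr (bump_sum l) m (\<theta>, q)) (\<lambda>t. X t \<omega>) \<alpha> T n
          * rsum (bump m (\<theta>, q)) (\<lambda>t. X t \<omega>) (\<lambda>t. Z t \<omega>) \<alpha> T n)\<bar> \<le> e"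
  proof -
    obtain C where C: "0 < C" "\<And>m (p :: 7 cell) h v. \<bar>partial_deriv h (bump m p) v\<bar> \<le> 2 ^ m * C"
      using bump_gradient_bound by blast
    have corr_el: "corr f m p \<in> elementary" if "f \<in> elementary" for f :: "real ^ 7 \<Rightarrow> real" and m p
    proof -
      have "(\<lambda>v. partial_deriv h f v * (1 / 2 ^ m * partial_deriv h (bump m p) v)) \<in> elementary" for h
        by (intro elementary.mult elementary_cmult elementary_partial_deriv that bump_elementary)
      then show ?thesis unfolding corr_def[abs_def] by (intro elementary_sum) simp
    qed
    have bd: "\<bar>corr f m (\<theta>, q) v\<bar> \<le> real CARD(7) * (2 * C) * indicator (cell m (\<theta>, q)) v"
      if "q \<in> good_cells U f m \<theta>" for f :: "real ^ 7 \<Rightarrow> real" and m \<theta> q v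
    proof (cases "v \<in> cell m (\<theta>, q)")
      case True
      have "\<bar>corr f m (\<theta>, q) v\<bar> \<le> (\<Sum>h::7\<in>UNIV. 2 * C)"
        unfolding corr_def
      proof (intro order_trans[OF sum_abs] sum_mono)
        fix h
        have "\<bar>partial_deriv h f v\<bar> \<le> 2" using that True by (auto simp: good_cells_def)
        moreover have "\<bar>partial_deriv h (bump m (\<theta>, q)) v / 2 ^ m\<bar> \<le> C"
          using C(2)[of h m "(\<theta>, q)" v] by (simp add: field_simps)
        ultimately show "\<bar>partial_deriv h f v * (partial_deriv h (bump m (\<theta>, q)) v / 2 ^ m)\<bar> \<le> 2 * C"
          unfolding abs_mult by (intro mult_mono) auto
      qed
      then show ?thesis using True by simp
    qed (simp add: corr_def partial_deriv_bump_eq_0)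
    show ?thesis
      unfolding AE_all_countable[where P = "\<lambda>\<omega> l. \<forall>\<theta>. _ \<omega> l \<theta>"] AE_all_countable[where P = "\<lambda>\<omega> \<theta>. \<forall>e>0. _ \<omega> \<theta> e"]
      by (intro allI AE_cross_var[where \<kappa> = "real CARD(7) * (2 * C)"] \<alpha> T fin bd elementary_borel corr_el bump_sum_elementary)
         (use C in auto)
  qed
  show "AE \<omega> in M. \<exists>B. \<exists>\<^sub>F m in sequentially. \<exists>\<^sub>F n in sequentially.
       4 ^ m * (\<Sum>p\<in>{p. cell m p \<subseteq> U}. (rsum (bump m p) (\<lambda>t. X t \<omega>) (\<lambda>t. Z t \<omega>) \<alpha> T n) ^ 4 +
          tsum (indicator (cell m p)) (\<lambda>t. X t \<omega>) \<alpha> T n * (rsum (bump m p) (\<lambda>t. X t \<omega>) (\<lambda>t. Z t \<omega>) \<alpha> T n)\<^sup>2) \<le> B"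
    by (rule AE_fourth[OF \<alpha> T U])
  have "AE \<omega> in M. (\<lambda>n. \<Sum>k<2^n. partial_deriv c (bump_sum l) (X (grid \<alpha> T n k) \<omega>) *
        A (emb c) 8 (grid \<alpha> T n k) (grid \<alpha> T n (Suc k)) \<omega>) \<longlonglongrightarrow> 0" for l c
  proof -
    obtain B where "\<And>h v. \<bar>partial_deriv h (bump_sum l) v\<bar> \<le> B" using bump_sum_gradient_bounded by blast
    then show ?thesis
      by (intro AE_second_level_sum[OF iv \<alpha> T] elementary_borel elementary_partial_deriv bump_sum_elementary)
  qed
  then show "AE \<omega> in M. \<forall>l c. (\<lambda>n. \<Sum>k<2^n. partial_deriv c (bump_sum l) (X (grid \<alpha> T n k) \<omega>) *
        A (emb c) 8 (grid \<alpha> T n k) (grid \<alpha> T n (Suc k)) \<omega>) \<longlonglongrightarrow> 0"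
    unfolding AE_all_countable by blast
qed

text \<open>Everything is linear in f: multiplication by \<epsilon>/3 turns the gradient bound 3
  into \<epsilon> and an integral of at least 3/\<epsilon> into one of at least 1.\<close>

lemma good_path_piece:
  assumes good: "good_path A \<alpha> T U \<omega>" and \<alpha>: "0 < \<alpha>" and T: "0 < T" and U: "open U" "bounded U"
    and cont: "continuous_on {0..} (\<lambda>t. W t \<omega>)" and inside: "\<And>t. \<alpha> \<le> t \<Longrightarrow> t \<le> \<alpha> + T \<Longrightarrow> X t \<omega> \<in> U"
    and \<epsilon>: "0 < \<epsilon>"
  shows "\<exists>g l. g \<in> elementary \<and> (\<forall>v. v \<notin> U \<longrightarrow> g v = 0 \<and> (\<forall>h. partial_deriv h g v = 0)) \<and>
    (\<forall>h v. \<bar>partial_deriv h g v\<bar> \<le> \<epsilon>) \<and>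
    compensated_sum g (\<lambda>t. W t \<omega>) (\<lambda>r j s t. A r j s t \<omega>) \<alpha> T \<longlonglongrightarrow> l \<and> 1 \<le> l"
proof -
  interpret window_path "\<lambda>t. X t \<omega>" "\<lambda>t. Z t \<omega>" \<alpha> T U "range bump_sum"
  proof
    show "0 < T" "open U" "bounded U" by fact+
    show "continuous_on {\<alpha>..\<alpha> + T} (\<lambda>t. X t \<omega>)"
      by (rule continuous_on_subset[OF continuous_first_seven[OF cont]]) (use \<alpha> in auto)
    show "X t \<omega> \<in> U" if "\<alpha> \<le> t" "t \<le> \<alpha> + T" for t using inside that .
    show "f \<in> elementary" if "f \<in> range bump_sum" for f :: "real ^ 7 \<Rightarrow> real" using that bump_sum_elementary by auto
    have "(\<lambda>_. 0) = bump_sum []" by (simp add: bump_sum_simps fun_eq_iff)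
    then show "(\<lambda>_. 0) \<in> range bump_sum" by (rule range_eqI)
    show "(\<lambda>v. f v + c * bump m p v) \<in> range bump_sum" if f: "f \<in> range bump_sum" and c: "c \<in> \<rat>"
      for f :: "real ^ 7 \<Rightarrow> real" and c m p
    proof -
      obtain l where l: "f = bump_sum l" using f by auto
      obtain c' where c': "c = of_rat c'" using c by (auto elim: Rats_cases)
      have "(\<lambda>v. f v + c * bump m p v) = bump_sum ((c', m, p) # l)" by (simp add: l c' bump_sum_simps)
      then show ?thesis by blast
    qed
    show "convergent (rsum f (\<lambda>t. X t \<omega>) (\<lambda>t. Z t \<omega>) \<alpha> T)" if "f \<in> range bump_sum" for f
      using good that unfolding good_path_def by auto
    show "\<forall>\<^sub>F m in sequentially. \<exists>\<^sub>F n in sequentially.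
       \<bar>\<Sum>q\<in>good_cells U f m \<theta>. (rsum (bump m (\<theta>, q)) (\<lambda>t. X t \<omega>) (\<lambda>t. Z t \<omega>) \<alpha> T n)\<^sup>2
         - tsum (\<lambda>v. (bump m (\<theta>, q) v)\<^sup>2) (\<lambda>t. X t \<omega>) \<alpha> T n\<bar> \<le> e"
      if "f \<in> range bump_sum" "0 < e" for f \<theta> e
      using good that unfolding good_path_def by auto
    show "\<forall>\<^sub>F m in sequentially. \<exists>\<^sub>F n in sequentially.
       \<bar>2 ^ m * (\<Sum>q\<in>good_cells U f m \<theta>. tsum (corr f m (\<theta>, q)) (\<lambda>t. X t \<omega>) \<alpha> T n
         * rsum (bump m (\<theta>, q)) (\<lambda>t. X t \<omega>) (\<lambda>t. Z t \<omega>) \<alpha> T n)\<bar> \<le> e"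
      if "f \<in> range bump_sum" "0 < e" for f \<theta> e
      using good that unfolding good_path_def by auto
    show "\<exists>B. \<exists>\<^sub>F m in sequentially. \<exists>\<^sub>F n in sequentially.
       4 ^ m * (\<Sum>p\<in>{p. cell m p \<subseteq> U}. (rsum (bump m p) (\<lambda>t. X t \<omega>) (\<lambda>t. Z t \<omega>) \<alpha> T n) ^ 4 +
          tsum (indicator (cell m p)) (\<lambda>t. X t \<omega>) \<alpha> T n * (rsum (bump m p) (\<lambda>t. X t \<omega>) (\<lambda>t. Z t \<omega>) \<alpha> T n)\<^sup>2) \<le> B"
      using good unfolding good_path_def by (elim conjE)
  qed
  obtain f where f: "f \<in> range bump_sum" "\<And>v. v \<notin> U \<Longrightarrow> f v = 0" "\<And>v h. v \<notin> U \<Longrightarrow> partial_deriv h f v = 0"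
     "\<And>h v. \<bar>partial_deriv h f v\<bar> \<le> 3" "3 / \<epsilon> \<le> J f"
    using integral_unbounded[of "3 / \<epsilon>"] by blast
  obtain l where l: "f = bump_sum l" using f(1) by auto
  have f_el: "f \<in> elementary" by (simp add: l bump_sum_elementary)
  define g where "g v = \<epsilon> / 3 * f v" for v
  have pd: "partial_deriv h g v = \<epsilon> / 3 * partial_deriv h f v" for h v
    unfolding g_def by (rule partial_deriv_cmult[OF f_el])
  have "(\<lambda>n. \<epsilon> / 3 * (rsum f (\<lambda>t. X t \<omega>) (\<lambda>t. Z t \<omega>) \<alpha> T n + (\<Sum>c\<in>UNIV. \<Sum>k<2^n. partial_deriv c f (X (grid \<alpha> T n k) \<omega>) *
        A (emb c) 8 (grid \<alpha> T n k) (grid \<alpha> T n (Suc k)) \<omega>))) \<longlonglongrightarrow> \<epsilon> / 3 * (J f + (\<Sum>c\<in>(UNIV :: 7 set). 0))"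
    using good unfolding good_path_def
    by (intro tendsto_intros J_tendsto f(1)) (auto simp: l)
  moreover have "\<epsilon> / 3 * (rsum f (\<lambda>t. X t \<omega>) (\<lambda>t. Z t \<omega>) \<alpha> T n + (\<Sum>c\<in>UNIV. \<Sum>k<2^n. partial_deriv c f (X (grid \<alpha> T n k) \<omega>) *
        A (emb c) 8 (grid \<alpha> T n k) (grid \<alpha> T n (Suc k)) \<omega>)) =
      compensated_sum g (\<lambda>t. W t \<omega>) (\<lambda>r j s t. A r j s t \<omega>) \<alpha> T n" for n
    unfolding compensated_sum_def pd g_def rsum_def sum.distrib
    by (subst sum.swap) (simp add: distrib_left sum_distrib_left mult.assoc)
  ultimately have "compensated_sum g (\<lambda>t. W t \<omega>) (\<lambda>r j s t. A r j s t \<omega>) \<alpha> T \<longlonglongrightarrow> \<epsilon> / 3 * J f"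
    by simp
  moreover have "1 \<le> \<epsilon> / 3 * J f" using f(5) \<epsilon> by (simp add: field_simps)
  moreover have "g \<in> elementary" unfolding g_def by (rule elementary_cmult[OF f_el])
  moreover have "\<bar>partial_deriv h g v\<bar> \<le> \<epsilon>" for h v
    unfolding pd abs_mult using f(4)[of h v] \<epsilon> by (simp add: field_simps)
  moreover have "g v = 0 \<and> (\<forall>h. partial_deriv h g v = 0)" if "v \<notin> U" for v
    using f(2,3)[OF that] unfolding pd by (simp add: g_def)
  ultimately show ?thesis by blast
qed

end

theorem theorem4p13:
  fixes M :: "'a measure"
    and W :: "real \<Rightarrow> 'a \<Rightarrow> real ^ 8"
    and A :: "8 \<Rightarrow> 8 \<Rightarrow> real \<Rightarrow> real \<Rightarrow> 'a \<Rightarrow> real"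
  assumes "standard_brownian_motion M W"
    and "iterated_integral_version M W A"
  shows "AE \<omega> in M. \<exists>f :: real ^ 7 \<Rightarrow> real.
           compact (closure {x. f x \<noteq> 0}) \<and>
           Ck_on 1 UNIV f \<and>
           smooth_on (UNIV - {0}) f \<and>
           \<not> (\<exists>y :: real \<Rightarrow> real ^ 8.
                continuous_on {0..1} y \<and> y 0 = 0 \<and>
                satisfied_locally (system_coeff f) (\<lambda>t. W t \<omega>) (\<lambda>r j s t. A r j s t \<omega>) y)"
proof -
  interpret prob_space M using assms(1) by (simp add: standard_brownian_motion_def)
  interpret brownian M W by unfold_locales (rule assms(1))
  \<comment> \<open>The windows run from \<open>\<alpha> j\<close> to twice that time: countably
    many, arbitrarily early, and each away from time 0.\<close>
  define \<alpha> :: "nat \<Rightarrow> real" where "\<alpha> j = (1 / 4) / 2 ^ j" for j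
  have \<alpha>: "0 < \<alpha> j" for j by (simp add: \<alpha>_def)
  have "AE \<omega> in M. \<forall>j i k. good_path A (\<alpha> j) (\<alpha> j) (annulus i k) \<omega>"
    unfolding AE_all_countable by (intro allI AE_good_path assms(2) \<alpha> annulus_bounded)
  moreover have "AE \<omega> in M. \<forall>b\<ge>0. \<exists>c. \<forall>s t. 0 \<le> s \<and> s \<le> t \<and> t \<le> b \<longrightarrow> norm (W t \<omega> - W s \<omega>) \<le> c * (t - s) powr (1 / 3)"
  proof -
    have "AE \<omega> in M. \<forall>p a b. 2 < p \<and> 0 \<le> a \<and> a \<le> b \<longrightarrow>
           (\<exists>c. \<forall>s t. a \<le> s \<and> s \<le> t \<and> t \<le> b \<longrightarrow>
              norm (W t \<omega> - W s \<omega>) \<le> c * (t - s) powr (1 / p) \<and>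
              (\<forall>r j. \<bar>A r j s t \<omega>\<bar> \<le> c * (t - s) powr (2 / p)))"
      using assms(2) unfolding iterated_integral_version_def by (elim conjE) (auto elim: eventually_mono)
    then show ?thesis
    proof eventually_elim
      case (elim \<omega>)
      show ?case
      proof (intro allI impI)
        fix b :: real assume "0 \<le> b"
        with elim[rule_format, of 3 0 b] show "\<exists>c. \<forall>s t. 0 \<le> s \<and> s \<le> t \<and> t \<le> b \<longrightarrow> norm (W t \<omega> - W s \<omega>) \<le> c * (t - s) powr (1 / 3)"
          by auto
      qed
    qed
  qed
  note hoelder = this
  \<comment> \<open>The half-open interval is taken longer than the window so that it contains the
    closed window.\<close>
  moreover have "AE \<omega> in M. \<forall>j. \<forall>t. \<alpha> j \<le> t \<and> t < \<alpha> j + 2 * \<alpha> j \<longrightarrow> X t \<omega> \<noteq> 0"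
    unfolding AE_all_countable[where P = "\<lambda>\<omega> j. \<forall>t. _ \<omega> j t"]
    by (intro allI AE_path_nonzero hoelder \<alpha> mult_pos_pos) simp
  ultimately show ?thesis using W_0 W_continuous
  proof eventually_elim
    case (elim \<omega>)
    show ?case
    proof (rule no_solution_from_pieces)
      show "continuous_on {0..} (\<lambda>t. W t \<omega>)" "W 0 \<omega> = 0" by (fact elim)+
      fix \<delta> \<epsilon> :: real assume \<delta>: "0 < \<delta>" and \<epsilon>: "0 < \<epsilon>"
      have X_cont: "continuous_on {0..} (\<lambda>t. X t \<omega>)" by (rule continuous_first_seven[OF elim(5)])
      have X_0: "X 0 \<omega> = 0" using elim(4) by (simp add: vec_eq_iff first_seven_nth)
      \<comment> \<open>The outer radius is fixed first, then continuity at 0 gives a window on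
        which the path stays inside it, and finally compactness of the path over that window, which
        avoids the origin, gives the inner radius.\<close>
      obtain k where k: "1 / real (Suc k) < \<delta>" using reals_Archimedean[OF \<delta>] by (auto simp: inverse_eq_divide)
      have "0 < 1 / real (Suc k)" by simp
      from X_cont[unfolded continuous_on_iff, rule_format, of 0, OF _ this]
      obtain \<eta> where \<eta>: "0 < \<eta>" "\<And>t. 0 \<le> t \<Longrightarrow> t < \<eta> \<Longrightarrow> norm (X t \<omega>) < 1 / real (Suc k)"
        by (auto simp: X_0 dist_norm)
      have "(\<lambda>j. (1 / 2) / 2 ^ j :: real) \<longlonglongrightarrow> 0" by (rule LIMSEQ_divide_realpow_zero) simp
      then have "\<forall>\<^sub>F j in sequentially. (1 / 2) / 2 ^ j < min \<eta> \<delta>" using \<eta>(1) \<delta> by (intro order_tendstoD) auto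
      then obtain j where j: "(1 / 2) / 2 ^ j < min \<eta> \<delta>" by (auto simp: eventually_sequentially)
      have "\<alpha> j + \<alpha> j = (1 / 2) / 2 ^ j" by (simp add: \<alpha>_def)
      then have j: "\<alpha> j + \<alpha> j < \<eta>" "\<alpha> j + \<alpha> j < \<delta>" using j by auto
      have "compact ((\<lambda>t. X t \<omega>) ` {\<alpha> j..\<alpha> j + \<alpha> j})"
        using \<alpha>[of j] by (intro compact_continuous_image continuous_on_subset[OF X_cont]) auto
      moreover have "0 \<notin> (\<lambda>t. X t \<omega>) ` {\<alpha> j..\<alpha> j + \<alpha> j}"
      proof
        assume "0 \<in> (\<lambda>t. X t \<omega>) ` {\<alpha> j..\<alpha> j + \<alpha> j}"
        then obtain t where "X t \<omega> = 0" "\<alpha> j \<le> t" "t \<le> \<alpha> j + \<alpha> j" by auto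
        moreover from this have "t < \<alpha> j + 2 * \<alpha> j" using \<alpha>[of j] by linarith
        ultimately show False using elim(3) by blast
      qed
      ultimately have "\<exists>d>0. \<forall>v\<in>(\<lambda>t. X t \<omega>) ` {\<alpha> j..\<alpha> j + \<alpha> j}. d \<le> dist 0 v"
        by (intro separate_point_closed compact_imp_closed)
      then obtain d where d: "0 < d" "\<And>v. v \<in> (\<lambda>t. X t \<omega>) ` {\<alpha> j..\<alpha> j + \<alpha> j} \<Longrightarrow> d \<le> dist 0 v"
        by (elim exE conjE) (rule that, assumption, erule bspec)
      obtain i where i: "1 / real (Suc i) < d" using reals_Archimedean[OF d(1)] by (auto simp: inverse_eq_divide)
      have inside: "X t \<omega> \<in> annulus i k" if "\<alpha> j \<le> t" "t \<le> \<alpha> j + \<alpha> j" for t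
        using d(2)[of "X t \<omega>"] \<eta>(2)[of t] i j(1) that \<alpha>[of j] by (auto simp: annulus_def dist_norm)
      have good: "good_path A (\<alpha> j) (\<alpha> j) (annulus i k) \<omega>" using elim(1) by blast
      obtain g l where g: "g \<in> elementary" "\<And>v h. v \<notin> annulus i k \<Longrightarrow> g v = 0 \<and> partial_deriv h g v = 0"
        "\<And>h v. \<bar>partial_deriv h g v\<bar> \<le> \<epsilon>"
        "compensated_sum g (\<lambda>t. W t \<omega>) (\<lambda>r j s t. A r j s t \<omega>) (\<alpha> j) (\<alpha> j) \<longlonglongrightarrow> l" "1 \<le> l"
        using good_path_piece[OF good \<alpha> \<alpha> annulus_open annulus_bounded elim(5) inside \<epsilon>] by blast
      define \<rho> where "\<rho> = 1 / real (Suc i)"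
      have path: "\<forall>t\<in>{\<alpha> j..\<alpha> j + \<alpha> j}. \<rho> < norm (X t \<omega>) \<and> norm (X t \<omega>) < \<delta>"
        using inside k by (fastforce simp: annulus_def \<rho>_def)
      then have "\<rho> < \<delta>" using \<alpha>[of j] by force
      moreover have "g v = 0 \<and> (\<forall>h. partial_deriv h g v = 0)" if "\<not> (\<rho> < norm v \<and> norm v < \<delta>)" for v
      proof -
        have "v \<notin> annulus i k" using that k by (auto simp: annulus_def \<rho>_def)
        then show ?thesis using g(2) by blast
      qed
      moreover have "0 < \<rho>" by (simp add: \<rho>_def)
      ultimately show "\<exists>\<alpha> T \<rho> g l. 0 < \<alpha> \<and> 0 < T \<and> \<alpha> + T < \<delta> \<and> 0 < \<rho> \<and> \<rho> < \<delta> \<and>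
         g \<in> elementary \<and> (\<forall>x. \<not> (\<rho> < norm x \<and> norm x < \<delta>) \<longrightarrow> g x = 0 \<and> (\<forall>h. partial_deriv h g x = 0)) \<and>
         (\<forall>h x. \<bar>partial_deriv h g x\<bar> \<le> \<epsilon>) \<and>
         (\<forall>t\<in>{\<alpha>..\<alpha> + T}. \<rho> < norm (X t \<omega>) \<and> norm (X t \<omega>) < \<delta>) \<and>
         compensated_sum g (\<lambda>t. W t \<omega>) (\<lambda>r j s t. A r j s t \<omega>) \<alpha> T \<longlonglongrightarrow> l \<and> 1 \<le> l"
        using \<alpha>[of j] j(2) g(1,3,4,5) path
        by - (rule exI[of _ "\<alpha> j"], rule exI[of _ "\<alpha> j"], rule exI[of _ \<rho>], rule exI[of _ g], rule exI[of _ l], intro conjI; blast)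
    qed
  qed
qed

end
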